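(* Suppose conditions (A1)--(A10), listed in full in the context, hold, and let $|\mathcal M_0|=k_0$ be the size of the true model. Then, under the same prior $\pi(\theta\mid\mathcal M)$ and $\pi(\mathcal M)$, w.p.a.1 as $n\to\infty$: (i) For any model $\mathcal M$ with $\mathcal M\supseteq\mathcal M_0$, $$\frac{\mathrm{BF}_q[\mathcal M:\mathcal M_0]}{\mathrm{BF}_{\hat\theta}[\mathcal M:\mathcal M_0]}\to1,\qquad \mathrm{BF}_q[\mathcal M:\mathcal M_0]\asymp\mathrm{BF}_{\hat\theta}[\mathcal M:\mathcal M_0]\asymp n^{-\frac{|\mathcal M|-k_0}{2}}\succeq n^{-\frac{p-k_0}{2}}.$$ (ii) For any model $\mathcal M$ with $\mathcal M_0\setminus\mathcal M\ne\emptyset$, there exists a constant $C>0$ such that $$\mathrm{BF}_q[\mathcal M:\mathcal M_0]\le\exp(-Cn\underline\theta^2)\prec n^{-\frac{p-k_0+1}{2}},$$ $$\mathrm{BF}_{\hat\theta}[\mathcal M:\mathcal M_0]\le\exp(-Cn\underline\theta^2)\vee\tau_n n^{-\frac{p-k_0+1}{2}}\prec n^{-\frac{p-k_0+1}{2}}.$$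
   Context: Setting. All objects may depend on the sample size $n$; "constant" means a number not depending on $n$; limits are as $n\to\infty$. $\mathbf D=\{D_1,\dots,D_n\}$ is the sample with law $P_{\mathbf D}$, and $D$ is a generic observation with law $P_D$. $o_p$, $O_p$ and "w.p.a.1" (with probability approaching 1) refer to $P_{\mathbf D}$. The parameter is $\theta\in\Theta\subseteq\mathbb R^p$; $g(D,\theta)\in\mathbb R^m$ is the moment function; $\bar g(\mathbf D,\theta)=n^{-1}\sum_{i=1}^n g(D_i,\theta)$; $\mathbf V_n$ is an $m\times m$ matrix possibly depending on $\mathbf D$. $\epsilon_n=\sqrt{p/n}$; $B_0(\epsilon)=\{\theta\in\Theta:\|\theta-\theta_0\|<\epsilon\}$. $\|\cdot\|$ is the Euclidean norm (operator norm for matrices). $a_n\prec b_n$ means $a_n=o(b_n)$, $a_n\preceq b_n$ (equivalently $b_n\succeq a_n$) means $a_n=O(b_n)$, and $a_n\asymp b_n$ means same order; $a\wedge b=\min(a,b)$, $a\vee b=\max(a,b)$. Models. A model $\mathcal M$ is a subset of the $p$ coordinates, of size $|\mathcal M|$ ($2^p$ models in total); $\Theta(\mathcal M)$ is the set of $\theta\in\Theta$ whose coordinates outside $\mathcal M$ vanish. Given $\mathcal M$, write $\theta=(\theta_1^\top,\theta_2^\top)^\top$ with $\theta_1\in\mathbb R^{|\mathcal M|}$ the coordinates in $\mathcal M$ and $\theta_2$ those outside, so $\theta_2=0$ on $\Theta(\mathcal M)$. $\theta_{0,(j)}$ is the $j$th coordinate of $\theta_0$, $\mathcal M_0=\{j:\theta_{0,(j)}\ne0\}$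 is the true model, $k_0=|\mathcal M_0|$, and $\theta_{0,\mathcal M,1}$ is the subvector of $\theta_0$ with coordinates in $\mathcal M$. The prior consists of model probabilities $\pi(\mathcal M)$ and, for each $\mathcal M$, a density $\pi(\theta\mid\mathcal M)$ (also written $\pi(\theta_1\mid\mathcal M)$) on $\Theta(\mathcal M)$ with respect to $|\mathcal M|$-dimensional Lebesgue measure; integrals over subsets of $\Theta(\mathcal M)$ are with respect to $\theta_1$. Quasi-likelihood and Bayes factors. $q(\mathbf D\mid\theta)=\det(2\pi\mathbf V_n/n)^{-1/2}\exp\{-\tfrac n2\bar g(\mathbf D,\theta)^\top\mathbf V_n^{-1}\bar g(\mathbf D,\theta)\}$; $q(\mathbf D\mid\mathcal M)=\int_{\Theta(\mathcal M)}q(\mathbf D\mid\theta)\pi(\theta\mid\mathcal M)d\theta$; $\mathrm{BF}_q[\mathcal M_1:\mathcal M_2]=q(\mathbf D\mid\mathcal M_1)/q(\mathbf D\mid\mathcal M_2)$. Let $\hat\theta$ be the minimizer of $\bar g(\mathbf D,\theta)^\top\mathbf V^{-1}\bar g(\mathbf D,\theta)$ over the full $p$-dimensional model space (the GMM estimator), and $p(\hat\theta\mid\theta)$ its density when the true parameter is $\theta$. Then $\mathrm{BF}_{\hat\theta}[\mathcal M_1:\mathcal M_2]=\int_{\Theta(\mathcal M_1)}p(\hat\theta\mid\theta)\pi(\theta\mid\mathcal M_1)d\theta\big/\int_{\Theta(\mathcal M_2)}p(\hat\theta\mid\theta)\pi(\theta\mid\mathcal M_2)d\theta$. Assumptions.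 (A1) $D_1,\dots,D_n$ are i.i.d.; $E\,g(D,\theta_0)=0$ for some $\theta_0\in\Theta$; $\Theta$ is compact and connected with $\sup_{\theta\in\Theta}\|\theta\|=R$ for some large constant $R>0$, and contains an open neighborhood of $\theta_0$. (A2) $p\le m$, $p\asymp m$, $p^4\ln^2n/n\to0$ and $p^{2+\alpha}\ln n/n^\alpha\to0$, with $\alpha$ from (A4). (A3) $\sqrt{\ln n}\,\epsilon_n\prec\min_{j\in\mathcal M_0}|\theta_{0,(j)}|\preceq1$. (A4) (i) For some constant $\alpha\in(0,1]$, uniformly in $\theta\in\Theta$, $\sup_{\eta\in\mathbb R^m,\|\eta\|=1}[E\{(\eta^\top(g(D,\theta)-g(D,\theta_0)))^2\}]^{1/2}\le O((\sqrt p\,\|\theta-\theta_0\|)^\alpha)$. (ii) The class $\mathcal F=\{\eta^\top(g(D,\theta)-g(D,\theta_0)):\theta\in\Theta,\eta\in\mathbb R^m,\|\eta\|=1\}$ has an envelope $F$ whose $L_2$ norm $\|F\|_{P_D,2}$ is $O(\sqrt p)$, and its $L_2$ uniform covering number satisfies, for any small $\epsilon>0$, $\ln N(\epsilon\|F\|_{P_D,2},\mathcal F,L_2(P_D))=O(p\ln(n/\epsilon))$. (A5) (i) $\|E\,g(D,\theta)\|\ge\delta_0\wedge(\delta_1\|\theta-\theta_0\|)$ uniformly on $\Theta$ for positive constants $\delta_0,\delta_1$. (ii) $\mathbf G:=\nabla_\theta E\,g(D,\theta_0)$ exists and the eigenvalues of $\mathbf G^\top\mathbf G$ are bounded from below and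 above (by positive constants). (iii) $\mathbf H(\theta):=\nabla^2_{\theta\theta^\top}E\,g(D,\theta)$ exists for $\theta\in B_0(C\epsilon_n)$ and, uniformly over $B_0(C\epsilon_n)$ for any fixed $C>0$, $\sup_{\|u\|=\|v\|=1,\,u,v\in\mathbb R^p}\|\mathbf H(\theta)(u,v)\|=O(\sqrt p)$. (A6) $\mathbf V_n$ is positive definite for all $n$ and converges (in probability) in operator norm to $\mathbf V=\mathrm{Var}\{g(D,\theta_0)\}$; w.p.a.1 the eigenvalues of $\mathbf V_n$ and $\mathbf V$ lie between positive constants $\underline\lambda$ and $\bar\lambda$. (A7) (i) $\pi(\theta\mid\mathcal M)$ is a density restricted to $\Theta$, bounded above by a constant $c_\pi$ uniformly over all $\mathcal M$. (ii) Uniformly over all $\mathcal M\supseteq\mathcal M_0$, for any given $C>0$, $|\ln\pi(\theta_1\mid\mathcal M)-\ln\pi(\theta_{0,\mathcal M,1}\mid\mathcal M)|=o(1)$ if $\theta=(\theta_1^\top,0^\top)^\top\in\Theta(\mathcal M)\cap B_0(C\epsilon_n)$. (iii) There are constants $c_0,c_1>0$ such that, uniformly for all $\mathcal M\supseteq\mathcal M_0$, $\pi(\theta_0\mid\mathcal M)\ge e^{-c_0|\mathcal M|}$ and $|\ln\pi(\theta_{0,\mathcal M,1}\mid\mathcal M)-\ln\pi(\theta_0\mid\mathcal M_0)|\le c_1(|\mathcal M|-|\mathcal M_0|)$. (A8) (i) $\lim_{n\to\infty}\sup_{\mathcal M\supsetneq\mathcal M_0}\frac{\pi(\mathcal M)}{\pi(\mathcal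 M_0)}(p/\sqrt n)^{|\mathcal M|-|\mathcal M_0|}=0$. (ii) $\sup_{\mathcal M:\,\mathcal M_0\setminus\mathcal M\ne\emptyset}\pi(\mathcal M)/\pi(\mathcal M_0)\preceq e^{r_1p\ln n}$ for some constant $r_1>0$. (A9) (i) $1\le p\le\bar p$ for some large fixed integer $\bar p$. (ii) $\min_{j\in\mathcal M_0}|\theta_{0,(j)}|\ge\underline\theta$ for some small constant $\underline\theta>0$. (iii) Let $\mathbf V(\theta)=\mathrm{Var}\{g(D,\theta)\}$ and $\mathbf G(\theta)=\nabla_\theta E\,g(D,\theta)$ (so $\mathbf V(\theta_0)=\mathbf V$, $\mathbf G(\theta_0)=\mathbf G$). The elements of $\mathbf V(\theta),\mathbf G(\theta)$ are continuous in $\theta$, and the eigenvalues of $\mathbf G(\theta)^\top\mathbf G(\theta)$ and $\mathbf V(\theta)$ are uniformly bounded below and above (by positive constants) for all $\theta\in\Theta$. (iv) For any two models $\mathcal M_1,\mathcal M_2$, $\pi(\mathcal M_2)/\pi(\mathcal M_1)\le r$ for some constant $r>0$. (v) $\|\hat\theta-\bar\theta\|=O_p(1/n)$, where $\bar\theta=\theta_0-(\mathbf G^\top\mathbf V^{-1}\mathbf G)^{-1}\mathbf G^\top\mathbf V^{-1}\bar g(\mathbf D,\theta_0)$. (A10) Let $\mathbf F(\theta)$ be a $p\times p$ matrix with $\mathbf F(\theta)^\top\mathbf F(\theta)=\mathbf G(\theta)^\top\mathbf V(\theta)^{-1}\mathbf G(\theta)$, $Z=\sqrt n\,\mathbf F(\theta)(\hat\theta-\theta)$,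 and $p_Z(z\mid\theta)$ the density of $Z$ when the true parameter is $\theta$. Then $\sup_{\theta\in\Theta}\sup_z(1+\|z\|^{p+1})|p_Z(z\mid\theta)-\phi(z;0,\mathbf I_p)|=\tau_n$, where $\tau_n=o(1)$ does not depend on $z,\theta$, and $\phi(\cdot;\mu,\boldsymbol\Sigma)$ is the normal density with mean $\mu$ and covariance $\boldsymbol\Sigma$.
   Formalization: In (i) the upper bounds BF ⪯ n^{-(|M|-k_0)/2} hold as O_p, not with one fixed constant w.p.a.1; in (ii) τ_n in the bound for BF_θ̂ carries a factor K that is bounded in probability (depending on the confidence level), since factor 1 is false. *)

theory Defs
  imports
    "HOL-Probability.Probability"
    "HOL-Library.Landau_Symbols"
    "HOL-Library.Extended_Nat"
    "Jordan_Normal_Form.Gauss_Jordan_Elimination"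
    "Jordan_Normal_Form.Char_Poly"
begin

text \<open>
  The dimensions p and m vary with the sample size n, so they cannot be types.  Parameters are
  functions \<^typ>\<open>nat \<Rightarrow> real\<close> that vanish at all indices \<open>\<ge> p\<close>; their topology and
  Borel sets are those of the product space \<^typ>\<open>nat \<Rightarrow> real\<close>, which induce the usual ones
  on \<open>Rn p\<close>.  Moment vectors and matrices are \<^typ>\<open>real vec\<close> and \<^typ>\<open>real mat\<close>.
\<close>

section \<open>Euclidean space, matrices, derivatives\<close>

definition Rn :: "nat \<Rightarrow> (nat \<Rightarrow> real) set" where
  "Rn p = {x. \<forall>j\<ge>p. x j = 0}"

definition pad :: "nat set \<Rightarrow> (nat \<Rightarrow> real) \<Rightarrow> nat \<Rightarrow> real" where
  "pad I x = (\<lambda>j. if j \<in> I then x j else 0)"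

text \<open>\<open>leb I\<close> is card I-dimensional Lebesgue measure in the coordinates in \<open>I\<close>, carried by the
  vectors whose coordinates outside \<open>I\<close> vanish; \<open>leb {}\<close> is the unit point mass at 0.\<close>

definition leb :: "nat set \<Rightarrow> (nat \<Rightarrow> real) measure" where
  "leb I = distr (\<Pi>\<^sub>M j\<in>I. lborel) borel (pad I)"

lemma measurable_pad: "pad I \<in> measurable (\<Pi>\<^sub>M j\<in>I. (lborel :: real measure)) borel"
proof (rule measurable_coordinatewise_then_product)
  fix j :: nat
  show "(\<lambda>x. pad I x j) \<in> borel_measurable (\<Pi>\<^sub>M j\<in>I. (lborel :: real measure))"
    by (cases "j \<in> I") (auto simp: pad_def)
qed

definition nrm :: "nat \<Rightarrow> (nat \<Rightarrow> real) \<Rightarrow> real" where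
  "nrm p x = L2_set x {..<p}"

definition vnorm :: "real vec \<Rightarrow> real" where
  "vnorm v = L2_set (vec_index v) {..<dim_vec v}"

definition opnorm :: "real mat \<Rightarrow> real" where
  "opnorm A = Sup {vnorm (A *\<^sub>v v) |v. v \<in> carrier_vec (dim_col A) \<and> vnorm v = 1}"

definition minv :: "real mat \<Rightarrow> real mat" where
  "minv A = the (mat_inverse A)"

definition pos_def :: "nat \<Rightarrow> real mat \<Rightarrow> bool" where
  "pos_def m A \<longleftrightarrow> A \<in> carrier_mat m m \<and> transpose_mat A = A \<and>
     (\<forall>v\<in>carrier_vec m. v \<noteq> 0\<^sub>v m \<longrightarrow> 0 < scalar_prod v (A *\<^sub>v v))"

definition eigs_in :: "real mat \<Rightarrow> real \<Rightarrow> real \<Rightarrow> bool" where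
  "eigs_in A a b \<longleftrightarrow> (\<forall>l. eigenvalue A l \<longrightarrow> a \<le> l \<and> l \<le> b)"

text \<open>\<open>A\<close> is the Jacobian matrix at \<open>x\<close>, within the set \<open>T\<close>, of \<open>f\<close> as a map from \<open>Rn p\<close> to
  k-dimensional vectors (Frechet differentiability).\<close>

definition has_jacobian ::
  "nat \<Rightarrow> nat \<Rightarrow> ((nat \<Rightarrow> real) \<Rightarrow> real vec) \<Rightarrow> real mat \<Rightarrow> (nat \<Rightarrow> real) \<Rightarrow> (nat \<Rightarrow> real) set \<Rightarrow> bool"
  where
  "has_jacobian p k f A x T \<longleftrightarrow> A \<in> carrier_mat k p \<and>
     (\<forall>e>0. \<exists>d>0. \<forall>y\<in>T. nrm p (\<lambda>j. y j - x j) < d \<longrightarrow>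
        vnorm (f y - f x - A *\<^sub>v vec p (\<lambda>j. y j - x j)) \<le> e * nrm p (\<lambda>j. y j - x j))"

text \<open>The normal density with mean 0 and identity covariance in dimension p.\<close>

definition std_mvn :: "nat \<Rightarrow> (nat \<Rightarrow> real) \<Rightarrow> real" where
  "std_mvn p z = (2 * pi) powr (- (real p / 2)) * exp (- (nrm p z)\<^sup>2 / 2)"

section \<open>Square-integrable functions and covering numbers\<close>

definition L2_space :: "'d measure \<Rightarrow> ('d \<Rightarrow> real) set" where
  "L2_space P = {f \<in> borel_measurable P. integrable P (\<lambda>x. (f x)\<^sup>2)}"

definition L2_norm :: "'d measure \<Rightarrow> ('d \<Rightarrow> real) \<Rightarrow> real" where
  "L2_norm P f = sqrt (\<integral>x. (f x)\<^sup>2 \<partial>P)"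

definition covering_number :: "'d measure \<Rightarrow> real \<Rightarrow> ('d \<Rightarrow> real) set \<Rightarrow> enat" where
  "covering_number P r \<F> =
     (INF T\<in>{T. finite T \<and> T \<subseteq> L2_space P \<and> (\<forall>f\<in>\<F>. \<exists>h\<in>T. L2_norm P (\<lambda>x. f x - h x) < r)}.
        enat (card T))"

section \<open>The model for one sample size\<close>

text \<open>
  \<open>law \<theta>\<close> is the law of one observation when the true parameter is \<open>\<theta>\<close>, so the law of the
  observations is \<open>law (true_par X)\<close>.  \<open>jac\<close> and \<open>hess\<close> are the first and second derivatives of
  \<open>E g(D, \<theta>)\<close> in \<open>\<theta>\<close>, the latter one p x p matrix per component of g.  \<open>est_dens X t \<theta>\<close> and
  \<open>std_dens X z \<theta>\<close> are the densities of the estimator and of \<open>Z\<close> at \<open>t\<close> and \<open>z\<close> when the true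
  parameter is \<open>\<theta>\<close>.  Models are subsets of \<open>{..<dim_par X}\<close>; \<open>par_prior X M \<theta>\<close> is the prior
  density of \<open>\<theta>\<close> given \<open>M\<close>.
\<close>

record 'd gmm =
  dim_par :: nat
  dim_mom :: nat
  par_space :: "(nat \<Rightarrow> real) set"
  true_par :: "nat \<Rightarrow> real"
  law :: "(nat \<Rightarrow> real) \<Rightarrow> 'd measure"
  mom :: "'d \<Rightarrow> (nat \<Rightarrow> real) \<Rightarrow> real vec"
  wt :: "(nat \<Rightarrow> 'd) \<Rightarrow> real mat"
  jac :: "(nat \<Rightarrow> real) \<Rightarrow> real mat"
  hess :: "(nat \<Rightarrow> real) \<Rightarrow> nat \<Rightarrow> real mat"
  root :: "(nat \<Rightarrow> real) \<Rightarrow> real mat"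
  est :: "(nat \<Rightarrow> 'd) \<Rightarrow> nat \<Rightarrow> real"
  est_dens :: "(nat \<Rightarrow> real) \<Rightarrow> (nat \<Rightarrow> real) \<Rightarrow> real"
  std_dens :: "(nat \<Rightarrow> real) \<Rightarrow> (nat \<Rightarrow> real) \<Rightarrow> real"
  mod_prior :: "nat set \<Rightarrow> real"
  par_prior :: "nat set \<Rightarrow> (nat \<Rightarrow> real) \<Rightarrow> real"

definition obs_law :: "'d gmm \<Rightarrow> 'd measure" where
  "obs_law X = law X (true_par X)"

text \<open>The law of an i.i.d. sample of size \<open>n\<close> (indexed by \<open>0..n-1\<close>) when the true parameter is
  \<open>\<theta>\<close>.\<close>

definition sample_law :: "nat \<Rightarrow> 'd gmm \<Rightarrow> (nat \<Rightarrow> real) \<Rightarrow> (nat \<Rightarrow> 'd) measure" where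
  "sample_law n X \<theta> = (\<Pi>\<^sub>M i\<in>{..<n}. law X \<theta>)"

definition dist0 :: "'d gmm \<Rightarrow> (nat \<Rightarrow> real) \<Rightarrow> real" where
  "dist0 X \<theta> = nrm (dim_par X) (\<lambda>j. \<theta> j - true_par X j)"

definition ball0 :: "'d gmm \<Rightarrow> real \<Rightarrow> (nat \<Rightarrow> real) set" where
  "ball0 X e = {\<theta> \<in> par_space X. dist0 X \<theta> < e}"

definition eps :: "nat \<Rightarrow> 'd gmm \<Rightarrow> real" where
  "eps n X = sqrt (real (dim_par X) / real n)"

definition models :: "'d gmm \<Rightarrow> nat set set" where
  "models X = Pow {..<dim_par X}"

definition submodel :: "'d gmm \<Rightarrow> nat set \<Rightarrow> (nat \<Rightarrow> real) set" where
  "submodel X M = {\<theta> \<in> par_space X. \<forall>j. j \<notin> M \<longrightarrow> \<theta> j = 0}"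

definition true_model :: "'d gmm \<Rightarrow> nat set" where
  "true_model X = {j. j < dim_par X \<and> true_par X j \<noteq> 0}"

definition k0 :: "'d gmm \<Rightarrow> nat" where
  "k0 X = card (true_model X)"

text \<open>If the true model is empty there is no signal to bound; the value 1 then makes the
  conditions on the minimal signal vacuous.\<close>

definition min_signal :: "'d gmm \<Rightarrow> real" where
  "min_signal X = (if true_model X = {} then 1 else Min ((\<lambda>j. \<bar>true_par X j\<bar>) ` true_model X))"

definition mean_mom :: "'d gmm \<Rightarrow> (nat \<Rightarrow> real) \<Rightarrow> real vec" where
  "mean_mom X \<theta> = vec (dim_mom X) (\<lambda>k. \<integral>d. mom X d \<theta> $ k \<partial>obs_law X)"

definition var_mom :: "'d gmm \<Rightarrow> (nat \<Rightarrow> real) \<Rightarrow> real mat" where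
  "var_mom X \<theta> = mat (dim_mom X) (dim_mom X) (\<lambda>(k, l).
     \<integral>d. (mom X d \<theta> $ k - mean_mom X \<theta> $ k) * (mom X d \<theta> $ l - mean_mom X \<theta> $ l) \<partial>obs_law X)"

definition avg_mom :: "nat \<Rightarrow> 'd gmm \<Rightarrow> (nat \<Rightarrow> 'd) \<Rightarrow> (nat \<Rightarrow> real) \<Rightarrow> real vec" where
  "avg_mom n X D \<theta> = vec (dim_mom X) (\<lambda>k. (\<Sum>i<n. mom X (D i) \<theta> $ k) / real n)"

definition gmm_objective :: "nat \<Rightarrow> 'd gmm \<Rightarrow> (nat \<Rightarrow> 'd) \<Rightarrow> (nat \<Rightarrow> real) \<Rightarrow> real" where
  "gmm_objective n X D \<theta> =
     scalar_prod (avg_mom n X D \<theta>) (minv (var_mom X (true_par X)) *\<^sub>v avg_mom n X D \<theta>)"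

section \<open>Bayes factors\<close>

definition quasi_lik :: "nat \<Rightarrow> 'd gmm \<Rightarrow> (nat \<Rightarrow> 'd) \<Rightarrow> (nat \<Rightarrow> real) \<Rightarrow> real" where
  "quasi_lik n X D \<theta> =
     Determinant.det ((2 * pi / real n) \<cdot>\<^sub>m wt X D) powr (- 1 / 2) *
     exp (- (real n / 2) * scalar_prod (avg_mom n X D \<theta>) (minv (wt X D) *\<^sub>v avg_mom n X D \<theta>))"

definition marg_q :: "nat \<Rightarrow> 'd gmm \<Rightarrow> (nat \<Rightarrow> 'd) \<Rightarrow> nat set \<Rightarrow> real" where
  "marg_q n X D M = (LINT \<theta>:submodel X M|leb M. quasi_lik n X D \<theta> * par_prior X M \<theta>)"

definition BF_q :: "nat \<Rightarrow> 'd gmm \<Rightarrow> (nat \<Rightarrow> 'd) \<Rightarrow> nat set \<Rightarrow> nat set \<Rightarrow> real" where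
  "BF_q n X D M\<^sub>1 M\<^sub>2 = marg_q n X D M\<^sub>1 / marg_q n X D M\<^sub>2"

definition marg_est :: "'d gmm \<Rightarrow> (nat \<Rightarrow> 'd) \<Rightarrow> nat set \<Rightarrow> real" where
  "marg_est X D M = (LINT \<theta>:submodel X M|leb M. est_dens X (est X D) \<theta> * par_prior X M \<theta>)"

definition BF_est :: "'d gmm \<Rightarrow> (nat \<Rightarrow> 'd) \<Rightarrow> nat set \<Rightarrow> nat set \<Rightarrow> real" where
  "BF_est X D M\<^sub>1 M\<^sub>2 = marg_est X D M\<^sub>1 / marg_est X D M\<^sub>2"

text \<open>Bayes factors of \<open>M\<close> against the true model.\<close>

definition BFq0 :: "nat \<Rightarrow> 'd gmm \<Rightarrow> (nat \<Rightarrow> 'd) \<Rightarrow> nat set \<Rightarrow> real" where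
  "BFq0 n X D M = BF_q n X D M (true_model X)"

definition BFe0 :: "'d gmm \<Rightarrow> (nat \<Rightarrow> 'd) \<Rightarrow> nat set \<Rightarrow> real" where
  "BFe0 X D M = BF_est X D M (true_model X)"

section \<open>Stochastic orders for a sequence of models\<close>

definition wprob :: "(nat \<Rightarrow> 'd gmm) \<Rightarrow> (nat \<Rightarrow> (nat \<Rightarrow> 'd) \<Rightarrow> bool) \<Rightarrow> nat \<Rightarrow> real" where
  "wprob S Q n = \<P>(D in sample_law n (S n) (true_par (S n)). Q n D)"

definition wpa1 :: "(nat \<Rightarrow> 'd gmm) \<Rightarrow> (nat \<Rightarrow> (nat \<Rightarrow> 'd) \<Rightarrow> bool) \<Rightarrow> bool" where
  "wpa1 S Q \<longleftrightarrow> wprob S Q \<longlonglongrightarrow> 1"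

text \<open>\<open>Op S Y a\<close> means \<open>Y = O_p(a)\<close> for deterministic \<open>a\<close>.\<close>

definition Op :: "(nat \<Rightarrow> 'd gmm) \<Rightarrow> (nat \<Rightarrow> (nat \<Rightarrow> 'd) \<Rightarrow> real) \<Rightarrow> (nat \<Rightarrow> real) \<Rightarrow> bool" where
  "Op S Y a \<longleftrightarrow>
     (\<forall>\<delta>>0. \<exists>K>0. \<forall>\<^sub>F n in sequentially. wprob S (\<lambda>n D. \<bar>Y n D\<bar> \<le> K * a n) n \<ge> 1 - \<delta>)"

section \<open>Well-formedness of the model\<close>

definition est_minimizes :: "nat \<Rightarrow> 'd gmm \<Rightarrow> (nat \<Rightarrow> 'd) \<Rightarrow> bool" where
  "est_minimizes n X D \<longleftrightarrow>
     (\<forall>\<theta>\<in>Rn (dim_par X). gmm_objective n X D (est X D) \<le> gmm_objective n X D \<theta>)"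

text \<open>Types, measurability and the defining properties of the densities.  That \<open>\<theta>\<close> is the true
  parameter under \<open>law \<theta>\<close> is the moment condition for \<open>law \<theta>\<close>.  Second moments of g are needed for
  the variance matrices to exist.\<close>

definition gmm_structure :: "nat \<Rightarrow> 'd gmm \<Rightarrow> bool" where
  "gmm_structure n X \<longleftrightarrow>
     par_space X \<subseteq> Rn (dim_par X) \<and> true_par X \<in> par_space X \<and>
     (\<forall>\<theta>\<in>par_space X. prob_space (law X \<theta>) \<and> sets (law X \<theta>) = sets (obs_law X)) \<and>
     (\<forall>d \<theta>. mom X d \<theta> \<in> carrier_vec (dim_mom X)) \<and>
     (\<forall>k<dim_mom X. (\<lambda>(d, \<theta>). mom X d \<theta> $ k) \<in> borel_measurable (obs_law X \<Otimes>\<^sub>M borel)) \<and>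
     (\<forall>\<theta>\<in>par_space X. \<forall>k<dim_mom X.
        integrable (law X \<theta>) (\<lambda>d. mom X d \<theta> $ k) \<and> (\<integral>d. mom X d \<theta> $ k \<partial>law X \<theta>) = 0) \<and>
     (\<forall>\<theta>\<in>par_space X. \<forall>k<dim_mom X. integrable (obs_law X) (\<lambda>d. (mom X d \<theta> $ k)\<^sup>2)) \<and>
     (\<forall>D. wt X D \<in> carrier_mat (dim_mom X) (dim_mom X)) \<and>
     (\<forall>k<dim_mom X. \<forall>l<dim_mom X.
        (\<lambda>D. wt X D $$ (k, l)) \<in> borel_measurable (sample_law n X (true_par X))) \<and>
     est X \<in> measurable (sample_law n X (true_par X)) borel \<and>
     (\<forall>D. est X D \<in> Rn (dim_par X)) \<and>
     (\<forall>\<theta>\<in>par_space X. AE D in sample_law n X \<theta>. est_minimizes n X D) \<and>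
     (\<lambda>(t, \<theta>). est_dens X t \<theta>) \<in> borel_measurable (borel \<Otimes>\<^sub>M borel) \<and>
     (\<forall>t \<theta>. 0 \<le> est_dens X t \<theta>) \<and>
     (\<forall>\<theta>\<in>par_space X.
        distributed (sample_law n X \<theta>) (leb {..<dim_par X}) (est X) (\<lambda>t. ennreal (est_dens X t \<theta>))) \<and>
     (\<forall>M\<in>models X. par_prior X M \<in> borel_measurable borel \<and>
        (\<forall>\<theta>\<in>submodel X M. 0 \<le> par_prior X M \<theta>) \<and>
        (LINT \<theta>:submodel X M|leb M. par_prior X M \<theta>) = 1) \<and>
     (\<forall>M\<in>models X. 0 \<le> mod_prior X M) \<and> (\<Sum>M\<in>models X. mod_prior X M) = 1"

section \<open>Assumptions\<close>

text \<open>All assumptions are asymptotic: conditions on the individual objects are imposed for all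
  large \<open>n\<close>, with constants not depending on \<open>n\<close>.  The i.i.d. assumption and the moment condition
  at the true parameter are part of \<^const>\<open>sample_law\<close> and \<^const>\<open>gmm_structure\<close>.\<close>

definition cond_parameter_space :: "(nat \<Rightarrow> 'd gmm) \<Rightarrow> bool" where
  "cond_parameter_space S \<longleftrightarrow>
     (\<exists>R>0. \<forall>\<^sub>F n in sequentially.
        compact (par_space (S n)) \<and> connected (par_space (S n)) \<and>
        (SUP \<theta>\<in>par_space (S n). nrm (dim_par (S n)) \<theta>) = R) \<and>
     (\<exists>\<rho>>0. \<forall>\<^sub>F n in sequentially.
        {\<theta> \<in> Rn (dim_par (S n)). dist0 (S n) \<theta> < \<rho>} \<subseteq> par_space (S n))"

definition cond_dimensions :: "(nat \<Rightarrow> 'd gmm) \<Rightarrow> real \<Rightarrow> bool" where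
  "cond_dimensions S \<alpha> \<longleftrightarrow>
     (\<forall>\<^sub>F n in sequentially. dim_par (S n) \<le> dim_mom (S n)) \<and>
     (\<lambda>n. real (dim_par (S n))) \<in> \<Theta>(\<lambda>n. real (dim_mom (S n))) \<and>
     (\<lambda>n. real (dim_par (S n)) ^ 4 * (ln (real n))\<^sup>2 / real n) \<longlonglongrightarrow> 0 \<and>
     (\<lambda>n. real (dim_par (S n)) powr (2 + \<alpha>) * ln (real n) / real n powr \<alpha>) \<longlonglongrightarrow> 0"

definition cond_signal :: "(nat \<Rightarrow> 'd gmm) \<Rightarrow> bool" where
  "cond_signal S \<longleftrightarrow>
     (\<lambda>n. sqrt (ln (real n)) * eps n (S n)) \<in> o(\<lambda>n. min_signal (S n)) \<and>
     (\<lambda>n. min_signal (S n)) \<in> O(\<lambda>n. 1)"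

definition unit_vecs :: "nat \<Rightarrow> real vec set" where
  "unit_vecs k = {v \<in> carrier_vec k. vnorm v = 1}"

definition mom_diff :: "'d gmm \<Rightarrow> real vec \<Rightarrow> (nat \<Rightarrow> real) \<Rightarrow> 'd \<Rightarrow> real" where
  "mom_diff X \<eta> \<theta> d = scalar_prod \<eta> (mom X d \<theta> - mom X d (true_par X))"

definition mom_class :: "'d gmm \<Rightarrow> ('d \<Rightarrow> real) set" where
  "mom_class X = {mom_diff X \<eta> \<theta> |\<eta> \<theta>. \<theta> \<in> par_space X \<and> \<eta> \<in> unit_vecs (dim_mom X)}"

definition cond_moment_class :: "(nat \<Rightarrow> 'd gmm) \<Rightarrow> real \<Rightarrow> bool" where
  "cond_moment_class S \<alpha> \<longleftrightarrow> 0 < \<alpha> \<and> \<alpha> \<le> 1 \<and>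
     (\<exists>K. \<forall>\<^sub>F n in sequentially. \<forall>\<theta>\<in>par_space (S n). \<forall>\<eta>\<in>unit_vecs (dim_mom (S n)).
        L2_norm (obs_law (S n)) (mom_diff (S n) \<eta> \<theta>)
          \<le> K * (sqrt (real (dim_par (S n))) * dist0 (S n) \<theta>) powr \<alpha>) \<and>
     (\<exists>F. (\<forall>\<^sub>F n in sequentially. F n \<in> L2_space (obs_law (S n)) \<and>
            (\<forall>f\<in>mom_class (S n). \<forall>d\<in>space (obs_law (S n)). \<bar>f d\<bar> \<le> F n d)) \<and>
          (\<lambda>n. L2_norm (obs_law (S n)) (F n)) \<in> O(\<lambda>n. sqrt (real (dim_par (S n)))) \<and>
          (\<exists>K. \<exists>e\<^sub>0>0. \<forall>\<^sub>F n in sequentially. \<forall>e. 0 < e \<and> e < e\<^sub>0 \<longrightarrow>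
             (let N = covering_number (obs_law (S n)) (e * L2_norm (obs_law (S n)) (F n))
                        (mom_class (S n))
              in N \<noteq> \<infinity> \<and> ln (real (the_enat N)) \<le> K * real (dim_par (S n)) * ln (real n / e))))"

definition hess_form :: "'d gmm \<Rightarrow> (nat \<Rightarrow> real) \<Rightarrow> real vec \<Rightarrow> real vec \<Rightarrow> real vec" where
  "hess_form X \<theta> u v = vec (dim_mom X) (\<lambda>k. scalar_prod u (hess X \<theta> k *\<^sub>v v))"

definition has_jac :: "'d gmm \<Rightarrow> (nat \<Rightarrow> real) \<Rightarrow> bool" where
  "has_jac X \<theta> \<longleftrightarrow>
     has_jacobian (dim_par X) (dim_mom X) (mean_mom X) (jac X \<theta>) \<theta> (par_space X)"

definition has_hess :: "'d gmm \<Rightarrow> (nat \<Rightarrow> real) \<Rightarrow> bool" where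
  "has_hess X \<theta> \<longleftrightarrow> (\<forall>k<dim_mom X.
     has_jacobian (dim_par X) (dim_par X) (\<lambda>\<xi>. Matrix.row (jac X \<xi>) k) (hess X \<theta> k) \<theta> (par_space X))"

definition cond_identification :: "(nat \<Rightarrow> 'd gmm) \<Rightarrow> bool" where
  "cond_identification S \<longleftrightarrow>
     (\<exists>\<delta>\<^sub>0>0. \<exists>\<delta>\<^sub>1>0. \<forall>\<^sub>F n in sequentially. \<forall>\<theta>\<in>par_space (S n).
        min \<delta>\<^sub>0 (\<delta>\<^sub>1 * dist0 (S n) \<theta>) \<le> vnorm (mean_mom (S n) \<theta>)) \<and>
     (\<exists>a>0. \<exists>b>0. \<forall>\<^sub>F n in sequentially. has_jac (S n) (true_par (S n)) \<and>
        eigs_in (transpose_mat (jac (S n) (true_par (S n))) * jac (S n) (true_par (S n))) a b) \<and>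
     (\<forall>C>0. \<exists>K. \<forall>\<^sub>F n in sequentially. \<forall>\<theta>\<in>ball0 (S n) (C * eps n (S n)).
        has_jac (S n) \<theta> \<and> has_hess (S n) \<theta> \<and>
        (\<forall>u\<in>unit_vecs (dim_par (S n)). \<forall>v\<in>unit_vecs (dim_par (S n)).
           vnorm (hess_form (S n) \<theta> u v) \<le> K * sqrt (real (dim_par (S n)))))"

definition cond_weight :: "(nat \<Rightarrow> 'd gmm) \<Rightarrow> bool" where
  "cond_weight S \<longleftrightarrow>
     (\<forall>\<^sub>F n in sequentially. \<forall>D\<in>space (sample_law n (S n) (true_par (S n))).
        pos_def (dim_mom (S n)) (wt (S n) D)) \<and>
     (\<forall>e>0. wpa1 S (\<lambda>n D. opnorm (wt (S n) D - var_mom (S n) (true_par (S n))) < e)) \<and>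
     (\<exists>a>0. \<exists>b>0. wpa1 S (\<lambda>n D. eigs_in (wt (S n) D) a b \<and>
        eigs_in (var_mom (S n) (true_par (S n))) a b))"

text \<open>The explicit positivity of the prior density near the true parameter is part of the
  logarithmic condition, since \<^term>\<open>ln (0::real)\<close> is 0 rather than minus infinity.\<close>

definition cond_par_prior :: "(nat \<Rightarrow> 'd gmm) \<Rightarrow> bool" where
  "cond_par_prior S \<longleftrightarrow>
     (\<exists>c. \<forall>\<^sub>F n in sequentially. \<forall>M\<in>models (S n). \<forall>\<theta>\<in>submodel (S n) M. par_prior (S n) M \<theta> \<le> c) \<and>
     (\<forall>C>0. \<forall>e>0. \<forall>\<^sub>F n in sequentially. \<forall>M\<in>models (S n). true_model (S n) \<subseteq> M \<longrightarrow>
        (\<forall>\<theta>\<in>submodel (S n) M \<inter> ball0 (S n) (C * eps n (S n)).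
           0 < par_prior (S n) M \<theta> \<and>
           \<bar>ln (par_prior (S n) M \<theta>) - ln (par_prior (S n) M (true_par (S n)))\<bar> < e)) \<and>
     (\<exists>c\<^sub>0>0. \<exists>c\<^sub>1>0. \<forall>\<^sub>F n in sequentially. \<forall>M\<in>models (S n). true_model (S n) \<subseteq> M \<longrightarrow>
        exp (- c\<^sub>0 * real (card M)) \<le> par_prior (S n) M (true_par (S n)) \<and>
        \<bar>ln (par_prior (S n) M (true_par (S n)))
           - ln (par_prior (S n) (true_model (S n)) (true_par (S n)))\<bar>
          \<le> c\<^sub>1 * (real (card M) - real (k0 (S n))))"

definition cond_mod_prior :: "(nat \<Rightarrow> 'd gmm) \<Rightarrow> bool" where
  "cond_mod_prior S \<longleftrightarrow>
     (\<forall>\<^sub>F n in sequentially. 0 < mod_prior (S n) (true_model (S n))) \<and>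
     (\<forall>e>0. \<forall>\<^sub>F n in sequentially. \<forall>M\<in>models (S n). true_model (S n) \<subset> M \<longrightarrow>
        mod_prior (S n) M / mod_prior (S n) (true_model (S n)) *
          (real (dim_par (S n)) / sqrt (real n)) ^ (card M - k0 (S n)) < e) \<and>
     (\<exists>r\<^sub>1>0. \<exists>K. \<forall>\<^sub>F n in sequentially. \<forall>M\<in>models (S n). true_model (S n) - M \<noteq> {} \<longrightarrow>
        mod_prior (S n) M / mod_prior (S n) (true_model (S n))
          \<le> K * exp (r\<^sub>1 * real (dim_par (S n)) * ln (real n)))"

definition oracle_est :: "nat \<Rightarrow> 'd gmm \<Rightarrow> (nat \<Rightarrow> 'd) \<Rightarrow> nat \<Rightarrow> real" where
  "oracle_est n X D = (let G = jac X (true_par X); W = minv (var_mom X (true_par X));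
      v = minv (transpose_mat G * W * G) *\<^sub>v (transpose_mat G *\<^sub>v (W *\<^sub>v avg_mom n X D (true_par X)))
    in (\<lambda>j. if j < dim_par X then true_par X j - v $ j else 0))"

definition cond_fixed_dimension :: "(nat \<Rightarrow> 'd gmm) \<Rightarrow> real \<Rightarrow> bool" where
  "cond_fixed_dimension S \<theta>\<^sub>l \<longleftrightarrow>
     (\<exists>pmax. \<forall>\<^sub>F n in sequentially. 1 \<le> dim_par (S n) \<and> dim_par (S n) \<le> pmax) \<and>
     0 < \<theta>\<^sub>l \<and> (\<forall>\<^sub>F n in sequentially. \<forall>j\<in>true_model (S n). \<theta>\<^sub>l \<le> \<bar>true_par (S n) j\<bar>) \<and>
     (\<forall>\<^sub>F n in sequentially.
        (\<forall>\<theta>\<in>par_space (S n). has_jac (S n) \<theta>) \<and>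
        (\<forall>k<dim_mom (S n). \<forall>l<dim_mom (S n).
           continuous_on (par_space (S n)) (\<lambda>\<theta>. var_mom (S n) \<theta> $$ (k, l))) \<and>
        (\<forall>k<dim_mom (S n). \<forall>j<dim_par (S n).
           continuous_on (par_space (S n)) (\<lambda>\<theta>. jac (S n) \<theta> $$ (k, j)))) \<and>
     (\<exists>a>0. \<exists>b>0. \<forall>\<^sub>F n in sequentially. \<forall>\<theta>\<in>par_space (S n).
        eigs_in (transpose_mat (jac (S n) \<theta>) * jac (S n) \<theta>) a b \<and>
        eigs_in (var_mom (S n) \<theta>) a b) \<and>
     (\<exists>r>0. \<forall>\<^sub>F n in sequentially. \<forall>M\<^sub>1\<in>models (S n). \<forall>M\<^sub>2\<in>models (S n).
        0 < mod_prior (S n) M\<^sub>1 \<and> mod_prior (S n) M\<^sub>2 / mod_prior (S n) M\<^sub>1 \<le> r) \<and>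
     Op S (\<lambda>n D. nrm (dim_par (S n)) (\<lambda>j. est (S n) D j - oracle_est n (S n) D j)) (\<lambda>n. 1 / real n)"

definition std_est :: "nat \<Rightarrow> 'd gmm \<Rightarrow> (nat \<Rightarrow> real) \<Rightarrow> (nat \<Rightarrow> 'd) \<Rightarrow> nat \<Rightarrow> real" where
  "std_est n X \<theta> D = (\<lambda>j. if j < dim_par X
     then sqrt (real n) * (root X \<theta> *\<^sub>v vec (dim_par X) (\<lambda>i. est X D i - \<theta> i)) $ j else 0)"

definition cond_est_density :: "(nat \<Rightarrow> 'd gmm) \<Rightarrow> (nat \<Rightarrow> real) \<Rightarrow> bool" where
  "cond_est_density S \<tau> \<longleftrightarrow>
     (\<forall>\<^sub>F n in sequentially. \<forall>\<theta>\<in>par_space (S n).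
        root (S n) \<theta> \<in> carrier_mat (dim_par (S n)) (dim_par (S n)) \<and>
        transpose_mat (root (S n) \<theta>) * root (S n) \<theta>
          = transpose_mat (jac (S n) \<theta>) * minv (var_mom (S n) \<theta>) * jac (S n) \<theta> \<and>
        (\<forall>z. 0 \<le> std_dens (S n) z \<theta>) \<and>
        distributed (sample_law n (S n) \<theta>) (leb {..<dim_par (S n)}) (std_est n (S n) \<theta>)
          (\<lambda>z. ennreal (std_dens (S n) z \<theta>))) \<and>
     (\<forall>\<^sub>F n in sequentially.
        (SUP \<theta>\<in>par_space (S n). SUP z\<in>Rn (dim_par (S n)).
           ereal ((1 + nrm (dim_par (S n)) z ^ (dim_par (S n) + 1)) *
                  \<bar>std_dens (S n) z \<theta> - std_mvn (dim_par (S n)) z\<bar>)) = ereal (\<tau> n)) \<and>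
     \<tau> \<longlonglongrightarrow> 0"

end

theory Submission
 imports Defs "HOL-Real_Asymp.Real_Asymp"
begin

text \<open>Both Bayes factors are quotients of integrals over a model of a kernel against the prior density.
 On the scale \<open>1 / sqrt n\<close> around the true parameter both kernels, suitably normalised, approach in
 \<open>L\<^sup>1\<close> one and the same Gaussian kernel, centred at the oracle version of the estimator: the
 quasi-likelihood because the moment equations linearise (\<open>q_kernel_dist\<close>), the density of the
 estimator because its standardisation is nearly standard normal (\<open>e_kernel_dist\<close>).  The
 normalisations do not depend on the model and cancel in the Bayes factors.  Hence for a model that
 contains the true one both marginal likelihoods, multiplied by \<open>sqrt n\<close> to the power of the model
 dimension, have the same positive random limit (\<open>likely_mass_event\<close>), the prior density at the true
 parameter times the Gaussian mass of the model (\<open>limit_mass\<close>).  The quotient of the scale factors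
 is the rate, and the quotient of the two Bayes factors tends to 1.

 No uniform law over the parameter space is used.  Since only integrals over the parameter matter,
 the error terms are estimated in mean for each parameter separately, integrated with Tonelli's
 theorem, and converted into statements about probabilities with Markov's inequality.  Near the true
 parameter second moments suffice (\<open>fluct_near_expectation\<close>).  Far from it the
 quasi-likelihood must be exponentially small although the moments are only square integrable:
 projecting the moment function on the direction of its mean and truncating the projection from below
 gives a variable with a one-sided exponential moment (\<open>tail_expectation\<close>), and the truncation error
 is governed by an average of the envelope.

 A model that misses a coordinate of the true one stays at a fixed distance from the true parameter.
 The same exponential bound then has a rate proportional to the sample size
 (\<open>separated_point\<close>).  For the estimator the Gaussian part decays in the same way, and the
 approximation error \<open>\<tau> n\<close> is divided by the power \<open>p + 1\<close> of \<open>sqrt n\<close>, which is where the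
 rate \<open>n\<close> to the power \<open>- (p - k + 1) / 2\<close> comes from (\<open>e_separated\<close>).\<close>

section \<open>Vectors, matrices and quadratic forms\<close>

abbreviation en :: "real => ennreal" where
 "en == ennreal"

abbreviation bm :: "'x measure => ('x => 'y::topological_space) set" where
 "bm == borel_measurable"

abbreviation eventually_seq :: "(nat => bool) => bool" (binder "EV " 10) where
 "eventually_seq P == eventually P sequentially"

abbreviation dot :: "real vec => real vec => real" (infix "\<star>" 70) where
 "x \<star> y \<equiv> scalar_prod x y"

lemma vnorm_nonneg [simp]: "0 <= vnorm v"
 by (simp add: vnorm_def)

lemma dot_self: "v \<star> v = (vnorm v)\<^sup>2"
 by (simp add: vnorm_def L2_set_def scalar_prod_def sum_nonneg power2_eq_square lessThan_atLeast0)

lemma dot_self_nonneg [simp]: "0 <= v \<star> (v :: real vec)"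
 by (simp add: dot_self)

lemma abs_dot_le:
 assumes "v : carrier_vec k" "w : carrier_vec k"
 shows "\<bar>v \<star> w\<bar> <= vnorm v * vnorm w"
proof -
 have "\<bar>v \<star> w\<bar> <= (\<Sum>i<k. \<bar>v $ i\<bar> * \<bar>w $ i\<bar>)"
  using assms by (auto simp: scalar_prod_def abs_mult lessThan_atLeast0 intro!: order.trans[OF sum_abs])
 also have "... <= L2_set (vec_index v) {..<k} * L2_set (vec_index w) {..<k}"
  by (rule L2_set_mult_ineq)
 finally show ?thesis using assms by (simp add: vnorm_def)
qed

lemma vnorm_triangle:
 assumes "v : carrier_vec k" "w : carrier_vec k"
 shows "vnorm (v + w) <= vnorm v + vnorm w"
proof -
 have "L2_set (vec_index (v + w)) {..<k} = L2_set (%i. v $ i + w $ i) {..<k}"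
  using assms by (intro L2_set_cong) auto
 also have "... <= L2_set (vec_index v) {..<k} + L2_set (vec_index w) {..<k}"
  by (rule L2_set_triangle_ineq)
 finally show ?thesis using assms by (simp add: vnorm_def)
qed

lemma vnorm_smult: "vnorm (c \<cdot>\<^sub>v v) = \<bar>c\<bar> * vnorm v"
proof -
 have "L2_set (vec_index (c \<cdot>\<^sub>v v)) {..<dim_vec v} = L2_set (%i. \<bar>c\<bar> * v $ i) {..<dim_vec v}"
  unfolding L2_set_def by (intro arg_cong[where f=sqrt] sum.cong) (auto simp: power_mult_distrib)
 then show ?thesis by (simp add: vnorm_def L2_set_right_distrib)
qed

lemma vnorm_uminus: "vnorm (- v) = vnorm v"
 by (simp add: vnorm_def L2_set_def)

lemma vnorm_diff_triangle:
 assumes "v : carrier_vec k" "w : carrier_vec k"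
 shows "vnorm v <= vnorm w + vnorm (v - w)"
proof -
 have "v = w + (v - w)" using assms by auto
 then show ?thesis using vnorm_triangle[of w k "v - w"] assms by simp
qed

lemma vnorm_zero [simp]: "vnorm (0\<^sub>v k) = 0"
 by (simp add: vnorm_def L2_set_def)

lemma vnorm_eq_0: "v : carrier_vec k ==> vnorm v = 0 \<longleftrightarrow> v = 0\<^sub>v k"
 by (auto simp: vnorm_def L2_set_eq_0_iff)

lemma vnorm_le_sum_abs: "v : carrier_vec k ==> vnorm v <= (\<Sum>i<k. \<bar>v $ i\<bar>)"
 unfolding vnorm_def using L2_set_le_sum_abs[of "vec_index v" "{..<k}"] by simp

lemma abs_index_le_vnorm:
 assumes "v : carrier_vec k" "i < k"
 shows "\<bar>v $ i\<bar> <= vnorm v"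
 using member_le_L2_set[of "{..<k}" i "%i. \<bar>v $ i\<bar>"] assms
 by (simp add: vnorm_def L2_set_def)

lemma vnorm_le_if_dot:
 assumes v: "v : carrier_vec k" and le: "!!et. et : carrier_vec k ==> vnorm et = 1 ==> et \<star> v <= c" and c: "0 <= c"
 shows "vnorm v <= c"
proof (cases "vnorm v = 0")
 case True then show ?thesis using c by simp
next
 case False
 then have pos: "0 < vnorm v" by (simp add: less_le)
 have "vnorm ((1 / vnorm v) \<cdot>\<^sub>v v) = 1" using pos by (simp add: vnorm_smult)
 from le[OF _ this] v have "(1 / vnorm v) * (v \<star> v) <= c" by simp
 then show ?thesis using pos by (simp add: dot_self power2_eq_square)
qed

lemma nrm_vec: "nrm p x = vnorm (vec p x)"
 unfolding nrm_def vnorm_def by (auto intro: L2_set_cong)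

lemma nrm_nonneg [simp]: "0 <= nrm p x"
 by (simp add: nrm_def)

lemma mult_mat_zero_vec: "A : carrier_mat k l ==> A *\<^sub>v 0\<^sub>v l = (0\<^sub>v k :: real vec)"
 by (intro eq_vecI) (auto simp: scalar_prod_def)

lemma smult_mat_vec:
 "A : carrier_mat k l ==> v : carrier_vec l ==> (c \<cdot>\<^sub>m A) *\<^sub>v v = c \<cdot>\<^sub>v (A *\<^sub>v (v :: real vec))"
 by (intro eq_vecI) (auto simp: scalar_prod_def sum_distrib_left mult.assoc)

subsection \<open>Quadratic forms\<close>

text \<open>The two-sided form bound replaces the spectrum: it is stable under the inequalities used
 below and needs no diagonalisation.\<close>

definition form_in :: "nat => real mat => real => real => bool" where
 "form_in k A a b \<longleftrightarrow> A : carrier_mat k k & transpose_mat A = A &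
  (ALL v:carrier_vec k. a * (vnorm v)\<^sup>2 <= v \<star> (A *\<^sub>v v) & v \<star> (A *\<^sub>v v) <= b * (vnorm v)\<^sup>2)"

lemma sym_dot:
 assumes "A : carrier_mat k k" "transpose_mat A = A" "x : carrier_vec k" "y : carrier_vec k"
 shows "x \<star> (A *\<^sub>v y) = y \<star> (A *\<^sub>v x)"
proof -
 have "x \<star> (A *\<^sub>v y) = (A *\<^sub>v x) \<star> y"
  using transpose_vec_mult_scalar[OF assms(1) assms(4) assms(3)] assms(2) by simp
 also have "... = y \<star> (A *\<^sub>v x)"
  using assms by (intro comm_scalar_prod[of _ k]) auto
 finally show ?thesis .
qed

lemma form_add:
 assumes A: "A : carrier_mat k k" "transpose_mat A = A" and xy: "x : carrier_vec k" "y : carrier_vec k"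
 shows "(x + y) \<star> (A *\<^sub>v (x + y)) = x \<star> (A *\<^sub>v x) + 2 * (x \<star> (A *\<^sub>v y)) + y \<star> (A *\<^sub>v y)"
proof -
 have "(x + y) \<star> (A *\<^sub>v (x + y)) = x \<star> (A *\<^sub>v x) + x \<star> (A *\<^sub>v y) + (y \<star> (A *\<^sub>v x) + y \<star> (A *\<^sub>v y))"
  using A xy by (simp add: mult_add_distrib_mat_vec[of _ k k] add_scalar_prod_distrib[of _ k] scalar_prod_add_distrib[of _ k])
 then show ?thesis using sym_dot[OF A xy] by simp
qed

lemma form_smult:
 assumes A: "A : carrier_mat k k" and x: "x : carrier_vec k"
 shows "(c \<cdot>\<^sub>v x) \<star> (A *\<^sub>v (c \<cdot>\<^sub>v x)) = c\<^sup>2 * (x \<star> (A *\<^sub>v x))"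
 using A x by (simp add: mult_mat_vec[of _ k k] power2_eq_square)

lemma discriminant_nonpos:
 fixes a b c :: real
 assumes "!!t. 0 <= a + 2 * t * b + t\<^sup>2 * c" "0 <= c"
 shows "b\<^sup>2 <= a * c"
proof (cases "c = 0")
 case True
 have "b = 0"
 proof (rule ccontr)
  assume "b ~= 0"
  with assms(1)[of "- (a + 1) / (2 * b)"] True show False by (simp add: field_simps)
 qed
 then show ?thesis using True by simp
next
 case False
 then have "0 < c" using assms(2) by simp
 have "0 <= a + 2 * (- b / c) * b + (- b / c)\<^sup>2 * c" by (rule assms(1))
 also have "... = a - b\<^sup>2 / c" using \<open>0 < c\<close> by (simp add: field_simps power2_eq_square)
 finally show ?thesis using \<open>0 < c\<close> by (simp add: field_simps)
qed

lemma psd_Cauchy_Schwarz: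
 assumes A: "A : carrier_mat k k" "transpose_mat A = A"
  and psd: "!!v. v : carrier_vec k ==> 0 <= v \<star> (A *\<^sub>v v)"
  and xy: "x : carrier_vec k" "y : carrier_vec k"
 shows "(x \<star> (A *\<^sub>v y))\<^sup>2 <= (x \<star> (A *\<^sub>v x)) * (y \<star> (A *\<^sub>v y))"
proof (rule discriminant_nonpos)
 fix t :: real
 have "0 <= (x + t \<cdot>\<^sub>v y) \<star> (A *\<^sub>v (x + t \<cdot>\<^sub>v y))" using xy by (intro psd) auto
 also have "... = x \<star> (A *\<^sub>v x) + 2 * t * (x \<star> (A *\<^sub>v y)) + t\<^sup>2 * (y \<star> (A *\<^sub>v y))"
  using A xy by (simp add: form_add form_smult mult_mat_vec[of _ k k] power2_eq_square)
 finally show "0 <= ..." .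
qed (use psd xy in auto)

lemma compact_unit_cube: "compact (UNIV \<rightarrow>\<^sub>E {-1..1::real} :: (nat => real) set)"
proof -
 have "compactin (product_topology (%i::nat. euclidean :: real topology) UNIV) (UNIV \<rightarrow>\<^sub>E {-1..1::real})"
  by (simp add: compactin_PiE)
 then show ?thesis by (simp add: euclidean_product_topology compactin_euclidean_iff)
qed

lemma dot_mult_mat_vec_sum:
 assumes "A : carrier_mat k k" "x : carrier_vec k" "y : carrier_vec k"
 shows "x \<star> (A *\<^sub>v y) = (\<Sum>i<k. \<Sum>j<k. x $ i * A $$ (i, j) * y $ j)"
 using assms by (auto simp: scalar_prod_def lessThan_atLeast0 sum_distrib_left mult.assoc intro!: sum.cong)

text \<open>Why a bound on all eigenvalues bounds the form: the maximum \<open>%\<close> of the form over the unit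
 sphere is attained, say at \<open>x\<close>; the form of \<open>% I - A\<close> is then nonnegative and vanishes at \<open>x\<close>,
 so \<open>(% I - A) x = 0\<close> by the Cauchy--Schwarz inequality, and \<open>%\<close> is an eigenvalue.\<close>

lemma form_le_if_eigenvalues_le:
 assumes A: "A : carrier_mat k k" "transpose_mat A = A"
  and le: "!!l. eigenvalue A l ==> l <= b"
  and v: "v : carrier_vec k"
 shows "v \<star> (A *\<^sub>v v) <= b * (vnorm v)\<^sup>2"
proof (cases "v = 0\<^sub>v k")
 case True then show ?thesis using A by simp
next
 case False
 then have k: "0 < k" using v by (cases k) auto
 define S where "S = {x : UNIV \<rightarrow>\<^sub>E {-1..1::real}. (\<forall>j\<ge>k. x j = (0::real)) & (\<Sum>j<k. (x j)\<^sup>2) = 1}"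
 define q where "q x = (\<Sum>i<k. \<Sum>j<k. x i * A $$ (i, j) * x j)" for x :: "nat => real"
 have cont: "continuous_on UNIV q" unfolding q_def by (intro continuous_intros continuous_on_product_coordinates)
 define Z where "Z = {x :: nat => real. (\<forall>j\<ge>k. x j = (0::real)) & (\<Sum>j<k. (x j)\<^sup>2) = 1}"
 have "closed Z" unfolding Z_def
  by (intro closed_Collect_conj closed_Collect_all closed_Collect_imp open_Collect_const closed_Collect_eq continuous_intros continuous_on_product_coordinates)
 moreover have "S = (UNIV \<rightarrow>\<^sub>E {-1..1}) \<inter> Z" unfolding S_def Z_def by blast
 ultimately have "compact S"
  using compact_Int_closed[OF compact_unit_cube] by metis
 moreover have "(%j. if j = 0 then 1 else 0) : S"
  using k by (auto simp: S_def PiE_def if_distrib[where f="%x. x\<^sup>2"] cong: if_cong)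
 ultimately obtain x where x: "x : S" "!!y. y : S ==> q y <= q x"
  using continuous_attains_sup[of S q] continuous_on_subset[OF cont] by blast
 have q_vec: "vec k y \<star> (A *\<^sub>v vec k y) = q y" for y
  using A by (simp add: dot_mult_mat_vec_sum q_def)
 have form_le: "y \<star> (A *\<^sub>v y) <= q x * (vnorm y)\<^sup>2" if y: "y : carrier_vec k" for y
 proof (cases "vnorm y = 0")
  case True then show ?thesis using A y by (simp add: vnorm_eq_0[OF y])
 next
  case False
  then have pos: "0 < vnorm y" by (simp add: less_le)
  define z where "z j = (if j < k then y $ j / vnorm y else 0)" for j
  have zy: "vec k z = (1 / vnorm y) \<cdot>\<^sub>v y" using y by (auto simp: z_def)
  have "vnorm (vec k z) = 1" using pos by (simp add: zy vnorm_smult)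
  then have sq: "(\<Sum>j<k. (z j)\<^sup>2) = 1" by (simp add: vnorm_def L2_set_def)
  have "\<bar>z j\<bar> <= 1" for j
  using abs_index_le_vnorm[OF y, of j] pos by (auto simp: z_def field_simps)
  then have "z j : {-1..1}" for j by (metis abs_le_iff atLeastAtMost_iff minus_le_iff)
  with sq have "z : S" by (auto simp: S_def z_def)
  from x(2)[OF this] have "(1 / vnorm y)\<^sup>2 * (y \<star> (A *\<^sub>v y)) <= q x"
  using q_vec[of z] form_smult[OF A(1) y, of "1 / vnorm y"] by (simp add: zy)
  then show ?thesis using pos by (simp add: field_simps power2_eq_square)
 qed
 define xv where "xv = vec k x"
 have xv: "xv : carrier_vec k" by (simp add: xv_def)
 have nx: "vnorm xv = 1" using x(1) by (simp add: xv_def vnorm_def L2_set_def S_def)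
 define B where "B = q x \<cdot>\<^sub>m 1\<^sub>m k - A"
 have Bc: "B : carrier_mat k k" using A unfolding B_def by (intro minus_carrier_mat)
 have Bv: "B *\<^sub>v y = q x \<cdot>\<^sub>v y - A *\<^sub>v y" if "y : carrier_vec k" for y
 proof -
  have "(q x \<cdot>\<^sub>m 1\<^sub>m k) *\<^sub>v y = q x \<cdot>\<^sub>v (1\<^sub>m k *\<^sub>v y)" using that
  by (intro smult_mat_vec) auto
  then have "(q x \<cdot>\<^sub>m 1\<^sub>m k) *\<^sub>v y = q x \<cdot>\<^sub>v y" using that by simp
  then show ?thesis unfolding B_def using A that by (subst minus_mult_distrib_mat_vec[of _ k k]) auto
 qed
 have Bdot: "y \<star> (B *\<^sub>v z) = q x * (y \<star> z) - y \<star> (A *\<^sub>v z)"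
  if "y : carrier_vec k" "z : carrier_vec k" for y z
  using that A by (simp add: Bv scalar_prod_minus_distrib[of _ k])
 have Bt: "transpose_mat B = B"
 proof -
  have "transpose_mat (q x \<cdot>\<^sub>m 1\<^sub>m k) = q x \<cdot>\<^sub>m 1\<^sub>m k" by (intro eq_matI) auto
  then show ?thesis using A transpose_minus[of "q x \<cdot>\<^sub>m 1\<^sub>m k" k k A] by (simp add: B_def)
 qed
 have "0 <= y \<star> (B *\<^sub>v y)" if "y : carrier_vec k" for y
  using form_le[OF that] Bdot[OF that that] by (simp add: dot_self)
 from psd_Cauchy_Schwarz[OF Bc Bt this, of "B *\<^sub>v xv" xv]
 have "((vnorm (B *\<^sub>v xv))\<^sup>2)\<^sup>2 <= ((B *\<^sub>v xv) \<star> (B *\<^sub>v (B *\<^sub>v xv))) * (xv \<star> (B *\<^sub>v xv))"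
  using Bc xv by (simp add: dot_self)
 also have "xv \<star> (B *\<^sub>v xv) = 0"
  using Bdot[OF xv xv] q_vec[of x] nx by (simp add: xv_def dot_self)
 finally have "vnorm (B *\<^sub>v xv) = 0" by simp
 then have "B *\<^sub>v xv = 0\<^sub>v k" using vnorm_eq_0[of "B *\<^sub>v xv" k] Bc xv by simp
 then have eq: "A *\<^sub>v xv = q x \<cdot>\<^sub>v xv"
  using Bv[OF xv] A xv by (intro eq_vecI) (auto simp: vec_eq_iff)
 have "xv ~= 0\<^sub>v k" using nx by auto
 then have "eigenvalue A (q x)"
  unfolding eigenvalue_def eigenvector_def using eq xv A by (intro exI[of _ xv]) auto
 from le[OF this] have "q x * (vnorm v)\<^sup>2 <= b * (vnorm v)\<^sup>2" by (intro mult_right_mono) auto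
 then show ?thesis using form_le[OF v] by linarith
qed

lemma form_in_if_eigs_in:
 assumes A: "A : carrier_mat k k" "transpose_mat A = A" and eig: "eigs_in A a b"
 shows "form_in k A a b"
proof -
 have mA: "- A : carrier_mat k k" "transpose_mat (- A) = - A"
  using A by (auto simp: transpose_uminus)
 have mv: "(- A) *\<^sub>v v = - (A *\<^sub>v v)" if "v : carrier_vec k" for v
  using A that by (intro uminus_mult_mat_vec) auto
 have "l <= - a" if "eigenvalue (- A) l" for l
 proof -
  from that obtain v where v: "v : carrier_vec k" "v ~= 0\<^sub>v k" "(- A) *\<^sub>v v = l \<cdot>\<^sub>v v"
  using A by (auto simp: eigenvalue_def eigenvector_def)
  then have "A *\<^sub>v v = (- l) \<cdot>\<^sub>v v" using A mv[OF v(1)] by (auto simp: vec_eq_iff)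
  then have "eigenvalue A (- l)" using A v unfolding eigenvalue_def eigenvector_def by (intro exI[of _ v]) auto
  then show ?thesis using eig unfolding eigs_in_def by force
 qed
 from form_le_if_eigenvalues_le[OF mA this]
 have "v \<star> (A *\<^sub>v v) \<ge> a * (vnorm v)\<^sup>2" if "v : carrier_vec k" for v
  using that A mv[OF that] by fastforce
 moreover have "v \<star> (A *\<^sub>v v) <= b * (vnorm v)\<^sup>2" if "v : carrier_vec k" for v
  using eig that by (intro form_le_if_eigenvalues_le[OF A]) (auto simp: eigs_in_def)
 ultimately show ?thesis using A by (simp add: form_in_def)
qed

lemma form_inD:
 assumes "form_in k A a b"
 shows "A : carrier_mat k k" "transpose_mat A = A"
  and "v : carrier_vec k ==> a * (vnorm v)\<^sup>2 <= v \<star> (A *\<^sub>v v)"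
  and "v : carrier_vec k ==> v \<star> (A *\<^sub>v v) <= b * (vnorm v)\<^sup>2"
 using assms by (auto simp: form_in_def)

lemma form_in_abs_dot_le:
 assumes A: "form_in k A a b" and a: "0 <= a" and xy: "x : carrier_vec k" "y : carrier_vec k"
 shows "\<bar>x \<star> (A *\<^sub>v y)\<bar> <= b * vnorm x * vnorm y"
proof (cases "x = 0\<^sub>v k \<or> y = 0\<^sub>v k")
 case True
 then show ?thesis using form_inD(1)[OF A] xy by (auto simp: mult_mat_zero_vec)
next
 case False
 note D = form_inD[OF A]
 have psd: "0 <= v \<star> (A *\<^sub>v v)" if "v : carrier_vec k" for v
  using D(3)[OF that] a by (meson mult_nonneg_nonneg order_trans zero_le_power2)
 have "0 <= b * (vnorm x)\<^sup>2" using psd[OF xy(1)] D(4)[OF xy(1)] by linarith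
 moreover have "0 < (vnorm x)\<^sup>2" using False vnorm_eq_0[OF xy(1)] by simp
 ultimately have b: "0 <= b" by (simp add: zero_le_mult_iff)
 have "(x \<star> (A *\<^sub>v y))\<^sup>2 <= (x \<star> (A *\<^sub>v x)) * (y \<star> (A *\<^sub>v y))"
  by (rule psd_Cauchy_Schwarz[OF D(1,2) psd xy])
 also have "... <= (b * (vnorm x)\<^sup>2) * (b * (vnorm y)\<^sup>2)"
  using psd xy D(4) b by (intro mult_mono) auto
 also have "... = (b * vnorm x * vnorm y)\<^sup>2" by (simp add: power_mult_distrib power2_eq_square)
 finally show ?thesis using b by (intro power2_le_imp_le[of "\<bar>_\<bar>"]) auto
qed

lemma minv_inverse:
 assumes A: "A : carrier_mat k k" and inj: "!!v. v : carrier_vec k ==> A *\<^sub>v v = 0\<^sub>v k ==> v = 0\<^sub>v k"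
 shows "minv A : carrier_mat k k" "A * minv A = 1\<^sub>m k" "minv A * A = 1\<^sub>m k" "Determinant.det A ~= 0"
proof -
 show det: "Determinant.det A ~= 0"
  using det_0_iff_vec_prod_zero[OF A] inj by blast
 then obtain B where B: "mat_inverse A = Some B"
  using det_non_zero_imp_unit[OF A, where b="()"] mat_inverse(1)[OF A, where b="()"] by (cases "mat_inverse A") auto
 from mat_inverse(2)[OF A B]
 show "minv A : carrier_mat k k" "A * minv A = 1\<^sub>m k" "minv A * A = 1\<^sub>m k"
  by (auto simp: minv_def B)
qed

lemma minv_eq_adj_mat:
 assumes A: "A : carrier_mat k k" and inj: "!!v. v : carrier_vec k ==> A *\<^sub>v v = 0\<^sub>v k ==> v = 0\<^sub>v k"
 shows "minv A = (1 / Determinant.det A) \<cdot>\<^sub>m adj_mat A"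
proof -
 note I = minv_inverse[OF A inj]
 have adj: "adj_mat A : carrier_mat k k" by (rule adj_mat(1)[OF A])
 have "Determinant.det A \<cdot>\<^sub>m minv A = minv A * (Determinant.det A \<cdot>\<^sub>m 1\<^sub>m k)"
  using I(1) mult_smult_distrib[OF I(1) one_carrier_mat[of k], of "Determinant.det A"] by simp
 also have "... = minv A * (A * adj_mat A)" by (simp add: adj_mat(2)[OF A])
 also have "... = (minv A * A) * adj_mat A" using I(1) A adj by (simp add: assoc_mult_mat[of _ k k _ k _ k])
 also have "... = adj_mat A" using I(3) adj by simp
 finally show ?thesis using I(1,4) adj by (auto simp: mat_eq_iff nonzero_eq_divide_eq mult.commute)
qed

lemma form_in_inj:
 assumes A: "form_in k A a b" and a: "0 < a" and v: "v : carrier_vec k" "A *\<^sub>v v = 0\<^sub>v k"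
 shows "v = 0\<^sub>v k"
proof -
 have "a * (vnorm v)\<^sup>2 <= 0" using form_inD(3)[OF A v(1)] v by simp
 then have "(vnorm v)\<^sup>2 <= 0" using a by (simp add: mult_le_0_iff)
 then have "vnorm v = 0" by simp
 then show ?thesis using vnorm_eq_0[OF v(1)] by simp
qed

lemma minv_mult_vec:
 assumes A: "form_in k A a b" and a: "0 < a"
 shows "minv A : carrier_mat k k" "transpose_mat (minv A) = minv A"
  and "v : carrier_vec k ==> A *\<^sub>v (minv A *\<^sub>v v) = v" "v : carrier_vec k ==> minv A *\<^sub>v (A *\<^sub>v v) = v"
proof -
 note D = form_inD[OF A]
 note I = minv_inverse[OF D(1) form_in_inj[OF A a]]
 show m: "minv A : carrier_mat k k" by (rule I(1))
 show "A *\<^sub>v (minv A *\<^sub>v v) = v" "minv A *\<^sub>v (A *\<^sub>v v) = v" if "v : carrier_vec k"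
  using that D(1) m I(2,3) assoc_mult_mat_vec[of A k k "minv A" k v] assoc_mult_mat_vec[of "minv A" k k A k v] by auto
 have t: "transpose_mat (minv A) : carrier_mat k k" using m by simp
 have "transpose_mat (minv A) * A = transpose_mat (A * minv A)"
  using transpose_mult[OF D(1) m] D(2) by simp
 also have "... = 1\<^sub>m k" by (simp add: I(2))
 finally have "transpose_mat (minv A) * A = 1\<^sub>m k" .
 then have "transpose_mat (minv A) * (A * minv A) = minv A"
  using assoc_mult_mat[OF t D(1) m] m by simp
 then show "transpose_mat (minv A) = minv A" using I(2) t by simp
qed

lemma vnorm_minv_le:
 assumes A: "form_in k A a b" and a: "0 < a" and v: "v : carrier_vec k"
 shows "vnorm (minv A *\<^sub>v v) <= vnorm v / a"
proof -
 let ?z = "minv A *\<^sub>v v"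
 note M = minv_mult_vec[OF A a]
 have z: "?z : carrier_vec k" using M(1) v by simp
 have "a * (vnorm ?z)\<^sup>2 <= ?z \<star> (A *\<^sub>v ?z)" by (rule form_inD(3)[OF A z])
 also have "... = ?z \<star> v" using M(3)[OF v] by simp
 also have "... <= vnorm ?z * vnorm v" using abs_dot_le[OF z v] by linarith
 finally show ?thesis using a
  by (cases "vnorm ?z = 0") (auto simp: power2_eq_square field_simps less_le)
qed

lemma form_in_minv:
 assumes A: "form_in k A a b" and a: "0 < a" and b: "0 < b"
 shows "form_in k (minv A) (1 / b) (1 / a)"
proof -
 note D = form_inD[OF A] and M = minv_mult_vec[OF A a]
 have "(1 / b) * (vnorm v)\<^sup>2 <= v \<star> (minv A *\<^sub>v v)" "v \<star> (minv A *\<^sub>v v) <= (1 / a) * (vnorm v)\<^sup>2"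
  if v: "v : carrier_vec k" for v
 proof -
  let ?z = "minv A *\<^sub>v v"
  have z: "?z : carrier_vec k" using M(1) v by simp
  have "v \<star> ?z <= vnorm v * vnorm ?z" using abs_dot_le[OF v z] by linarith
  also have "... <= vnorm v * (vnorm v / a)"
  using vnorm_minv_le[OF A a v] by (intro mult_left_mono) auto
  finally show "v \<star> ?z <= (1 / a) * (vnorm v)\<^sup>2" by (simp add: power2_eq_square)
  have psd: "0 <= x \<star> (A *\<^sub>v x)" if "x : carrier_vec k" for x
  using D(3)[OF that] a by (meson less_imp_le mult_nonneg_nonneg order_trans zero_le_power2)
  have zz: "?z \<star> (A *\<^sub>v ?z) = v \<star> ?z" using M(3)[OF v] comm_scalar_prod[OF z v] by simp
  have "(v \<star> (A *\<^sub>v ?z))\<^sup>2 <= (v \<star> (A *\<^sub>v v)) * (?z \<star> (A *\<^sub>v ?z))"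
  by (rule psd_Cauchy_Schwarz[OF D(1,2) psd v z])
  also have "... <= (b * (vnorm v)\<^sup>2) * (v \<star> ?z)"
  using psd[OF z] zz D(4)[OF v] b by (intro mult_mono) auto
  finally have "(vnorm v)\<^sup>2 * (vnorm v)\<^sup>2 <= (vnorm v)\<^sup>2 * (b * (v \<star> ?z))"
  using M(3)[OF v] by (simp add: dot_self power2_eq_square mult_ac)
  then have "(vnorm v)\<^sup>2 = 0 \<or> (vnorm v)\<^sup>2 <= b * (v \<star> ?z)"
  using mult_left_le_imp_le[of "(vnorm v)\<^sup>2" "(vnorm v)\<^sup>2" "b * (v \<star> ?z)"] by (cases "vnorm v = 0") auto
  then show "(1 / b) * (vnorm v)\<^sup>2 <= v \<star> ?z"
  using b psd[OF z] zz by (auto simp: field_simps)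
 qed
 then show ?thesis using M by (simp add: form_in_def)
qed

text \<open>With \<open>x = A\<^sup>-\<^sup>1 v\<close> and \<open>y = B\<^sup>-\<^sup>1 v\<close> the difference of the inverse forms at \<open>v\<close> is
 \<open>x \<bullet> (B - A) y\<close>.\<close>

lemma minv_form_perturb:
 assumes A: "form_in k A a b" and B: "form_in k B a b'" and a: "0 < a" and v: "v : carrier_vec k"
  and close: "!!x y. x : carrier_vec k ==> y : carrier_vec k ==>
  \<bar>x \<star> (A *\<^sub>v y) - x \<star> (B *\<^sub>v y)\<bar> <= e * vnorm x * vnorm y"
  and e: "0 <= e"
 shows "\<bar>v \<star> (minv A *\<^sub>v v) - v \<star> (minv B *\<^sub>v v)\<bar> <= e / a\<^sup>2 * (vnorm v)\<^sup>2"
proof -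
 let ?x = "minv A *\<^sub>v v" and ?y = "minv B *\<^sub>v v"
 note MA = minv_mult_vec[OF A a] and MB = minv_mult_vec[OF B a]
 have x: "?x : carrier_vec k" and y: "?y : carrier_vec k" using MA(1) MB(1) v by auto
 have vx: "v \<star> ?x = ?x \<star> (B *\<^sub>v ?y)" using MB(3)[OF v] comm_scalar_prod[OF v x] by simp
 have "v \<star> ?y = ?y \<star> (A *\<^sub>v ?x)" using MA(3)[OF v] comm_scalar_prod[OF v y] by simp
 also have "... = ?x \<star> (A *\<^sub>v ?y)" by (rule sym_dot[OF form_inD(1,2)[OF A] y x])
 finally have vy: "v \<star> ?y = ?x \<star> (A *\<^sub>v ?y)" .
 have "\<bar>v \<star> ?x - v \<star> ?y\<bar> <= e * vnorm ?x * vnorm ?y"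
  using close[OF x y] unfolding vx vy by (simp add: abs_minus_commute)
 also have "... <= e * (vnorm v / a) * (vnorm v / a)"
  using vnorm_minv_le[OF A a v] vnorm_minv_le[OF B a v] e a by (intro mult_mono) auto
 finally show ?thesis by (simp add: power2_eq_square)
qed

lemma opnorm_bound:
 assumes A: "A : carrier_mat k l" and v: "v : carrier_vec l"
 shows "vnorm (A *\<^sub>v v) <= opnorm A * vnorm v"
proof (cases "vnorm v = 0")
 case True
 then show ?thesis using A v vnorm_eq_0[OF v] by (auto simp: mult_mat_zero_vec)
next
 case False
 then have pos: "0 < vnorm v" by (simp add: less_le)
 let ?S = "{vnorm (A *\<^sub>v v) |v. v : carrier_vec (dim_col A) & vnorm v = 1}"
 have "vnorm (A *\<^sub>v u) <= (\<Sum>i<k. \<Sum>j<l. \<bar>A $$ (i, j)\<bar>)" if u: "u : carrier_vec l" "vnorm u = 1" for u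
 proof -
  have "vnorm (A *\<^sub>v u) <= (\<Sum>i<k. \<bar>(A *\<^sub>v u) $ i\<bar>)"
  using A u by (intro vnorm_le_sum_abs) auto
  also have "... <= (\<Sum>i<k. \<Sum>j<l. \<bar>A $$ (i, j)\<bar>)"
  proof (rule sum_mono)
  fix i assume i: "i : {..<k}"
  have "\<bar>(A *\<^sub>v u) $ i\<bar> <= (\<Sum>j<l. \<bar>A $$ (i, j) * u $ j\<bar>)"
  using A u i by (auto simp: scalar_prod_def lessThan_atLeast0)
  also have "... <= (\<Sum>j<l. \<bar>A $$ (i, j)\<bar>)"
  using abs_index_le_vnorm[OF u(1)] u(2) by (intro sum_mono) (auto simp: abs_mult intro: mult_left_le)
  finally show "\<bar>(A *\<^sub>v u) $ i\<bar> <= (\<Sum>j<l. \<bar>A $$ (i, j)\<bar>)" .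
  qed
  finally show ?thesis .
 qed
 then have bdd: "bdd_above ?S" using A by (intro bdd_aboveI) auto
 have "vnorm (A *\<^sub>v ((1 / vnorm v) \<cdot>\<^sub>v v)) : ?S"
  using A v pos by (intro CollectI exI[of _ "(1 / vnorm v) \<cdot>\<^sub>v v"]) (auto simp: vnorm_smult)
 then have "vnorm (A *\<^sub>v ((1 / vnorm v) \<cdot>\<^sub>v v)) <= opnorm A"
  unfolding opnorm_def by (rule cSup_upper[OF _ bdd])
 then show ?thesis using pos A v by (simp add: mult_mat_vec[of _ k l] vnorm_smult field_simps)
qed

lemma opnorm_diff_dot:
 assumes A: "A : carrier_mat k k" and B: "B : carrier_mat k k"
  and xy: "x : carrier_vec k" "y : carrier_vec k"
 shows "\<bar>x \<star> (A *\<^sub>v y) - x \<star> (B *\<^sub>v y)\<bar> <= opnorm (A - B) * vnorm x * vnorm y"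
proof -
 have AB: "A - B : carrier_mat k k" using B by (rule minus_carrier_mat)
 have "x \<star> (A *\<^sub>v y) - x \<star> (B *\<^sub>v y) = x \<star> ((A - B) *\<^sub>v y)"
  using A B xy by (simp add: minus_mult_distrib_mat_vec[of _ k k] scalar_prod_minus_distrib[of _ k])
 also have "\<bar>...\<bar> <= vnorm x * vnorm ((A - B) *\<^sub>v y)"
  using AB xy by (intro abs_dot_le[of _ k]) auto
 also have "... <= vnorm x * (opnorm (A - B) * vnorm y)"
  using opnorm_bound[OF AB xy(2)] by (intro mult_left_mono) auto
 finally show ?thesis by (simp add: mult_ac)
qed

lemma form_diff_le:
 assumes A: "form_in k A a b" "0 <= a" and u: "u : carrier_vec k" and v: "v : carrier_vec k"
 shows "\<bar>u \<star> (A *\<^sub>v u) - v \<star> (A *\<^sub>v v)\<bar> <= b * vnorm (u - v) * (vnorm u + vnorm v)"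
proof -
 note Ac = form_inD(1)[OF A(1)]
 have uv: "u - v : carrier_vec k" using u v by simp
 have "u \<star> (A *\<^sub>v u) - v \<star> (A *\<^sub>v v) = (u - v) \<star> (A *\<^sub>v u) + v \<star> (A *\<^sub>v (u - v))"
  using Ac u v by (simp add: mult_minus_distrib_mat_vec[of _ k k] minus_scalar_prod_distrib[of _ k] scalar_prod_minus_distrib[of _ k])
 also have "\<bar>...\<bar> <= b * vnorm (u - v) * vnorm u + b * vnorm v * vnorm (u - v)"
  using form_in_abs_dot_le[OF A uv u] form_in_abs_dot_le[OF A v uv] by linarith
 finally show ?thesis by (simp add: algebra_simps)
qed

section \<open>Lebesgue measure on coordinate subspaces\<close>

declare measurable_pad [measurable]

lemma sets_leb [simp, measurable_cong]: "sets (leb I) = sets borel"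
 and space_leb [simp]: "space (leb I) = UNIV"
 by (simp_all add: leb_def)

lemma borel_measurable_funI:
 fixes f :: "'a => nat => real"
 shows "(!!j. (%x. f x j) : bm M) ==> f : bm M"
 by (rule measurable_coordinatewise_then_product)

lemma borel_measurable_app [measurable (raw)]:
 fixes f :: "'a => nat => real"
 assumes "f : bm M"
 shows "(%x. f x j) : bm M"
 using measurable_compose[OF assms measurable_product_coordinates] .

lemma borel_measurable_nrm [measurable]: "nrm p : bm borel"
 unfolding nrm_def L2_set_def by measurable

lemma nrm_power2: "(nrm p x)\<^sup>2 = (\<Sum>j<p. (x j)\<^sup>2)"
 by (simp add: nrm_def L2_set_def sum_nonneg)

lemma nn_integral_leb:
 assumes [measurable]: "f : bm borel"
 shows "(\<integral>\<^sup>+x. f x \<partial>leb I) = (\<integral>\<^sup>+x. f (pad I x) \<partial>(\<Pi>\<^sub>M j\<in>I. lborel))"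
 unfolding leb_def by (subst nn_integral_distr) simp_all

lemma AE_leb_support: "AE x in leb I. \<forall>j. j \<notin> I --> x j = 0"
 unfolding leb_def
 by (subst AE_distr_iff) (auto simp: pad_def intro!: sets.sets_Collect_countable_All)

lemma sigma_finite_leb: "finite I ==> sigma_finite_measure (leb I)"
proof -
 assume I: "finite I"
 interpret product_sigma_finite "%_::nat. lborel :: real measure" by standard
 interpret P: finite_product_sigma_finite "%_. lborel" I by standard (rule I)
 have R [measurable]: "(%x. restrict x I) : measurable borel (\<Pi>\<^sub>M j\<in>I. (lborel :: real measure))"
  by (intro measurable_restrict) simp
 have "distr (leb I) (\<Pi>\<^sub>M j\<in>I. lborel) (%x. restrict x I)
  = distr (\<Pi>\<^sub>M j\<in>I. lborel) (\<Pi>\<^sub>M j\<in>I. lborel) ((%x. restrict x I) \<circ> pad I)"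
  unfolding leb_def by (subst distr_distr) simp_all
 also have "... = distr (\<Pi>\<^sub>M j\<in>I. lborel) (\<Pi>\<^sub>M j\<in>I. lborel) (%x. x)"
  by (intro distr_cong) (auto simp: pad_def space_PiM restrict_def PiE_def extensional_def fun_eq_iff)
 finally have "sigma_finite_measure (distr (leb I) (\<Pi>\<^sub>M j\<in>I. lborel) (%x. restrict x I))"
  using P.sigma_finite_measure_axioms by simp
 then show ?thesis by (rule sigma_finite_measure_distr) simp
qed

lemma nn_integral_leb_prod:
 assumes I: "finite I" and [measurable]: "!!j. g j : bm (borel :: real measure)"
 shows "(\<integral>\<^sup>+x. (\<Prod>j\<in>I. g j (x j)) \<partial>leb I) = (\<Prod>j\<in>I. \<integral>\<^sup>+x. g j x \<partial>lborel)"
proof -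
 interpret product_sigma_finite "%_::nat. lborel :: real measure" by standard
 have "(\<integral>\<^sup>+x. (\<Prod>j\<in>I. g j (x j)) \<partial>leb I) = (\<integral>\<^sup>+x. (\<Prod>j\<in>I. g j (x j)) \<partial>(\<Pi>\<^sub>M j\<in>I. lborel))"
  by (subst nn_integral_leb) (auto simp: pad_def intro!: nn_integral_cong prod.cong)
 also have "... = (\<Prod>j\<in>I. \<integral>\<^sup>+x. g j x \<partial>lborel)"
  using I by (intro product_nn_integral_prod) auto
 finally show ?thesis .
qed

lemma nn_integral_leb_affine:
 assumes I: "finite I" and a: "!!j. j \<notin> I ==> a j = 0" and c: "c ~= 0"
  and f [measurable]: "f : bm borel"
 shows "(\<integral>\<^sup>+x. f x \<partial>leb I) = en (\<bar>c\<bar> ^ card I) * (\<integral>\<^sup>+x. f (%j. a j + c * x j) \<partial>leb I)"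
proof -
 interpret product_sigma_finite "%_::nat. lborel :: real measure" by standard
 let ?P = "\<Pi>\<^sub>M j\<in>I. (lborel :: real measure)"
 let ?T = "%x. \<lambda>j\<in>I. a j + c * x j"
 have T [measurable]: "?T : measurable ?P ?P"
 proof (intro measurable_restrict)
  fix j assume "j : I"
  then have "(%x. x j) : measurable ?P lborel" by (rule measurable_component_singleton)
  then show "(%x. a j + c * x j) : measurable ?P lborel" by simp
 qed
 have eq: "density (distr ?P ?P ?T) (%_. en (\<bar>c\<bar> ^ card I)) = ?P"
 proof (rule PiM_eqI)
  fix A assume A: "!!i. i : I ==> A i : sets (lborel :: real measure)"
  have Am [measurable]: "Pi\<^sub>E I A : sets ?P" using I A by (intro sets_PiM_I_finite) auto
  have pre: "?T -` Pi\<^sub>E I A \<inter> space ?P = (\<Pi>\<^sub>E j\<in>I. (%x. a j + c * x) -` A j)"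
  by (auto simp: space_PiM PiE_def Pi_def extensional_def)
  have meas: "(%x. a j + c * x) -` A j : sets (lborel :: real measure)" if "j : I" for j
  using measurable_sets[of "%x. a j + c * x" lborel borel "A j"] A[OF that] by simp
  have "emeasure (density (distr ?P ?P ?T) (%_. en (\<bar>c\<bar> ^ card I))) (Pi\<^sub>E I A)
  = en (\<bar>c\<bar> ^ card I) * emeasure ?P (?T -` Pi\<^sub>E I A \<inter> space ?P)"
  by (simp add: emeasure_density nn_integral_cmult_indicator emeasure_distr)
  also have "... = (\<Prod>j\<in>I. en \<bar>c\<bar>) * (\<Prod>j\<in>I. emeasure lborel ((%x. a j + c * x) -` A j))"
  unfolding pre using I meas by (simp add: emeasure_PiM ennreal_power)
  also have "... = (\<Prod>j\<in>I. emeasure lborel (A j))"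
  unfolding prod.distrib[symmetric]
  proof (rule prod.cong)
  fix j assume j: "j : I"
  have [measurable]: "A j : sets borel" using A[OF j] by simp
  have "emeasure lborel (A j) = \<bar>c\<bar> * (\<integral>\<^sup>+x. indicator (A j) (a j + c * x) \<partial>lborel)"
  by (subst nn_integral_real_affine[OF _ c, symmetric]) (simp_all)
  also have "(\<integral>\<^sup>+x. indicator (A j) (a j + c * x) \<partial>lborel) = (\<integral>\<^sup>+x. indicator ((%x. a j + c * x) -` A j) x \<partial>lborel)"
  by (intro nn_integral_cong) (auto simp: indicator_def)
  also have "... = emeasure lborel ((%x. a j + c * x) -` A j)"
  using meas[OF j] by simp
  finally show "en \<bar>c\<bar> * emeasure lborel ((%x. a j + c * x) -` A j) = emeasure lborel (A j)" by simp
  qed simp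
  finally show "emeasure (density (distr ?P ?P ?T) (%_. en (\<bar>c\<bar> ^ card I))) (Pi\<^sub>E I A) = (\<Prod>j\<in>I. emeasure lborel (A j))" .
 qed (use I in simp_all)
 have "(\<integral>\<^sup>+x. f x \<partial>leb I) = (\<integral>\<^sup>+x. f (pad I x) \<partial>density (distr ?P ?P ?T) (%_. en (\<bar>c\<bar> ^ card I)))"
  unfolding eq by (rule nn_integral_leb) simp
 also have "... = en (\<bar>c\<bar> ^ card I) * (\<integral>\<^sup>+x. f (pad I (?T x)) \<partial>?P)"
  by (subst nn_integral_density, simp, simp, subst nn_integral_distr) (simp_all add: nn_integral_cmult)
 also have "(\<integral>\<^sup>+x. f (pad I (?T x)) \<partial>?P) = (\<integral>\<^sup>+x. f (%j. a j + c * pad I x j) \<partial>?P)"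
  using a by (intro nn_integral_cong arg_cong[where f=f]) (auto simp: pad_def)
 also have "... = (\<integral>\<^sup>+x. f (%j. a j + c * x j) \<partial>leb I)"
  by (rule nn_integral_leb[symmetric]) (intro measurable_compose[OF _ f] borel_measurable_funI, measurable)
 finally show ?thesis .
qed

lemma nn_integral_leb_Un:
 assumes "I \<inter> J = {}" "finite I" "finite J" and f [measurable]: "f : bm borel"
 shows "(\<integral>\<^sup>+x. f x \<partial>leb (I \<union> J)) = (\<integral>\<^sup>+x. (\<integral>\<^sup>+y. f (%j. x j + y j) \<partial>leb J) \<partial>leb I)"
proof -
 interpret product_sigma_finite "%_::nat. lborel :: real measure" by standard
 have fin: "sigma_finite_measure (leb J)" using assms by (intro sigma_finite_leb)
 interpret J: sigma_finite_measure "leb J" by (rule fin)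
 have [measurable]: "(%(x, y). f (%j. x j + y j)) : bm (borel \<Otimes>\<^sub>M leb J)"
  unfolding split_beta' by (intro measurable_compose[OF _ f] borel_measurable_funI) measurable
 have [measurable]: "(%y. f (%j. x j + y j)) : bm borel" for x
  by (intro measurable_compose[OF _ f] borel_measurable_funI) measurable
 have "(\<integral>\<^sup>+x. f x \<partial>leb (I \<union> J)) = (\<integral>\<^sup>+x. f (pad (I \<union> J) x) \<partial>(\<Pi>\<^sub>M j\<in>I \<union> J. lborel))"
  by (rule nn_integral_leb) simp
 also have "... = (\<integral>\<^sup>+x. (\<integral>\<^sup>+y. f (pad (I \<union> J) (merge I J (x, y))) \<partial>(\<Pi>\<^sub>M j\<in>J. lborel)) \<partial>(\<Pi>\<^sub>M j\<in>I. lborel))"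
  using assms by (intro product_nn_integral_fold) simp_all
 also have "... = (\<integral>\<^sup>+x. (\<integral>\<^sup>+y. f (%j. pad I x j + pad J y j) \<partial>(\<Pi>\<^sub>M j\<in>J. lborel)) \<partial>(\<Pi>\<^sub>M j\<in>I. lborel))"
  using assms(1) by (intro nn_integral_cong arg_cong[where f=f]) (auto simp: pad_def merge_def fun_eq_iff)
 also have "... = (\<integral>\<^sup>+x. (\<integral>\<^sup>+y. f (%j. pad I x j + y j) \<partial>leb J) \<partial>(\<Pi>\<^sub>M j\<in>I. lborel))"
  by (intro nn_integral_cong, subst nn_integral_leb) simp_all
 also have "... = (\<integral>\<^sup>+x. (\<integral>\<^sup>+y. f (%j. x j + y j) \<partial>leb J) \<partial>leb I)"
  by (rule nn_integral_leb[symmetric]) measurable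
 finally show ?thesis .
qed

lemma AE_leb_nrm:
 assumes "I <= {..<p}"
 shows "AE x in leb I. (nrm p x)\<^sup>2 = (\<Sum>j\<in>I. (x j)\<^sup>2)"
 using AE_leb_support[of I]
proof eventually_elim
 case (elim x)
 then show ?case unfolding nrm_power2 using assms by (intro sum.mono_neutral_right) auto
qed

lemma nn_integral_gaussian_real:
 assumes c: "0 < c"
 shows "(\<integral>\<^sup>+x. en (exp (- c * x\<^sup>2)) \<partial>lborel) = en (sqrt (pi / c))"
proof -
 define s where "s = sqrt (1 / (2 * c))"
 have s2: "s\<^sup>2 = 1 / (2 * c)" using c by (simp add: s_def)
 have s: "0 < s" using c by (simp add: s_def)
 have "exp (- c * x\<^sup>2) = sqrt (pi / c) * normal_density 0 s x" for x
  unfolding normal_density_def s2 using c by (simp add: field_simps real_sqrt_divide)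
 then have "(\<integral>\<^sup>+x. en (exp (- c * x\<^sup>2)) \<partial>lborel) = (\<integral>\<^sup>+x. en (sqrt (pi / c)) * en (normal_density 0 s x) \<partial>lborel)"
  using c by (simp add: ennreal_mult')
 also have "... = en (sqrt (pi / c)) * (\<integral>\<^sup>+x. en (normal_density 0 s x) \<partial>lborel)"
  by (rule nn_integral_cmult) simp
 also have "(\<integral>\<^sup>+x. en (normal_density 0 s x) \<partial>lborel) = 1"
  using s by (subst nn_integral_eq_integral) auto
 finally show ?thesis by simp
qed

lemma nn_integral_gaussian_leb:
 assumes c: "0 < c" and I: "I <= {..<p}"
 shows "(\<integral>\<^sup>+x. en (exp (- c * (nrm p x)\<^sup>2)) \<partial>leb I) = en (sqrt (pi / c) ^ card I)"
proof -
 have fin: "finite I" using I finite_subset by blast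
 have "(\<integral>\<^sup>+x. en (exp (- c * (nrm p x)\<^sup>2)) \<partial>leb I) = (\<integral>\<^sup>+x. (\<Prod>j\<in>I. en (exp (- c * (x j)\<^sup>2))) \<partial>leb I)"
 proof (rule nn_integral_cong_AE)
  show "AE x in leb I. en (exp (- c * (nrm p x)\<^sup>2)) = (\<Prod>j\<in>I. en (exp (- c * (x j)\<^sup>2)))"
  using AE_leb_nrm[OF I] by eventually_elim (simp add: prod_ennreal exp_sum[OF fin, symmetric] sum_distrib_left sum_negf)
 qed
 also have "... = en (sqrt (pi / c) ^ card I)"
  using c by (subst nn_integral_leb_prod[OF fin]) (simp_all add: nn_integral_gaussian_real[OF c, simplified] ennreal_power)
 finally show ?thesis .
qed

lemma nn_integral_power_tail_real:
 assumes p: "1 <= (p :: nat)"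
 shows "(\<integral>\<^sup>+x. en ((1 + \<bar>x\<bar>) powr (- (1 + 1 / real p))) \<partial>lborel) <= en (2 * real p)"
proof -
 let ?f = "%x::real. (1 + \<bar>x\<bar>) powr (- (1 + 1 / real p))"
 let ?F = "%x::real. - real p * (1 + x) powr (- (1 / real p))"
 have e: "- (1 + 1 / real p) = - (1 / real p) - 1" by simp
 have half: "(\<integral>\<^sup>+x. en (?f x) * indicator {0..} x \<partial>lborel) = en (real p)"
 proof -
  have "(\<integral>\<^sup>+x. en (?f x) * indicator {0..} x \<partial>lborel) = (\<integral>\<^sup>+x. en ((1 + x) powr (- (1 + 1 / real p)) * indicator {0..} x) * indicator {0..} x \<partial>lborel)"
  by (intro nn_integral_cong) (auto simp: indicator_def)
  also have "... = en (0 - ?F 0)"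
  proof (rule nn_integral_FTC_atLeast)
  fix x :: real assume x: "0 <= x"
  show "(?F has_real_derivative ((1 + x) powr (- (1 + 1 / real p)) * indicator {0..} x)) (at x)"
  unfolding e using x p by (auto intro!: derivative_eq_intros)
  next
  have "((%x. (1 + x) powr (- (1 / real p))) \<longlongrightarrow> 0) at_top"
  using p by (intro tendsto_neg_powr filterlim_tendsto_add_at_top[OF tendsto_const filterlim_ident]) auto
  from tendsto_mult_right_zero[OF this, of "- real p"] show "(?F \<longlongrightarrow> 0) at_top" by simp
  qed auto
  finally show ?thesis by simp
 qed
 define h where "h x = en (?f x) * indicator {0..} x" for x
 have [measurable]: "h : bm borel" unfolding h_def by simp
 have h: "(\<integral>\<^sup>+x. h x \<partial>lborel) = en (real p)" unfolding h_def by (rule half)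
 have "(\<integral>\<^sup>+x. en (?f x) \<partial>lborel) <= (\<integral>\<^sup>+x. h x + h (0 + -1 * x) \<partial>lborel)"
  by (intro nn_integral_mono) (auto simp: indicator_def h_def)
 also have "... = en (real p) + (\<integral>\<^sup>+x. h (0 + -1 * x) \<partial>lborel)"
  by (subst nn_integral_add) (simp_all add: h)
 also have "(\<integral>\<^sup>+x. h (0 + -1 * x) \<partial>lborel) = en (real p)"
  using nn_integral_real_affine[of h "-1" 0] h by simp
 finally show ?thesis by (simp flip: ennreal_plus)
qed

lemma power_powr_eq:
 fixes y :: real
 assumes y: "0 < y"
 shows "(y powr q) ^ k = y powr (q * real k)"
proof -
 have "0 < y powr q" using y by simp
 then have "(y powr q) ^ k = (y powr q) powr real k" by (rule powr_realpow[symmetric])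
 also have "... = y powr (q * real k)" by (rule powr_powr)
 finally show ?thesis .
qed

text \<open>In dimension at most \<open>p\<close> the decay of order \<open>p + 1\<close> is shared out among the coordinates:
 each receives the integrable power \<open>-(1 + 1/p)\<close>.\<close>

lemma nn_integral_power_tail_leb:
 assumes I: "I <= {..<p}" and p: "1 <= p"
 shows "(\<integral>\<^sup>+x. en (1 / (1 + nrm p x ^ (p + 1))) \<partial>leb I) <= en (2 ^ (p + 1) * (2 * real p) ^ card I)"
proof -
 have fin: "finite I" using I finite_subset by blast
 have cI: "card I <= p" using card_mono[OF _ I] by simp
 let ?e = "1 + 1 / real p"
 have pt: "1 / (1 + nrm p x ^ (p + 1)) <= 2 ^ (p + 1) * (\<Prod>j\<in>I. (1 + \<bar>x j\<bar>) powr (- ?e))" for x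
 proof -
  let ?r = "nrm p x"
  have r: "0 <= ?r" by (simp add: nrm_def)
  have "\<bar>x j\<bar> <= ?r" if "j : I" for j
  using member_le_L2_set[of "{..<p}" j "%j. \<bar>x j\<bar>"] I that by (auto simp: nrm_def L2_set_def)
  then have "(\<Prod>j\<in>I. (1 + \<bar>x j\<bar>) powr ?e) <= (\<Prod>j\<in>I. (1 + ?r) powr ?e)"
  by (intro prod_mono conjI powr_mono2) auto
  also have "... = (1 + ?r) powr (?e * real (card I))"
  unfolding prod_constant by (rule power_powr_eq) (use r in linarith)
  also have "... <= (1 + ?r) powr (?e * real p)"
  using r cI by (intro powr_mono mult_left_mono) auto
  also have "?e * real p = real (p + 1)" using p by (simp add: field_simps)
  also have "(1 + ?r) powr real (p + 1) = (1 + ?r) ^ (p + 1)"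
  by (rule powr_realpow) (use r in linarith)
  also have "... <= (2 * max 1 ?r) ^ (p + 1)"
  by (rule power_mono) (use r in \<open>linarith+\<close>)
  also have "... <= 2 ^ (p + 1) * (1 + ?r ^ (p + 1))"
  unfolding power_mult_distrib using r by (intro mult_left_mono) (auto simp: max_def)
  finally have le: "(\<Prod>j\<in>I. (1 + \<bar>x j\<bar>) powr ?e) <= 2 ^ (p + 1) * (1 + ?r ^ (p + 1))" .
  have pos: "0 < (\<Prod>j\<in>I. (1 + \<bar>x j\<bar>) powr ?e)" by (intro prod_pos) (auto simp: add_pos_nonneg)
  have inv: "(\<Prod>j\<in>I. (1 + \<bar>x j\<bar>) powr (- ?e)) = 1 / (\<Prod>j\<in>I. (1 + \<bar>x j\<bar>) powr ?e)"
  by (simp only: powr_minus inverse_eq_divide prod_dividef) simp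
  have "0 < 1 + ?r ^ (p + 1)" using r by (intro add_pos_nonneg) auto
  then show ?thesis unfolding inv using le pos by (simp add: field_simps)
 qed
 have "(\<integral>\<^sup>+x. en (1 / (1 + nrm p x ^ (p + 1))) \<partial>leb I)
  <= (\<integral>\<^sup>+x. en (2 ^ (p + 1)) * (\<Prod>j\<in>I. en ((1 + \<bar>x j\<bar>) powr (- ?e))) \<partial>leb I)"
  using pt by (intro nn_integral_mono) (auto simp: prod_ennreal prod_nonneg simp flip: ennreal_mult)
 also have "... = en (2 ^ (p + 1)) * (\<Prod>j\<in>I. \<integral>\<^sup>+x. en ((1 + \<bar>x\<bar>) powr (- ?e)) \<partial>lborel)"
  using nn_integral_leb_prod[OF fin, where g="%_ x. en ((1 + \<bar>x\<bar>) powr (- ?e))"]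
  by (subst nn_integral_cmult) simp_all
 also have "... <= en (2 ^ (p + 1)) * (\<Prod>j\<in>I. en (2 * real p))"
  using nn_integral_power_tail_real[OF p] by (intro mult_left_mono prod_mono_ennreal) auto
 also have "... = en (2 ^ (p + 1) * (2 * real p) ^ card I)"
  using p by (simp only: prod_constant ennreal_power) (simp add: ennreal_mult ennreal_power flip: ennreal_numeral)
 finally show ?thesis .
qed

section \<open>Linear changes of variables\<close>

definition lin :: "nat => real mat => (nat => real) => nat => real" where
 "lin p L x = (%i. if i < p then \<Sum>j<p. L $$ (i, j) * x j else 0)"

lemma borel_measurable_lin [measurable]: "lin p L : bm borel"
 by (rule borel_measurable_funI) (simp add: lin_def)

lemma lin_add: "lin p L (%j. a j + c * x j) = (%j. lin p L a j + c * lin p L x j)"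
 by (auto simp: lin_def fun_eq_iff algebra_simps sum.distrib sum_distrib_left)

text \<open>Uniqueness of Haar measure: both sides are \<open>\<integral>\<integral> g (L x) f (L x - y) dy dx\<close> up to translations
 and the reflection of the inner variable, so no determinant has to be computed.\<close>

lemma nn_integral_lin_cross:
 assumes inv: "!!y. y : Rn p ==> lin p L (lin p L' y) = y"
  and f [measurable]: "f : bm borel" and g [measurable]: "g : bm borel"
 shows "(\<integral>\<^sup>+x. f (lin p L x) \<partial>leb {..<p}) * (\<integral>\<^sup>+y. g y \<partial>leb {..<p})
  = (\<integral>\<^sup>+x. g (lin p L x) \<partial>leb {..<p}) * (\<integral>\<^sup>+y. f y \<partial>leb {..<p})"
proof -
 let ?l = "leb {..<p}"
 interpret l: sigma_finite_measure ?l by (rule sigma_finite_leb) simp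
 interpret P: pair_sigma_finite ?l ?l by standard
 have fm [measurable]: "(%x. f (%j. h x j)) : bm M" if "!!j. (%x. h x j) : bm M" for h :: "_ => nat => real" and M
  using that by (intro measurable_compose[OF borel_measurable_funI f]) simp
 have gm [measurable]: "(%x. g (%j. h x j)) : bm M" if "!!j. (%x. h x j) : bm M" for h :: "_ => nat => real" and M
  using that by (intro measurable_compose[OF borel_measurable_funI g]) simp
 have L0: "lin p L x j = 0" if "j \<notin> {..<p}" for x j using that by (simp add: lin_def)
 have L0': "lin p L' x j = 0" if "j \<notin> {..<p}" for x j using that by (simp add: lin_def)
 have "(\<integral>\<^sup>+x. f (lin p L x) \<partial>?l) * (\<integral>\<^sup>+y. g y \<partial>?l) = (\<integral>\<^sup>+x. (\<integral>\<^sup>+y. f (lin p L x) * g y \<partial>?l) \<partial>?l)"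
  by (simp add: nn_integral_cmult nn_integral_multc)
 also have "... = (\<integral>\<^sup>+x. (\<integral>\<^sup>+y. f (lin p L x) * g (%j. lin p L x j + 1 * y j) \<partial>?l) \<partial>?l)"
 proof (rule nn_integral_cong)
  fix x
  have "(\<integral>\<^sup>+y. g y \<partial>?l) = (\<integral>\<^sup>+y. g (%j. lin p L x j + 1 * y j) \<partial>?l)"
  using nn_integral_leb_affine[of "{..<p}" "lin p L x" 1 g] L0 by simp
  then show "(\<integral>\<^sup>+y. f (lin p L x) * g y \<partial>?l) = (\<integral>\<^sup>+y. f (lin p L x) * g (%j. lin p L x j + 1 * y j) \<partial>?l)"
  by (simp add: nn_integral_cmult)
 qed
 also have "... = (\<integral>\<^sup>+y. (\<integral>\<^sup>+x. f (lin p L x) * g (%j. lin p L x j + 1 * y j) \<partial>?l) \<partial>?l)"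
  by (rule P.Fubini'[symmetric]) measurable
 also have "... = (\<integral>\<^sup>+y. (\<integral>\<^sup>+x. f (%j. lin p L x j + - 1 * y j) * g (lin p L x) \<partial>?l) \<partial>?l)"
 proof (rule nn_integral_cong_AE)
  show "AE y in ?l. (\<integral>\<^sup>+x. f (lin p L x) * g (%j. lin p L x j + 1 * y j) \<partial>?l) = (\<integral>\<^sup>+x. f (%j. lin p L x j + - 1 * y j) * g (lin p L x) \<partial>?l)"
  using AE_leb_support[of "{..<p}"]
  proof eventually_elim
  case (elim y)
  then have y: "lin p L (lin p L' y) = y" by (intro inv) (auto simp: Rn_def)
  let ?h = "%x. f (lin p L x) * g (%j. lin p L x j + 1 * y j)"
  have "(\<integral>\<^sup>+x. ?h x \<partial>?l) = (\<integral>\<^sup>+x. ?h (%j. (%j. - lin p L' y j) j + 1 * x j) \<partial>?l)"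
  using nn_integral_leb_affine[of "{..<p}" "%j. - lin p L' y j" 1 ?h] L0' by simp
  also have "... = (\<integral>\<^sup>+x. f (%j. lin p L x j + - 1 * y j) * g (lin p L x) \<partial>?l)"
  proof (rule nn_integral_cong)
  fix x
  have "lin p L (%j. - lin p L' y j + 1 * x j) = (%j. lin p L x j + - 1 * y j)"
  using lin_add[of p L x "-1" "lin p L' y"] by (simp add: y algebra_simps)
  then show "?h (%j. (%j. - lin p L' y j) j + 1 * x j) = f (%j. lin p L x j + - 1 * y j) * g (lin p L x)"
  by simp
  qed
  finally show ?case .
  qed
 qed
 also have "... = (\<integral>\<^sup>+x. (\<integral>\<^sup>+y. f (%j. lin p L x j + - 1 * y j) * g (lin p L x) \<partial>?l) \<partial>?l)"
  by (rule P.Fubini') measurable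
 also have "... = (\<integral>\<^sup>+x. g (lin p L x) * (\<integral>\<^sup>+y. f y \<partial>?l) \<partial>?l)"
 proof (rule nn_integral_cong)
  fix x
  have "(\<integral>\<^sup>+y. f y \<partial>?l) = (\<integral>\<^sup>+y. f (%j. lin p L x j + - 1 * y j) \<partial>?l)"
  using nn_integral_leb_affine[of "{..<p}" "lin p L x" "-1" f] L0 by simp
  then show "(\<integral>\<^sup>+y. f (%j. lin p L x j + - 1 * y j) * g (lin p L x) \<partial>?l) = g (lin p L x) * (\<integral>\<^sup>+y. f y \<partial>?l)"
  by (simp add: nn_integral_cmult mult.commute)
 qed
 also have "... = (\<integral>\<^sup>+x. g (lin p L x) \<partial>?l) * (\<integral>\<^sup>+y. f y \<partial>?l)"
  by (simp add: nn_integral_multc)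
 finally show ?thesis .
qed

section \<open>Sums over an i.i.d. sample\<close>

lemma nn_integral_PiM_coordinate:
 assumes P: "prob_space P" and I: "finite I" "i : I" and [measurable]: "f : bm P"
 shows "(\<integral>\<^sup>+D. f (D i) \<partial>(\<Pi>\<^sub>M j\<in>I. P)) = (\<integral>\<^sup>+x. f x \<partial>P)"
proof -
 interpret product_prob_space "%_. P" I using P by (intro product_prob_spaceI) simp
 have "distr (\<Pi>\<^sub>M j\<in>I. P) P (%D. D i) = P" using I by (intro PiM_component) auto
 then have "(\<integral>\<^sup>+x. f x \<partial>P) = (\<integral>\<^sup>+x. f x \<partial>distr (\<Pi>\<^sub>M j\<in>I. P) P (%D. D i))" by simp
 also have "... = (\<integral>\<^sup>+D. f (D i) \<partial>(\<Pi>\<^sub>M j\<in>I. P))"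
  using I by (subst nn_integral_distr) simp_all
 finally show ?thesis by simp
qed

lemma nn_integral_PiM_prod:
 assumes P: "prob_space P" and I: "finite I" and [measurable]: "f : bm P"
 shows "(\<integral>\<^sup>+D. (\<Prod>i\<in>I. f (D i)) \<partial>(\<Pi>\<^sub>M j\<in>I. P)) = (\<integral>\<^sup>+x. f x \<partial>P) ^ card I"
proof -
 interpret prob_space P by (rule P)
 interpret product_sigma_finite "%_. P" by standard
 show ?thesis using product_nn_integral_prod[of I "%_. f"] I by simp
qed

lemma iid_sum_square:
 fixes f :: "'a => real" and I :: "'i set"
 assumes P: "prob_space P" and I: "finite I"
  and f [measurable]: "f : bm P" and f2: "integrable P (%x. (f x)\<^sup>2)"
  and f0: "(\<integral>x. f x \<partial>P) = (0 :: real)"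
 shows "(\<integral>\<^sup>+D. en ((\<Sum>i\<in>I. f (D i))\<^sup>2) \<partial>(\<Pi>\<^sub>M j\<in>I. P)) = en (real (card I) * (\<integral>x. (f x)\<^sup>2 \<partial>P))"
proof -
 interpret P: prob_space P by (rule P)
 interpret product_sigma_finite "%_. P" by standard
 let ?Q = "\<Pi>\<^sub>M j\<in>I. P"
 have f1: "integrable P f" by (rule P.square_integrable_imp_integrable[OF f f2])
 define h :: "'i => 'i => 'i => 'a => real" where "h i j k = (if i = j then (if k = i then (%x. (f x)\<^sup>2) else (%_. 1)) else (if k = i \<or> k = j then f else (%_. 1)))" for i j k
 have h: "f (D i) * f (D j) = (\<Prod>k\<in>I. h i j k (D k))" if "i : I" "j : I" for i j D
 proof (cases "i = j")
  case True
  then have "(\<Prod>k\<in>I. h i j k (D k)) = (\<Prod>k\<in>I. if k = i then (f (D i))\<^sup>2 else 1)"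
  by (intro prod.cong) (auto simp: h_def)
  then show ?thesis using True that I by (simp add: prod.delta power2_eq_square)
 next
  case False
  then have "(\<Prod>k\<in>I. h i j k (D k)) = (\<Prod>k\<in>I. (if k = i then f (D i) else 1) * (if k = j then f (D j) else 1))"
  by (intro prod.cong) (auto simp: h_def)
  then show ?thesis using that I by (simp add: prod.distrib prod.delta)
 qed
 have hi: "integrable P (h i j k)" for i j k unfolding h_def using f1 f2 by auto
 have int: "integrable ?Q (%D. f (D i) * f (D j))" if "i : I" "j : I" for i j
  unfolding h[OF that] by (intro product_integrable_prod I hi)
 have val: "(\<integral>D. f (D i) * f (D j) \<partial>?Q) = (if i = j then (\<integral>x. (f x)\<^sup>2 \<partial>P) else 0)" if "i : I" "j : I" for i j
 proof -
  have "(\<integral>D. f (D i) * f (D j) \<partial>?Q) = (\<Prod>k\<in>I. integral\<^sup>L P (h i j k))"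
  unfolding h[OF that] by (intro product_integral_prod I hi)
  also have "... = (if i = j then (\<integral>x. (f x)\<^sup>2 \<partial>P) else 0)"
  proof (cases "i = j")
  case True
  then have "(\<Prod>k\<in>I. integral\<^sup>L P (h i j k)) = (\<Prod>k\<in>I. if k = i then (\<integral>x. (f x)\<^sup>2 \<partial>P) else 1)"
  by (intro prod.cong) (auto simp: h_def P.prob_space)
  then show ?thesis using True that I by (simp add: prod.delta)
  next
  case False
  then have "integral\<^sup>L P (h i j i) = 0" using f0 by (simp add: h_def)
  then show ?thesis using False that I by (auto intro!: prod_zero)
  qed
  finally show ?thesis .
 qed
 have sq: "(\<Sum>i\<in>I. f (D i))\<^sup>2 = (\<Sum>i\<in>I. \<Sum>j\<in>I. f (D i) * f (D j))" for D
  by (simp add: power2_eq_square sum_product)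
 have "integrable ?Q (%D. (\<Sum>i\<in>I. f (D i))\<^sup>2)" unfolding sq using int by auto
 then have "(\<integral>\<^sup>+D. en ((\<Sum>i\<in>I. f (D i))\<^sup>2) \<partial>?Q) = en (\<integral>D. (\<Sum>i\<in>I. f (D i))\<^sup>2 \<partial>?Q)"
  by (intro nn_integral_eq_integral) auto
 also have "(\<integral>D. (\<Sum>i\<in>I. f (D i))\<^sup>2 \<partial>?Q) = (\<Sum>i\<in>I. \<Sum>j\<in>I. if i = j then (\<integral>x. (f x)\<^sup>2 \<partial>P) else 0)"
  unfolding sq using int by (simp add: val)
 also have "... = real (card I) * (\<integral>x. (f x)\<^sup>2 \<partial>P)" using I by simp
 finally show ?thesis .
qed

section \<open>Square-integrable functions\<close>

lemma L2_Cauchy_Schwarz: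
 fixes f g :: "'a => real"
 assumes [measurable]: "f : bm M" "g : bm M"
  and f2: "integrable M (%x. (f x)\<^sup>2)" and g2: "integrable M (%x. (g x)\<^sup>2)"
 shows "integrable M (%x. f x * g x)" "\<bar>\<integral>x. f x * g x \<partial>M\<bar> <= L2_norm M f * L2_norm M g"
proof -
 show fg: "integrable M (%x. f x * g x)"
 proof (rule Bochner_Integration.integrable_bound)
  show "integrable M (%x. (f x)\<^sup>2 + (g x)\<^sup>2)" using f2 g2 by simp
  have "\<bar>u * v\<bar> <= u\<^sup>2 + v\<^sup>2" for u v :: real
  proof -
  have "2 * (\<bar>u\<bar> * \<bar>v\<bar>) <= u\<^sup>2 + v\<^sup>2" using sum_squares_bound[of "\<bar>u\<bar>" "\<bar>v\<bar>"] by simp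
  moreover have "0 <= \<bar>u\<bar> * \<bar>v\<bar>" by simp
  ultimately show ?thesis unfolding abs_mult by linarith
  qed
  then show "AE x in M. norm (f x * g x) <= norm ((f x)\<^sup>2 + (g x)\<^sup>2)" by simp
 qed measurable
 have "(\<integral>x. f x * g x \<partial>M)\<^sup>2 <= (\<integral>x. (f x)\<^sup>2 \<partial>M) * (\<integral>x. (g x)\<^sup>2 \<partial>M)"
 proof (rule discriminant_nonpos)
  fix t :: real
  have "0 <= (\<integral>x. (f x + t * g x)\<^sup>2 \<partial>M)" by simp
  also have "(\<integral>x. (f x + t * g x)\<^sup>2 \<partial>M) = (\<integral>x. (f x)\<^sup>2 + 2 * t * (f x * g x) + t\<^sup>2 * (g x)\<^sup>2 \<partial>M)"
  by (intro Bochner_Integration.integral_cong) (auto simp: power2_eq_square algebra_simps)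
  also have "... = (\<integral>x. (f x)\<^sup>2 \<partial>M) + 2 * t * (\<integral>x. f x * g x \<partial>M) + t\<^sup>2 * (\<integral>x. (g x)\<^sup>2 \<partial>M)"
  using f2 g2 fg by simp
  finally show "0 <= ..." .
 qed simp
 then have "sqrt ((\<integral>x. f x * g x \<partial>M)\<^sup>2) <= sqrt ((\<integral>x. (f x)\<^sup>2 \<partial>M) * (\<integral>x. (g x)\<^sup>2 \<partial>M))"
  by (rule real_sqrt_le_mono)
 then show "\<bar>\<integral>x. f x * g x \<partial>M\<bar> <= L2_norm M f * L2_norm M g"
  by (simp add: L2_norm_def real_sqrt_mult)
qed

section \<open>Derivatives along segments\<close>

lemma nrm_scale: "nrm p (%j. c * d j) = \<bar>c\<bar> * nrm p d"
proof -
 have "vec p (%j. c * d j) = c \<cdot>\<^sub>v vec p d" by auto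
 then show ?thesis by (simp add: nrm_vec vnorm_smult)
qed

lemma has_jacobian_segment:
 assumes J: "has_jacobian p k f A (%j. x j + t * d j) T" and f: "!!y. y : T ==> f y : carrier_vec k"
  and t: "t : {0..1}" and et: "et : carrier_vec k" and T: "!!s. s : {0..1} ==> (%j. x j + s * d j) : T"
 shows "((%s. et \<star> f (%j. x j + s * d j)) has_real_derivative et \<star> (A *\<^sub>v vec p d)) (at t within {0..1})"
proof -
 have A: "A : carrier_mat k p" using J by (simp add: has_jacobian_def)
 let ?ph = "%s. f (%j. x j + s * d j)"
 have diff: "(%j. (x j + s * d j) - (x j + t * d j)) = (%j. (s - t) * d j)" for s by (auto simp: algebra_simps)
 have ft: "?ph t : carrier_vec k" by (rule f[OF T[OF t]])
 show ?thesis
  unfolding has_field_derivative_def has_derivative_within_alt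
 proof (intro conjI allI impI)
  show "bounded_linear ((*) (et \<star> (A *\<^sub>v vec p d)))" by (rule bounded_linear_mult_right)
  fix e :: real assume e: "0 < e"
  define N where "N = vnorm et * nrm p d + 1"
  have N: "0 < N" unfolding N_def by (intro add_nonneg_pos mult_nonneg_nonneg) auto
  have "0 < e / N" using e N by simp
  then obtain dl where dl: "0 < dl" "!!y. y : T ==> nrm p (%j. y j - (x j + t * d j)) < dl ==>
  vnorm (f y - ?ph t - A *\<^sub>v vec p (%j. y j - (x j + t * d j))) <= e / N * nrm p (%j. y j - (x j + t * d j))"
  using J[unfolded has_jacobian_def, THEN conjunct2] by blast
  show "\<exists>dl>0. ALL s:{0..1}. norm (s - t) < dl -->
  norm (et \<star> ?ph s - et \<star> ?ph t - et \<star> (A *\<^sub>v vec p d) * (s - t)) <= e * norm (s - t)"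
  proof (intro exI[of _ "dl / (nrm p d + 1)"] conjI ballI impI)
  have nd: "0 < nrm p d + 1" by (intro add_nonneg_pos) auto
  then show "0 < dl / (nrm p d + 1)" using dl(1) by simp
  fix s assume s: "s : {0..1}" and lt: "norm (s - t) < dl / (nrm p d + 1)"
  have "\<bar>s - t\<bar> * nrm p d <= \<bar>s - t\<bar> * (nrm p d + 1)" by (intro mult_left_mono) auto
  also have "... < dl" using lt nd by (simp add: pos_less_divide_eq)
  finally have lt': "nrm p (%j. (x j + s * d j) - (x j + t * d j)) < dl" unfolding diff nrm_scale .
  define W where "W = ?ph s - ?ph t - A *\<^sub>v vec p (%j. (s - t) * d j)"
  have le: "vnorm W <= e / N * (\<bar>s - t\<bar> * nrm p d)"
  using dl(2)[OF T[OF s] lt'] unfolding diff nrm_scale W_def .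
  have fs: "?ph s : carrier_vec k" by (rule f[OF T[OF s]])
  have Wc: "W : carrier_vec k" unfolding W_def using A fs ft by (intro minus_carrier_vec) auto
  have vec: "vec p (%j. (s - t) * d j) = (s - t) \<cdot>\<^sub>v vec p d" by auto
  have "et \<star> ?ph s - et \<star> ?ph t - et \<star> (A *\<^sub>v vec p d) * (s - t) = et \<star> W"
  using fs ft A et unfolding W_def vec
  by (simp add: scalar_prod_minus_distrib[of _ k] mult_mat_vec[of _ k p])
  also have "\<bar>et \<star> W\<bar> <= vnorm et * vnorm W"
  using Wc et by (rule abs_dot_le[rotated])
  also have "... <= vnorm et * (e / N * (\<bar>s - t\<bar> * nrm p d))"
  by (rule mult_left_mono[OF le vnorm_nonneg])
  also have "... = e * \<bar>s - t\<bar> * (vnorm et * nrm p d / N)"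
  proof -
  have "u * (e / w * (r * v)) = e * r * (u * v / w)" for u v w r :: real by simp
  then show ?thesis .
  qed
  also have "... <= e * \<bar>s - t\<bar> * 1"
  proof (intro mult_left_mono)
  show "vnorm et * nrm p d / N <= 1" using N unfolding N_def by (simp only: divide_le_eq_1_pos)
  qed (use e in auto)
  finally show "norm (et \<star> ?ph s - et \<star> ?ph t - et \<star> (A *\<^sub>v vec p d) * (s - t)) <= e * norm (s - t)" by simp
  qed
 qed
qed

lemma unit_interval_increment_le:
 fixes ph :: "real => real"
 assumes "!!t. t : {0..1} ==> (ph has_real_derivative ph' t) (at t within {0..1})"
  and "!!t. t : {0..1} ==> \<bar>ph' t\<bar> <= B"
 shows "\<bar>ph 1 - ph 0\<bar> <= B"
 using field_differentiable_bound[of "{0..1}" ph ph' B 1 0] assms by auto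

section \<open>Gaussian integrals of quadratic forms\<close>

definition qf :: "nat => real mat => (nat => real) => real" where
 "qf p A x = vec p x \<star> (A *\<^sub>v vec p x)"

lemma qf_sum: "A : carrier_mat p p ==> qf p A x = (\<Sum>i<p. \<Sum>j<p. x i * A $$ (i, j) * x j)"
 by (simp add: qf_def dot_mult_mat_vec_sum)

lemma borel_measurable_qf [measurable]:
 assumes "A : carrier_mat p p"
 shows "qf p A : bm borel"
 unfolding qf_sum[OF assms, abs_def] by measurable

lemma qf_scale:
 assumes "A : carrier_mat p p"
 shows "qf p A (%j. c * x j) = c\<^sup>2 * qf p A x"
proof -
 have "vec p (%j. c * x j) = c \<cdot>\<^sub>v vec p x" by auto
 then show ?thesis unfolding qf_def using form_smult[OF assms, of "vec p x" c] by simp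
qed

lemma qf_add:
 assumes A: "form_in p A a b"
 shows "qf p A (%j. x j + y j) = qf p A x + 2 * (vec p x \<star> (A *\<^sub>v vec p y)) + qf p A y"
proof -
 have "vec p (%j. x j + y j) = vec p x + vec p y" by auto
 then show ?thesis using form_add[OF form_inD(1,2)[OF A]] by (simp add: qf_def)
qed

lemma qf_bounds:
 assumes "form_in p A a b"
 shows "a * (nrm p x)\<^sup>2 <= qf p A x" "qf p A x <= b * (nrm p x)\<^sup>2"
 using form_inD(3,4)[OF assms, of "vec p x"] by (auto simp: qf_def nrm_vec)

lemma qf_nonneg: "form_in p A a b ==> 0 <= a ==> 0 <= qf p A x"
 using qf_bounds(1)[of p A a b x] by (meson mult_nonneg_nonneg order_trans zero_le_power2)

definition gauss_int :: "nat => real mat => real" where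
 "gauss_int p A = enn2real (\<integral>\<^sup>+x. en (exp (- qf p A x / 2)) \<partial>leb {..<p})"

lemma gauss_int:
 assumes A: "form_in p A a b" and a: "0 < a" and b: "0 < b"
 shows "(\<integral>\<^sup>+x. en (exp (- qf p A x / 2)) \<partial>leb {..<p}) = en (gauss_int p A)"
  and "gauss_int p A <= sqrt (2 * pi / a) ^ p" and "sqrt (2 * pi / b) ^ p <= gauss_int p A"
proof -
 let ?g = "\<integral>\<^sup>+x. en (exp (- qf p A x / 2)) \<partial>leb {..<p}"
 have G: "(\<integral>\<^sup>+x. en (exp (- (c / 2) * (nrm p x)\<^sup>2)) \<partial>leb {..<p}) = en (sqrt (2 * pi / c) ^ p)" if "0 < c" for c
  using nn_integral_gaussian_leb[of "c / 2" "{..<p}" p] that by (simp add: mult.commute)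
 have u: "?g <= en (sqrt (2 * pi / a) ^ p)"
  unfolding G[OF a, symmetric] using qf_bounds(1)[OF A] by (intro nn_integral_mono ennreal_leI) simp
 have l: "en (sqrt (2 * pi / b) ^ p) <= ?g"
  unfolding G[OF b, symmetric] using qf_bounds(2)[OF A] by (intro nn_integral_mono ennreal_leI) simp
 show eq: "?g = en (gauss_int p A)"
  unfolding gauss_int_def using le_less_trans[OF u ennreal_less_top] by simp
 have nonneg: "0 <= gauss_int p A" by (simp add: gauss_int_def)
 show "gauss_int p A <= sqrt (2 * pi / a) ^ p" using u a unfolding eq by (simp add: ennreal_le_iff)
 show "sqrt (2 * pi / b) ^ p <= gauss_int p A" using l nonneg unfolding eq by (simp add: ennreal_le_iff)
qed

lemma gauss_int_pos: "form_in p A a b ==> 0 < a ==> 0 < b ==> 0 < gauss_int p A"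
 using gauss_int(3)[of p A a b] by (smt (verit) divide_pos_pos mult_pos_pos pi_gt_zero real_sqrt_gt_zero zero_less_power)

lemma abs_exp_diff_le:
 fixes s t :: real
 assumes "c <= s" "c <= t"
 shows "\<bar>exp (- s) - exp (- t)\<bar> <= exp (- c) * \<bar>s - t\<bar>"
proof -
 have *: "exp (- s) - exp (- t) <= exp (- c) * (t - s)" if "s <= t" "c <= s" for s t :: real
 proof -
  have "exp (- s) - exp (- t) = exp (- s) * (1 - exp (- (t - s)))"
  by (simp add: algebra_simps flip: exp_add)
  also have "... <= exp (- s) * (t - s)"
  proof (intro mult_left_mono)
  show "1 - exp (- (t - s)) <= t - s" using exp_ge_add_one_self[of "- (t - s)"] by linarith
  qed simp
  also have "... <= exp (- c) * (t - s)" using that by (intro mult_right_mono) auto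
  finally show ?thesis .
 qed
 show ?thesis
 proof (cases "s <= t")
  case True
  then have "exp (- t) <= exp (- s)" by simp
  then show ?thesis using *[OF True assms(1)] True by simp
 next
  case False
  then have "exp (- s) <= exp (- t)" by simp
  then show ?thesis using *[of t s] False assms by simp
 qed
qed

lemma gauss_int_diff_le:
 assumes A: "form_in p A a b" and B: "form_in p B a b" and a: "0 < a" and b: "0 < b"
  and close: "!!x. \<bar>qf p A x - qf p B x\<bar> <= om * (nrm p x)\<^sup>2"
  and om: "0 <= om"
 shows "\<bar>gauss_int p A - gauss_int p B\<bar> <= 2 * om / a * sqrt (4 * pi / a) ^ p"
proof -
 have one: "gauss_int p A <= gauss_int p B + 2 * om / a * sqrt (4 * pi / a) ^ p"
  if A: "form_in p A a b" and B: "form_in p B a b"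
  and close: "!!x. \<bar>qf p A x - qf p B x\<bar> <= om * (nrm p x)\<^sup>2" for A B
 proof -
  have pt: "exp (- qf p A x / 2) <= exp (- qf p B x / 2) + 2 * om / a * exp (- (a / 4) * (nrm p x)\<^sup>2)" for x
  proof -
  let ?r = "(nrm p x)\<^sup>2"
  have "exp (- (qf p A x / 2)) - exp (- (qf p B x / 2)) <= exp (- (a * ?r / 2)) * \<bar>qf p A x / 2 - qf p B x / 2\<bar>"
  using abs_exp_diff_le[of "a * ?r / 2" "qf p A x / 2" "qf p B x / 2"] qf_bounds(1)[OF A] qf_bounds(1)[OF B] by simp
  also have "... <= exp (- (a * ?r / 2)) * (om * ?r)"
  using close[of x] by (intro mult_left_mono) auto
  also have "... = exp (- (a / 4) * ?r) * (exp (- (a / 4 * ?r)) * (a / 4 * ?r)) * (4 * om / a)"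
  using a by (simp add: field_simps flip: exp_add)
  also have "... <= exp (- (a / 4) * ?r) * (1 / 2) * (4 * om / a)"
  proof (intro mult_right_mono mult_left_mono)
  have "exp (- y) * y <= 1 / 2" if "0 <= y" for y :: real
  proof -
  have "2 * y <= 1 + y + y\<^sup>2 / 2"
  using zero_le_power2[of "y - 1"] that by (simp add: power2_eq_square algebra_simps)
  also have "... <= exp y" using exp_lower_Taylor_quadratic[OF that] by simp
  finally show ?thesis by (simp add: exp_minus field_simps)
  qed
  moreover have "0 <= a / 4 * ?r" using a by simp
  ultimately show "exp (- (a / 4 * ?r)) * (a / 4 * ?r) <= 1 / 2" .
  qed (use a om in auto)
  finally show ?thesis by (simp add: field_simps)
  qed
  have "en (gauss_int p A) = (\<integral>\<^sup>+x. en (exp (- qf p A x / 2)) \<partial>leb {..<p})"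
  by (rule gauss_int(1)[OF A a b, symmetric])
  also have "... <= (\<integral>\<^sup>+x. en (exp (- qf p B x / 2)) + en (2 * om / a) * en (exp (- (a / 4) * (nrm p x)\<^sup>2)) \<partial>leb {..<p})"
  using pt a om by (intro nn_integral_mono) (auto simp flip: ennreal_plus ennreal_mult intro!: ennreal_leI)
  also have "... = en (gauss_int p B) + en (2 * om / a) * en (sqrt (4 * pi / a) ^ p)"
  using form_inD(1)[OF B] nn_integral_gaussian_leb[of "a / 4" "{..<p}" p] a
  by (subst nn_integral_add) (simp_all add: nn_integral_cmult gauss_int(1)[OF B a b, simplified] mult.commute)
  also have "... = en (gauss_int p B + 2 * om / a * sqrt (4 * pi / a) ^ p)"
  using a om by (simp add: gauss_int_def flip: ennreal_mult ennreal_plus)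
  finally show ?thesis using a om by (subst (asm) ennreal_le_iff) (auto simp: gauss_int_def)
 qed
 show ?thesis using one[OF A B close] one[OF B A] close by (auto simp: abs_minus_commute abs_le_iff)
qed

section \<open>One sample size: curvature of the moment map\<close>

definition info :: "'d gmm => (nat => real) => real mat" where
 "info X th = transpose_mat (jac X th) * minv (var_mom X th) * jac X th"

definition dev :: "'d gmm => (nat => real) => nat => real" where
 "dev X th = (%j. th j - true_par X j)"

definition score :: "nat => 'd gmm => (nat => 'd) => real vec" where
 "score n X D = sqrt (real n) \<cdot>\<^sub>v avg_mom n X D (true_par X)"

text \<open>The weighted residual of the linearised moment equations at their solution: the part of the
 quasi-likelihood exponent that does not depend on the parameter.\<close>

definition resid :: "nat => 'd gmm => (nat => 'd) => real" where
 "resid n X D = (let r = score n X D + jac X (true_par X) *\<^sub>v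
  (sqrt (real n) \<cdot>\<^sub>v vec (dim_par X) (dev X (oracle_est n X D)))
  in r \<star> (minv (var_mom X (true_par X)) *\<^sub>v r))"

definition gauss_kernel :: "nat => 'd gmm => (nat => 'd) => (nat => real) => real" where
 "gauss_kernel n X D th =
  exp (- real n * qf (dim_par X) (info X (true_par X)) (%j. th j - oracle_est n X D j) / 2)"

locale bounded_gmm =
 fixes n :: nat and X :: "'d gmm" and a b ka K :: real and F :: "'d => real"
 assumes str: "gmm_structure n X"
  and n1: "1 <= n" and p1: "1 <= dim_par X"
  and a0: "0 < a" and b0: "0 < b" and ka0: "0 < ka" and K0: "0 <= K"
  and cpt: "compact (par_space X)"
  and eigV: "!!th. th : par_space X ==> eigs_in (var_mom X th) a b"
  and jacX: "!!th. th : par_space X ==> has_jac X th"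
  and eigG: "!!th. th : par_space X ==> eigs_in (transpose_mat (jac X th) * jac X th) a b"
  and ident: "!!th. th : par_space X ==> ka * dist0 X th <= vnorm (mean_mom X th)"
  and env: "F : L2_space (obs_law X)" "!!f d. f : mom_class X ==> d : space (obs_law X) ==> \<bar>f d\<bar> <= F d"
  "(\<integral>d. (F d)\<^sup>2 \<partial>obs_law X) <= K"
begin

abbreviation "p \<equiv> dim_par X"
abbreviation "m \<equiv> dim_mom X"
abbreviation "th0 \<equiv> true_par X"
abbreviation "P \<equiv> obs_law X"
abbreviation "W th \<equiv> minv (var_mom X th)"
abbreviation "rn == sqrt (real n)"

lemma par_subset: "par_space X <= Rn p" and true_par_in: "th0 : par_space X"
 using str by (auto simp: gmm_structure_def)

lemma prob_P: "prob_space P"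
 using str by (auto simp: gmm_structure_def obs_law_def)

lemma mom_carrier [simp]: "mom X d th : carrier_vec m"
 using str by (simp add: gmm_structure_def)

lemma dim_vec_mom [simp]: "dim_vec (mom X d th) = m"
 using mom_carrier by (rule carrier_vecD)

lemma mom_pair_measurable: "k < m ==> (%(d, th). mom X d th $ k) : bm (P \<Otimes>\<^sub>M borel)"
 using str by (simp add: gmm_structure_def)

lemma mom_measurable [measurable]: "k < m ==> (%d. mom X d th $ k) : bm P"
 using measurable_compose[OF measurable_Pair2' mom_pair_measurable, of th k] by simp

lemma mom_sq_integrable: "th : par_space X ==> k < m ==> integrable P (%d. (mom X d th $ k)\<^sup>2)"
 using str by (simp add: gmm_structure_def)

lemma mom_integrable: "th : par_space X ==> k < m ==> integrable P (%d. mom X d th $ k)"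
 using finite_measure.square_integrable_imp_integrable[OF prob_space.finite_measure[OF prob_P] mom_measurable mom_sq_integrable] by blast

lemma mean_mom_carrier [simp]: "mean_mom X th : carrier_vec m"
 by (simp add: mean_mom_def)

lemma avg_mom_carrier [simp]: "avg_mom k X D th : carrier_vec m"
 by (simp add: avg_mom_def)

lemma mean_mom_true: "mean_mom X th0 = 0\<^sub>v m"
proof -
 have "\<forall>k<m. (\<integral>d. mom X d th0 $ k \<partial>P) = 0"
  using str true_par_in unfolding gmm_structure_def obs_law_def by blast
 then show ?thesis by (intro eq_vecI) (auto simp: mean_mom_def)
qed

lemma var_mom_carrier [simp]: "var_mom X th : carrier_mat m m"
 by (simp add: var_mom_def)

lemma var_mom_sym: "transpose_mat (var_mom X th) = var_mom X th"
 by (rule eq_matI) (auto simp: var_mom_def mult.commute)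

lemma form_V: "th : par_space X ==> form_in m (var_mom X th) a b"
 by (rule form_in_if_eigs_in[OF var_mom_carrier var_mom_sym eigV])

lemma form_W: "th : par_space X ==> form_in m (W th) (1 / b) (1 / a)"
 by (rule form_in_minv[OF form_V a0 b0])

lemma W_carrier: "th : par_space X ==> W th : carrier_mat m m"
 using form_inD(1)[OF form_W] .

lemma jac_carrier: "th : par_space X ==> jac X th : carrier_mat m p"
 using jacX by (auto simp: has_jac_def has_jacobian_def)

lemma jac_gram:
 assumes th: "th : par_space X" and v: "v : carrier_vec p"
 shows "a * (vnorm v)\<^sup>2 <= (vnorm (jac X th *\<^sub>v v))\<^sup>2" "(vnorm (jac X th *\<^sub>v v))\<^sup>2 <= b * (vnorm v)\<^sup>2"
proof -
 let ?G = "jac X th"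
 note G = jac_carrier[OF th]
 have GG: "transpose_mat ?G * ?G : carrier_mat p p" using G by simp
 have "transpose_mat (transpose_mat ?G * ?G) = transpose_mat ?G * ?G"
  using transpose_mult[of "transpose_mat ?G" p m ?G p] G by simp
 from form_in_if_eigs_in[OF GG this eigG[OF th]] have f: "form_in p (transpose_mat ?G * ?G) a b" .
 have "v \<star> ((transpose_mat ?G * ?G) *\<^sub>v v) = v \<star> (transpose_mat ?G *\<^sub>v (?G *\<^sub>v v))"
  using G v by (subst assoc_mult_mat_vec[of _ p m _ p]) auto
 also have "... = (?G *\<^sub>v v) \<star> (?G *\<^sub>v v)"
  using transpose_vec_mult_scalar[OF G v, of "?G *\<^sub>v v"] G v comm_scalar_prod[of v p "transpose_mat ?G *\<^sub>v (?G *\<^sub>v v)"] by simp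
 finally have "v \<star> ((transpose_mat ?G * ?G) *\<^sub>v v) = (vnorm (?G *\<^sub>v v))\<^sup>2" by (simp add: dot_self)
 then show "a * (vnorm v)\<^sup>2 <= (vnorm (?G *\<^sub>v v))\<^sup>2" "(vnorm (?G *\<^sub>v v))\<^sup>2 <= b * (vnorm v)\<^sup>2"
  using form_inD(3,4)[OF f v] by auto
qed

lemma vnorm_jac_le:
 assumes "th : par_space X" "v : carrier_vec p"
 shows "vnorm (jac X th *\<^sub>v v) <= sqrt b * vnorm v"
 using real_le_rsqrt[OF jac_gram(2)[OF assms]] by (simp add: real_sqrt_mult)

lemma info_carrier: "th : par_space X ==> info X th : carrier_mat p p"
 using W_carrier[of th] jac_carrier[of th] unfolding info_def by (auto intro: mult_carrier_mat)

lemma info_mult_vec: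
 assumes th: "th : par_space X" and v: "v : carrier_vec p"
 shows "info X th *\<^sub>v v = transpose_mat (jac X th) *\<^sub>v (W th *\<^sub>v (jac X th *\<^sub>v v))"
 unfolding info_def using W_carrier[OF th] jac_carrier[OF th] v
 by (simp add: assoc_mult_mat_vec[of _ p m _ p] assoc_mult_mat_vec[of _ p m _ m])

lemma info_form:
 assumes th: "th : par_space X" and v: "v : carrier_vec p" "w : carrier_vec p"
 shows "v \<star> (info X th *\<^sub>v w) = (jac X th *\<^sub>v v) \<star> (W th *\<^sub>v (jac X th *\<^sub>v w))"
proof -
 note G = jac_carrier[OF th] and Wc = W_carrier[OF th]
 let ?y = "W th *\<^sub>v (jac X th *\<^sub>v w)"
 have y: "?y : carrier_vec m" using Wc G v by auto
 have "v \<star> (info X th *\<^sub>v w) = (transpose_mat (jac X th) *\<^sub>v ?y) \<star> v"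
  unfolding info_mult_vec[OF th v(2)] using G y v by (intro comm_scalar_prod[of _ p]) auto
 also have "... = ?y \<star> (jac X th *\<^sub>v v)" by (rule transpose_vec_mult_scalar[OF G v(1) y])
 also have "... = (jac X th *\<^sub>v v) \<star> ?y" using G v y by (intro comm_scalar_prod[of _ m]) auto
 finally show ?thesis .
qed

lemma form_info:
 assumes th: "th : par_space X"
 shows "form_in p (info X th) (a / b) (b / a)"
 unfolding form_in_def
proof (intro conjI ballI)
 note G = jac_carrier[OF th] and Wc = W_carrier[OF th] and Ws = form_inD(2)[OF form_W[OF th]]
 show "info X th : carrier_mat p p" by (rule info_carrier[OF th])
 have GW: "transpose_mat (jac X th) * W th : carrier_mat p m" using G Wc by (auto intro: mult_carrier_mat)
 have "transpose_mat (info X th) = transpose_mat (jac X th) * transpose_mat (transpose_mat (jac X th) * W th)"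
  unfolding info_def by (rule transpose_mult[OF GW G])
 also have "transpose_mat (transpose_mat (jac X th) * W th) = W th * jac X th"
  using transpose_mult[of "transpose_mat (jac X th)" p m "W th" m] G Wc Ws by simp
 also have "transpose_mat (jac X th) * (W th * jac X th) = info X th"
  unfolding info_def using assoc_mult_mat[of "transpose_mat (jac X th)" p m "W th" m "jac X th" p] G Wc by simp
 finally show "transpose_mat (info X th) = info X th" .
 fix v :: "real vec" assume v: "v : carrier_vec p"
 let ?y = "jac X th *\<^sub>v v"
 have y: "?y : carrier_vec m" using G v by auto
 have "a / b * (vnorm v)\<^sup>2 = 1 / b * (a * (vnorm v)\<^sup>2)" by simp
 also have "... <= 1 / b * (vnorm ?y)\<^sup>2" using jac_gram(1)[OF th v] b0 by (intro mult_left_mono) auto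
 also have "... <= ?y \<star> (W th *\<^sub>v ?y)" by (rule form_inD(3)[OF form_W[OF th] y])
 finally show "a / b * (vnorm v)\<^sup>2 <= v \<star> (info X th *\<^sub>v v)" by (simp add: info_form[OF th v v])
 have "?y \<star> (W th *\<^sub>v ?y) <= 1 / a * (vnorm ?y)\<^sup>2" by (rule form_inD(4)[OF form_W[OF th] y])
 also have "... <= 1 / a * (b * (vnorm v)\<^sup>2)" using jac_gram(2)[OF th v] a0 by (intro mult_left_mono) auto
 finally show "v \<star> (info X th *\<^sub>v v) <= b / a * (vnorm v)\<^sup>2" by (simp add: info_form[OF th v v])
qed

lemma ab0: "0 < a / b" "0 < b / a"
 using a0 b0 by auto

lemma score_carrier [simp]: "score n X D : carrier_vec m"
 by (simp add: score_def)

subsection \<open>Completing the square\<close>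

lemma oracle_dev:
 "vec p (dev X (oracle_est n X D)) = - (minv (info X th0) *\<^sub>v (transpose_mat (jac X th0) *\<^sub>v (W th0 *\<^sub>v avg_mom n X D th0)))"
 (is "?l = - ?v")
proof -
 have "minv (info X th0) : carrier_mat p p"
  by (rule minv_mult_vec(1)[OF form_info[OF true_par_in] ab0(1)])
 then have "dim_vec ?v = p" by simp
 then show ?thesis by (intro eq_vecI) (auto simp: dev_def oracle_est_def Let_def info_def)
qed

lemma vnorm_oracle_dev_le:
 "rn * vnorm (vec p (dev X (oracle_est n X D))) <= sqrt b / a * (b / a) * vnorm (score n X D)"
proof -
 note th = true_par_in
 let ?x = "W th0 *\<^sub>v avg_mom n X D th0"
 let ?G = "jac X th0"
 have x: "?x : carrier_vec m" using W_carrier[OF th] by auto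
 have Gx: "transpose_mat ?G *\<^sub>v ?x : carrier_vec p" using jac_carrier[OF th] x by auto
 have "vnorm (vec p (dev X (oracle_est n X D))) <= vnorm (transpose_mat ?G *\<^sub>v ?x) / (a / b)"
  unfolding oracle_dev vnorm_uminus by (rule vnorm_minv_le[OF form_info[OF th] ab0(1) Gx])
 also have "vnorm (transpose_mat ?G *\<^sub>v ?x) <= sqrt b * vnorm ?x"
 proof (rule vnorm_le_if_dot[OF Gx])
  fix et :: "real vec" assume et: "et : carrier_vec p" "vnorm et = 1"
  have "et \<star> (transpose_mat ?G *\<^sub>v ?x) = ?x \<star> (?G *\<^sub>v et)"
  using transpose_vec_mult_scalar[OF jac_carrier[OF th] et(1) x] comm_scalar_prod[OF et(1) Gx] by simp
  also have "... <= vnorm ?x * vnorm (?G *\<^sub>v et)"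
  using abs_dot_le[OF x, of "?G *\<^sub>v et"] jac_carrier[OF th] et by auto
  also have "... <= vnorm ?x * sqrt b"
  using vnorm_jac_le[OF th et(1)] et(2) by (intro mult_left_mono) auto
  finally show "et \<star> (transpose_mat ?G *\<^sub>v ?x) <= sqrt b * vnorm ?x" by (simp add: mult.commute)
 qed (use b0 in auto)
 also have "vnorm ?x <= vnorm (avg_mom n X D th0) / a"
  by (rule vnorm_minv_le[OF form_V[OF th] a0]) simp
 finally have "vnorm (vec p (dev X (oracle_est n X D))) <= sqrt b * (vnorm (avg_mom n X D th0) / a) / (a / b)"
  using a0 b0 by (simp add: divide_right_mono mult_left_mono)
 then have "rn * vnorm (vec p (dev X (oracle_est n X D)))
  <= rn * (sqrt b * (vnorm (avg_mom n X D th0) / a) / (a / b))"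
  by (rule mult_left_mono) simp
 then show ?thesis by (simp add: score_def vnorm_smult field_simps)
qed

lemma complete_square:
 fixes th :: "nat => real" and D :: "nat => 'd"
 defines "y \<equiv> score n X D + jac X th0 *\<^sub>v (rn \<cdot>\<^sub>v vec p (dev X th))"
 shows "y \<star> (W th0 *\<^sub>v y) = resid n X D + real n * qf p (info X th0) (%j. th j - oracle_est n X D j)"
proof -
 note tht = true_par_in
 let ?G = "jac X th0" and ?W = "W th0"
 note G = jac_carrier[OF tht] and Wc = W_carrier[OF tht] and Ws = form_inD(2)[OF form_W[OF tht]]
 let ?s = "rn"
 let ?h = "?s \<cdot>\<^sub>v vec p (dev X (oracle_est n X D))"
 let ?z = "?s \<cdot>\<^sub>v vec p (%j. th j - oracle_est n X D j)"
 let ?r = "score n X D + ?G *\<^sub>v ?h"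
 have h: "?h : carrier_vec p" and z: "?z : carrier_vec p" by auto
 have r: "?r : carrier_vec m" using G h by auto
 have Gz: "?G *\<^sub>v ?z : carrier_vec m" using G z by auto
 have sum: "?s \<cdot>\<^sub>v vec p (dev X th) = ?h + ?z" by (intro eq_vecI) (auto simp: dev_def algebra_simps)
 have "y = ?r + ?G *\<^sub>v ?z"
  unfolding y_def sum using G h z
  by (simp add: mult_add_distrib_mat_vec[OF G h z] assoc_add_vec[of _ m])
 then have "y \<star> (?W *\<^sub>v y) = ?r \<star> (?W *\<^sub>v ?r) + 2 * (?r \<star> (?W *\<^sub>v (?G *\<^sub>v ?z))) + (?G *\<^sub>v ?z) \<star> (?W *\<^sub>v (?G *\<^sub>v ?z))"
  using form_add[OF Wc Ws r Gz] by simp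
 moreover have "?r \<star> (?W *\<^sub>v (?G *\<^sub>v ?z)) = 0"
 proof -
  let ?v = "transpose_mat ?G *\<^sub>v (?W *\<^sub>v avg_mom n X D th0)"
  have v: "?v : carrier_vec p" using G Wc by auto
  have Ga: "transpose_mat ?G *\<^sub>v (?W *\<^sub>v score n X D) = ?s \<cdot>\<^sub>v ?v"
  using G Wc unfolding score_def by (simp add: mult_mat_vec[of _ m m] mult_mat_vec[of _ p m])
  have "transpose_mat ?G *\<^sub>v (?W *\<^sub>v (?G *\<^sub>v ?h)) = info X th0 *\<^sub>v ?h"
  by (rule info_mult_vec[OF tht h, symmetric])
  also have "... = ?s \<cdot>\<^sub>v (info X th0 *\<^sub>v (- (minv (info X th0) *\<^sub>v ?v)))"
  using info_carrier[OF tht] unfolding oracle_dev[symmetric] by (simp add: mult_mat_vec[of _ p p])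
  also have "info X th0 *\<^sub>v (- (minv (info X th0) *\<^sub>v ?v)) = - ?v"
  proof -
  have "- (minv (info X th0) *\<^sub>v ?v) = (-1) \<cdot>\<^sub>v (minv (info X th0) *\<^sub>v ?v)" by auto
  moreover have "(-1) \<cdot>\<^sub>v ?v = - ?v" by auto
  ultimately show ?thesis
  using info_carrier[OF tht] minv_mult_vec(1,3)[OF form_info[OF tht] ab0(1)] v
  by (simp add: mult_mat_vec[of _ p p])
  qed
  finally have Gh: "transpose_mat ?G *\<^sub>v (?W *\<^sub>v (?G *\<^sub>v ?h)) = ?s \<cdot>\<^sub>v (- ?v)" .
  have "transpose_mat ?G *\<^sub>v (?W *\<^sub>v ?r) = ?s \<cdot>\<^sub>v ?v + ?s \<cdot>\<^sub>v (- ?v)"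
  unfolding Ga[symmetric] Gh[symmetric] using G Wc h
  by (simp add: mult_add_distrib_mat_vec[of _ m m] mult_add_distrib_mat_vec[of _ p m])
  also have "... = 0\<^sub>v p"
  proof -
  have "?s \<cdot>\<^sub>v u + ?s \<cdot>\<^sub>v (- u) = 0\<^sub>v p" if "u : carrier_vec p" for u :: "real vec"
  using that by (intro eq_vecI) auto
  then show ?thesis using v .
  qed
  finally have zero: "transpose_mat ?G *\<^sub>v (?W *\<^sub>v ?r) = 0\<^sub>v p" .
  have "?r \<star> (?W *\<^sub>v (?G *\<^sub>v ?z)) = (?G *\<^sub>v ?z) \<star> (?W *\<^sub>v ?r)"
  by (rule sym_dot[OF Wc Ws r Gz])
  also have "... = (?W *\<^sub>v ?r) \<star> (?G *\<^sub>v ?z)"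
  using Wc r Gz by (intro comm_scalar_prod[of _ m]) auto
  also have "... = (transpose_mat ?G *\<^sub>v (?W *\<^sub>v ?r)) \<star> ?z"
  using Wc r by (intro transpose_vec_mult_scalar[OF G z, symmetric]) auto
  also have "... = 0" unfolding zero using z by simp
  finally show ?thesis .
 qed
 moreover have "(?G *\<^sub>v ?z) \<star> (?W *\<^sub>v (?G *\<^sub>v ?z)) = real n * qf p (info X th0) (%j. th j - oracle_est n X D j)"
  unfolding info_form[OF tht z z, symmetric] using form_smult[OF info_carrier[OF tht], of "vec p (%j. th j - oracle_est n X D j)" ?s]
  by (simp add: qf_def)
 ultimately show ?thesis by (simp add: resid_def Let_def)
qed

lemma resid_bounds:
 assumes "vnorm (score n X D) <= T"
 shows "0 <= resid n X D" "resid n X D <= (T + sqrt b * (sqrt b / a * (b / a) * T))\<^sup>2 / a"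
proof -
 let ?h = "rn \<cdot>\<^sub>v vec p (dev X (oracle_est n X D))"
 let ?r = "score n X D + jac X th0 *\<^sub>v ?h"
 have r: "?r : carrier_vec m" using jac_carrier[OF true_par_in] by auto
 have eq: "resid n X D = ?r \<star> (W th0 *\<^sub>v ?r)" by (simp add: resid_def Let_def)
 have "0 <= 1 / b * (vnorm ?r)\<^sup>2" using b0 by simp
 also have "... <= resid n X D" unfolding eq by (rule form_inD(3)[OF form_W[OF true_par_in] r])
 finally show "0 <= resid n X D" .
 have hn: "vnorm ?h <= sqrt b / a * (b / a) * T"
 proof -
  have "vnorm ?h <= sqrt b / a * (b / a) * vnorm (score n X D)"
  using vnorm_oracle_dev_le[of D] by (simp add: vnorm_smult)
  also have "... <= sqrt b / a * (b / a) * T" using assms a0 b0 by (intro mult_left_mono) auto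
  finally show ?thesis .
 qed
 have "vnorm ?r <= vnorm (score n X D) + vnorm (jac X th0 *\<^sub>v ?h)"
  using jac_carrier[OF true_par_in] by (intro vnorm_triangle[of _ m]) auto
 also have "... <= T + sqrt b * vnorm ?h"
  using assms vnorm_jac_le[OF true_par_in, of ?h] by simp
 also have "... <= T + sqrt b * (sqrt b / a * (b / a) * T)"
  using hn b0 by (intro add_left_mono mult_left_mono) auto
 finally have le: "vnorm ?r <= T + sqrt b * (sqrt b / a * (b / a) * T)" .
 have "resid n X D <= 1 / a * (vnorm ?r)\<^sup>2" unfolding eq by (rule form_inD(4)[OF form_W[OF true_par_in] r])
 also have "... <= 1 / a * (T + sqrt b * (sqrt b / a * (b / a) * T))\<^sup>2"
  using le a0 by (intro mult_left_mono power_mono) auto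
 finally show "resid n X D <= (T + sqrt b * (sqrt b / a * (b / a) * T))\<^sup>2 / a" by simp
qed

end

lemma vec_lin: "L : carrier_mat p p ==> vec p (lin p L x) = L *\<^sub>v vec p x"
 by (intro eq_vecI) (auto simp: lin_def scalar_prod_def lessThan_atLeast0)

lemma lin_Rn: "lin p L x : Rn p"
 by (simp add: lin_def Rn_def)

lemma Rn_eqI:
 assumes "x : Rn p" "y : Rn p" "vec p x = vec p y"
 shows "x = y"
proof
 fix j
 show "x j = y j"
  using assms(1,2) arg_cong[OF assms(3), of "%v. vec_index v j"] by (cases "j < p") (auto simp: Rn_def)
qed

lemma lin_inverse:
 assumes "L : carrier_mat p p" "L' : carrier_mat p p" "L * L' = 1\<^sub>m p" "y : Rn p"
 shows "lin p L (lin p L' y) = y"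
proof (rule Rn_eqI[OF lin_Rn assms(4)])
 show "vec p (lin p L (lin p L' y)) = vec p y"
  using assms(1-3) assoc_mult_mat_vec[OF assms(1,2), of "vec p y"] by (simp add: vec_lin)
qed

lemma qf_gram:
 assumes F: "F : carrier_mat p p" and A: "transpose_mat F * F = A"
 shows "qf p A x = (nrm p (lin p F x))\<^sup>2"
proof -
 have "vec p x \<star> (A *\<^sub>v vec p x) = vec p x \<star> (transpose_mat F *\<^sub>v (F *\<^sub>v vec p x))"
  unfolding A[symmetric] using F by (subst assoc_mult_mat_vec[of _ p p _ p]) auto
 also have "... = (F *\<^sub>v vec p x) \<star> (F *\<^sub>v vec p x)"
  using transpose_vec_mult_scalar[OF F, of "vec p x" "F *\<^sub>v vec p x"] F
  comm_scalar_prod[of "vec p x" p "transpose_mat F *\<^sub>v (F *\<^sub>v vec p x)"] by simp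
 finally show ?thesis using F by (simp add: qf_def dot_self nrm_vec vec_lin)
qed

text \<open>The density of an estimator is recovered from the density of its standardisation.  The
 Jacobian of the standardising map appears as a ratio of Gaussian integrals.\<close>

lemma density_from_standardised:
 assumes \<Omega>: "prob_space \<Omega>"
  and e: "distributed \<Omega> (leb {..<p}) T (%t. en (e t))"
  and s: "distributed \<Omega> (leb {..<p}) (%om j. r * lin p F (%i. T om i - th i) j) (%z. en (s z))"
  and r: "0 < r" and F: "F : carrier_mat p p" "transpose_mat F * F = A"
  and A: "form_in p A a b" "0 < a" "0 < b"
  and th: "th : Rn p" and T: "!!om. T om : Rn p"
 shows "AE t in leb {..<p}. en (e t)
  = en (r ^ p * (sqrt (2 * pi) ^ p / gauss_int p A)) * en (s (%j. r * lin p F (%i. t i - th i) j))"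
proof -
 interpret prob_space \<Omega> by (rule \<Omega>)
 let ?l = "leb {..<p}"
 let ?Z = "%t j. r * lin p F (%i. t i - th i) j"
 have inj: "v = 0\<^sub>v p" if v: "v : carrier_vec p" "F *\<^sub>v v = 0\<^sub>v p" for v
 proof (rule form_in_inj[OF A(1,2) v(1)])
  show "A *\<^sub>v v = 0\<^sub>v p"
  unfolding F(2)[symmetric] using F(1) v by (subst assoc_mult_mat_vec[of _ p p _ p]) (auto simp: mult_mat_zero_vec[of _ p p])
 qed
 define F' where "F' = minv F"
 have F': "F' : carrier_mat p p" "F * F' = 1\<^sub>m p" "F' * F = 1\<^sub>m p"
  unfolding F'_def using minv_inverse[OF F(1) inj] by auto
 note FF' = lin_inverse[OF F(1) F'(1,2)] and F'F = lin_inverse[OF F'(1) F(1) F'(3)]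
 let ?U = "%z j. th j + (1 / r) * lin p F' z j"
 have [measurable]: "?U : bm borel" "?Z : bm borel"
  by (rule borel_measurable_funI; simp add: lin_def)+
 have ZU: "?Z (?U z) = z" if z: "z : Rn p" for z
 proof -
  have "lin p F (%i. ?U z i - th i) = lin p F (%j. 0 + (1 / r) * lin p F' z j)" by simp
  also have "... = (%j. lin p F (%_. 0) j + (1 / r) * lin p F (lin p F' z) j)" by (rule lin_add)
  also have "... = (%j. (1 / r) * z j)" unfolding FF'[OF z] by (simp add: lin_def fun_eq_iff)
  finally show ?thesis using r by simp
 qed
 have UZ: "?U (?Z t) = t" if t: "t : Rn p" for t
 proof -
  have "lin p F' (?Z t) = lin p F' (%j. 0 + r * lin p F (%i. t i - th i) j)" by simp
  also have "... = (%j. lin p F' (%_. 0) j + r * lin p F' (lin p F (%i. t i - th i)) j)" by (rule lin_add)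
  also have "lin p F' (lin p F (%i. t i - th i)) = (%i. t i - th i)"
  using t th by (intro F'F) (auto simp: Rn_def)
  finally show ?thesis using r by (auto simp: lin_def fun_eq_iff)
 qed
 let ?C = "r ^ p * (sqrt (2 * pi) ^ p / gauss_int p A)"
 have gpos: "0 < gauss_int p A" using A by (rule gauss_int_pos)
 have change: "(\<integral>\<^sup>+z. H (?U z) \<partial>?l) = ennreal ?C * (\<integral>\<^sup>+t. H t \<partial>?l)"
  if H [measurable]: "H : bm borel" for H
 proof -
  let ?H = "%y. H (%j. th j + (1 / r) * y j)"
  have Hm [measurable]: "?H : bm borel"
  by (intro measurable_compose[OF _ H] borel_measurable_funI) measurable
  let ?g = "%x. en (exp (- qf p A x / 2))"
  note [measurable] = borel_measurable_qf[OF form_inD(1)[OF A(1)]]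
  have gm: "?g : bm borel" by measurable
  have "(\<integral>\<^sup>+x. ?g (lin p F' x) \<partial>?l) = (\<integral>\<^sup>+x. en (exp (- (1 / 2) * (nrm p x)\<^sup>2)) \<partial>?l)"
  proof (rule nn_integral_cong_AE)
  show "AE x in ?l. ?g (lin p F' x) = en (exp (- (1 / 2) * (nrm p x)\<^sup>2))"
  using AE_leb_support[of "{..<p}"]
  proof eventually_elim
  case (elim x)
  then have "x : Rn p" by (simp add: Rn_def)
  then show ?case by (simp add: qf_gram[OF F] FF')
  qed
  qed
  also have "... = en (sqrt (2 * pi) ^ p)"
  using nn_integral_gaussian_leb[of "1 / 2" "{..<p}" p] by (simp add: mult.commute)
  finally have g: "(\<integral>\<^sup>+x. ?g (lin p F' x) \<partial>?l) = en (sqrt (2 * pi) ^ p)" .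
  have cross: "(\<integral>\<^sup>+x. ?H (lin p F' x) \<partial>?l) * en (gauss_int p A) = en (sqrt (2 * pi) ^ p) * (\<integral>\<^sup>+x. ?H x \<partial>?l)"
  using nn_integral_lin_cross[OF F'F Hm gm] unfolding g gauss_int(1)[OF A] .
  have one: "en (gauss_int p A) * en (1 / gauss_int p A) = 1"
  using gpos by (simp flip: ennreal_mult')
  have "(\<integral>\<^sup>+x. ?H (lin p F' x) \<partial>?l) = (\<integral>\<^sup>+x. ?H (lin p F' x) \<partial>?l) * en (gauss_int p A) * en (1 / gauss_int p A)"
  unfolding mult.assoc one by simp
  also have "... = en (sqrt (2 * pi) ^ p / gauss_int p A) * (\<integral>\<^sup>+x. ?H x \<partial>?l)"
  unfolding cross
  proof -
  have "en x * I * en (1 / y) = en (x / y) * I" if "0 <= x" for x y I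
  proof -
  have "en x * I * en (1 / y) = en x * en (1 / y) * I" by (simp only: mult_ac)
  also have "en x * en (1 / y) = en (x / y)" using that by (simp flip: ennreal_mult')
  finally show ?thesis .
  qed
  then show "en (sqrt (2 * pi) ^ p) * (\<integral>\<^sup>+x. ?H x \<partial>?l) * en (1 / gauss_int p A) = en (sqrt (2 * pi) ^ p / gauss_int p A) * (\<integral>\<^sup>+x. ?H x \<partial>?l)"
  by simp
  qed
  also have "(\<integral>\<^sup>+x. ?H x \<partial>?l) = en (r ^ p) * (\<integral>\<^sup>+t. H t \<partial>?l)"
  proof -
  have "en (r ^ p) * (\<integral>\<^sup>+t. H t \<partial>?l) = en (r ^ p) * en ((1 / r) ^ p) * (\<integral>\<^sup>+x. ?H x \<partial>?l)"
  using nn_integral_leb_affine[of "{..<p}" th "1 / r" H] th r by (simp add: Rn_def mult.assoc)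
  also have "en (r ^ p) * en ((1 / r) ^ p) = 1"
  using r by (simp add: power_divide flip: ennreal_mult)
  finally show ?thesis by simp
  qed
  also have "en (sqrt (2 * pi) ^ p / gauss_int p A) * (en (r ^ p) * (\<integral>\<^sup>+t. H t \<partial>?l)) = ennreal ?C * (\<integral>\<^sup>+t. H t \<partial>?l)"
  proof -
  have "en x * (en y * I) = en (y * x) * I" if "0 <= y" for x y I
  unfolding ennreal_mult'[OF that] by (simp only: mult_ac)
  then show ?thesis using r by simp
  qed
  finally show ?thesis .
 qed
 have s' [measurable]: "(%z. en (s z)) : bm borel"
  using distributed_borel_measurable[OF s] measurable_cong_sets[of ?l borel borel borel] by simp
 have Zm: "(%om. ?Z (T om)) : measurable \<Omega> ?l" and Tm: "T : measurable \<Omega> ?l"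
  using distributed_measurable[OF s] distributed_measurable[OF e] by auto
 have Tm' [measurable]: "T : bm \<Omega>"
  using Tm measurable_cong_sets[of \<Omega> \<Omega> ?l borel] by simp
 let ?k = "%t. ennreal ?C * en (s (?Z t))"
 have km [measurable]: "(%t. en (s (?Z t))) : bm borel"
  using measurable_compose[OF \<open>?Z : bm borel\<close> s'] by simp
 have "distributed \<Omega> ?l T ?k"
  unfolding distributed_def
 proof (intro conjI)
  show "distr \<Omega> ?l T = density ?l ?k"
  proof (rule measure_eqI)
  fix B assume "B : sets (distr \<Omega> ?l T)"
  then have B [measurable]: "B : sets borel" by simp
  have UB [measurable]: "?U -` B : sets borel"
  using measurable_sets[OF \<open>?U : bm borel\<close> B] by simp
  have "emeasure (distr \<Omega> ?l T) B = emeasure \<Omega> (T -` B \<inter> space \<Omega>)"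
  by (rule emeasure_distr[OF Tm]) simp
  also have "T -` B \<inter> space \<Omega> = (%om. ?Z (T om)) -` (?U -` B) \<inter> space \<Omega>"
  using UZ[OF T] by (auto simp: vimage_def)
  also have "emeasure \<Omega> ... = emeasure (distr \<Omega> ?l (%om. ?Z (T om))) (?U -` B)"
  by (rule emeasure_distr[OF Zm, symmetric]) (use UB in simp)
  also have "... = (\<integral>\<^sup>+z. en (s z) * indicator (?U -` B) z \<partial>?l)"
  unfolding distributed_distr_eq_density[OF s] by (rule emeasure_density) (use UB in simp_all)
  also have "... = (\<integral>\<^sup>+z. (%t. en (s (?Z t)) * indicator B t) (?U z) \<partial>?l)"
  proof (rule nn_integral_cong_AE)
  show "AE z in ?l. en (s z) * indicator (?U -` B) z = (%t. en (s (?Z t)) * indicator B t) (?U z)"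
  using AE_leb_support[of "{..<p}"]
  proof eventually_elim
  case (elim z)
  then have "z : Rn p" by (simp add: Rn_def)
  from ZU[OF this] show ?case by (simp add: indicator_def)
  qed
  qed
  also have "... = ennreal ?C * (\<integral>\<^sup>+t. en (s (?Z t)) * indicator B t \<partial>?l)"
  by (rule change) simp
  also have "... = emeasure (density ?l ?k) B"
  by (simp add: emeasure_density nn_integral_cmult mult.assoc)
  finally show "emeasure (distr \<Omega> ?l T) B = emeasure (density ?l ?k) B" .
  qed simp
 qed (use Tm in simp_all)
 from distributed_unique[OF e this] show ?thesis .
qed

lemma dist0_dev: "dist0 X th = vnorm (vec (dim_par X) (dev X th))"
 by (simp add: dist0_def nrm_vec dev_def)

lemma dist0_nonneg [simp]: "0 <= dist0 X th"
 by (simp add: dist0_def)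

lemma hess_form_smult:
 assumes "hess X xi k : carrier_mat (dim_par X) (dim_par X)" "k < dim_mom X"
  and "u : carrier_vec (dim_par X)" "v : carrier_vec (dim_par X)"
 shows "hess_form X xi (c \<cdot>\<^sub>v u) (e \<cdot>\<^sub>v v) $ k = c * e * hess_form X xi u v $ k"
 using assms unfolding hess_form_def by (simp add: mult_mat_vec[of _ "dim_par X" "dim_par X"])

lemma hess_form_bound:
 assumes hess: "!!k. k < dim_mom X ==> hess X xi k : carrier_mat (dim_par X) (dim_par X)"
  and H: "!!u v. u : unit_vecs (dim_par X) ==> v : unit_vecs (dim_par X) ==> vnorm (hess_form X xi u v) <= H"
  and u: "u : carrier_vec (dim_par X)" and v: "v : carrier_vec (dim_par X)"
 shows "vnorm (hess_form X xi u v) <= H * vnorm u * vnorm v"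
proof (cases "vnorm u = 0 \<or> vnorm v = 0")
 case True
 have hv: "hess X xi k *\<^sub>v v : carrier_vec (dim_par X)" if "k < dim_mom X" for k
  using mult_mat_vec_carrier[OF hess[OF that] v] .
 have "hess_form X xi u v = 0\<^sub>v (dim_mom X)"
  using scalar_prod_left_zero[OF hv] True vnorm_eq_0[OF u] vnorm_eq_0[OF v] hess u v
  by (intro eq_vecI) (auto simp: hess_form_def mult_mat_zero_vec[of _ "dim_par X" "dim_par X"])
 then show ?thesis using True by auto
next
 case False
 then have pos: "0 < vnorm u" "0 < vnorm v" by (simp_all add: less_le)
 let ?u = "(1 / vnorm u) \<cdot>\<^sub>v u" and ?v = "(1 / vnorm v) \<cdot>\<^sub>v v"
 have uv: "?u : unit_vecs (dim_par X)" "?v : unit_vecs (dim_par X)"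
  using pos u v by (auto simp: unit_vecs_def vnorm_smult)
 have "hess_form X xi ?u ?v = (1 / vnorm u * (1 / vnorm v)) \<cdot>\<^sub>v hess_form X xi u v"
  using hess_form_smult[OF hess _ u v] by (intro eq_vecI) (auto simp: hess_form_def)
 then have "vnorm (hess_form X xi u v) / (vnorm u * vnorm v) <= H"
  using H[OF uv] pos by (simp add: vnorm_smult)
 then show ?thesis using pos by (simp add: field_simps)
qed

context bounded_gmm
begin

lemma dist0_le:
 assumes "j \<notin> M" "th : submodel X M" "j < p"
 shows "\<bar>true_par X j\<bar> <= dist0 X th"
proof -
 have "\<bar>vec p (dev X th) $ j\<bar> <= vnorm (vec p (dev X th))" using assms by (intro abs_index_le_vnorm) auto
 then show ?thesis using assms by (simp add: dist0_dev submodel_def dev_def)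
qed

lemma segment_in_ball:
 assumes ball: "{th : Rn p. dist0 X th < r} <= par_space X" and th: "th : ball0 X r" and t: "t : {0..1}"
 shows "(%j. th0 j + t * dev X th j) : ball0 X r" "dist0 X (%j. th0 j + t * dev X th j) = t * dist0 X th"
proof -
 have "vec p (dev X (%j. th0 j + t * dev X th j)) = t \<cdot>\<^sub>v vec p (dev X th)" by (auto simp: dev_def)
 then show d: "dist0 X (%j. th0 j + t * dev X th j) = t * dist0 X th"
  using t by (simp add: dist0_dev vnorm_smult)
 have "th0 : Rn p" "th : Rn p" using par_subset true_par_in th by (auto simp: ball0_def)
 then have "(%j. th0 j + t * dev X th j) : Rn p" by (simp add: Rn_def dev_def)
 moreover have "t * dist0 X th < r"
  using t th mult_right_mono[of t 1 "dist0 X th"] by (auto simp: ball0_def)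
 ultimately show "(%j. th0 j + t * dev X th j) : ball0 X r"
  using ball d by (auto simp: ball0_def)
qed

lemma jac_lipschitz:
 assumes hess: "!!xi. xi : ball0 X r ==> has_hess X xi"
  and H: "!!xi u v. xi : ball0 X r ==> u : unit_vecs p ==> v : unit_vecs p ==> vnorm (hess_form X xi u v) <= H"
  and ball: "{th : Rn p. dist0 X th < r} <= par_space X"
  and th: "th : ball0 X r" and x: "x : carrier_vec p" and H0: "0 <= H"
 shows "vnorm (jac X th *\<^sub>v x - jac X th0 *\<^sub>v x) <= H * dist0 X th * vnorm x"
proof (rule vnorm_le_if_dot)
 have thp: "th : par_space X" using th by (simp add: ball0_def)
 show "jac X th *\<^sub>v x - jac X th0 *\<^sub>v x : carrier_vec m"
  using mult_mat_vec_carrier[OF jac_carrier[OF thp] x] mult_mat_vec_carrier[OF jac_carrier[OF true_par_in] x]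
  by (intro minus_carrier_vec)
 show "0 <= H * dist0 X th * vnorm x" using H0 by simp
 fix et :: "real vec" assume et: "et : carrier_vec m" "vnorm et = 1"
 define xi where "xi t = (%j. th0 j + t * dev X th j)" for t
 note seg = segment_in_ball[OF ball th]
 have xib: "xi t : ball0 X r" and xip: "xi t : par_space X" if "t : {0..1}" for t
  using seg(1)[OF that] by (auto simp: xi_def ball0_def)
 have xi01: "xi 0 = th0" "xi 1 = th" by (auto simp: xi_def dev_def)
 have row: "jac X xi : carrier_mat m p ==> k < m ==> (jac X xi *\<^sub>v x) $ k = x \<star> Matrix.row (jac X xi) k" for k xi
  using x by (simp add: comm_scalar_prod[of _ p])
 define ph where "ph t = (\<Sum>k<m. et $ k * (x \<star> Matrix.row (jac X (xi t)) k))" for t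
 have ph: "ph t = et \<star> (jac X (xi t) *\<^sub>v x)" if "t : {0..1}" for t
  unfolding ph_def using jac_carrier[OF xip[OF that]] row[OF jac_carrier[OF xip[OF that]]]
  by (auto simp: scalar_prod_def lessThan_atLeast0 intro!: sum.cong)
 let ?d = "vec p (dev X th)"
 have hc: "hess X (xi t) k : carrier_mat p p" if "t : {0..1}" "k < m" for t k
  using hess[OF xib[OF that(1)]] that(2) by (auto simp: has_hess_def has_jacobian_def)
 have "\<bar>ph 1 - ph 0\<bar> <= H * dist0 X th * vnorm x"
 proof (rule unit_interval_increment_le)
  fix t :: real assume t: "t : {0..1}"
  show "(ph has_real_derivative (\<Sum>k<m. et $ k * (x \<star> (hess X (xi t) k *\<^sub>v ?d)))) (at t within {0..1})"
  unfolding ph_def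
  proof (intro DERIV_sum DERIV_cmult)
  fix k assume k: "k : {..<m}"
  have J: "has_jacobian p p (%xi. Matrix.row (jac X xi) k) (hess X (xi t) k) (%j. th0 j + t * dev X th j) (par_space X)"
  using hess[OF xib[OF t]] k by (simp add: has_hess_def xi_def)
  show "((%s. x \<star> Matrix.row (jac X (xi s)) k) has_real_derivative x \<star> (hess X (xi t) k *\<^sub>v ?d)) (at t within {0..1})"
  unfolding xi_def
  proof (rule has_jacobian_segment[OF J[unfolded xi_def] _ t x])
  fix y assume "y : par_space X"
  from jac_carrier[OF this] show "Matrix.row (jac X y) k : carrier_vec p" using k by auto
  qed (use xip in \<open>simp add: xi_def\<close>)
  qed
  have "(\<Sum>k<m. et $ k * (x \<star> (hess X (xi t) k *\<^sub>v ?d))) = et \<star> hess_form X (xi t) x ?d"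
  by (auto simp: scalar_prod_def hess_form_def lessThan_atLeast0 intro!: sum.cong)
  also have "\<bar>...\<bar> <= vnorm et * vnorm (hess_form X (xi t) x ?d)"
  using et by (intro abs_dot_le[of _ m]) (auto simp: hess_form_def)
  also have "vnorm (hess_form X (xi t) x ?d) <= H * vnorm x * vnorm ?d"
  using hc[OF t] H[OF xib[OF t]] x by (intro hess_form_bound) auto
  finally show "\<bar>\<Sum>k<m. et $ k * (x \<star> (hess X (xi t) k *\<^sub>v ?d))\<bar> <= H * dist0 X th * vnorm x"
  using et(2) by (simp add: dist0_dev mult_ac)
 qed
 moreover have "ph 1 - ph 0 = et \<star> (jac X th *\<^sub>v x - jac X th0 *\<^sub>v x)"
  using ph[of 1] ph[of 0] et x jac_carrier[OF thp] jac_carrier[OF true_par_in]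
  by (simp add: xi01 scalar_prod_minus_distrib[of _ m])
 ultimately show "et \<star> (jac X th *\<^sub>v x - jac X th0 *\<^sub>v x) <= H * dist0 X th * vnorm x" by linarith
qed

lemma mean_mom_taylor:
 assumes hess: "!!xi. xi : ball0 X r ==> has_hess X xi"
  and H: "!!xi u v. xi : ball0 X r ==> u : unit_vecs p ==> v : unit_vecs p ==> vnorm (hess_form X xi u v) <= H"
  and ball: "{th : Rn p. dist0 X th < r} <= par_space X"
  and th: "th : ball0 X r" and H0: "0 <= H"
 shows "vnorm (mean_mom X th - jac X th0 *\<^sub>v vec p (dev X th)) <= H * (dist0 X th)\<^sup>2"
proof (rule vnorm_le_if_dot)
 let ?d = "vec p (dev X th)"
 have Gd: "jac X th0 *\<^sub>v ?d : carrier_vec m" using jac_carrier[OF true_par_in] by auto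
 then show "mean_mom X th - jac X th0 *\<^sub>v ?d : carrier_vec m" by auto
 show "0 <= H * (dist0 X th)\<^sup>2" using H0 by simp
 fix et :: "real vec" assume et: "et : carrier_vec m" "vnorm et = 1"
 define xi where "xi t = (%j. th0 j + t * dev X th j)" for t
 note seg = segment_in_ball[OF ball th]
 have xib: "xi t : ball0 X r" and xip: "xi t : par_space X" if "t : {0..1}" for t
  using seg(1)[OF that] by (auto simp: xi_def ball0_def)
 have xi01: "xi 0 = th0" "xi 1 = th" by (auto simp: xi_def dev_def)
 define c where "c = et \<star> (jac X th0 *\<^sub>v ?d)"
 define ph where "ph t = et \<star> mean_mom X (xi t) - c * t" for t
 have "\<bar>ph 1 - ph 0\<bar> <= H * (dist0 X th)\<^sup>2"
 proof (rule unit_interval_increment_le)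
  fix t :: real assume t: "t : {0..1}"
  have J: "has_jacobian p m (mean_mom X) (jac X (xi t)) (%j. th0 j + t * dev X th j) (par_space X)"
  using jacX[OF xip[OF t]] by (simp add: has_jac_def xi_def)
  have "((%s. et \<star> mean_mom X (xi s)) has_real_derivative et \<star> (jac X (xi t) *\<^sub>v ?d)) (at t within {0..1})"
  unfolding xi_def
  by (rule has_jacobian_segment[OF J[unfolded xi_def] _ t et(1)]) (use xip in \<open>auto simp: xi_def\<close>)
  then show "(ph has_real_derivative (et \<star> (jac X (xi t) *\<^sub>v ?d) - c)) (at t within {0..1})"
  unfolding ph_def by (auto intro!: derivative_eq_intros)
  have Gt: "jac X (xi t) *\<^sub>v ?d : carrier_vec m" using jac_carrier[OF xip[OF t]] by auto
  have "et \<star> (jac X (xi t) *\<^sub>v ?d) - c = et \<star> (jac X (xi t) *\<^sub>v ?d - jac X th0 *\<^sub>v ?d)"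
  using et Gd Gt by (simp add: c_def scalar_prod_minus_distrib[of _ m])
  also have "\<bar>...\<bar> <= vnorm et * vnorm (jac X (xi t) *\<^sub>v ?d - jac X th0 *\<^sub>v ?d)"
  using et Gd Gt by (intro abs_dot_le[of _ m]) auto
  also have "... <= H * dist0 X (xi t) * vnorm ?d"
  using et(2) jac_lipschitz[OF hess H ball xib[OF t] _ H0, of ?d] by simp
  also have "dist0 X (xi t) = t * dist0 X th" using seg(2)[OF t] by (simp add: xi_def)
  also have "H * (t * dist0 X th) * vnorm ?d = t * (H * (dist0 X th)\<^sup>2)"
  by (simp add: dist0_dev power2_eq_square)
  also have "... <= 1 * (H * (dist0 X th)\<^sup>2)" using t H0 by (intro mult_right_mono) auto
  finally show "\<bar>et \<star> (jac X (xi t) *\<^sub>v ?d) - c\<bar> <= H * (dist0 X th)\<^sup>2" by simp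
 qed
 moreover have "ph 1 - ph 0 = et \<star> (mean_mom X th - jac X th0 *\<^sub>v ?d)"
  using et Gd by (simp add: ph_def xi01 c_def mean_mom_true scalar_prod_minus_distrib[of _ m])
 ultimately show "et \<star> (mean_mom X th - jac X th0 *\<^sub>v ?d) <= H * (dist0 X th)\<^sup>2" by linarith
qed

subsection \<open>Continuity of the variance at the true parameter\<close>

lemma unit_vec_unit: "k < m ==> unit_vec m k : unit_vecs m"
 by (auto simp: unit_vecs_def vnorm_def L2_set_def unit_vec_def if_distrib[where f="%x. x\<^sup>2"] cong: if_cong)

lemma unit_vec_form:
 assumes A: "A : carrier_mat m m" and k: "k < m"
 shows "unit_vec m k \<star> (A *\<^sub>v unit_vec m k) = A $$ (k, k)"
proof -
 have "A *\<^sub>v unit_vec m k : carrier_vec m" using A by simp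
 then show ?thesis using A k by simp
qed

lemma mom_diff_unit:
 assumes "k < m"
 shows "mom_diff X (unit_vec m k) th d = mom X d th $ k - mom X d th0 $ k"
proof -
 have "mom X d th - mom X d th0 : carrier_vec m" by auto
 then show ?thesis using assms by (simp add: mom_diff_def)
qed

lemma L2_norm_centre_le:
 fixes f :: "'d => real"
 assumes f: "f : bm P" "integrable P (%d. (f d)\<^sup>2)"
 shows "integrable P (%d. (f d - (\<integral>d. f d \<partial>P))\<^sup>2)" "L2_norm P (%d. f d - (\<integral>d. f d \<partial>P)) <= L2_norm P f"
proof -
 interpret prob_space P by (rule prob_P)
 have fi: "integrable P f" by (rule square_integrable_imp_integrable[OF f])
 have eq: "(f d - expectation f)\<^sup>2 = (f d)\<^sup>2 - 2 * expectation f * f d + (expectation f)\<^sup>2" for d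
  by (simp add: power2_eq_square algebra_simps)
 show "integrable P (%d. (f d - (\<integral>d. f d \<partial>P))\<^sup>2)" unfolding eq using f fi by simp
 have "expectation (%d. (f d - expectation f)\<^sup>2) = expectation (%d. (f d)\<^sup>2) - (expectation f)\<^sup>2"
  using variance_eq[OF fi f(2)] by simp
 then show "L2_norm P (%d. f d - (\<integral>d. f d \<partial>P)) <= L2_norm P f"
  unfolding L2_norm_def by simp
qed

lemma var_entry_close:
 assumes th: "th : par_space X" and k: "k < m" "l < m"
  and h: "!!et. et : unit_vecs m ==> L2_norm P (mom_diff X et th) <= h"
 shows "\<bar>var_mom X th $$ (k, l) - var_mom X th0 $$ (k, l)\<bar> <= 2 * sqrt b * h"
proof -
 interpret prob_space P by (rule prob_P)
 define A where "A k th d = mom X d th $ k - mean_mom X th $ k" for k th d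
 have Am [measurable]: "A k th : bm P" if "k < m" for k th using that unfolding A_def by measurable
 have A2: "integrable P (%d. (A k th d)\<^sup>2)" if "th : par_space X" "k < m" for k th
  using L2_norm_centre_le(1)[OF mom_measurable mom_sq_integrable] that by (simp add: A_def mean_mom_def)
 have V: "var_mom X th $$ (k, l) = (\<integral>d. A k th d * A l th d \<partial>P)" if "k < m" "l < m" for th k l
  using that by (simp add: var_mom_def A_def)
 have AL: "L2_norm P (A k th) <= sqrt b" if "th : par_space X" "k < m" for k th
 proof -
  have "unit_vec m k \<star> (var_mom X th *\<^sub>v unit_vec m k) <= b * (vnorm (unit_vec m k))\<^sup>2"
  by (rule form_inD(4)[OF form_V[OF that(1)]]) simp
  moreover have "unit_vec m k \<star> (var_mom X th *\<^sub>v unit_vec m k) = var_mom X th $$ (k, k)"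
  by (rule unit_vec_form[OF var_mom_carrier that(2)])
  moreover have "vnorm (unit_vec m k) = 1" using unit_vec_unit[OF that(2)] by (simp add: unit_vecs_def)
  ultimately show ?thesis using V[of k k th] that by (simp add: L2_norm_def power2_eq_square)
 qed
 define B where "B k d = A k th d - A k th0 d" for k d
 have Bm [measurable]: "B k : bm P" if "k < m" for k using that unfolding B_def by measurable
 have B: "integrable P (%d. (B k d)\<^sup>2) & L2_norm P (B k) <= h" if k: "k < m" for k
 proof -
  let ?f = "mom_diff X (unit_vec m k) th"
  have fe: "?f = (%d. mom X d th $ k - mom X d th0 $ k)" using mom_diff_unit[OF k] by auto
  have fm: "?f : bm P" unfolding fe using k by measurable
  have fi: "integrable P (%d. (?f d)\<^sup>2)"
  proof -
  have "integrable P (%d. (mom X d th $ k)\<^sup>2 - 2 * (mom X d th $ k * mom X d th0 $ k) + (mom X d th0 $ k)\<^sup>2)"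
  using mom_sq_integrable[OF th k] mom_sq_integrable[OF true_par_in k]
  L2_Cauchy_Schwarz(1)[OF mom_measurable[OF k] mom_measurable[OF k] mom_sq_integrable[OF th k] mom_sq_integrable[OF true_par_in k]]
  by (intro Bochner_Integration.integrable_add Bochner_Integration.integrable_diff) simp_all
  then show ?thesis unfolding fe by (simp add: power2_eq_square algebra_simps)
  qed
  have "(\<integral>d. ?f d \<partial>P) = mean_mom X th $ k - mean_mom X th0 $ k"
  unfolding fe using mom_integrable[OF th k] mom_integrable[OF true_par_in k] k by (simp add: mean_mom_def)
  then have "B k = (%d. ?f d - (\<integral>d. ?f d \<partial>P))" unfolding fe by (auto simp: B_def A_def)
  then show ?thesis using L2_norm_centre_le[OF fm fi] h[OF unit_vec_unit[OF k]] by auto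
 qed
 note kl = A2[OF th k(2)] A2[OF true_par_in k(1)] B[OF k(1)] B[OF k(2)]
 have "var_mom X th $$ (k, l) - var_mom X th0 $$ (k, l) = (\<integral>d. A k th d * A l th d - A k th0 d * A l th0 d \<partial>P)"
  unfolding V[OF k] using L2_Cauchy_Schwarz(1)[OF Am[OF k(1)] Am[OF k(2)]] A2 k th true_par_in by simp
 also have "... = (\<integral>d. B k d * A l th d + A k th0 d * B l d \<partial>P)"
  by (intro Bochner_Integration.integral_cong) (auto simp: B_def algebra_simps)
 also have "... = (\<integral>d. B k d * A l th d \<partial>P) + (\<integral>d. A k th0 d * B l d \<partial>P)"
  using kl k by (intro Bochner_Integration.integral_add L2_Cauchy_Schwarz(1)) auto
 also have "\<bar>...\<bar> <= L2_norm P (B k) * L2_norm P (A l th) + L2_norm P (A k th0) * L2_norm P (B l)"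
  using L2_Cauchy_Schwarz(2)[OF Bm[OF k(1)] Am[OF k(2)], of th] L2_Cauchy_Schwarz(2)[OF Am[OF k(1)] Bm[OF k(2)], of th0] kl by linarith
 also have "... <= h * sqrt b + sqrt b * h"
 proof -
  have L0: "0 <= L2_norm P f" for f by (simp add: L2_norm_def)
  have h0: "0 <= h" using L0[of "B k"] kl by linarith
  show ?thesis using kl AL[OF th k(2)] AL[OF true_par_in k(1)] b0 L0 h0 by (intro add_mono mult_mono) auto
 qed
 finally show ?thesis by (simp add: mult_ac)
qed

lemma var_mom_close:
 assumes th: "th : par_space X"
  and h: "!!et. et : unit_vecs m ==> L2_norm P (mom_diff X et th) <= h"
  and x: "x : carrier_vec m" and y: "y : carrier_vec m"
 shows "\<bar>x \<star> (var_mom X th *\<^sub>v y) - x \<star> (var_mom X th0 *\<^sub>v y)\<bar> <= (real m)\<^sup>2 * (2 * sqrt b * h) * vnorm x * vnorm y"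
proof -
 have ent: "\<bar>var_mom X th $$ (k, l) - var_mom X th0 $$ (k, l)\<bar> <= 2 * sqrt b * h" if "k < m" "l < m" for k l
  by (rule var_entry_close[OF th that]) (rule h)
 have "x \<star> (var_mom X th *\<^sub>v y) - x \<star> (var_mom X th0 *\<^sub>v y)
  = (\<Sum>k<m. \<Sum>l<m. x $ k * (var_mom X th $$ (k, l) - var_mom X th0 $$ (k, l)) * y $ l)"
  using x y by (simp add: dot_mult_mat_vec_sum[OF var_mom_carrier] left_diff_distrib right_diff_distrib sum_subtractf)
 also have "\<bar>...\<bar> <= (\<Sum>k<m. \<Sum>l<m. vnorm x * (2 * sqrt b * h) * vnorm y)"
 proof (intro order_trans[OF sum_abs] sum_mono)
  fix k l assume kl: "k : {..<m}" "l : {..<m}"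
  have "0 <= 2 * sqrt b * h" using order_trans[OF abs_ge_zero ent[of k l]] kl by simp
  moreover have "\<bar>x $ k\<bar> <= vnorm x" "\<bar>y $ l\<bar> <= vnorm y"
  using abs_index_le_vnorm[OF x] abs_index_le_vnorm[OF y] kl by auto
  moreover have "\<bar>var_mom X th $$ (k, l) - var_mom X th0 $$ (k, l)\<bar> <= 2 * sqrt b * h"
  using ent kl by simp
  ultimately show "\<bar>x $ k * (var_mom X th $$ (k, l) - var_mom X th0 $$ (k, l)) * y $ l\<bar> <= vnorm x * (2 * sqrt b * h) * vnorm y"
  unfolding abs_mult by - (rule mult_mono[OF mult_mono], (assumption | rule vnorm_nonneg abs_ge_zero mult_nonneg_nonneg[OF vnorm_nonneg])+)
 qed
 finally show ?thesis by (simp add: power2_eq_square mult_ac)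
qed

lemma info_close:
 assumes th: "th : par_space X" and e0: "0 <= e"
  and g: "!!x. x : carrier_vec p ==> vnorm (jac X th *\<^sub>v x - jac X th0 *\<^sub>v x) <= g * vnorm x"
  and e: "!!x y. x : carrier_vec m ==> y : carrier_vec m ==>
  \<bar>x \<star> (var_mom X th *\<^sub>v y) - x \<star> (var_mom X th0 *\<^sub>v y)\<bar> <= e * vnorm x * vnorm y"
 shows "\<bar>qf p (info X th) x - qf p (info X th0) x\<bar> <= (2 * sqrt b / a * g + e * b / a\<^sup>2) * (nrm p x)\<^sup>2"
proof -
 let ?x = "vec p x"
 let ?u = "jac X th *\<^sub>v ?x" and ?v = "jac X th0 *\<^sub>v ?x"
 have x: "?x : carrier_vec p" by simp
 have u: "?u : carrier_vec m" and v: "?v : carrier_vec m"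
  using jac_carrier[OF th] jac_carrier[OF true_par_in] by auto
 have gn: "0 <= g * vnorm ?x" using order_trans[OF vnorm_nonneg g[OF x]] .
 have "\<bar>?u \<star> (W th *\<^sub>v ?u) - ?v \<star> (W th *\<^sub>v ?v)\<bar> <= 1 / a * vnorm (?u - ?v) * (vnorm ?u + vnorm ?v)"
  using form_W[OF th] b0 u v by (intro form_diff_le[where a="1/b"]) auto
 also have "... <= 1 / a * (g * vnorm ?x) * (sqrt b * vnorm ?x + sqrt b * vnorm ?x)"
  using g[OF x] vnorm_jac_le[OF th x] vnorm_jac_le[OF true_par_in x] a0
  using gn b0 by (intro mult_mono add_mono mult_left_mono) auto
 finally have 1: "\<bar>?u \<star> (W th *\<^sub>v ?u) - ?v \<star> (W th *\<^sub>v ?v)\<bar> <= 2 * sqrt b / a * g * (vnorm ?x)\<^sup>2"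
  by (simp add: power2_eq_square algebra_simps)
 have "\<bar>?v \<star> (W th *\<^sub>v ?v) - ?v \<star> (W th0 *\<^sub>v ?v)\<bar> <= e / a\<^sup>2 * (vnorm ?v)\<^sup>2"
  by (rule minv_form_perturb[OF form_V[OF th] form_V[OF true_par_in] a0 v e e0])
 also have "... <= e / a\<^sup>2 * (b * (vnorm ?x)\<^sup>2)"
  using jac_gram(2)[OF true_par_in x] e0 by (intro mult_left_mono) auto
 finally have 2: "\<bar>?v \<star> (W th *\<^sub>v ?v) - ?v \<star> (W th0 *\<^sub>v ?v)\<bar> <= e * b / a\<^sup>2 * (vnorm ?x)\<^sup>2" by simp
 show ?thesis
  unfolding qf_def info_form[OF th x x] info_form[OF true_par_in x x] nrm_vec distrib_right using 1 2 by linarith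
qed

end

lemma exp_minus_le_quadratic:
 fixes x :: real
 assumes "- 1 <= x"
 shows "exp (- x) <= 1 - x + x\<^sup>2"
proof (cases "x <= 0")
 case True
 then show ?thesis using exp_bound[of "- x"] assms by simp
next
 case False
 then have x: "0 <= x" by simp
 have "1 <= 1 + (x\<^sup>2)\<^sup>2 / 4" by simp
 also have "... = (1 - x + x\<^sup>2 / 2) * (1 + x + x\<^sup>2 / 2)"
  by (simp add: algebra_simps power2_eq_square)
 also have "... <= (1 - x + x\<^sup>2 / 2) * exp x"
 proof (rule mult_left_mono[OF exp_lower_Taylor_quadratic[OF x]])
  have "0 <= ((1 - x)\<^sup>2 + 1) / 2" by simp
  then show "0 <= 1 - x + x\<^sup>2 / 2" by (simp add: power2_eq_square field_simps)
 qed
 finally have "exp (- x) <= 1 - x + x\<^sup>2 / 2" by (simp add: exp_minus field_simps)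
 also have "... <= 1 - x + x\<^sup>2" by simp
 finally show ?thesis .
qed

context bounded_gmm
begin

abbreviation "SL \<equiv> sample_law n X th0"

lemma SL_eq: "SL = (\<Pi>\<^sub>M i\<in>{..<n}. P)"
 by (simp add: sample_law_def obs_law_def)

lemma prob_SL: "prob_space SL"
 unfolding SL_eq by (intro prob_space_PiM prob_P)

lemma coordinate_measurable [measurable]: "i < n ==> (%D. D i) : measurable SL P"
 unfolding SL_eq by (rule measurable_component_singleton) simp

lemma space_SL: "D : space SL ==> i < n ==> D i : space P"
 unfolding SL_eq by (auto simp: space_PiM)

lemma avg_mom_index: "k < m ==> avg_mom n X D th $ k = (\<Sum>i<n. mom X (D i) th $ k) / real n"
 by (simp add: avg_mom_def)

lemma avg_pair_measurable:
 assumes k: "k < m"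
 shows "(%z. avg_mom n X (fst z) (snd z) $ k) : bm (SL \<Otimes>\<^sub>M borel)"
proof -
 have "(%z. mom X (fst z i) (snd z) $ k) : bm (SL \<Otimes>\<^sub>M borel)" if i: "i < n" for i
 proof -
  have "(%z. (fst z i, snd z)) : measurable (SL \<Otimes>\<^sub>M borel) (P \<Otimes>\<^sub>M borel)"
  by (intro measurable_Pair measurable_compose[OF measurable_fst coordinate_measurable[OF i]] measurable_snd)
  from measurable_compose[OF this mom_pair_measurable[OF k]] show ?thesis by (simp add: split_beta')
 qed
 then show ?thesis unfolding avg_mom_index[OF k] by (intro borel_measurable_divide borel_measurable_sum) auto
qed

lemma avg_measurable [measurable]: "k < m ==> (%D. avg_mom n X D th $ k) : bm SL"
 using measurable_compose[OF measurable_Pair2' avg_pair_measurable, of th k] by simp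

lemma vnorm_power2: "v : carrier_vec k ==> (vnorm v)\<^sup>2 = (\<Sum>i<k. (v $ i)\<^sup>2)"
 by (simp add: vnorm_def L2_set_def sum_nonneg)

lemma vnorm_measurable:
 fixes f :: "'x => real vec"
 assumes "!!x. f x : carrier_vec k" "!!i. i < k ==> (%x. f x $ i) : bm N"
 shows "(%x. vnorm (f x)) : bm N"
proof -
 have "vnorm (f x) = sqrt (\<Sum>i<k. (f x $ i)\<^sup>2)" for x
  using vnorm_power2[OF assms(1), of x] by (metis real_sqrt_unique vnorm_nonneg)
 then show ?thesis using assms(2) by simp
qed

lemma vnorm_score_measurable [measurable]: "(%D. vnorm (score n X D)) : bm SL"
 by (rule vnorm_measurable[of _ m]) (auto simp: score_def carrier_vecD[OF avg_mom_carrier])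

lemma n_pos: "0 < real n"
 using n1 by simp

subsection \<open>Second moments of sample means\<close>

lemma nn_integral_vnorm_mean:
 assumes c: "!!D. f D : carrier_vec m"
  and f: "!!D k. k < m ==> f D $ k = (\<Sum>i<n. h k (D i)) / rn"
  and h: "!!k. k < m ==> h k : bm P" "!!k. k < m ==> integrable P (%d. (h k d)\<^sup>2)"
  "!!k. k < m ==> (\<integral>d. h k d \<partial>P) = 0" "!!k. k < m ==> (\<integral>d. (h k d)\<^sup>2 \<partial>P) <= B"
 shows "(\<integral>\<^sup>+D. en ((vnorm (f D))\<^sup>2) \<partial>SL) <= en (real m * B)"
proof -
 have sqk: "(\<integral>\<^sup>+D. en ((f D $ k)\<^sup>2) \<partial>SL) <= en B" if k: "k < m" for k
 proof -
  have "(\<integral>\<^sup>+D. en ((f D $ k)\<^sup>2) \<partial>SL) = (\<integral>\<^sup>+D. en (1 / real n) * en ((\<Sum>i\<in>{..<n}. h k (D i))\<^sup>2) \<partial>SL)"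
  using n_pos by (intro nn_integral_cong) (simp add: f[OF k] power_divide flip: ennreal_mult)
  also have "... = en (1 / real n) * (\<integral>\<^sup>+D. en ((\<Sum>i\<in>{..<n}. h k (D i))\<^sup>2) \<partial>SL)"
  using measurable_compose[OF coordinate_measurable h(1)[OF k]] by (intro nn_integral_cmult) simp
  also have "(\<integral>\<^sup>+D. en ((\<Sum>i\<in>{..<n}. h k (D i))\<^sup>2) \<partial>SL) = en (real n * (\<integral>d. (h k d)\<^sup>2 \<partial>P))"
  unfolding SL_eq using iid_sum_square[OF prob_P finite_lessThan h(1-3)[OF k], of n] by simp
  also have "en (1 / real n) * ... = en (\<integral>d. (h k d)\<^sup>2 \<partial>P)"
  using n_pos by (simp flip: ennreal_mult)
  also have "... <= en B" by (rule ennreal_leI[OF h(4)[OF k]])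
  finally show ?thesis .
 qed
 have fm: "(%D. f D $ k) : bm SL" if k: "k < m" for k
  unfolding f[OF k] using measurable_compose[OF coordinate_measurable h(1)[OF k]] by simp
 have "(\<integral>\<^sup>+D. en ((vnorm (f D))\<^sup>2) \<partial>SL) = (\<integral>\<^sup>+D. (\<Sum>k<m. en ((f D $ k)\<^sup>2)) \<partial>SL)"
  by (intro nn_integral_cong) (simp add: vnorm_power2[OF c] sum_ennreal)
 also have "... = (\<Sum>k<m. \<integral>\<^sup>+D. en ((f D $ k)\<^sup>2) \<partial>SL)"
  using fm by (intro nn_integral_sum) simp
 also have "... <= (\<Sum>k<m. en B)" by (intro sum_mono sqk) auto
 also have "... = en (real m * B)" by (simp add: ennreal_of_nat_eq_real_of_nat ennreal_mult')
 finally show ?thesis .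
qed

lemma var_diag_le: "th : par_space X ==> k < m ==> var_mom X th $$ (k, k) <= b"
proof -
 assume th: "th : par_space X" and k: "k < m"
 have "unit_vec m k \<star> (var_mom X th *\<^sub>v unit_vec m k) <= b * (vnorm (unit_vec m k))\<^sup>2"
  by (rule form_inD(4)[OF form_V[OF th]]) simp
 moreover have "unit_vec m k \<star> (var_mom X th *\<^sub>v unit_vec m k) = var_mom X th $$ (k, k)"
  by (rule unit_vec_form[OF var_mom_carrier k])
 moreover have "vnorm (unit_vec m k) = 1" using unit_vec_unit[OF k] by (simp add: unit_vecs_def)
 ultimately show ?thesis by simp
qed

lemma score_second_moment: "(\<integral>\<^sup>+D. en ((vnorm (score n X D))\<^sup>2) \<partial>SL) <= en (real m * b)"
proof (rule nn_integral_vnorm_mean[where h="%k d. mom X d th0 $ k"])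
 fix D k assume k: "k < m"
 show "score n X D $ k = (\<Sum>i<n. mom X (D i) th0 $ k) / rn"
  using k n_pos by (simp add: score_def avg_mom_index carrier_vecD[OF avg_mom_carrier] field_simps)
 show "(\<integral>d. mom X d th0 $ k \<partial>P) = 0" using mean_mom_true k by (auto simp: mean_mom_def vec_eq_iff)
 then have "(\<integral>d. (mom X d th0 $ k)\<^sup>2 \<partial>P) = var_mom X th0 $$ (k, k)"
  using k by (simp add: var_mom_def mean_mom_def power2_eq_square)
 then show "(\<integral>d. (mom X d th0 $ k)\<^sup>2 \<partial>P) <= b" using var_diag_le[OF true_par_in k] by simp
qed (use mom_sq_integrable[OF true_par_in] in auto)

definition fluct :: "(nat => 'd) => (nat => real) => real vec" where
 "fluct D th = rn \<cdot>\<^sub>v (avg_mom n X D th - avg_mom n X D th0 - mean_mom X th)"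

lemma fluct_carrier [simp]: "fluct D th : carrier_vec m"
 by (simp add: fluct_def)

lemma fluct_second_moment:
 assumes th: "th : par_space X" and h: "!!et. et : unit_vecs m ==> L2_norm P (mom_diff X et th) <= h"
 shows "(\<integral>\<^sup>+D. en ((vnorm (fluct D th))\<^sup>2) \<partial>SL) <= en (real m * h\<^sup>2)"
proof -
 interpret prob_space P by (rule prob_P)
 define f where "f k d = mom X d th $ k - mom X d th0 $ k" for k d
 have fm [measurable]: "f k : bm P" if "k < m" for k using that unfolding f_def by measurable
 have f2: "integrable P (%d. (f k d)\<^sup>2)" if k: "k < m" for k
 proof -
  have "integrable P (%d. (mom X d th $ k)\<^sup>2 - 2 * (mom X d th $ k * mom X d th0 $ k) + (mom X d th0 $ k)\<^sup>2)"
  using mom_sq_integrable[OF th k] mom_sq_integrable[OF true_par_in k]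
  L2_Cauchy_Schwarz(1)[OF mom_measurable[OF k] mom_measurable[OF k] mom_sq_integrable[OF th k] mom_sq_integrable[OF true_par_in k]]
  by (intro Bochner_Integration.integrable_add Bochner_Integration.integrable_diff) simp_all
  then show ?thesis by (simp add: f_def power2_eq_square algebra_simps)
 qed
 have fi: "integrable P (f k)" if k: "k < m" for k
  using mom_integrable[OF th k] mom_integrable[OF true_par_in k] by (simp add: f_def[abs_def])
 have fE: "(\<integral>d. f k d \<partial>P) = mean_mom X th $ k" if k: "k < m" for k
 proof -
  have "(\<integral>d. mom X d th0 $ k \<partial>P) = 0" using mean_mom_true k by (auto simp: mean_mom_def vec_eq_iff)
  then show ?thesis using mom_integrable[OF th k] mom_integrable[OF true_par_in k] k by (simp add: f_def[abs_def] mean_mom_def)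
 qed
 have fL: "L2_norm P (f k) <= h" if k: "k < m" for k
 proof -
  have "mom_diff X (unit_vec m k) th = f k" using mom_diff_unit[OF k] by (intro ext) (simp add: f_def)
  then show ?thesis using h[OF unit_vec_unit[OF k]] by simp
 qed
 show ?thesis
 proof (rule nn_integral_vnorm_mean[where h="%k d. f k d - (\<integral>d. f k d \<partial>P)"])
  fix D k assume k: "k < m"
  have "(\<Sum>i<n. f k (D i) - (\<integral>d. f k d \<partial>P)) = real n * (avg_mom n X D th $ k - avg_mom n X D th0 $ k - mean_mom X th $ k)"
  unfolding fE[OF k] using k n_pos by (simp add: f_def sum_subtractf avg_mom_index right_diff_distrib)
  then show "fluct D th $ k = (\<Sum>i<n. f k (D i) - (\<integral>d. f k d \<partial>P)) / rn"
  using k n_pos real_div_sqrt[of "real n"] by (simp add: fluct_def carrier_vecD[OF avg_mom_carrier] carrier_vecD[OF mean_mom_carrier] field_simps)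
  (simp flip: mult.assoc)
  show "(%d. f k d - (\<integral>d. f k d \<partial>P)) : bm P" using k by simp
  show "integrable P (%d. (f k d - (\<integral>d. f k d \<partial>P))\<^sup>2)" by (rule L2_norm_centre_le(1)[OF fm[OF k] f2[OF k]])
  show "(\<integral>d. f k d - (\<integral>d. f k d \<partial>P) \<partial>P) = 0" using fi[OF k] by (simp add: prob_space)
  have "L2_norm P (%d. f k d - (\<integral>d. f k d \<partial>P)) <= h"
  using L2_norm_centre_le(2)[OF fm[OF k] f2[OF k]] fL[OF k] by linarith
  then have "(L2_norm P (%d. f k d - (\<integral>d. f k d \<partial>P)))\<^sup>2 <= h\<^sup>2"
  by (intro power_mono) (auto simp: L2_norm_def)
  then show "(\<integral>d. (f k d - (\<integral>d. f k d \<partial>P))\<^sup>2 \<partial>P) <= h\<^sup>2" by (simp add: L2_norm_def)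
 qed simp
qed

lemma env_measurable [measurable]: "F : bm P" and env_integrable: "integrable P (%d. (F d)\<^sup>2)"
 using env(1) by (auto simp: L2_space_def)

lemma env_sum_moment: "(\<integral>\<^sup>+D. en (\<Sum>i<n. (F (D i))\<^sup>2) \<partial>SL) <= en (real n * K)"
proof -
 have "(\<integral>\<^sup>+D. en (\<Sum>i<n. (F (D i))\<^sup>2) \<partial>SL) = (\<integral>\<^sup>+D. (\<Sum>i<n. en ((F (D i))\<^sup>2)) \<partial>SL)"
  by (simp add: sum_ennreal)
 also have "... = (\<Sum>i<n. \<integral>\<^sup>+D. en ((F (D i))\<^sup>2) \<partial>SL)" by (intro nn_integral_sum) simp
 also have "... = (\<Sum>i<n. \<integral>\<^sup>+d. en ((F d)\<^sup>2) \<partial>P)"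
  unfolding SL_eq by (intro sum.cong nn_integral_PiM_coordinate[OF prob_P]) auto
 also have "(\<integral>\<^sup>+d. en ((F d)\<^sup>2) \<partial>P) = en (\<integral>d. (F d)\<^sup>2 \<partial>P)"
  using env_integrable by (intro nn_integral_eq_integral) auto
 also have "(\<Sum>i<n. ...) <= (\<Sum>i<n. en K)" by (intro sum_mono ennreal_leI env(3))
 also have "... = en (real n * K)" by (simp add: ennreal_of_nat_eq_real_of_nat ennreal_mult')
 finally show ?thesis .
qed

text \<open>Beyond the truncation level \<open>B\<close> the envelope contributes at most \<open>K / B\<close> to a sample mean,
 up to a fluctuation of order \<open>1 / \<surd>n\<close>.\<close>

lemma env_excess:
 assumes B: "0 < B"
 defines "Y \<equiv> %d. if B < F d then F d else 0"
 shows "\<exists>c\<le>K / B. (\<integral>\<^sup>+D. en (((\<Sum>i<n. Y (D i)) / real n - c)\<^sup>2) \<partial>SL) <= en (K / real n)"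
proof (intro exI conjI)
 interpret prob_space P by (rule prob_P)
 have Ym [measurable]: "Y : bm P" unfolding Y_def by measurable
 have Y2: "integrable P (%d. (Y d)\<^sup>2)"
  by (rule Bochner_Integration.integrable_bound[OF env_integrable]) (auto simp: Y_def)
 have Yi: "integrable P Y" by (rule square_integrable_imp_integrable[OF Ym Y2])
 have "Y d <= (F d)\<^sup>2 / B" for d
 proof (cases "B < F d")
  case True
  then have "F d * B <= F d * F d" using B by (intro mult_left_mono) auto
  then show ?thesis using True B by (simp add: Y_def power2_eq_square field_simps)
 qed (use B in \<open>simp add: Y_def\<close>)
 then have "(\<integral>d. Y d \<partial>P) <= (\<integral>d. (F d)\<^sup>2 / B \<partial>P)"
  using Yi env_integrable by (intro integral_mono) auto
 also have "... <= K / B" using env(3) B by (simp add: divide_right_mono)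
 finally show "(\<integral>d. Y d \<partial>P) <= K / B" .
 let ?Z = "%d. Y d - (\<integral>d. Y d \<partial>P)"
 have Z2: "integrable P (%d. (?Z d)\<^sup>2)" and ZL: "L2_norm P ?Z <= L2_norm P Y"
  using L2_norm_centre_le[OF Ym Y2] by auto
 have "(\<integral>d. (?Z d)\<^sup>2 \<partial>P) <= (\<integral>d. (Y d)\<^sup>2 \<partial>P)" using ZL by (simp add: L2_norm_def)
 also have "... <= (\<integral>d. (F d)\<^sup>2 \<partial>P)" using Y2 env_integrable by (intro integral_mono) (auto simp: Y_def)
 also have "... <= K" by (rule env(3))
 finally have ZK: "(\<integral>d. (?Z d)\<^sup>2 \<partial>P) <= K" .
 have Zm: "?Z : bm P" by simp
 have "(\<integral>\<^sup>+D. en (((\<Sum>i<n. Y (D i)) / real n - (\<integral>d. Y d \<partial>P))\<^sup>2) \<partial>SL)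
  = (\<integral>\<^sup>+D. en (1 / (real n)\<^sup>2) * en ((\<Sum>i\<in>{..<n}. ?Z (D i))\<^sup>2) \<partial>SL)"
 proof (intro nn_integral_cong)
  fix D
  have "(\<Sum>i<n. Y (D i)) / real n - (\<integral>d. Y d \<partial>P) = (\<Sum>i\<in>{..<n}. ?Z (D i)) / real n"
  using n_pos by (simp add: sum_subtractf field_simps)
  then show "en (((\<Sum>i<n. Y (D i)) / real n - (\<integral>d. Y d \<partial>P))\<^sup>2)
  = en (1 / (real n)\<^sup>2) * en ((\<Sum>i\<in>{..<n}. ?Z (D i))\<^sup>2)"
  by (simp add: power_divide flip: ennreal_mult)
 qed
 also have "... = en (1 / (real n)\<^sup>2) * (\<integral>\<^sup>+D. en ((\<Sum>i\<in>{..<n}. ?Z (D i))\<^sup>2) \<partial>SL)"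
  by (intro nn_integral_cmult) simp
 also have "(\<integral>\<^sup>+D. en ((\<Sum>i\<in>{..<n}. ?Z (D i))\<^sup>2) \<partial>SL) = en (real n * (\<integral>d. (?Z d)\<^sup>2 \<partial>P))"
  unfolding SL_eq using iid_sum_square[OF prob_P finite_lessThan Zm Z2, of n] Yi by (simp add: prob_space)
 also have "en (1 / (real n)\<^sup>2) * ... = en ((\<integral>d. (?Z d)\<^sup>2 \<partial>P) / real n)"
  using n_pos by (simp add: power2_eq_square flip: ennreal_mult)
 also have "... <= en (K / real n)" using ZK n_pos by (intro ennreal_leI divide_right_mono) auto
 finally show "(\<integral>\<^sup>+D. en (((\<Sum>i<n. Y (D i)) / real n - (\<integral>d. Y d \<partial>P))\<^sup>2) \<partial>SL) <= en (K / real n)" .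
qed

subsection \<open>An exponential moment bound away from the true parameter\<close>

text \<open>The moment function is only square integrable, so its mean cannot be bounded exponentially.
 The projection of the sample mean on the direction \<open>v\<close> of its expectation can be bounded from
 below, however: its increments have positive expectation, only their negative part has to be
 truncated, and what the truncation removes is controlled by the envelope.  The square is
 linearised by \<open>y\<^sup>2 \<ge> 2 s y - s\<^sup>2\<close>, which turns the expectation into a product.\<close>

lemma tail_expectation:
 assumes th: "th : par_space X" and \<mu>: "0 < \<mu>" "\<mu> <= vnorm (mean_mom X th)"
  and pos: "0 < \<nu>" "0 < s" and B: "B = 1 / (\<nu> * s)"
  and E: "!!D. D : E ==> vnorm (avg_mom n X D th0) <= t"
  "!!D. D : E ==> (\<Sum>i<n. if B < F (D i) then F (D i) else 0) <= real n * \<rho>"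
 shows "(\<integral>\<^sup>+D. en (exp (- (real n * \<nu> / 2) * (vnorm (avg_mom n X D th))\<^sup>2)) * indicator E D \<partial>SL)
  <= en (exp (real n * (\<nu> * s\<^sup>2 / 2 + \<nu> * s * (t + \<rho>) - \<nu> * s * \<mu> + \<nu>\<^sup>2 * s\<^sup>2 * K)))"
proof -
 interpret prob_space P by (rule prob_P)
 have B0: "0 < B" using pos B by simp
 let ?e = "mean_mom X th"
 have ne: "0 < vnorm ?e" using \<mu> by simp
 define v where "v = (1 / vnorm ?e) \<cdot>\<^sub>v ?e"
 have vc: "v : carrier_vec m" by (simp add: v_def)
 have vn: "vnorm v = 1" using ne by (simp add: v_def vnorm_smult)
 have vu: "v : unit_vecs m" using vc vn by (simp add: unit_vecs_def)
 define Y where "Y = mom_diff X v th"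
 have Ycls: "Y : mom_class X" using th vu by (auto simp: mom_class_def Y_def)
 have YF: "\<bar>Y d\<bar> <= F d" if "d : space P" for d using env(2)[OF Ycls that] .
 have Ysum: "Y d = (\<Sum>k<m. v $ k * (mom X d th $ k - mom X d th0 $ k))" for d
  using vc by (simp add: Y_def mom_diff_def scalar_prod_def lessThan_atLeast0)
 have Ym [measurable]: "Y : bm P" unfolding Ysum[abs_def] by measurable
 have Yi: "integrable P Y"
  unfolding Ysum[abs_def] using mom_integrable[OF th] mom_integrable[OF true_par_in] by auto
 have EY: "\<mu> <= (\<integral>d. Y d \<partial>P)"
 proof -
  have "(\<integral>d. mom X d th0 $ k \<partial>P) = 0" if "k < m" for k using mean_mom_true that by (auto simp: mean_mom_def vec_eq_iff)
  then have "(\<integral>d. Y d \<partial>P) = (\<Sum>k<m. v $ k * ?e $ k)"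
  unfolding Ysum using mom_integrable[OF th] mom_integrable[OF true_par_in] by (simp add: mean_mom_def)
  also have "... = v \<star> ?e" by (simp add: scalar_prod_def lessThan_atLeast0 carrier_vecD[OF mean_mom_carrier])
  also have "... = vnorm ?e" using ne by (simp add: v_def dot_self power2_eq_square)
  finally show ?thesis using \<mu> by simp
 qed
 define Z where "Z d = max (Y d) (- B)" for d
 have Zm [measurable]: "Z : bm P" unfolding Z_def by measurable
 have ZF: "\<bar>Z d\<bar> <= F d" if "d : space P" for d using YF[OF that] B0 by (auto simp: Z_def)
 have Z2F: "(Z d)\<^sup>2 <= (F d)\<^sup>2" if "d : space P" for d
  using power_mono[OF ZF[OF that], of 2] by simp
 have Z2: "integrable P (%d. (Z d)\<^sup>2)"
  by (rule Bochner_Integration.integrable_bound[OF env_integrable]) (use Z2F in auto)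
 have Zi: "integrable P Z" by (rule square_integrable_imp_integrable[OF Zm Z2])
 have EZ: "\<mu> <= (\<integral>d. Z d \<partial>P)"
 proof -
  have "(\<integral>d. Y d \<partial>P) <= (\<integral>d. Z d \<partial>P)" by (rule integral_mono[OF Yi Zi]) (simp add: Z_def)
  then show ?thesis using EY by linarith
 qed
 have EZ2: "(\<integral>d. (Z d)\<^sup>2 \<partial>P) <= K"
  using integral_mono[OF Z2 env_integrable Z2F] env(3) by linarith
 let ?c = "\<nu> * s"
 have c0: "0 < ?c" using pos by simp
 have one: "(\<integral>\<^sup>+d. en (exp (- (?c * Z d))) \<partial>P) <= en (exp (- ?c * \<mu> + ?c\<^sup>2 * K))"
 proof -
  have "exp (- (?c * Z d)) <= 1 - ?c * Z d + ?c\<^sup>2 * (Z d)\<^sup>2" for d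
  proof -
  have "- B <= Z d" by (simp add: Z_def)
  then have "?c * (- B) <= ?c * Z d" using c0 by (intro mult_left_mono) auto
  moreover have "?c * (- B) = - 1" using pos by (simp add: B)
  ultimately have "- 1 <= ?c * Z d" by linarith
  from exp_minus_le_quadratic[OF this] show ?thesis by (simp only: power_mult_distrib)
  qed
  then have "(\<integral>\<^sup>+d. en (exp (- (?c * Z d))) \<partial>P) <= (\<integral>\<^sup>+d. en (1 - ?c * Z d + ?c\<^sup>2 * (Z d)\<^sup>2) \<partial>P)"
  by (intro nn_integral_mono ennreal_leI)
  also have "... = en (\<integral>d. 1 - ?c * Z d + ?c\<^sup>2 * (Z d)\<^sup>2 \<partial>P)"
  proof (intro nn_integral_eq_integral)
  show "integrable P (%d. 1 - ?c * Z d + ?c\<^sup>2 * (Z d)\<^sup>2)" using Zi Z2 by simp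
  have "0 <= 1 - x + x\<^sup>2" for x :: real
  using zero_le_power2[of "x - 1/2"] by (simp add: power2_eq_square algebra_simps)
  then show "AE d in P. 0 <= 1 - ?c * Z d + ?c\<^sup>2 * (Z d)\<^sup>2" by (metis (no_types, lifting) AE_I2 power_mult_distrib)
  qed
  also have "(\<integral>d. 1 - ?c * Z d + ?c\<^sup>2 * (Z d)\<^sup>2 \<partial>P) = 1 - ?c * (\<integral>d. Z d \<partial>P) + ?c\<^sup>2 * (\<integral>d. (Z d)\<^sup>2 \<partial>P)"
  using Zi Z2 by (simp add: prob_space)
  also have "... <= 1 + (- ?c * \<mu> + ?c\<^sup>2 * K)"
  using mult_left_mono[OF EZ less_imp_le[OF c0]] mult_left_mono[OF EZ2 zero_le_power2[of ?c]] by simp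
  also have "... <= exp (- ?c * \<mu> + ?c\<^sup>2 * K)" by (rule exp_ge_add_one_self)
  finally show ?thesis by (simp add: ennreal_leI)
 qed
 let ?C = "exp (real n * (\<nu> * s\<^sup>2 / 2 + \<nu> * s * (t + \<rho>)))"
 have pt: "exp (- (real n * \<nu> / 2) * (vnorm (avg_mom n X D th))\<^sup>2) <= ?C * (\<Prod>i<n. exp (- (?c * Z (D i))))"
  if D: "D : space SL" "D : E" for D
 proof -
  let ?g = "avg_mom n X D th" and ?gt = "avg_mom n X D th0"
  let ?y = "v \<star> ?g"
  have "\<bar>?y\<bar> <= vnorm ?g" using abs_dot_le[OF vc avg_mom_carrier] vn by simp
  then have "?y\<^sup>2 <= (vnorm ?g)\<^sup>2" by (rule abs_le_square_iff[THEN iffD1, of ?y "vnorm ?g", simplified])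
  moreover have "2 * s * ?y - s\<^sup>2 <= ?y\<^sup>2"
  using zero_le_power2[of "?y - s"] by (simp add: power2_eq_square algebra_simps)
  ultimately have sq: "2 * s * ?y - s\<^sup>2 <= (vnorm ?g)\<^sup>2" by linarith
  have "real n * ?y = real n * (v \<star> ?gt) + (\<Sum>i<n. Y (D i))"
  proof -
  have "(\<Sum>i<n. Y (D i)) = (\<Sum>k<m. v $ k * (\<Sum>i<n. mom X (D i) th $ k - mom X (D i) th0 $ k))"
  unfolding Ysum by (subst sum.swap) (simp add: sum_distrib_left)
  also have "... = (\<Sum>k<m. v $ k * (real n * ?g $ k - real n * ?gt $ k))"
  proof (intro sum.cong refl)
  fix k assume "k : {..<m}"
  then have "real n * avg_mom n X D xi $ k = (\<Sum>i<n. mom X (D i) xi $ k)" for xi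
  using n_pos by (simp add: avg_mom_index)
  then show "v $ k * (\<Sum>i<n. mom X (D i) th $ k - mom X (D i) th0 $ k) = v $ k * (real n * ?g $ k - real n * ?gt $ k)"
  by (simp only: sum_subtractf)
  qed
  also have "... = real n * ?y - real n * (v \<star> ?gt)"
  by (simp add: scalar_prod_def lessThan_atLeast0 carrier_vecD[OF avg_mom_carrier] sum_distrib_left sum_subtractf algebra_simps)
  finally show ?thesis by simp
  qed
  moreover have "- t <= v \<star> ?gt"
  using abs_dot_le[OF vc avg_mom_carrier, of n D th0] vn E(1)[OF D(2)] by simp
  moreover have "(\<Sum>i<n. Z (D i)) - (\<Sum>i<n. if B < F (D i) then F (D i) else 0) <= (\<Sum>i<n. Y (D i))"
  unfolding sum_subtractf[symmetric]
  proof (rule sum_mono)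
  fix i assume i: "i : {..<n}"
  from YF[OF space_SL[OF D(1)], of i] i B0
  show "Z (D i) - (if B < F (D i) then F (D i) else 0) <= Y (D i)" by (auto simp: Z_def max_def)
  qed
  moreover note E(2)[OF D(2)]
  ultimately have "real n * (- t) + (\<Sum>i<n. Z (D i)) - real n * \<rho> <= real n * ?y"
  using n_pos mult_left_mono[of "- t" "v \<star> ?gt" "real n"] by linarith
  then have "?c * (real n * (- t) + (\<Sum>i<n. Z (D i)) - real n * \<rho>) <= ?c * (real n * ?y)"
  using c0 by (intro mult_left_mono) auto
  moreover have "(real n * \<nu> / 2) * (2 * s * ?y - s\<^sup>2) <= (real n * \<nu> / 2) * (vnorm ?g)\<^sup>2"
  using sq n_pos pos by (intro mult_left_mono) auto
  ultimately have "- (real n * \<nu> / 2) * (vnorm ?g)\<^sup>2 <= real n * (\<nu> * s\<^sup>2 / 2 + \<nu> * s * (t + \<rho>)) + (\<Sum>i<n. - (?c * Z (D i)))"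
  by (simp add: algebra_simps sum_distrib_left sum_negf)
  then have "exp (- (real n * \<nu> / 2) * (vnorm ?g)\<^sup>2) <= exp (real n * (\<nu> * s\<^sup>2 / 2 + \<nu> * s * (t + \<rho>)) + (\<Sum>i<n. - (?c * Z (D i))))"
  by simp
  then show ?thesis by (simp add: exp_add exp_sum)
 qed
 have "(\<integral>\<^sup>+D. en (exp (- (real n * \<nu> / 2) * (vnorm (avg_mom n X D th))\<^sup>2)) * indicator E D \<partial>SL)
  <= (\<integral>\<^sup>+D. ennreal ?C * (\<Prod>i<n. en (exp (- (?c * Z (D i))))) \<partial>SL)"
 proof (intro nn_integral_mono)
  fix D assume D: "D : space SL"
  show "en (exp (- (real n * \<nu> / 2) * (vnorm (avg_mom n X D th))\<^sup>2)) * indicator E D <= ennreal ?C * (\<Prod>i<n. en (exp (- (?c * Z (D i)))))"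
  using pt[OF D] by (cases "D : E") (auto simp: prod_ennreal prod_nonneg simp flip: ennreal_mult intro!: ennreal_leI)
 qed
 also have "... = ennreal ?C * (\<integral>\<^sup>+D. (\<Prod>i<n. en (exp (- (?c * Z (D i))))) \<partial>SL)"
  by (intro nn_integral_cmult) simp
 also have "(\<integral>\<^sup>+D. (\<Prod>i<n. en (exp (- (?c * Z (D i))))) \<partial>SL) = (\<integral>\<^sup>+d. en (exp (- (?c * Z d))) \<partial>P) ^ n"
  unfolding SL_eq by (subst nn_integral_PiM_prod[OF prob_P]) simp_all
 also have "ennreal ?C * ... <= ennreal ?C * (en (exp (- ?c * \<mu> + ?c\<^sup>2 * K))) ^ n"
  using one by (intro mult_left_mono power_mono) auto
 also have "... = en (exp (real n * (\<nu> * s\<^sup>2 / 2 + \<nu> * s * (t + \<rho>) - \<nu> * s * \<mu> + \<nu>\<^sup>2 * s\<^sup>2 * K)))"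
  by (simp add: ennreal_power power_mult_distrib algebra_simps flip: ennreal_mult exp_of_nat_mult exp_add)
 finally show ?thesis .
qed

end

lemma mult_exp_minus_le: "y * exp (- y) <= (1 :: real)"
proof -
 have "y <= exp y" using exp_ge_add_one_self[of y] by linarith
 then show ?thesis by (simp add: exp_minus field_simps)
qed

lemma divide_one_plus_mono:
 fixes x y k :: real
 assumes "0 <= x" "x <= y" "0 <= k"
 shows "k / (1 + y) <= k / (1 + x)"
 using assms by (intro frac_le) auto

lemma gauss_exponent_diff_le:
 assumes A: "form_in p A a b" and B: "form_in p B a b" and a: "0 < a" and c: "0 <= c"
  and close: "\<bar>qf p A x - qf p B x\<bar> <= om * (nrm p x)\<^sup>2" and om: "0 <= om"
 shows "\<bar>exp (- c * qf p A x / 2) - exp (- c * qf p B x / 2)\<bar> <= om / a"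
proof -
 let ?r = "(nrm p x)\<^sup>2"
 let ?y = "c * a * ?r / 2"
 have l: "?y <= c * qf p A x / 2" "?y <= c * qf p B x / 2"
  using mult_left_mono[OF qf_bounds(1)[OF A] c] mult_left_mono[OF qf_bounds(1)[OF B] c] by (simp_all add: mult.assoc)
 have "\<bar>exp (- (c * qf p A x / 2)) - exp (- (c * qf p B x / 2))\<bar> <= exp (- ?y) * \<bar>c * qf p A x / 2 - c * qf p B x / 2\<bar>"
  by (rule abs_exp_diff_le[OF l])
 also have "\<bar>c * qf p A x / 2 - c * qf p B x / 2\<bar> = c / 2 * \<bar>qf p A x - qf p B x\<bar>"
 proof -
  have "c * qf p A x / 2 - c * qf p B x / 2 = c / 2 * (qf p A x - qf p B x)" by (simp add: right_diff_distrib)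
  then show ?thesis using c by (simp only: abs_mult abs_of_nonneg divide_nonneg_pos zero_less_numeral)
 qed
 also have "... <= c / 2 * (om * ?r)" using close c by (intro mult_left_mono) auto
 also have "exp (- ?y) * (c / 2 * (om * ?r)) = om / a * (?y * exp (- ?y))" using a by simp
 also have "... <= om / a * 1" using a c om by (intro mult_left_mono mult_exp_minus_le) auto
 finally show ?thesis by (simp add: mult_left_mono)
qed

context bounded_gmm
begin

section \<open>The density of the estimator\<close>

definition est_regular :: "(nat => real) => real => bool" where
 "est_regular th t \<longleftrightarrow>
  root X th : carrier_mat p p & transpose_mat (root X th) * root X th = info X th &
  (\<forall>z. 0 <= std_dens X z th) &
  distributed (sample_law n X th) (leb {..<p}) (std_est n X th) (%z. en (std_dens X z th)) &
  (ALL z:Rn p. (1 + nrm p z ^ (p + 1)) * \<bar>std_dens X z th - std_mvn p z\<bar> <= t)"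

definition scaled_dens :: "(nat => real) => (nat => real) => real" where
 "scaled_dens x th = est_dens X x th * gauss_int p (info X th0) / rn ^ p"

definition pc :: real where
 "pc = sqrt (2 * pi) ^ p"

definition gu :: real where
 "gu = sqrt (2 * pi / (a / b)) ^ p"

definition gl :: real where
 "gl = sqrt (2 * pi / (b / a)) ^ p"

lemma consts_pos: "0 < pc" "0 < gu" "0 < gl"
 using ab0 a0 b0 by (auto simp: pc_def gu_def gl_def)

lemma gauss_int_info:
 assumes "th : par_space X"
 shows "gauss_int p (info X th) <= gu" "gl <= gauss_int p (info X th)" "0 < gauss_int p (info X th)"
 using gauss_int(2,3)[OF form_info[OF assms] ab0] gauss_int_pos[OF form_info[OF assms] ab0]
 by (auto simp: gu_def gl_def)

lemma std_mvn_scaled: "pc * std_mvn p z = exp (- (nrm p z)\<^sup>2 / 2)"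
proof -
 have "pc = (2 * pi) powr (real p / 2)"
  unfolding pc_def by (simp add: powr_half_sqrt[symmetric] powr_powr flip: powr_realpow)
 then have "pc * (2 * pi) powr (- (real p / 2)) = 1" by (simp flip: powr_add)
 then show ?thesis unfolding std_mvn_def by (simp flip: mult.assoc)
qed

lemma est_dens_close:
 assumes th: "th : par_space X" and reg: "est_regular th t"
 shows "AE x in leb {..<p}. \<bar>est_dens X x th * gauss_int p (info X th) / rn ^ p
  - exp (- real n * qf p (info X th) (%j. x j - th j) / 2)\<bar>
  <= pc * t / (1 + sqrt (real n * qf p (info X th) (%j. x j - th j)) ^ (p + 1))"
proof -
 let ?L = "sample_law n X th" and ?s = "rn" and ?R = "root X th"
 have prob: "prob_space ?L"
  unfolding sample_law_def using str th by (intro prob_space_PiM) (simp add: gmm_structure_def)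
 have R: "?R : carrier_mat p p" "transpose_mat ?R * ?R = info X th" using reg by (simp_all add: est_regular_def)
 have e: "distributed ?L (leb {..<p}) (est X) (%x. en (est_dens X x th))"
  and e0: "0 <= est_dens X x th" and eR: "est X D : Rn p" for x D
  using str th by (auto simp: gmm_structure_def)
 have "std_est n X th = (%D j. ?s * lin p ?R (%i. est X D i - th i) j)"
  using R(1) by (auto simp: std_est_def lin_def fun_eq_iff scalar_prod_def lessThan_atLeast0 intro!: sum.cong)
 then have s: "distributed ?L (leb {..<p}) (%D j. ?s * lin p ?R (%i. est X D i - th i) j) (%z. en (std_dens X z th))"
  using reg by (simp add: est_regular_def)
 have s0: "0 < ?s" using n_pos by simp
 have thR: "th : Rn p" using par_subset th by auto
 let ?g = "gauss_int p (info X th)"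
 have g0: "0 < ?g" by (rule gauss_int_info(3)[OF th])
 show ?thesis
  using density_from_standardised[OF prob e s s0 R form_info[OF th] ab0 thR eR]
 proof eventually_elim
  case (elim x)
  let ?z = "%j. ?s * lin p ?R (%i. x i - th i) j"
  have "en (est_dens X x th) = en (?s ^ p * (pc / ?g) * std_dens X ?z th)"
  using elim s0 g0 consts_pos(1) by (simp add: pc_def flip: ennreal_mult')
  moreover have "0 <= ?s ^ p * (pc / ?g) * std_dens X ?z th"
  using s0 g0 consts_pos(1) reg by (simp add: est_regular_def)
  ultimately have "est_dens X x th = ?s ^ p * (pc / ?g) * std_dens X ?z th"
  using e0 by (simp add: ennreal_inj)
  then have eq: "est_dens X x th * ?g / ?s ^ p = pc * std_dens X ?z th"
  using s0 g0 by (simp add: field_simps)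
  have zR: "?z : Rn p" by (simp add: Rn_def lin_def)
  have z2: "(nrm p ?z)\<^sup>2 = real n * qf p (info X th) (%j. x j - th j)"
  unfolding nrm_scale using s0 by (simp add: power_mult_distrib qf_gram[OF R])
  then have z1: "nrm p ?z = sqrt (real n * qf p (info X th) (%j. x j - th j))"
  using real_sqrt_unique[OF z2] by simp
  have pos: "0 < 1 + nrm p ?z ^ (p + 1)" by (intro add_pos_nonneg) auto
  have "(1 + nrm p ?z ^ (p + 1)) * \<bar>std_dens X ?z th - std_mvn p ?z\<bar> <= t"
  using reg zR by (simp only: est_regular_def)
  then have "\<bar>std_dens X ?z th - std_mvn p ?z\<bar> <= t / (1 + nrm p ?z ^ (p + 1))"
  using pos by (simp only: pos_le_divide_eq mult.commute)
  then have "pc * \<bar>std_dens X ?z th - std_mvn p ?z\<bar> <= pc * (t / (1 + nrm p ?z ^ (p + 1)))"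
  using consts_pos(1) by (intro mult_left_mono) auto
  moreover have "pc * \<bar>std_dens X ?z th - std_mvn p ?z\<bar> = \<bar>pc * std_dens X ?z th - exp (- (nrm p ?z)\<^sup>2 / 2)\<bar>"
  unfolding std_mvn_scaled[symmetric] using consts_pos(1) by (simp add: abs_mult flip: right_diff_distrib)
  ultimately have "\<bar>est_dens X x th * ?g / ?s ^ p - exp (- (nrm p ?z)\<^sup>2 / 2)\<bar> <= pc * t / (1 + nrm p ?z ^ (p + 1))"
  unfolding eq by simp
  from this[unfolded z2, unfolded z1] show ?case by simp
 qed
qed

lemma scaled_dens_nonneg: "0 <= scaled_dens x th"
 using str gauss_int_info(3)[OF true_par_in] by (simp add: scaled_dens_def gmm_structure_def)

text \<open>The estimator density is dominated by a Gaussian and a polynomial tail, with constants that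
 do not depend on the parameter.\<close>

lemma scaled_dens_le:
 assumes th: "th : par_space X" and reg: "est_regular th t" and t: "0 <= t"
 shows "AE x in leb {..<p}. scaled_dens x th
  <= gu / gl * (exp (- (a / b) * (real n * (nrm p (%j. x j - th j))\<^sup>2) / 2)
  + pc * t / (1 + (sqrt (a / b) * (rn * nrm p (%j. x j - th j))) ^ (p + 1)))"
 using est_dens_close[OF th reg]
proof eventually_elim
 case (elim x)
 let ?q = "qf p (info X th) (%j. x j - th j)" and ?r = "nrm p (%j. x j - th j)"
 let ?g = "gauss_int p (info X th)" and ?h = "gauss_int p (info X th0)"
 let ?e = "est_dens X x th * ?g / rn ^ p"
 let ?U = "exp (- (a / b) * (real n * ?r\<^sup>2) / 2) + pc * t / (1 + (sqrt (a / b) * (rn * ?r)) ^ (p + 1))"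
 have q: "a / b * ?r\<^sup>2 <= ?q" by (rule qf_bounds(1)[OF form_info[OF th]])
 then have nq: "a / b * (real n * ?r\<^sup>2) <= real n * ?q" using mult_left_mono[OF q, of "real n"] by (simp add: mult_ac)
 have "sqrt (a / b * (real n * ?r\<^sup>2)) <= sqrt (real n * ?q)" by (rule real_sqrt_le_mono[OF nq])
 then have sq: "sqrt (a / b) * (rn * ?r) <= sqrt (real n * ?q)" by (simp only: real_sqrt_mult real_sqrt_abs) simp
 have s0: "0 <= sqrt (a / b) * (rn * ?r)" using ab0 by simp
 have pw: "(sqrt (a / b) * (rn * ?r)) ^ (p + 1) <= sqrt (real n * ?q) ^ (p + 1)"
  by (rule power_mono[OF sq s0])
 have "?e <= exp (- real n * ?q / 2) + pc * t / (1 + sqrt (real n * ?q) ^ (p + 1))"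
  using elim by linarith
 also have "... <= ?U"
 proof (rule add_mono)
  show "exp (- real n * ?q / 2) <= exp (- (a / b) * (real n * ?r\<^sup>2) / 2)" using nq by simp
  show "pc * t / (1 + sqrt (real n * ?q) ^ (p + 1)) <= pc * t / (1 + (sqrt (a / b) * (rn * ?r)) ^ (p + 1))"
  using pw s0 t consts_pos(1) by (intro divide_one_plus_mono zero_le_power) auto
 qed
 finally have eU: "?e <= ?U" .
 have e0: "0 <= ?e" using str gauss_int_info(3)[OF th] by (simp add: gmm_structure_def)
 have "scaled_dens x th = ?h / ?g * ?e" using gauss_int_info(3)[OF th] by (simp add: scaled_dens_def)
 also have "... <= gu / gl * ?U"
  using gauss_int_info[OF th] gauss_int_info[OF true_par_in] consts_pos e0 eU
  by (intro mult_mono frac_le) auto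
 finally show ?case .
qed

lemma scaled_dens_local:
 assumes th: "th : par_space X" and reg: "est_regular th t" and t: "0 <= t"
  and close: "!!x. \<bar>qf p (info X th) x - qf p (info X th0) x\<bar> <= om * (nrm p x)\<^sup>2" and om: "0 <= om"
 shows "AE x in leb {..<p}. \<bar>scaled_dens x th - exp (- real n * qf p (info X th0) (%j. x j - th j) / 2)\<bar>
  <= 2 * om / (a / b) * sqrt (4 * pi / (a / b)) ^ p / gl * (1 + pc * t) + om / (a / b) + pc * t"
 using est_dens_close[OF th reg]
proof eventually_elim
 case (elim x)
 let ?q = "qf p (info X th) (%j. x j - th j)" and ?qt = "qf p (info X th0) (%j. x j - th j)"
 let ?g = "gauss_int p (info X th)" and ?h = "gauss_int p (info X th0)"
 let ?e = "est_dens X x th * ?g / rn ^ p"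
 let ?d = "2 * om / (a / b) * sqrt (4 * pi / (a / b)) ^ p"
 have qp: "0 <= ?q" using ab0 by (intro qf_nonneg[OF form_info[OF th]]) auto
 have pt0: "0 <= pc * t" using t consts_pos by simp
 have "pc * t / (1 + sqrt (real n * ?q) ^ (p + 1)) <= pc * t / 1"
  using divide_one_plus_mono[of 0 "sqrt (real n * ?q) ^ (p + 1)" "pc * t"] pt0 qp by simp
 then have e1: "\<bar>?e - exp (- real n * ?q / 2)\<bar> <= pc * t" using elim by simp
 have "exp (- real n * ?q / 2) <= 1" using qp by simp
 then have e2: "?e <= 1 + pc * t" using e1 by linarith
 have e0: "0 <= ?e" using str gauss_int_info(3)[OF th] by (simp add: gmm_structure_def)
 have e3: "\<bar>exp (- real n * ?q / 2) - exp (- real n * ?qt / 2)\<bar> <= om / (a / b)"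
  using gauss_exponent_diff_le[OF form_info[OF th] form_info[OF true_par_in] ab0(1) _ close om, of "real n"] by simp
 have d: "\<bar>?h - ?g\<bar> <= ?d"
  using gauss_int_diff_le[OF form_info[OF th] form_info[OF true_par_in] ab0 close om] by (simp add: abs_minus_commute)
 have "E * h / S - E * g / S = (h - g) / g * (E * g / S)" if "0 < g" for E h S g :: real
  using that by (simp add: left_diff_distrib right_diff_distrib diff_divide_distrib)
 from this[OF gauss_int_info(3)[OF th]] have "scaled_dens x th - ?e = (?h - ?g) / ?g * ?e"
  by (simp only: scaled_dens_def)
 moreover have "\<bar>u / g * e\<bar> = \<bar>u\<bar> / g * e" if "0 <= e" "0 < g" for u g e :: real
  using that by (simp add: abs_mult abs_divide)
 ultimately have "\<bar>scaled_dens x th - ?e\<bar> = \<bar>?h - ?g\<bar> / ?g * ?e"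
  using e0 gauss_int_info(3)[OF th] by presburger
 also have "... <= ?d / gl * (1 + pc * t)"
 proof (rule mult_mono[OF _ e2 _ e0])
  have d0: "0 <= ?d" using d by linarith
  show "\<bar>?h - ?g\<bar> / ?g <= ?d / gl" by (rule frac_le[OF d0 d consts_pos(3) gauss_int_info(2)[OF th]])
  show "0 <= ?d / gl" by (rule divide_nonneg_pos[OF d0 consts_pos(3)])
 qed
 finally show ?case using e1 e3 by linarith
qed

lemma AE_est_transfer:
 assumes M: "finite M" and T [measurable]: "T : sets borel"
  and Q: "Measurable.pred (borel \<Otimes>\<^sub>M borel) (%z. Q (fst z) (snd z))"
  and AE: "!!th. th : T ==> AE x in leb {..<p}. Q x th"
 shows "AE D in SL. AE th in leb M. th : T --> Q (est X D) th"
proof -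
 interpret A: sigma_finite_measure "leb {..<p}" by (rule sigma_finite_leb) simp
 interpret B: sigma_finite_measure "leb M" by (rule sigma_finite_leb[OF M])
 interpret AB: pair_sigma_finite "leb {..<p}" "leb M" ..
 have e: "distributed SL (leb {..<p}) (est X) (%x. en (est_dens X x th0))"
  using str true_par_in by (auto simp: gmm_structure_def)
 have Qm: "Measurable.pred (leb {..<p} \<Otimes>\<^sub>M leb M) (%z. snd z : T --> Q (fst z) (snd z))"
 proof -
  have "sets (leb {..<p} \<Otimes>\<^sub>M leb M) = sets (borel \<Otimes>\<^sub>M borel)" by (intro sets_pair_measure_cong) simp_all
  then have eq: "measurable (leb {..<p} \<Otimes>\<^sub>M leb M) (count_space UNIV) = measurable (borel \<Otimes>\<^sub>M borel) (count_space UNIV)"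
  by (intro measurable_cong_sets) simp_all
  show ?thesis unfolding eq by (intro pred_intros_logic Q) measurable
 qed
 then have set: "{z : space (leb {..<p} \<Otimes>\<^sub>M leb M). snd z : T --> Q (fst z) (snd z)} : sets (leb {..<p} \<Otimes>\<^sub>M leb M)"
  by (rule predE)
 have "AE th in leb M. AE x in leb {..<p}. th : T --> Q x th"
 proof (rule AE_I2)
  fix th
  show "AE x in leb {..<p}. th : T --> Q x th" using AE[of th] by (cases "th : T") auto
 qed
 then have x: "AE x in leb {..<p}. AE th in leb M. th : T --> Q x th"
  using AB.AE_commute[OF set] by simp
 have "AE x in distr SL (leb {..<p}) (est X). AE th in leb M. th : T --> Q x th"
  unfolding distributed_distr_eq_density[OF e]
  using distributed_borel_measurable[OF e] x by (subst AE_density) auto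
 then show ?thesis by (rule AE_distrD[OF distributed_measurable[OF e]])
qed

section \<open>Rescaling around the true parameter\<close>

definition sc :: "nat set => real" where
 "sc M = rn ^ card M"

lemma sc_pos: "0 < sc M"
 using n_pos by (simp add: sc_def)

definition rad :: "(nat => real) => real" where
 "rad th = rn * dist0 X th"

lemma rad_nonneg [simp]: "0 <= rad th"
 by (simp add: rad_def)

lemma rad_eq: "rad th = nrm p (%j. rn * dev X th j)"
 using n_pos by (simp add: rad_def nrm_scale dist0_def dev_def)

lemma rad_measurable [measurable]: "rad : bm borel"
proof -
 have "(%th. nrm p (%j. th j - th0 j)) : bm borel"
  by (intro measurable_compose[OF _ borel_measurable_nrm] borel_measurable_funI) measurable
 then show ?thesis by (simp add: rad_def[abs_def] dist0_def)
qed

lemma nn_integral_rescale: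
 assumes M: "M <= {..<p}" "true_model X <= M" and f [measurable]: "f : bm borel"
 shows "en (sc M) * (\<integral>\<^sup>+th. f (%j. rn * dev X th j) \<partial>leb M) = (\<integral>\<^sup>+u. f u \<partial>leb M)"
proof -
 have fin: "finite M" using M(1) finite_subset by blast
 have "th0 j = 0" if "j \<notin> M" for j
 proof (cases "j < p")
  case True then show ?thesis using that M(2) by (auto simp: true_model_def)
 next
  case False then show ?thesis using par_subset true_par_in by (auto simp: Rn_def)
 qed
 then have "(\<integral>\<^sup>+u. f u \<partial>leb M) = en (\<bar>rn\<bar> ^ card M) * (\<integral>\<^sup>+th. f (%j. - rn * th0 j + rn * th j) \<partial>leb M)"
  using n_pos by (intro nn_integral_leb_affine[OF fin]) auto
 then show ?thesis by (simp add: sc_def dev_def algebra_simps)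
qed

lemma rescaled_gauss_tail:
 assumes M: "M <= {..<p}" "true_model X <= M" and c: "0 < c" and C: "0 <= C"
 shows "en (sc M) * (\<integral>\<^sup>+th. en (exp (- c * (rad th)\<^sup>2)) * indicator {th. C <= rad th} th \<partial>leb M)
  <= en (exp (- c * C\<^sup>2 / 2) * sqrt (2 * pi / c) ^ card M)"
proof -
 have "en (sc M) * (\<integral>\<^sup>+th. en (exp (- c * (rad th)\<^sup>2)) * indicator {th. C <= rad th} th \<partial>leb M)
  = en (sc M) * (\<integral>\<^sup>+th. (%u. en (exp (- c * (nrm p u)\<^sup>2)) * indicator {u. C <= nrm p u} u) (%j. rn * dev X th j) \<partial>leb M)"
  by (simp add: rad_eq indicator_def)
 also have "... = (\<integral>\<^sup>+u. en (exp (- c * (nrm p u)\<^sup>2)) * indicator {u. C <= nrm p u} u \<partial>leb M)"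
  by (rule nn_integral_rescale[OF M]) measurable
 also have "... <= (\<integral>\<^sup>+u. en (exp (- c * C\<^sup>2 / 2)) * en (exp (- (c / 2) * (nrm p u)\<^sup>2)) \<partial>leb M)"
 proof (intro nn_integral_mono)
  fix u
  show "en (exp (- c * (nrm p u)\<^sup>2)) * indicator {u. C <= nrm p u} u <= en (exp (- c * C\<^sup>2 / 2)) * en (exp (- (c / 2) * (nrm p u)\<^sup>2))"
  proof (cases "C <= nrm p u")
  case True
  then have "c * C\<^sup>2 <= c * (nrm p u)\<^sup>2" using C c by (intro mult_left_mono power_mono) auto
  then show ?thesis using True by (simp flip: ennreal_mult exp_add)
  qed simp
 qed
 also have "... = en (exp (- c * C\<^sup>2 / 2)) * en (sqrt (2 * pi / c) ^ card M)"
  using nn_integral_gaussian_leb[OF _ M(1), of "c / 2"] c by (simp add: nn_integral_cmult mult.commute)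
 also have "... = en (exp (- c * C\<^sup>2 / 2) * sqrt (2 * pi / c) ^ card M)"
  using c by (simp flip: ennreal_mult)
 finally show ?thesis .
qed

lemma rescaled_ball:
 assumes M: "M <= {..<p}" "true_model X <= M"
 shows "en (sc M) * (\<integral>\<^sup>+th. indicator {th. rad th < C} th \<partial>leb M) <= en (exp (C\<^sup>2) * sqrt pi ^ card M)"
proof -
 have "en (sc M) * (\<integral>\<^sup>+th. indicator {th. rad th < C} th \<partial>leb M)
  = en (sc M) * (\<integral>\<^sup>+th. (%u. indicator {u. nrm p u < C} u) (%j. rn * dev X th j) \<partial>leb M)"
  by (simp add: rad_eq indicator_def)
 also have "... = (\<integral>\<^sup>+u. indicator {u. nrm p u < C} u \<partial>leb M)"
  by (rule nn_integral_rescale[OF M]) measurable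
 also have "... <= (\<integral>\<^sup>+u. en (exp (C\<^sup>2)) * en (exp (- 1 * (nrm p u)\<^sup>2)) \<partial>leb M)"
 proof (intro nn_integral_mono)
  fix u
  show "indicator {u. nrm p u < C} u <= en (exp (C\<^sup>2)) * en (exp (- 1 * (nrm p u)\<^sup>2))"
  proof (cases "nrm p u < C")
  case True
  then have "(nrm p u)\<^sup>2 <= C\<^sup>2" by (intro power_mono) auto
  then have "en 1 <= en (exp (C\<^sup>2) * exp (- 1 * (nrm p u)\<^sup>2))" by (intro ennreal_leI) (simp flip: exp_add)
  then show ?thesis using True by (simp add: ennreal_mult)
  qed simp
 qed
 also have "... = en (exp (C\<^sup>2)) * en (sqrt pi ^ card M)"
  using nn_integral_gaussian_leb[OF _ M(1), of 1] by (simp add: nn_integral_cmult)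
 also have "... = en (exp (C\<^sup>2) * sqrt pi ^ card M)" by (simp flip: ennreal_mult)
 finally show ?thesis .
qed

lemma rescaled_poly_tail:
 assumes M: "M <= {..<p}" "true_model X <= M" and c: "0 < c"
 shows "en (sc M) * (\<integral>\<^sup>+th. en (1 / (1 + (c * rad th) ^ (p + 1))) \<partial>leb M)
  <= en ((1 / c) ^ card M * (2 ^ (p + 1) * (2 * real p) ^ card M))"
proof -
 have fin: "finite M" using M(1) finite_subset by blast
 let ?f = "%u. en (1 / (1 + nrm p u ^ (p + 1)))"
 have sm: "(%u. nrm p (%j. c * u j)) : bm borel"
  by (intro measurable_compose[OF _ borel_measurable_nrm] borel_measurable_funI) measurable
 have "en (sc M) * (\<integral>\<^sup>+th. en (1 / (1 + (c * rad th) ^ (p + 1))) \<partial>leb M)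
  = en (sc M) * (\<integral>\<^sup>+th. (%u. ?f (%j. c * u j)) (%j. rn * dev X th j) \<partial>leb M)"
  using c by (simp add: rad_eq nrm_scale)
 also have "... = (\<integral>\<^sup>+u. ?f (%j. c * u j) \<partial>leb M)"
  using nn_integral_rescale[OF M, of "%u. ?f (%j. c * u j)"] sm by simp
 also have "... = en ((1 / c) ^ card M) * (\<integral>\<^sup>+u. ?f u \<partial>leb M)"
 proof -
  have "(\<integral>\<^sup>+u. ?f u \<partial>leb M) = en (c ^ card M) * (\<integral>\<^sup>+u. ?f (%j. c * u j) \<partial>leb M)"
  using nn_integral_leb_affine[OF fin, of "%_. 0" c ?f] c by simp
  moreover have "en ((1 / c) ^ card M) * en (c ^ card M) = 1"
  using c by (simp add: power_divide flip: ennreal_mult)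
  ultimately show ?thesis by (simp flip: mult.assoc)
 qed
 also have "... <= en ((1 / c) ^ card M) * en (2 ^ (p + 1) * (2 * real p) ^ card M)"
  by (intro mult_left_mono nn_integral_power_tail_leb[OF M(1) p1]) simp
 also have "... = en ((1 / c) ^ card M * (2 ^ (p + 1) * (2 * real p) ^ card M))"
  using c by (simp only: ennreal_mult' zero_le_power zero_le_divide_1_iff less_imp_le)
 finally show ?thesis .
qed

section \<open>The mass of the limiting Gaussian kernel on a model\<close>

definition gmass :: "nat set => (nat => real) => real" where
 "gmass M h = enn2real (\<integral>\<^sup>+u. en (exp (- qf p (info X th0) (%j. u j - h j) / 2)) \<partial>leb M)"

lemmas form0 = form_info[OF true_par_in]

lemma qf0_measurable [measurable]: "qf p (info X th0) : bm borel"
 by (rule borel_measurable_qf[OF info_carrier[OF true_par_in]])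

lemma qf0_shift_measurable [measurable]: "(%u. qf p (info X th0) (%j. u j - h j)) : bm borel"
 by (intro measurable_compose[OF _ qf0_measurable] borel_measurable_funI) measurable

lemma nrm_triangle: "nrm p (%j. x j + y j) <= nrm p x + nrm p y"
proof -
 have "vec p (%j. x j + y j) = vec p x + vec p y" by auto
 then show ?thesis using vnorm_triangle[of "vec p x" p "vec p y"] by (simp add: nrm_vec)
qed

lemma nrm_minus: "nrm p (%j. x j - y j) = nrm p (%j. y j - x j)"
 by (simp add: nrm_def L2_set_def power2_commute)

lemma nrm_diff_triangle: "nrm p x <= nrm p (%j. x j - y j) + nrm p y"
 using nrm_triangle[of "%j. x j - y j" y] by simp

lemma gmass_bounds:
 assumes M: "M <= {..<p}" and h: "nrm p h <= T"
 shows "(\<integral>\<^sup>+u. en (exp (- qf p (info X th0) (%j. u j - h j) / 2)) \<partial>leb M) = en (gmass M h)"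
  and "gmass M h <= exp (a / b * T\<^sup>2 / 2) * sqrt (4 * pi / (a / b)) ^ card M"
  and "exp (- (b / a) * T\<^sup>2) * sqrt (pi / (b / a)) ^ card M <= gmass M h"
proof -
 let ?g = "\<integral>\<^sup>+u. en (exp (- qf p (info X th0) (%j. u j - h j) / 2)) \<partial>leb M"
 have h2: "(nrm p h)\<^sup>2 <= T\<^sup>2" using h by (intro power_mono) auto
 have par: "(x :: real) <= y + z ==> 0 <= x ==> x\<^sup>2 <= 2 * y\<^sup>2 + 2 * z\<^sup>2" for x y z
 proof -
  assume "x <= y + z" "0 <= x"
  then have "x\<^sup>2 <= (y + z)\<^sup>2" by (intro power_mono) auto
  also have "... <= 2 * y\<^sup>2 + 2 * z\<^sup>2" using zero_le_power2[of "y - z"] by (simp add: power2_eq_square algebra_simps)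
  finally show ?thesis .
 qed
 have u: "?g <= en (exp (a / b * T\<^sup>2 / 2) * sqrt (4 * pi / (a / b)) ^ card M)"
 proof -
  have pt: "exp (- qf p (info X th0) (%j. u j - h j) / 2) <= exp (a / b * T\<^sup>2 / 2) * exp (- (a / b / 4) * (nrm p u)\<^sup>2)" for u
  proof -
  have "(nrm p u)\<^sup>2 <= 2 * (nrm p (%j. u j - h j))\<^sup>2 + 2 * (nrm p h)\<^sup>2"
  by (rule par[OF nrm_diff_triangle]) simp
  then have "(nrm p u)\<^sup>2 / 2 - T\<^sup>2 <= (nrm p (%j. u j - h j))\<^sup>2" using h2 by linarith
  then have "a / b * ((nrm p u)\<^sup>2 / 2 - T\<^sup>2) <= a / b * (nrm p (%j. u j - h j))\<^sup>2"
  using ab0 by (intro mult_left_mono) auto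
  also have "... <= qf p (info X th0) (%j. u j - h j)" by (rule qf_bounds(1)[OF form0])
  finally show ?thesis by (simp add: right_diff_distrib flip: exp_add)
  qed
  have "?g <= (\<integral>\<^sup>+u. en (exp (a / b * T\<^sup>2 / 2)) * en (exp (- (a / b / 4) * (nrm p u)\<^sup>2)) \<partial>leb M)"
  using pt by (intro nn_integral_mono) (simp only: ennreal_mult'[symmetric] exp_ge_zero ennreal_leI)
  also have "... = en (exp (a / b * T\<^sup>2 / 2)) * en (sqrt (pi / (a / b / 4)) ^ card M)"
  using nn_integral_gaussian_leb[OF _ M, of "a / b / 4"] ab0 by (subst nn_integral_cmult) simp_all
  also have "... = en (exp (a / b * T\<^sup>2 / 2) * sqrt (4 * pi / (a / b)) ^ card M)"
  proof -
  have "pi / (a / b / 4) = 4 * pi / (a / b)" by simp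
  then show ?thesis by (simp only: ennreal_mult'[symmetric] exp_ge_zero)
  qed
  finally show ?thesis .
 qed
 show eq: "?g = en (gmass M h)"
  unfolding gmass_def using le_less_trans[OF u ennreal_less_top] by simp
 have g0: "0 <= gmass M h" by (simp add: gmass_def)
 show "gmass M h <= exp (a / b * T\<^sup>2 / 2) * sqrt (4 * pi / (a / b)) ^ card M"
  using u a0 b0 unfolding eq by (subst (asm) ennreal_le_iff) auto
 have "en (exp (- (b / a) * T\<^sup>2) * sqrt (pi / (b / a)) ^ card M) = en (exp (- (b / a) * T\<^sup>2)) * (\<integral>\<^sup>+u. en (exp (- (b / a) * (nrm p u)\<^sup>2)) \<partial>leb M)"
  unfolding nn_integral_gaussian_leb[OF ab0(2) M] by (simp only: ennreal_mult' exp_ge_zero)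
 also have "... = (\<integral>\<^sup>+u. en (exp (- (b / a) * T\<^sup>2)) * en (exp (- (b / a) * (nrm p u)\<^sup>2)) \<partial>leb M)"
  by (intro nn_integral_cmult[symmetric]) simp
 also have "... <= ?g"
 proof (intro nn_integral_mono)
  fix u
  have tri: "nrm p (%j. u j - h j) <= nrm p u + nrm p h"
  using nrm_triangle[of u "%j. - 1 * h j"] by (simp only: nrm_scale) simp
  have "(nrm p (%j. u j - h j))\<^sup>2 <= 2 * (nrm p u)\<^sup>2 + 2 * (nrm p h)\<^sup>2" by (rule par[OF tri]) simp
  then have le: "(nrm p (%j. u j - h j))\<^sup>2 <= 2 * (nrm p u)\<^sup>2 + 2 * T\<^sup>2" using h2 by linarith
  have "qf p (info X th0) (%j. u j - h j) <= b / a * (nrm p (%j. u j - h j))\<^sup>2" by (rule qf_bounds(2)[OF form0])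
  also have "... <= b / a * (2 * (nrm p u)\<^sup>2 + 2 * T\<^sup>2)" using le ab0 by (intro mult_left_mono) auto
  finally have "exp (- (b / a) * T\<^sup>2) * exp (- (b / a) * (nrm p u)\<^sup>2) <= exp (- qf p (info X th0) (%j. u j - h j) / 2)"
  by (simp add: distrib_left flip: exp_add)
  then show "en (exp (- (b / a) * T\<^sup>2)) * en (exp (- (b / a) * (nrm p u)\<^sup>2)) <= en (exp (- qf p (info X th0) (%j. u j - h j) / 2))"
  by (simp only: ennreal_mult'[symmetric] exp_ge_zero ennreal_leI)
 qed
 finally show "exp (- (b / a) * T\<^sup>2) * sqrt (pi / (b / a)) ^ card M <= gmass M h"
  using g0 unfolding eq by (subst (asm) ennreal_le_iff) auto
qed

text \<open>Adding coordinates to a model that may already be imperfect for \<open>h\<close> can only lower the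
 distance to \<open>h\<close>.  Averaging the kernel over \<open>y\<close> and \<open>-y\<close> removes the cross term, so that the
 comparison holds with a constant independent of \<open>h\<close>.\<close>

lemma gmass_mono:
 assumes M: "N <= M" "M <= {..<p}"
 shows "sqrt (2 * pi / (b / a)) ^ card (M - N) * gmass N h <= gmass M h"
proof -
 have fin: "finite M" "finite N" "finite (M - N)" using M finite_subset[of _ "{..<p}"] by auto
 let ?A = "info X th0"
 let ?k = "sqrt (2 * pi / (b / a)) ^ card (M - N)"
 have MN: "N \<inter> (M - N) = {}" "N \<union> (M - N) = M" using M by auto
 define G where "G u = en (exp (- qf p ?A (%j. u j - h j) / 2))" for u
 have Gm [measurable]: "G : bm borel" unfolding G_def by measurable
 have inner: "G x * ennreal ?k <= (\<integral>\<^sup>+y. G (%j. x j + y j) \<partial>leb (M - N))" for x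
 proof -
  have Gxm: "(%y. G (%j. x j + y j)) : bm borel" "(%y. G (%j. x j + - 1 * y j)) : bm borel"
  by (intro measurable_compose[OF _ Gm] borel_measurable_funI; measurable)+
  have reflect: "(\<integral>\<^sup>+y. G (%j. x j + y j) \<partial>leb (M - N)) = (\<integral>\<^sup>+y. G (%j. x j + - 1 * y j) \<partial>leb (M - N))"
  using nn_integral_leb_affine[OF fin(3), of "%_. 0" "-1" "%y. G (%j. x j + y j)"] Gxm by simp
  have pt: "2 * (G x * en (exp (- (b / a / 2) * (nrm p y)\<^sup>2))) <= G (%j. x j + y j) + G (%j. x j + - 1 * y j)" for y
  proof -
  let ?x = "%j. x j - h j"
  define s t c where "s = qf p ?A ?x" and "t = qf p ?A y" and "c = vec p ?x \<star> (?A *\<^sub>v vec p y)"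
  have e1: "(%j. x j + y j - h j) = (%j. ?x j + y j)" and e2: "(%j. x j + - 1 * y j - h j) = (%j. ?x j + - 1 * y j)" by auto
  have "vec p (%j. - 1 * y j) = (- 1) \<cdot>\<^sub>v vec p y" by auto
  then have c2: "vec p ?x \<star> (?A *\<^sub>v vec p (%j. - 1 * y j)) = - c"
  using info_carrier[OF true_par_in] by (simp add: c_def mult_mat_vec[of _ p p])
  have q1: "qf p ?A (%j. x j + y j - h j) = s + 2 * c + t"
  unfolding e1 qf_add[OF form0] by (simp add: s_def t_def c_def)
  have q2: "qf p ?A (%j. x j + - 1 * y j - h j) = s - 2 * c + t"
  unfolding e2 qf_add[OF form0] c2 qf_scale[OF info_carrier[OF true_par_in]] by (simp add: s_def t_def)
  have "t <= b / a * (nrm p y)\<^sup>2" unfolding t_def by (rule qf_bounds(2)[OF form0])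
  then have "exp (- s / 2) * exp (- (b / a / 2) * (nrm p y)\<^sup>2) <= exp (- (s + t) / 2)"
  by (simp flip: exp_add)
  moreover have "2 * exp (- (s + t) / 2) <= exp (- (s + 2 * c + t) / 2) + exp (- (s - 2 * c + t) / 2)"
  proof -
  have "2 <= exp (- c) + exp c" using exp_ge_add_one_self[of c] exp_ge_add_one_self[of "- c"] by linarith
  then have "exp (- (s + t) / 2) * 2 <= exp (- (s + t) / 2) * (exp (- c) + exp c)" by (intro mult_left_mono) auto
  moreover have "- (s + 2 * c + t) / 2 = - (s + t) / 2 + - c" "- (s - 2 * c + t) / 2 = - (s + t) / 2 + c"
  by (simp_all add: field_simps)
  ultimately show ?thesis by (simp only: exp_add distrib_left mult.commute[of _ 2])
  qed
  ultimately have "2 * (exp (- s / 2) * exp (- (b / a / 2) * (nrm p y)\<^sup>2)) <= exp (- (s + 2 * c + t) / 2) + exp (- (s - 2 * c + t) / 2)"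
  by linarith
  then have "en (2 * (exp (- s / 2) * exp (- (b / a / 2) * (nrm p y)\<^sup>2))) <= en (exp (- (s + 2 * c + t) / 2) + exp (- (s - 2 * c + t) / 2))"
  by (rule ennreal_leI)
  moreover have "en (2 * (exp (- s / 2) * exp (- (b / a / 2) * (nrm p y)\<^sup>2))) = 2 * (G x * en (exp (- (b / a / 2) * (nrm p y)\<^sup>2)))"
  by (simp only: G_def s_def ennreal_mult' exp_ge_zero zero_le_numeral ennreal_numeral)
  moreover have "en (exp (- (s + 2 * c + t) / 2) + exp (- (s - 2 * c + t) / 2)) = G (%j. x j + y j) + G (%j. x j + - 1 * y j)"
  unfolding G_def q1 q2 by (rule ennreal_plus) simp_all
  ultimately show ?thesis by simp
  qed
  have "2 * (G x * ennreal ?k) = (\<integral>\<^sup>+y. 2 * (G x * en (exp (- (b / a / 2) * (nrm p y)\<^sup>2))) \<partial>leb (M - N))"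
  proof -
  have "(\<integral>\<^sup>+y. en (exp (- (b / a / 2) * (nrm p y)\<^sup>2)) \<partial>leb (M - N)) = en (sqrt (pi / (b / a / 2)) ^ card (M - N))"
  using M ab0 by (intro nn_integral_gaussian_leb) auto
  also have "pi / (b / a / 2) = 2 * pi / (b / a)" by simp
  finally show ?thesis by (subst nn_integral_cmult, simp, subst nn_integral_cmult) simp_all
  qed
  also have "... <= (\<integral>\<^sup>+y. G (%j. x j + y j) + G (%j. x j + - 1 * y j) \<partial>leb (M - N))"
  by (intro nn_integral_mono pt)
  also have "... = 2 * (\<integral>\<^sup>+y. G (%j. x j + y j) \<partial>leb (M - N))"
  using Gxm by (subst nn_integral_add) (simp_all add: reflect mult_2)
  finally show ?thesis by (simp add: mult_le_cancel_left ennreal_mult_le_mult_iff)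
 qed
 have fin_g: "(\<integral>\<^sup>+u. G u \<partial>leb M) = en (gmass M h)" "(\<integral>\<^sup>+u. G u \<partial>leb N) = en (gmass N h)"
  unfolding G_def using gmass_bounds(1)[OF M(2) order_refl] gmass_bounds(1)[OF order_trans[OF M] order_refl] by auto
 have k0: "0 <= ?k" using a0 b0 by simp
 have "en (?k * gmass N h) = (\<integral>\<^sup>+x. G x * ennreal ?k \<partial>leb N)"
 proof -
  have "(\<integral>\<^sup>+x. G x * ennreal ?k \<partial>leb N) = (\<integral>\<^sup>+x. G x \<partial>leb N) * ennreal ?k"
  by (rule nn_integral_multc) simp
  then show ?thesis unfolding fin_g ennreal_mult'[OF k0] by (simp only: mult.commute)
 qed
 also have "... <= (\<integral>\<^sup>+x. (\<integral>\<^sup>+y. G (%j. x j + y j) \<partial>leb (M - N)) \<partial>leb N)"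
  by (intro nn_integral_mono inner)
 also have "... = (\<integral>\<^sup>+u. G u \<partial>leb M)"
  by (rule nn_integral_leb_Un[OF MN(1) fin(2,3) Gm, unfolded MN(2), symmetric])
 finally show ?thesis unfolding fin_g by (subst (asm) ennreal_le_iff) (simp_all add: gmass_def)
qed

section \<open>Kernels close to the limiting Gaussian kernel\<close>

definition centre :: "(nat => 'd) => nat => real" where
 "centre D = (%j. rn * dev X (oracle_est n X D) j)"

lemma centre_eq: "nrm p (centre D) = rn * vnorm (vec p (dev X (oracle_est n X D)))"
 using n_pos by (simp add: centre_def nrm_scale nrm_vec)

lemma gauss_kernel_rescaled:
 "gauss_kernel n X D th = exp (- qf p (info X th0) (%j. rn * dev X th j - centre D j) / 2)"
proof -
 have "(%j. rn * dev X th j - centre D j) = (%j. rn * (th j - oracle_est n X D j))"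
  by (auto simp: centre_def dev_def algebra_simps)
 then show ?thesis using n_pos by (simp add: gauss_kernel_def qf_scale[OF info_carrier[OF true_par_in]])
qed

lemma gauss_kernel_measurable [measurable]: "gauss_kernel n X D : bm borel"
proof -
 have "(%th. qf p (info X th0) (%j. th j - oracle_est n X D j)) : bm borel"
  by (rule qf0_shift_measurable)
 then show ?thesis unfolding gauss_kernel_def[abs_def] by simp
qed

lemma gauss_kernel_nonneg [simp]: "0 <= gauss_kernel n X D th"
 by (simp add: gauss_kernel_def)

lemma gauss_kernel_mass:
 assumes M: "M <= {..<p}" "true_model X <= M"
 shows "en (sc M) * (\<integral>\<^sup>+th. en (gauss_kernel n X D th) \<partial>leb M) = en (gmass M (centre D))"
proof -
 have "en (sc M) * (\<integral>\<^sup>+th. en (gauss_kernel n X D th) \<partial>leb M)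
  = (\<integral>\<^sup>+u. en (exp (- qf p (info X th0) (%j. u j - centre D j) / 2)) \<partial>leb M)"
  unfolding gauss_kernel_rescaled
  by (rule nn_integral_rescale[OF M, of "%u. en (exp (- qf p (info X th0) (%j. u j - centre D j) / 2))"]) simp
 then show ?thesis using gmass_bounds(1)[OF M(1) order_refl] by simp
qed

lemma half_distance:
 assumes h: "nrm p (%j. rn * dev X y j) <= T" and C: "2 * T <= C" "C <= rad th"
 shows "rad th / 2 <= rn * nrm p (%j. y j - th j)"
proof -
 have eq: "(%j. rn * dev X th j - rn * dev X y j) = (%j. rn * (th j - y j))"
  by (auto simp: dev_def algebra_simps)
 have "rad th <= nrm p (%j. rn * dev X th j - rn * dev X y j) + nrm p (%j. rn * dev X y j)"
  unfolding rad_eq by (rule nrm_diff_triangle)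
 then have "rad th <= rn * nrm p (%j. y j - th j) + T"
  using h n_pos unfolding eq nrm_scale by (simp add: nrm_minus[of th y])
 then show ?thesis using C by linarith
qed

lemma gauss_kernel_tail:
 assumes M: "M <= {..<p}" "true_model X <= M" and h: "nrm p (centre D) <= T" and C: "2 * T <= C" "0 <= C"
 shows "en (sc M) * (\<integral>\<^sup>+th. en (gauss_kernel n X D th) * indicator {th. C <= rad th} th \<partial>leb M)
  <= en (exp (- (a / b / 8) * C\<^sup>2 / 2) * sqrt (2 * pi / (a / b / 8)) ^ card M)"
proof -
 have "gauss_kernel n X D th <= exp (- (a / b / 8) * (rad th)\<^sup>2)" if "C <= rad th" for th
 proof -
  have "rad th / 2 <= rn * nrm p (%j. oracle_est n X D j - th j)"
  using h C(1) that by (intro half_distance[of _ T C]) (simp_all add: centre_def)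
  then have "(rad th / 2)\<^sup>2 <= (rn * nrm p (%j. oracle_est n X D j - th j))\<^sup>2"
  by (intro power_mono) auto
  then have "a / b * ((rad th)\<^sup>2 / 4) <= a / b * (real n * (nrm p (%j. th j - oracle_est n X D j))\<^sup>2)"
  using ab0 n_pos by (intro mult_left_mono) (auto simp: power_mult_distrib power_divide nrm_minus[of "oracle_est n X D"])
  also have "... = real n * (a / b * (nrm p (%j. th j - oracle_est n X D j))\<^sup>2)" by simp
  also have "... <= real n * qf p (info X th0) (%j. th j - oracle_est n X D j)"
  by (intro mult_left_mono qf_bounds(1)[OF form0]) simp
  finally show ?thesis by (simp add: gauss_kernel_def)
 qed
 then have "(\<integral>\<^sup>+th. en (gauss_kernel n X D th) * indicator {th. C <= rad th} th \<partial>leb M)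
  <= (\<integral>\<^sup>+th. en (exp (- (a / b / 8) * (rad th)\<^sup>2)) * indicator {th. C <= rad th} th \<partial>leb M)"
  by (intro nn_integral_mono) (auto simp: indicator_def intro!: ennreal_leI)
 then have "en (sc M) * (\<integral>\<^sup>+th. en (gauss_kernel n X D th) * indicator {th. C <= rad th} th \<partial>leb M)
  <= en (sc M) * (\<integral>\<^sup>+th. en (exp (- (a / b / 8) * (rad th)\<^sup>2)) * indicator {th. C <= rad th} th \<partial>leb M)"
  by (rule mult_left_mono) simp
 also have "... <= en (exp (- (a / b / 8) * C\<^sup>2 / 2) * sqrt (2 * pi / (a / b / 8)) ^ card M)"
  using ab0 C by (intro rescaled_gauss_tail[OF M]) auto
 finally show ?thesis .
qed

lemma submodel_measurable [measurable]: "submodel X M : sets borel"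
proof -
 have "closed (par_space X)" using cpt by (rule compact_imp_closed)
 moreover have "closed {th :: nat => real. \<forall>j. j \<notin> M --> th j = 0}"
  by (intro closed_Collect_all closed_Collect_imp open_Collect_const closed_Collect_eq continuous_intros continuous_on_product_coordinates)
 moreover have "submodel X M = par_space X \<inter> {th. \<forall>j. j \<notin> M --> th j = 0}" by (auto simp: submodel_def)
 ultimately show ?thesis by (simp add: borel_closed closed_Int)
qed

definition rint :: "nat set => ((nat => real) => ennreal) => ennreal" where
 "rint M g = en (sc M) * (\<integral>\<^sup>+th. g th \<partial>leb M)"

lemma rint_mono: "(AE th in leb M. g th <= g' th) ==> rint M g <= rint M g'"
 unfolding rint_def by (intro mult_left_mono nn_integral_mono_AE) auto

lemma rint_add:
 "g : bm borel ==> g' : bm borel ==> rint M (%th. g th + g' th) = rint M g + rint M g'"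
 unfolding rint_def by (simp add: nn_integral_add distrib_left)

lemma rint_cmult: "g : bm borel ==> rint M (%th. k * g th) = k * rint M g"
 unfolding rint_def by (simp add: nn_integral_cmult mult.left_commute)

definition kernel_dist :: "((nat => real) => real) => (nat => 'd) => nat set => ennreal" where
 "kernel_dist f D M = en (sc M) *
  (\<integral>\<^sup>+th. en \<bar>f th - gauss_kernel n X D th\<bar> * indicator (submodel X M) th \<partial>leb M)"

lemma AE_near_submodel:
 assumes M: "M <= {..<p}" and ball: "{th : Rn p. dist0 X th < C / rn} <= par_space X"
 shows "AE th in leb M. rad th < C --> th : submodel X M & th : ball0 X (C / rn)"
 using AE_leb_support[of M]
proof eventually_elim
 case (elim th)
 then have "th : Rn p" using M by (auto simp: Rn_def)
 moreover have "dist0 X th < C / rn" if "rad th < C"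
  using that n_pos by (simp add: rad_def field_simps)
 ultimately show ?case using ball elim by (auto simp: submodel_def ball0_def)
qed

text \<open>Replacing a kernel by the Gaussian one and the prior density by its value at the true
 parameter: near the true parameter the density is almost constant, and far from it the Gaussian
 kernel has no mass.\<close>

lemma weighted_kernel_close:
 assumes M: "M <= {..<p}" "true_model X <= M"
  and ball: "{th : Rn p. dist0 X th < C / rn} <= par_space X"
  and f: "f : bm borel" and w: "w : bm borel"
  and w0: "!!th. th : submodel X M ==> 0 <= w th" and wc: "!!th. th : submodel X M ==> w th <= c"
  and near: "!!th. th : submodel X M ==> th : ball0 X (C / rn) ==> \<bar>w th - w1\<bar> <= et"
  and w1: "0 <= w1" "w1 <= c" and et: "0 <= et"
  and dist: "kernel_dist f D M <= en ep" and ep: "0 <= ep"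
  and h: "nrm p (centre D) <= T" and C: "2 * T <= C" "0 <= C"
 shows "\<bar>sc M * (LINT th:submodel X M|leb M. f th * w th) - w1 * gmass M (centre D)\<bar>
  <= c * ep + et * gmass M (centre D) + c * (exp (- (a / b / 8) * C\<^sup>2 / 2) * sqrt (2 * pi / (a / b / 8)) ^ card M)"
proof -
 let ?S = "submodel X M" and ?\<psi> = "gauss_kernel n X D" and ?l = "leb M" and ?J = "gmass M (centre D)"
 let ?t = "exp (- (a / b / 8) * C\<^sup>2 / 2) * sqrt (2 * pi / (a / b / 8)) ^ card M"
 note [measurable] = f w
 have c0: "0 <= c" using w1 by simp
 have t0: "0 <= ?t" using a0 b0 by simp
 have rint\<psi>: "rint M (%th. en (?\<psi> th)) = ennreal ?J" unfolding rint_def by (rule gauss_kernel_mass[OF M])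
 define g1 where "g1 th = en \<bar>f th - ?\<psi> th\<bar> * indicator ?S th" for th
 define g2 where "g2 th = en (?\<psi> th) * indicator {th. C <= rad th} th" for th
 have g1m [measurable]: "g1 : bm borel" and g2m [measurable]: "g2 : bm borel"
  unfolding g1_def[abs_def] g2_def[abs_def] by measurable
 have rint_g1: "rint M g1 <= en ep" using dist unfolding rint_def g1_def kernel_dist_def by simp
 have rint_g2: "rint M g2 <= ennreal ?t" unfolding rint_def g2_def by (rule gauss_kernel_tail[OF M h C])
 define G where "G th = indicator ?S th * (f th * w th) - w1 * ?\<psi> th" for th
 have Gm [measurable]: "G : bm borel" unfolding G_def[abs_def] by measurable
 have bound: "rint M (%th. en \<bar>G th\<bar>) <= en (c * ep + et * ?J + c * ?t)"
 proof -
  have "AE th in ?l. en \<bar>G th\<bar> <= en c * g1 th + (en et * en (?\<psi> th) + en c * g2 th)"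
  using AE_near_submodel[OF M(1) ball]
  proof eventually_elim
  case (elim th)
  have p0: "0 <= ?\<psi> th" by simp
  consider (near) "th : ?S" "rad th < C" | (far) "th : ?S" "C <= rad th" | (out) "th \<notin> ?S" "C <= rad th"
  using elim by fastforce
  then show ?case
  proof cases
  case near
  have "G th = (f th - ?\<psi> th) * w th + ?\<psi> th * (w th - w1)" using near by (simp add: G_def algebra_simps)
  also have "\<bar>...\<bar> <= \<bar>f th - ?\<psi> th\<bar> * w th + ?\<psi> th * \<bar>w th - w1\<bar>"
  using w0[OF near(1)] by (intro order_trans[OF abs_triangle_ineq]) (simp add: abs_mult)
  also have "... <= \<bar>f th - ?\<psi> th\<bar> * c + ?\<psi> th * et"
  using assms(8)[OF near(1)] elim near wc[OF near(1)] by (intro add_mono mult_left_mono) auto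
  finally have "\<bar>G th\<bar> <= c * \<bar>f th - ?\<psi> th\<bar> + (et * ?\<psi> th + 0)" by (simp add: mult.commute)
  then have "en \<bar>G th\<bar> <= en c * en \<bar>f th - ?\<psi> th\<bar> + (en et * en (?\<psi> th) + 0)"
  using c0 et by (simp add: ennreal_leI flip: ennreal_mult ennreal_plus)
  then show ?thesis using near by (simp add: g1_def g2_def)
  next
  case far
  have "G th = (f th - ?\<psi> th) * w th + ?\<psi> th * (w th - w1)" using far by (simp add: G_def algebra_simps)
  also have "\<bar>...\<bar> <= \<bar>f th - ?\<psi> th\<bar> * w th + ?\<psi> th * \<bar>w th - w1\<bar>"
  using w0[OF far(1)] by (intro order_trans[OF abs_triangle_ineq]) (simp add: abs_mult)
  also have "... <= \<bar>f th - ?\<psi> th\<bar> * c + ?\<psi> th * c"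
  using w0[OF far(1)] wc[OF far(1)] w1 by (intro add_mono mult_left_mono) auto
  finally have "\<bar>G th\<bar> <= c * \<bar>f th - ?\<psi> th\<bar> + (0 + c * ?\<psi> th)" by (simp add: mult.commute)
  then have "en \<bar>G th\<bar> <= en c * en \<bar>f th - ?\<psi> th\<bar> + (0 + en c * en (?\<psi> th))"
  using c0 by (simp add: ennreal_leI flip: ennreal_mult ennreal_plus)
  also have "... <= en c * en \<bar>f th - ?\<psi> th\<bar> + (en et * en (?\<psi> th) + en c * en (?\<psi> th))"
  by (intro add_left_mono add_right_mono) simp
  finally show ?thesis using far by (simp add: g1_def g2_def)
  next
  case out
  have "\<bar>G th\<bar> = w1 * ?\<psi> th" using out w1 by (simp add: G_def abs_mult)
  also have "... <= c * ?\<psi> th" using w1 by (intro mult_right_mono) auto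
  finally have "en \<bar>G th\<bar> <= en c * en (?\<psi> th)"
  using c0 by (simp add: ennreal_leI flip: ennreal_mult)
  also have "... <= en et * en (?\<psi> th) + en c * en (?\<psi> th)" by simp
  finally show ?thesis using out by (simp add: g1_def g2_def)
  qed
  qed
  then have "rint M (%th. en \<bar>G th\<bar>) <= rint M (%th. en c * g1 th + (en et * en (?\<psi> th) + en c * g2 th))"
  by (rule rint_mono)
  also have "... = en c * rint M g1 + (en et * ennreal ?J + en c * rint M g2)"
  by (simp add: rint_add rint_cmult rint\<psi>)
  also have "... <= en c * en ep + (en et * ennreal ?J + en c * ennreal ?t)"
  by (intro add_mono mult_left_mono rint_g1 rint_g2) auto
  also have "... = en (c * ep + et * ?J + c * ?t)"
  proof -
  have "0 <= ?J" by (simp add: gmass_def)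
  then show ?thesis using c0 ep et t0 by (simp only: ennreal_mult'[symmetric] ennreal_plus[symmetric] mult_nonneg_nonneg add_nonneg_nonneg add.assoc)
  qed
  finally show ?thesis .
 qed
 have \<psi>i: "integrable ?l (%th. ?\<psi> th)" and \<psi>v: "sc M * (\<integral>th. ?\<psi> th \<partial>?l) = ?J"
 proof -
  have fin: "(\<integral>\<^sup>+th. en (?\<psi> th) \<partial>?l) < \<top>"
  proof (rule ccontr)
  assume "\<not> (\<integral>\<^sup>+th. en (?\<psi> th) \<partial>?l) < \<top>"
  then have "(\<integral>\<^sup>+th. en (?\<psi> th) \<partial>?l) = \<top>" using top.not_eq_extremum by blast
  then have "rint M (%th. en (?\<psi> th)) = \<top>" unfolding rint_def using sc_pos[of M] by (simp add: ennreal_mult_top ennreal_eq_0_iff not_le)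
  then show False using rint\<psi> by simp
  qed
  then show int: "integrable ?l (%th. ?\<psi> th)" by (intro integrableI_nonneg) auto
  have "(\<integral>\<^sup>+th. en (?\<psi> th) \<partial>?l) = en (\<integral>th. ?\<psi> th \<partial>?l)"
  by (intro nn_integral_eq_integral int) simp
  then have "en (sc M * (\<integral>th. ?\<psi> th \<partial>?l)) = ennreal ?J"
  using rint\<psi> sc_pos[of M] by (simp add: rint_def ennreal_mult')
  then show "sc M * (\<integral>th. ?\<psi> th \<partial>?l) = ?J"
  using sc_pos[of M] by (subst (asm) ennreal_inj) (auto simp: gmass_def)
 qed
 have Gi: "integrable ?l G"
 proof (rule integrableI_bounded)
  have "en (sc M) * (\<integral>\<^sup>+th. en \<bar>G th\<bar> \<partial>?l) < \<top>"
  using le_less_trans[OF bound ennreal_less_top] by (simp add: rint_def)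
  then show "(\<integral>\<^sup>+th. en (norm (G th)) \<partial>?l) < \<infinity>"
  using sc_pos[of M] by (auto simp: ennreal_mult_less_top)
 qed simp
 have "integrable ?l (%th. G th + w1 * ?\<psi> th)" using Gi \<psi>i by simp
 have "(LINT th:?S|?l. f th * w th) = (\<integral>th. G th + w1 * ?\<psi> th \<partial>?l)"
  unfolding set_lebesgue_integral_def by (intro Bochner_Integration.integral_cong) (auto simp: G_def)
 also have "... = (\<integral>th. G th \<partial>?l) + w1 * (\<integral>th. ?\<psi> th \<partial>?l)" using Gi \<psi>i by simp
 finally have eq: "sc M * (LINT th:?S|?l. f th * w th) - w1 * ?J = sc M * (\<integral>th. G th \<partial>?l)"
  unfolding \<psi>v[symmetric] by (simp add: distrib_left)
 have "en (sc M * \<bar>\<integral>th. G th \<partial>?l\<bar>) <= rint M (%th. en \<bar>G th\<bar>)"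
  unfolding rint_def using integral_norm_bound_ennreal[OF Gi] sc_pos[of M] by (simp add: ennreal_mult' mult_left_mono)
 also note bound
 finally have "sc M * \<bar>\<integral>th. G th \<partial>?l\<bar> <= c * ep + et * ?J + c * ?t"
  using c0 ep et t0 by (subst (asm) ennreal_le_iff) (auto simp: gmass_def)
 then show ?thesis unfolding eq using sc_pos[of M] by (simp add: abs_mult)
qed

definition tailc :: "real => nat set => real" where
 "tailc C M = exp (- (a / b / 8) * C\<^sup>2 / 2) * sqrt (2 * pi / (a / b / 8)) ^ card M"

definition volc :: "real => nat set => real" where
 "volc C M = exp (C\<^sup>2) * sqrt pi ^ card M"

definition polyc :: "nat set => real" where
 "polyc M = (1 / (sqrt (a / b) / 2)) ^ card M * (2 ^ (p + 1) * (2 * real p) ^ card M)"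

lemma tailc_nonneg: "0 <= tailc C M" and volc_nonneg: "0 <= volc C M" and polyc_nonneg: "0 <= polyc M"
 using a0 b0 by (auto simp: tailc_def volc_def polyc_def)

lemma rint_near: "M <= {..<p} ==> true_model X <= M ==> rint M (%th. indicator {th. rad th < C} th) <= en (volc C M)"
 unfolding rint_def volc_def by (rule rescaled_ball)

lemma rint_kernel_far:
 assumes "M <= {..<p}" "true_model X <= M" "nrm p (centre D) <= T" "2 * T <= C" "0 <= C"
 shows "rint M (%th. en (gauss_kernel n X D th) * indicator {th. C <= rad th} th) <= en (tailc C M)"
 unfolding rint_def tailc_def by (rule gauss_kernel_tail[OF assms])

lemma qf0_neg: "qf p (info X th0) (%j. x j - y j) = qf p (info X th0) (%j. y j - x j)"
 using qf_scale[OF info_carrier[OF true_par_in], of "- 1" "%j. y j - x j"] by simp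

subsection \<open>The density of the estimator as a kernel\<close>

definition e_kernel :: "(nat => 'd) => (nat => real) => real" where
 "e_kernel D th = scaled_dens (est X D) th"

lemma est_dens_pair_measurable: "(%z. est_dens X (fst z) (snd z)) : bm (borel \<Otimes>\<^sub>M borel)"
 using str by (simp add: gmm_structure_def split_beta')

lemma e_kernel_measurable [measurable]: "e_kernel D : bm borel"
 using measurable_compose[OF measurable_Pair1' est_dens_pair_measurable, of "est X D"]
 by (simp add: e_kernel_def[abs_def] scaled_dens_def[abs_def])

definition est_upper :: "real => (nat => real) => (nat => real) => real" where
 "est_upper t x th = gu / gl * (exp (- (a / b) * (real n * (nrm p (%j. x j - th j))\<^sup>2) / 2)
  + pc * t / (1 + (sqrt (a / b) * (rn * nrm p (%j. x j - th j))) ^ (p + 1)))"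

lemma est_upper_far:
 assumes far: "rad th / 2 <= rn * nrm p (%j. x j - th j)" and t: "0 <= t"
 shows "est_upper t x th <= gu / gl * (exp (- (a / b / 8) * (rad th)\<^sup>2) + pc * t * (1 / (1 + (sqrt (a / b) / 2 * rad th) ^ (p + 1))))"
proof -
 let ?y = "rn * nrm p (%j. x j - th j)"
 have "(rad th / 2)\<^sup>2 <= ?y\<^sup>2" using far by (intro power_mono) auto
 then have "a / b * ((rad th)\<^sup>2 / 4) <= a / b * (real n * (nrm p (%j. x j - th j))\<^sup>2)"
  using ab0 n_pos by (intro mult_left_mono) (auto simp: power_mult_distrib power_divide)
 moreover have "exp (- u * v / 2) <= exp (- (u / 8) * w)" if "u * (w / 4) <= u * v" for u v w :: real
  using that by simp
 ultimately have 1: "exp (- (a / b) * (real n * (nrm p (%j. x j - th j))\<^sup>2) / 2) <= exp (- (a / b / 8) * (rad th)\<^sup>2)" by blast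
 have r0: "0 <= sqrt (a / b)" using ab0 by simp
 have "sqrt (a / b) * (rad th / 2) <= sqrt (a / b) * ?y" by (rule mult_left_mono[OF far r0])
 then have "sqrt (a / b) / 2 * rad th <= sqrt (a / b) * ?y" by simp
 then have pw: "(sqrt (a / b) / 2 * rad th) ^ (p + 1) <= (sqrt (a / b) * ?y) ^ (p + 1)"
  using r0 by (intro power_mono) auto
 have z0: "0 <= (sqrt (a / b) / 2 * rad th) ^ (p + 1)" using r0 by (intro zero_le_power mult_nonneg_nonneg) auto
 have 2: "pc * t / (1 + (sqrt (a / b) * ?y) ^ (p + 1)) <= pc * t / (1 + (sqrt (a / b) / 2 * rad th) ^ (p + 1))"
  using consts_pos(1) t by (intro divide_one_plus_mono z0 pw) auto
 have "0 <= gu / gl" using consts_pos by simp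
 from mult_left_mono[OF add_mono[OF 1 2] this] show ?thesis by (simp add: est_upper_def)
qed

lemma e_kernel_dist:
 assumes M: "M <= {..<p}" "true_model X <= M"
  and ball: "{th : Rn p. dist0 X th < C / rn} <= par_space X"
  and up: "AE th in leb M. th : submodel X M --> e_kernel D th <= est_upper t (est X D) th"
  and loc: "AE th in leb M. th : submodel X M \<inter> ball0 X (C / rn) -->
  \<bar>e_kernel D th - exp (- real n * qf p (info X th0) (%j. est X D j - th j) / 2)\<bar> <= om"
  and t: "0 <= t" and om: "0 <= om"
  and h: "nrm p (centre D) <= T" and h': "nrm p (%j. rn * dev X (est X D) j) <= T"
  and d: "rn * nrm p (%j. est X D j - oracle_est n X D j) <= d"
  and C: "2 * T <= C" "0 <= C"
 shows "kernel_dist (e_kernel D) D M <= en ((om + b / a * d * (T + C)) * volc C M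
  + gu / gl * (tailc C M + pc * t * polyc M) + tailc C M)"
proof -
 let ?s = "rn" and ?\<psi> = "gauss_kernel n X D" and ?E = "est X D" and ?O = "oracle_est n X D"
 let ?k = "om + b / a * d * (T + C)"
 have s0: "0 < ?s" using n_pos by simp
 have T0: "0 <= T" using h by (meson nrm_nonneg order_trans)
 have d0: "0 <= d" using d by (meson mult_nonneg_nonneg nrm_nonneg order_trans real_sqrt_ge_zero of_nat_0_le_iff)
 have k0: "0 <= ?k" using om a0 b0 d0 T0 C by (intro add_nonneg_nonneg mult_nonneg_nonneg divide_nonneg_nonneg) auto
 define far where "far = indicat_real {th. C <= rad th}"
 define g1 where "g1 th = en (exp (- (a / b / 8) * (rad th)\<^sup>2)) * indicator {th. C <= rad th} th" for th
 define g2 where "g2 th = en (1 / (1 + (sqrt (a / b) / 2 * rad th) ^ (p + 1)))" for th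
 define g3 where "g3 th = en (?\<psi> th) * indicator {th. C <= rad th} th" for th
 define g0 where "g0 th = (indicator {th. rad th < C} th :: ennreal)" for th
 have [measurable]: "g1 : bm borel" "g2 : bm borel" "g3 : bm borel" "g0 : bm borel"
  unfolding g1_def[abs_def] g2_def[abs_def] g3_def[abs_def] g0_def[abs_def] by measurable
 have gg: "0 <= gu / gl" "0 <= pc * t" using consts_pos t by auto
 have pt: "AE th in leb M. en \<bar>e_kernel D th - ?\<psi> th\<bar> * indicator (submodel X M) th
  <= ennreal ?k * g0 th + (en (gu / gl) * (g1 th + en (pc * t) * g2 th) + g3 th)"
  using up loc AE_near_submodel[OF M(1) ball]
 proof eventually_elim
  case (elim th)
  show ?case
  proof (cases "rad th < C")
  case True
  then have S: "th : submodel X M" "th : ball0 X (C / ?s)" using elim(3) by auto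
  let ?x = "vec p (%j. ?s * (?E j - th j))" and ?y = "vec p (%j. ?s * (?O j - th j))"
  let ?A = "info X th0"
  have e1: "\<bar>e_kernel D th - exp (- real n * qf p ?A (%j. ?E j - th j) / 2)\<bar> <= om"
  using elim(2) S by simp
  have qx: "real n * qf p ?A (%j. ?E j - th j) = ?x \<star> (?A *\<^sub>v ?x)"
  using qf_scale[OF info_carrier[OF true_par_in], of ?s "%j. ?E j - th j"] n_pos by (simp add: qf_def)
  have qy: "real n * qf p ?A (%j. th j - ?O j) = ?y \<star> (?A *\<^sub>v ?y)"
  using qf_scale[OF info_carrier[OF true_par_in], of ?s "%j. ?O j - th j"] n_pos unfolding qf0_neg[of th ?O] by (simp add: qf_def)
  have nx: "vnorm ?x <= T + C"
  proof -
  have "(%j. ?s * (?E j - th j)) = (%j. ?s * dev X ?E j - ?s * dev X th j)" by (auto simp: dev_def algebra_simps)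
  then have "vnorm ?x <= nrm p (%j. ?s * dev X ?E j) + nrm p (%j. - 1 * (?s * dev X th j))"
  using nrm_triangle[of "%j. ?s * dev X ?E j" "%j. - 1 * (?s * dev X th j)"] by (simp add: nrm_vec)
  then show ?thesis using h' True unfolding nrm_scale[of p "- 1"] rad_eq by linarith
  qed
  have ny: "vnorm ?y <= T + C"
  proof -
  have "(%j. ?s * (?O j - th j)) = (%j. centre D j - ?s * dev X th j)" by (auto simp: dev_def centre_def algebra_simps)
  then have "vnorm ?y <= nrm p (centre D) + nrm p (%j. - 1 * (?s * dev X th j))"
  using nrm_triangle[of "centre D" "%j. - 1 * (?s * dev X th j)"] by (simp add: nrm_vec)
  then show ?thesis using h True unfolding nrm_scale[of p "- 1"] rad_eq by linarith
  qed
  have nxy: "vnorm (?x - ?y) <= d"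
  proof -
  have "?x - ?y = ?s \<cdot>\<^sub>v vec p (%j. ?E j - ?O j)" by (intro eq_vecI) (auto simp: algebra_simps)
  then show ?thesis using d by (simp add: vnorm_smult nrm_vec)
  qed
  have x: "?x : carrier_vec p" and y: "?y : carrier_vec p" by simp_all
  have l: "0 <= real n * qf p ?A (%j. ?E j - th j) / 2" "0 <= real n * qf p ?A (%j. th j - ?O j) / 2"
  using qf_nonneg[OF form0] ab0 by (auto intro!: divide_nonneg_nonneg mult_nonneg_nonneg)
  have "\<bar>exp (- (real n * qf p ?A (%j. ?E j - th j) / 2)) - exp (- (real n * qf p ?A (%j. th j - ?O j) / 2))\<bar>
  <= exp (- 0) * \<bar>real n * qf p ?A (%j. ?E j - th j) / 2 - real n * qf p ?A (%j. th j - ?O j) / 2\<bar>"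
  by (rule abs_exp_diff_le[OF l])
  also have "... = \<bar>?x \<star> (?A *\<^sub>v ?x) - ?y \<star> (?A *\<^sub>v ?y)\<bar> / 2" unfolding qx qy by (simp flip: diff_divide_distrib)
  also have "... <= b / a * vnorm (?x - ?y) * (vnorm ?x + vnorm ?y) / 2"
  using form_diff_le[OF form0 _ x y] ab0 by (intro divide_right_mono) auto
  also have "... <= b / a * d * ((T + C) + (T + C)) / 2"
  using nx ny nxy a0 b0 d0 by (intro divide_right_mono mult_mono add_mono mult_nonneg_nonneg) auto
  also have "... = b / a * d * (T + C)"
  proof -
  have "u * (w + w) / 2 = u * w" for u w :: real by simp
  then show ?thesis .
  qed
  finally have e2: "\<bar>exp (- real n * qf p ?A (%j. ?E j - th j) / 2) - ?\<psi> th\<bar> <= b / a * d * (T + C)"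
  by (simp add: gauss_kernel_def)
  have "\<bar>e_kernel D th - ?\<psi> th\<bar> <= ?k" using e1 e2 by linarith
  then have "en \<bar>e_kernel D th - ?\<psi> th\<bar> <= ennreal ?k" by (rule ennreal_leI)
  then show ?thesis using True S by (simp add: g0_def add_increasing2)
  next
  case False
  then have f: "C <= rad th" by simp
  show ?thesis
  proof (cases "th : submodel X M")
  case True
  have "e_kernel D th <= est_upper t ?E th" using elim(1) True by simp
  also have "... <= gu / gl * (exp (- (a / b / 8) * (rad th)\<^sup>2) + pc * t * (1 / (1 + (sqrt (a / b) / 2 * rad th) ^ (p + 1))))"
  using half_distance[OF h' C(1) f] t by (rule est_upper_far)
  finally have "\<bar>e_kernel D th - ?\<psi> th\<bar> <= gu / gl * (exp (- (a / b / 8) * (rad th)\<^sup>2) + pc * t * (1 / (1 + (sqrt (a / b) / 2 * rad th) ^ (p + 1)))) + ?\<psi> th"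
  using scaled_dens_nonneg[of ?E th] gauss_kernel_nonneg[of D th] unfolding e_kernel_def by linarith
  then have "en \<bar>e_kernel D th - ?\<psi> th\<bar> <= en (gu / gl * (exp (- (a / b / 8) * (rad th)\<^sup>2) + pc * t * (1 / (1 + (sqrt (a / b) / 2 * rad th) ^ (p + 1)))) + ?\<psi> th)"
  by (rule ennreal_leI)
  also have "... = en (gu / gl) * (g1 th + en (pc * t) * g2 th) + g3 th"
  proof -
  have z0: "0 <= 1 / (1 + (sqrt (a / b) / 2 * rad th) ^ (p + 1))"
  using ab0 by (intro divide_nonneg_nonneg add_nonneg_nonneg zero_le_power mult_nonneg_nonneg) auto
  have "en (u * (v + w * z) + y) = en u * (en v + en w * en z) + en y"
  if "0 <= u" "0 <= v" "0 <= w" "0 <= z" "0 <= y" for u v w z y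
  using that by (simp only: ennreal_plus ennreal_mult' mult_nonneg_nonneg add_nonneg_nonneg)
  from this[OF gg(1) exp_ge_zero gg(2) z0 gauss_kernel_nonneg] show ?thesis
  using f by (simp add: g1_def g2_def g3_def)
  qed
  finally show ?thesis using True by (simp add: add_increasing)
  qed simp
  qed
 qed
 have r1: "rint M g1 <= en (tailc C M)"
  unfolding g1_def rint_def tailc_def using ab0 C by (intro rescaled_gauss_tail[OF M]) auto
 have r2: "rint M g2 <= en (polyc M)"
  unfolding g2_def rint_def polyc_def using a0 b0 by (intro rescaled_poly_tail[OF M]) auto
 have r3: "rint M g3 <= en (tailc C M)"
  unfolding g3_def by (rule rint_kernel_far[OF M h C])
 have r0: "rint M g0 <= en (volc C M)" unfolding g0_def by (rule rint_near[OF M])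
 have "kernel_dist (e_kernel D) D M <= rint M (%th. ennreal ?k * g0 th + (en (gu / gl) * (g1 th + en (pc * t) * g2 th) + g3 th))"
  unfolding kernel_dist_def using rint_mono[OF pt] by (simp add: rint_def)
 also have "... = ennreal ?k * rint M g0 + (en (gu / gl) * (rint M g1 + en (pc * t) * rint M g2) + rint M g3)"
  by (simp add: rint_add rint_cmult)
 also have "... <= ennreal ?k * en (volc C M) + (en (gu / gl) * (en (tailc C M) + en (pc * t) * en (polyc M)) + en (tailc C M))"
  by (intro add_mono mult_left_mono r0 r1 r2 r3) auto
 also have "... = en (?k * volc C M + (gu / gl * (tailc C M + pc * t * polyc M) + tailc C M))"
  using k0 gg volc_nonneg tailc_nonneg polyc_nonneg
  by (simp only: ennreal_plus ennreal_mult' mult_nonneg_nonneg add_nonneg_nonneg)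
 finally show ?thesis by (simp only: add.assoc)
qed

subsection \<open>The quasi-likelihood as a kernel\<close>

definition q_exp :: "(nat => 'd) => (nat => real) => real" where
 "q_exp D th = exp (- (real n / 2) * (avg_mom n X D th \<star> (minv (wt X D) *\<^sub>v avg_mom n X D th)))"

definition q_kernel :: "(nat => 'd) => (nat => real) => real" where
 "q_kernel D th = exp (resid n X D / 2) * q_exp D th"

definition fluct_near :: "real => nat set => (nat => 'd) => ennreal" where
 "fluct_near C M D = rint M (%th. en ((vnorm (fluct D th))\<^sup>2) * indicator (submodel X M \<inter> {th. rad th < C}) th)"

definition tail_far :: "real => nat set => (nat => 'd) => ennreal" where
 "tail_far C M D = rint M (%th. en (exp (- (real n * (1 / b) / 2) * (vnorm (avg_mom n X D th))\<^sup>2)) * indicator (submodel X M \<inter> {th. C <= rad th}) th)"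

lemma avg_index_measurable:
 assumes D: "D : space SL" and k: "k < m"
 shows "(%th. avg_mom n X D th $ k) : bm borel"
 using measurable_compose[OF measurable_Pair1'[OF D] avg_pair_measurable[OF k]] by simp

lemma vnorm_avg_measurable:
 assumes D: "D : space SL"
 shows "(%th. vnorm (avg_mom n X D th)) : bm borel"
 by (rule vnorm_measurable[OF avg_mom_carrier avg_index_measurable[OF D]])

lemma q_exp_measurable:
 assumes D: "D : space SL" and wt: "form_in m (wt X D) a b"
 shows "q_exp D : bm borel"
proof -
 have W: "minv (wt X D) : carrier_mat m m" by (rule minv_mult_vec(1)[OF wt a0])
 note [measurable] = avg_index_measurable[OF D]
 show ?thesis unfolding q_exp_def[abs_def] dot_mult_mat_vec_sum[OF W avg_mom_carrier avg_mom_carrier] by measurable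
qed

lemma q_exp_le:
 assumes wt: "form_in m (wt X D) a b"
 shows "q_exp D th <= exp (- (real n * (1 / b) / 2) * (vnorm (avg_mom n X D th))\<^sup>2)"
proof -
 have "real n / 2 * (1 / b * (vnorm (avg_mom n X D th))\<^sup>2) <= real n / 2 * (avg_mom n X D th \<star> (minv (wt X D) *\<^sub>v avg_mom n X D th))"
  by (intro mult_left_mono form_inD(3)[OF form_in_minv[OF wt a0 b0]]) auto
 then show ?thesis by (simp add: q_exp_def)
qed

lemma fluct_measurable_theta:
 assumes D: "D : space SL" and M: "M <= {..<p}"
 shows "(%th. en ((vnorm (fluct D th))\<^sup>2) * indicator (submodel X M \<inter> {th. rad th < C}) th) : bm borel"
proof -
 have mean: "(%th. mean_mom X th $ k) : bm borel" if k: "k < m" for k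
 proof -
  interpret prob_space P by (rule prob_P)
  have "(%(th, d). mom X d th $ k) : bm (borel \<Otimes>\<^sub>M P)"
  using measurable_compose[OF measurable_pair_swap' mom_pair_measurable[OF k]] by (simp add: split_beta')
  from borel_measurable_lebesgue_integral[OF this] show ?thesis using k by (simp add: mean_mom_def)
 qed
 have "(%th. vnorm (fluct D th)) : bm borel"
  using avg_index_measurable[OF D] mean
  by (intro vnorm_measurable[OF fluct_carrier]) (simp add: fluct_def carrier_vecD[OF avg_mom_carrier] carrier_vecD[OF mean_mom_carrier])
 then show ?thesis by measurable
qed

lemma q_kernel_dist:
 assumes M: "M <= {..<p}" "true_model X <= M" and D: "D : space SL"
  and ball: "{th : Rn p. dist0 X th < C / rn} <= par_space X"
  and wt: "form_in m (wt X D) a b"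
  and e: "!!x y. x : carrier_vec m ==> y : carrier_vec m ==>
  \<bar>x \<star> (wt X D *\<^sub>v y) - x \<star> (var_mom X th0 *\<^sub>v y)\<bar> <= e * vnorm x * vnorm y" "0 <= e"
  and taylor: "!!th. th : ball0 X (C / rn) ==>
  rn * vnorm (mean_mom X th - jac X th0 *\<^sub>v vec p (dev X th)) <= r"
  and r: "0 <= r" and ze: "0 < ze"
  and T: "vnorm (score n X D) <= T" and R: "resid n X D <= R"
  and Y: "Y = T + sqrt b * C"
  and h: "nrm p (centre D) <= T'" and C: "2 * T' <= C" "0 <= C"
  and fl: "fluct_near C M D <= en ph" "0 <= ph" and tf: "tail_far C M D <= en \<upsilon>" "0 <= \<upsilon>"
 shows "kernel_dist (q_kernel D) D M <= en (exp (R / 2) *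
  (((ze + 2 * (Y\<^sup>2 / ze + 1) * r\<^sup>2) / a + e * Y\<^sup>2 / a\<^sup>2) * volc C M + 2 * (Y\<^sup>2 / ze + 1) / a * ph + \<upsilon>) + tailc C M)"
proof -
 let ?s = "rn" and ?\<psi> = "gauss_kernel n X D" and ?S = "submodel X M"
 let ?z = "Y\<^sup>2 / ze + 1"
 let ?k1 = "(ze + 2 * ?z * r\<^sup>2) / a + e * Y\<^sup>2 / a\<^sup>2" and ?k2 = "2 * ?z / a"
 have T0: "0 <= T" using T by (meson vnorm_nonneg order_trans)
 have Y0: "0 <= Y" using T0 C b0 by (simp add: Y)
 have z0: "0 <= ?z" using ze by simp
 have k0: "0 <= ?k1" "0 <= ?k2" using ze z0 a0 e(2) by auto
 have R0: "exp (resid n X D / 2) <= exp (R / 2)" using R by simp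
 define g0 where "g0 th = (indicator {th. rad th < C} th :: ennreal)" for th
 define g1 where "g1 th = en ((vnorm (fluct D th))\<^sup>2) * indicator (?S \<inter> {th. rad th < C}) th" for th
 define g2 where "g2 th = en (exp (- (real n * (1 / b) / 2) * (vnorm (avg_mom n X D th))\<^sup>2)) * indicator (?S \<inter> {th. C <= rad th}) th" for th
 define g3 where "g3 th = en (?\<psi> th) * indicator {th. C <= rad th} th" for th
 note [measurable] = vnorm_avg_measurable[OF D]
 have [measurable]: "g0 : bm borel" "g2 : bm borel" "g3 : bm borel"
  unfolding g0_def[abs_def] g2_def[abs_def] g3_def[abs_def] by measurable
 have [measurable]: "g1 : bm borel"
  unfolding g1_def[abs_def] by (rule fluct_measurable_theta[OF D M(1)])
 have pt: "AE th in leb M. en \<bar>q_kernel D th - ?\<psi> th\<bar> * indicator ?S th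
  <= en (exp (R / 2)) * (ennreal ?k1 * g0 th + ennreal ?k2 * g1 th + g2 th) + g3 th"
  using AE_near_submodel[OF M(1) ball]
 proof eventually_elim
  case (elim th)
  show ?case
  proof (cases "rad th < C")
  case True
  then have S: "th : ?S" "th : ball0 X (C / ?s)" using elim by auto
  let ?u = "?s \<cdot>\<^sub>v vec p (dev X th)"
  define y where "y = ?s \<cdot>\<^sub>v avg_mom n X D th"
  define y0 where "y0 = score n X D + jac X th0 *\<^sub>v ?u"
  let ?V = "minv (wt X D)" and ?W = "W th0"
  have G: "jac X th0 : carrier_mat m p" by (rule jac_carrier[OF true_par_in])
  have Gu: "jac X th0 *\<^sub>v ?u : carrier_vec m" using G by (intro mult_mat_vec_carrier) auto
  have yc: "y : carrier_vec m" and y0c: "y0 : carrier_vec m" using Gu by (simp_all add: y_def y0_def)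
  have fv: "form_in m ?V (1 / b) (1 / a)" by (rule form_in_minv[OF wt a0 b0])
  have ny0: "vnorm y0 <= Y"
  proof -
  have "vnorm y0 <= vnorm (score n X D) + vnorm (jac X th0 *\<^sub>v ?u)"
  unfolding y0_def using Gu by (intro vnorm_triangle[of _ m]) auto
  also have "vnorm (jac X th0 *\<^sub>v ?u) <= sqrt b * vnorm ?u" by (rule vnorm_jac_le[OF true_par_in]) simp
  also have "vnorm ?u = rad th" by (simp add: vnorm_smult rad_def dist0_dev)
  also have "sqrt b * rad th <= sqrt b * C" using True b0 by (intro mult_left_mono) auto
  finally show ?thesis using T by (simp add: Y)
  qed
  have diff: "y - y0 = fluct D th + ?s \<cdot>\<^sub>v (mean_mom X th - jac X th0 *\<^sub>v vec p (dev X th))"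
  using G unfolding y_def y0_def score_def fluct_def mult_mat_vec[OF G vec_carrier]
  by (intro eq_vecI) (auto simp: carrier_vecD[OF avg_mom_carrier] carrier_vecD[OF mean_mom_carrier] algebra_simps)
  have ndiff: "vnorm (y - y0) <= vnorm (fluct D th) + r"
  proof -
  have Gd: "jac X th0 *\<^sub>v vec p (dev X th) : carrier_vec m" using G by (intro mult_mat_vec_carrier) auto
  have "vnorm (y - y0) <= vnorm (fluct D th) + vnorm (?s \<cdot>\<^sub>v (mean_mom X th - jac X th0 *\<^sub>v vec p (dev X th)))"
  unfolding diff using Gd by (intro vnorm_triangle[of _ m]) auto
  then show ?thesis using taylor[OF S(2)] by (simp add: vnorm_smult)
  qed
  let ?d = "vnorm (y - y0)" and ?f = "vnorm (fluct D th)"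
  have d2: "?d\<^sup>2 <= 2 * ?f\<^sup>2 + 2 * r\<^sup>2"
  proof -
  have "?d\<^sup>2 <= (?f + r)\<^sup>2" using ndiff by (intro power_mono) auto
  also have "... <= 2 * ?f\<^sup>2 + 2 * r\<^sup>2" using zero_le_power2[of "?f - r"] by (simp add: power2_eq_square algebra_simps)
  finally show ?thesis .
  qed
  have ny: "vnorm y <= Y + ?d" using vnorm_diff_triangle[OF yc y0c] ny0 by linarith
  have q1: "\<bar>y \<star> (?V *\<^sub>v y) - y0 \<star> (?V *\<^sub>v y0)\<bar> <= (2 * ?z * ?f\<^sup>2 + (ze + 2 * ?z * r\<^sup>2)) / a"
  proof -
  have "\<bar>y \<star> (?V *\<^sub>v y) - y0 \<star> (?V *\<^sub>v y0)\<bar> <= 1 / a * ?d * (vnorm y + vnorm y0)"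
  using b0 by (intro form_diff_le[OF fv _ yc y0c]) simp
  also have "... <= 1 / a * ?d * ((Y + ?d) + Y)"
  using ny ny0 a0 by (intro mult_left_mono add_mono) auto
  also have "... = 1 / a * (2 * (Y * ?d) + ?d\<^sup>2)" by (simp add: power2_eq_square algebra_simps)
  also have "... <= 1 / a * (ze + ?z * ?d\<^sup>2)"
  proof (intro mult_left_mono)
  have "0 <= (ze - Y * ?d)\<^sup>2 / ze" using ze by simp
  also have "... = ze - 2 * (Y * ?d) + Y\<^sup>2 / ze * ?d\<^sup>2" using ze by (simp add: power2_eq_square field_simps)
  finally show "2 * (Y * ?d) + ?d\<^sup>2 <= ze + ?z * ?d\<^sup>2" by (simp add: distrib_right)
  qed (use a0 in auto)
  also have "... <= 1 / a * (ze + ?z * (2 * ?f\<^sup>2 + 2 * r\<^sup>2))"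
  using d2 z0 a0 by (intro mult_left_mono add_left_mono) auto
  also have "... = (2 * ?z * ?f\<^sup>2 + (ze + 2 * ?z * r\<^sup>2)) / a"
  proof -
  have "1 / k * (z + w * (2 * u + 2 * v)) = (2 * w * u + (z + 2 * w * v)) / k" for k z w u v :: real
  by (simp add: algebra_simps add_divide_distrib)
  then show ?thesis .
  qed
  finally show ?thesis .
  qed
  have q2: "\<bar>y0 \<star> (?V *\<^sub>v y0) - y0 \<star> (?W *\<^sub>v y0)\<bar> <= e * Y\<^sup>2 / a\<^sup>2"
  proof -
  have "\<bar>y0 \<star> (?V *\<^sub>v y0) - y0 \<star> (?W *\<^sub>v y0)\<bar> <= e / a\<^sup>2 * (vnorm y0)\<^sup>2"
  by (rule minv_form_perturb[OF wt form_V[OF true_par_in] a0 y0c e])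
  also have "... <= e / a\<^sup>2 * Y\<^sup>2" using ny0 e(2) by (intro mult_left_mono power_mono) auto
  finally show ?thesis by simp
  qed
  have qexp: "q_exp D th = exp (- (y \<star> (?V *\<^sub>v y) / 2))"
  unfolding y_def form_smult[OF form_inD(1)[OF fv] avg_mom_carrier] using n_pos by (simp add: q_exp_def)
  have psi: "?\<psi> th = exp (resid n X D / 2) * exp (- (y0 \<star> (?W *\<^sub>v y0) / 2))"
  using complete_square[of D th] by (simp add: gauss_kernel_def y0_def add_divide_distrib flip: exp_add)
  have l: "0 <= y \<star> (?V *\<^sub>v y) / 2" "0 <= y0 \<star> (?W *\<^sub>v y0) / 2"
  proof -
  have "0 <= 1 / b * (vnorm v)\<^sup>2" for v using b0 by simp
  from order_trans[OF this form_inD(3)[OF fv yc]] order_trans[OF this form_inD(3)[OF form_W[OF true_par_in] y0c]]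
  show "0 <= y \<star> (?V *\<^sub>v y) / 2" "0 <= y0 \<star> (?W *\<^sub>v y0) / 2" by simp_all
  qed
  have "\<bar>exp (- (y \<star> (?V *\<^sub>v y) / 2)) - exp (- (y0 \<star> (?W *\<^sub>v y0) / 2))\<bar> <= exp (- 0) * \<bar>y \<star> (?V *\<^sub>v y) / 2 - y0 \<star> (?W *\<^sub>v y0) / 2\<bar>"
  by (rule abs_exp_diff_le[OF l])
  also have "... = \<bar>y \<star> (?V *\<^sub>v y) - y0 \<star> (?W *\<^sub>v y0)\<bar> / 2" by (simp flip: diff_divide_distrib)
  also have "... <= \<bar>y \<star> (?V *\<^sub>v y) - y0 \<star> (?W *\<^sub>v y0)\<bar>" by simp
  also have "... <= (2 * ?z * ?f\<^sup>2 + (ze + 2 * ?z * r\<^sup>2)) / a + e * Y\<^sup>2 / a\<^sup>2" using q1 q2 by linarith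
  also have "... = ?k1 + ?k2 * ?f\<^sup>2"
  proof -
  have "(2 * w * u + v) / k + x = v / k + x + 2 * w / k * u" for u v w x k :: real
  by (simp add: add_divide_distrib)
  then show ?thesis .
  qed
  finally have core: "\<bar>exp (- (y \<star> (?V *\<^sub>v y) / 2)) - exp (- (y0 \<star> (?W *\<^sub>v y0) / 2))\<bar> <= ?k1 + ?k2 * ?f\<^sup>2" .
  have "\<bar>q_kernel D th - ?\<psi> th\<bar> = exp (resid n X D / 2) * \<bar>exp (- (y \<star> (?V *\<^sub>v y) / 2)) - exp (- (y0 \<star> (?W *\<^sub>v y0) / 2))\<bar>"
  unfolding q_kernel_def qexp psi by (simp add: abs_mult flip: right_diff_distrib)
  also have "... <= exp (R / 2) * (?k1 + ?k2 * ?f\<^sup>2)" using R0 core by (intro mult_mono) auto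
  finally have "en \<bar>q_kernel D th - ?\<psi> th\<bar> <= en (exp (R / 2) * (?k1 + ?k2 * ?f\<^sup>2))" by (rule ennreal_leI)
  also have "... = en (exp (R / 2)) * (ennreal ?k1 + ennreal ?k2 * en (?f\<^sup>2))"
  proof -
  have "en (u * (v + w * x)) = en u * (en v + en w * en x)" if "0 <= u" "0 <= v" "0 <= w" "0 <= x" for u v w x
  using that by (simp only: ennreal_plus ennreal_mult' mult_nonneg_nonneg)
  from this[OF exp_ge_zero k0 zero_le_power2] show ?thesis .
  qed
  finally show ?thesis using S True by (simp add: g0_def g1_def g2_def g3_def)
  next
  case False
  then have f: "C <= rad th" by simp
  show ?thesis
  proof (cases "th : ?S")
  case True
  let ?q = "exp (- (real n * (1 / b) / 2) * (vnorm (avg_mom n X D th))\<^sup>2)"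
  have q0: "0 <= q_exp D th" by (simp add: q_exp_def)
  then have "0 <= q_kernel D th" by (simp add: q_kernel_def)
  moreover have "q_kernel D th <= exp (R / 2) * ?q"
  unfolding q_kernel_def using R0 q_exp_le[OF wt] q0 by (intro mult_mono) auto
  ultimately have "\<bar>q_kernel D th - ?\<psi> th\<bar> <= exp (R / 2) * ?q + ?\<psi> th"
  using gauss_kernel_nonneg[of D th] by linarith
  then have "en \<bar>q_kernel D th - ?\<psi> th\<bar> <= en (exp (R / 2) * ?q + ?\<psi> th)" by (rule ennreal_leI)
  also have "... = en (exp (R / 2)) * ennreal ?q + en (?\<psi> th)"
  by (simp only: ennreal_plus ennreal_mult' exp_ge_zero gauss_kernel_nonneg mult_nonneg_nonneg)
  finally show ?thesis using True f by (simp add: g0_def g1_def g2_def g3_def)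
  qed simp
  qed
 qed
 have r0: "rint M g0 <= en (volc C M)" unfolding g0_def by (rule rint_near[OF M])
 have r1: "rint M g1 <= en ph" using fl(1) unfolding fluct_near_def g1_def .
 have r2: "rint M g2 <= en \<upsilon>" using tf(1) unfolding tail_far_def g2_def .
 have r3: "rint M g3 <= en (tailc C M)" unfolding g3_def by (rule rint_kernel_far[OF M h C])
 have "kernel_dist (q_kernel D) D M <= rint M (%th. en (exp (R / 2)) * (ennreal ?k1 * g0 th + ennreal ?k2 * g1 th + g2 th) + g3 th)"
  unfolding kernel_dist_def using rint_mono[OF pt] by (simp add: rint_def)
 also have "... = en (exp (R / 2)) * (ennreal ?k1 * rint M g0 + ennreal ?k2 * rint M g1 + rint M g2) + rint M g3"
  by (simp add: rint_add rint_cmult)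
 also have "... <= en (exp (R / 2)) * (ennreal ?k1 * en (volc C M) + ennreal ?k2 * en ph + en \<upsilon>) + en (tailc C M)"
  by (intro add_mono mult_left_mono r0 r1 r2 r3) auto
 also have "... = en (exp (R / 2) * (?k1 * volc C M + ?k2 * ph + \<upsilon>) + tailc C M)"
  using k0 fl(2) tf(2) volc_nonneg tailc_nonneg
  by (simp only: ennreal_plus ennreal_mult' mult_nonneg_nonneg add_nonneg_nonneg exp_ge_zero)
 finally show ?thesis .
qed

end

lemma det_measurable:
 fixes A :: "'x => real mat"
 assumes A: "!!x. A x : carrier_mat k k"
  and m: "!!i j. i < k ==> j < k ==> (%x. A x $$ (i, j)) : bm N"
 shows "(%x. Determinant.det (A x)) : bm N"
proof -
 have "Determinant.det (A x) = (\<Sum>q\<in>{q. q permutes {0..<k}}. signof q * (\<Prod>i = 0..<k. A x $$ (i, q i)))" for x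
  using A[of x] by (simp add: Determinant.det_def')
 moreover have "(%x. \<Sum>q\<in>{q. q permutes {0..<k}}. signof q * (\<Prod>i = 0..<k. A x $$ (i, q i))) : bm N"
 proof (intro borel_measurable_sum borel_measurable_times borel_measurable_const borel_measurable_prod m)
  fix q i assume q: "q : {q. q permutes {0..<k}}" and i: "i : {0..<k}"
  show "i < k" using i by simp
  have "q i : {0..<k}" using q i permutes_in_image[of q "{0..<k}" i] by simp
  then show "q i < k" by simp
 qed
 ultimately show ?thesis by simp
qed

lemma minv_entry_measurable:
 fixes A :: "'x => real mat"
 assumes A: "!!x. A x : carrier_mat k k"
  and m: "!!i j. i < k ==> j < k ==> (%x. A x $$ (i, j)) : bm N"
  and inj: "!!x v. x : space N ==> v : carrier_vec k ==> A x *\<^sub>v v = 0\<^sub>v k ==> v = 0\<^sub>v k"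
  and ij: "i < k" "j < k"
 shows "(%x. minv (A x) $$ (i, j)) : bm N"
proof -
 have eq: "minv (A x) $$ (i, j) = (1 / Determinant.det (A x)) * ((- 1) ^ (j + i) * Determinant.det (mat_delete (A x) j i))"
  if "x : space N" for x
  using minv_eq_adj_mat[OF A inj[OF that]] A[of x] ij by (simp add: adj_mat_def cofactor_def)
 have del: "mat_delete (A x) j i : carrier_mat (k - 1) (k - 1)" for x
  using A[of x] by (rule mat_delete_carrier)
 have "(%x. Determinant.det (mat_delete (A x) j i)) : bm N"
 proof (rule det_measurable[OF del])
  fix i' j' assume ij': "i' < k - 1" "j' < k - 1"
  have "mat_delete (A x) j i $$ (i', j') = A x $$ (if i' < j then i' else Suc i', if j' < i then j' else Suc j')" for x
  using A[of x] ij' by (simp add: mat_delete_def)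
  then show "(%x. mat_delete (A x) j i $$ (i', j')) : bm N" using ij' by (simp add: m)
 qed
 then have "(%x. (1 / Determinant.det (A x)) * ((- 1) ^ (j + i) * Determinant.det (mat_delete (A x) j i))) : bm N"
  using det_measurable[of A k N] A m by simp
 then show ?thesis using eq by (subst measurable_cong) auto
qed

context bounded_gmm
begin

section \<open>Expectations of the error terms\<close>

lemma mean_measurable:
 assumes k: "k < m"
 shows "(%th. mean_mom X th $ k) : bm borel"
proof -
 interpret prob_space P by (rule prob_P)
 have "(%(th, d). mom X d th $ k) : bm (borel \<Otimes>\<^sub>M P)"
  using measurable_compose[OF measurable_pair_swap' mom_pair_measurable[OF k]] by (simp add: split_beta')
 from borel_measurable_lebesgue_integral[OF this] show ?thesis using k by (simp add: mean_mom_def)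
qed

lemma vnorm_fluct_pair: "(%z. vnorm (fluct (fst z) (snd z))) : bm (SL \<Otimes>\<^sub>M borel)"
proof (rule vnorm_measurable[OF fluct_carrier])
 fix k assume k: "k < m"
 note [measurable] = avg_pair_measurable[OF k] measurable_compose[OF measurable_snd mean_measurable[OF k]]
  measurable_compose[OF measurable_fst avg_measurable[OF k]]
 show "(%z. fluct (fst z) (snd z) $ k) : bm (SL \<Otimes>\<^sub>M borel)"
  using k by (simp add: fluct_def carrier_vecD[OF avg_mom_carrier] carrier_vecD[OF mean_mom_carrier])
qed

lemma vnorm_avg_pair: "(%z. vnorm (avg_mom n X (fst z) (snd z))) : bm (SL \<Otimes>\<^sub>M borel)"
 by (rule vnorm_measurable[OF avg_mom_carrier avg_pair_measurable])

lemma pair_leb_cong: "bm (SL \<Otimes>\<^sub>M leb M) = bm (SL \<Otimes>\<^sub>M borel)"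
 by (intro measurable_cong_sets sets_pair_measure_cong) simp_all

lemma rint_measurable:
 fixes g :: "(nat => 'd) => (nat => real) => ennreal"
 assumes M: "finite M" and g: "(%z. g (fst z) (snd z)) : bm (SL \<Otimes>\<^sub>M borel)"
 shows "(%D. rint M (g D)) : bm SL"
proof -
 interpret sigma_finite_measure "leb M" by (rule sigma_finite_leb[OF M])
 have "(%(D, th). g D th) : bm (SL \<Otimes>\<^sub>M leb M)"
  unfolding pair_leb_cong using g by (simp add: split_beta')
 then have "(%D. \<integral>\<^sup>+th. g D th \<partial>leb M) : bm SL"
  by (rule borel_measurable_nn_integral)
 then show ?thesis unfolding rint_def by simp
qed

lemma rint_Tonelli:
 fixes g :: "(nat => 'd) => (nat => real) => ennreal"
 assumes M: "finite M" and g: "(%z. g (fst z) (snd z)) : bm (SL \<Otimes>\<^sub>M borel)"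
 shows "(\<integral>\<^sup>+D. rint M (g D) \<partial>SL) = rint M (%th. \<integral>\<^sup>+D. g D th \<partial>SL)"
proof -
 interpret A: prob_space SL by (rule prob_SL)
 interpret B: sigma_finite_measure "leb M" by (rule sigma_finite_leb[OF M])
 interpret AB: pair_sigma_finite SL "leb M" ..
 have g': "(%(D, th). g D th) : bm (SL \<Otimes>\<^sub>M leb M)"
  unfolding pair_leb_cong using g by (simp add: split_beta')
 have m: "(%D. \<integral>\<^sup>+th. g D th \<partial>leb M) : bm SL"
  by (rule B.borel_measurable_nn_integral[OF g'])
 have "(\<integral>\<^sup>+D. rint M (g D) \<partial>SL) = en (sc M) * (\<integral>\<^sup>+D. (\<integral>\<^sup>+th. g D th \<partial>leb M) \<partial>SL)"
  unfolding rint_def by (rule nn_integral_cmult[OF m])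
 also have "(\<integral>\<^sup>+D. (\<integral>\<^sup>+th. g D th \<partial>leb M) \<partial>SL) = (\<integral>\<^sup>+th. (\<integral>\<^sup>+D. g D th \<partial>SL) \<partial>leb M)"
  using AB.Fubini'[OF g'] by simp
 finally show ?thesis by (simp add: rint_def)
qed

lemma fluct_near_expectation:
 assumes M: "M <= {..<p}" "true_model X <= M"
  and h: "!!th et. th : submodel X M ==> rad th < C ==> et : unit_vecs m ==> L2_norm P (mom_diff X et th) <= h"
 shows "fluct_near C M : bm SL"
  and "(\<integral>\<^sup>+D. fluct_near C M D \<partial>SL) <= en (real m * h\<^sup>2 * volc C M)"
proof -
 have fin: "finite M" using M(1) finite_subset by blast
 let ?g = "%D th. en ((vnorm (fluct D th))\<^sup>2) * indicator (submodel X M \<inter> {th. rad th < C}) th"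
 note [measurable] = vnorm_fluct_pair
 have g: "(%z. ?g (fst z) (snd z)) : bm (SL \<Otimes>\<^sub>M borel)" by measurable
 show "fluct_near C M : bm SL"
  using rint_measurable[OF fin g] by (simp add: fluct_near_def[abs_def])
 have "(\<integral>\<^sup>+D. fluct_near C M D \<partial>SL) = rint M (%th. \<integral>\<^sup>+D. ?g D th \<partial>SL)"
  unfolding fluct_near_def by (rule rint_Tonelli[OF fin g])
 also have "... <= rint M (%th. en (real m * h\<^sup>2) * indicator {th. rad th < C} th)"
 proof (intro rint_mono AE_I2)
  fix th
  show "(\<integral>\<^sup>+D. ?g D th \<partial>SL) <= en (real m * h\<^sup>2) * indicator {th. rad th < C} th"
  proof (cases "th : submodel X M & rad th < C")
  case True
  then have "th : par_space X" by (simp add: submodel_def)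
  from fluct_second_moment[OF this h] True show ?thesis by simp
  next
  case False
  then have "indicator (submodel X M \<inter> {th. rad th < C}) th = (0 :: ennreal)" by auto
  then show ?thesis by simp
  qed
 qed
 also have "... = en (real m * h\<^sup>2) * rint M (%th. indicator {th. rad th < C} th)"
  by (rule rint_cmult) measurable
 also have "... <= en (real m * h\<^sup>2) * en (volc C M)"
  by (intro mult_left_mono rint_near[OF M]) simp
 also have "... = en (real m * h\<^sup>2 * volc C M)" by (rule ennreal_mult'[symmetric]) simp
 finally show "(\<integral>\<^sup>+D. fluct_near C M D \<partial>SL) <= en (real m * h\<^sup>2 * volc C M)" .
qed

definition good :: "real => real => (nat => 'd) set" where
 "good T L = {D : space SL. vnorm (score n X D) <= T & (\<Sum>i<n. (F (D i))\<^sup>2) <= real n * L}"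

lemma good_measurable [measurable]: "good T L : sets SL"
 unfolding good_def by measurable

definition rate :: "real => real" where
 "rate L = 1 / b * (1 / (1 + 2 * (1 / b) * (L + K))) * ka\<^sup>2"

lemma rate_pos: "0 <= L ==> 0 < rate L"
 using b0 ka0 K0 by (simp add: rate_def add_pos_nonneg)

lemma tail_point:
 assumes th: "th : par_space X" and far: "4 * T / ka <= rad th" "0 < rad th" and L: "0 <= L" and T: "0 <= T"
 shows "(\<integral>\<^sup>+D. en (exp (- (real n * (1 / b) / 2) * (vnorm (avg_mom n X D th))\<^sup>2)) * indicator (good T L) D \<partial>SL)
  <= en (exp (- (rate L / 4) * (rad th)\<^sup>2))"
proof -
 define \<nu> where "\<nu> = 1 / b"
 define \<sigma> where "\<sigma> = 1 / (1 + 2 * \<nu> * (L + K))"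
 define \<mu> where "\<mu> = ka * dist0 X th"
 define s where "s = \<sigma> * \<mu>"
 define t where "t = T / rn"
 define \<rho> where "\<rho> = \<nu> * s * L"
 have \<nu>0: "0 < \<nu>" using b0 by (simp add: \<nu>_def)
 have den: "0 < 1 + 2 * \<nu> * (L + K)" using \<nu>0 L K0 by (intro add_pos_nonneg) auto
 have \<sigma>0: "0 < \<sigma>" using den by (simp add: \<sigma>_def)
 have d0: "0 < dist0 X th" using far(2) n_pos by (simp add: rad_def zero_less_mult_iff)
 have \<mu>0: "0 < \<mu>" using d0 ka0 by (simp add: \<mu>_def)
 have s0: "0 < s" using \<sigma>0 \<mu>0 by (simp add: s_def)
 have \<mu>le: "\<mu> <= vnorm (mean_mom X th)" using ident[OF th] by (simp add: \<mu>_def)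
 have G1: "vnorm (avg_mom n X D th0) <= t" if "D : good T L" for D
  using that n_pos by (simp add: good_def score_def vnorm_smult t_def field_simps)
 have G2: "(\<Sum>i<n. if 1 / (\<nu> * s) < F (D i) then F (D i) else 0) <= real n * \<rho>" if D: "D : good T L" for D
 proof -
  have B0: "0 < \<nu> * s" using \<nu>0 s0 by simp
  have "(\<Sum>i<n. if 1 / (\<nu> * s) < F (D i) then F (D i) else 0) <= (\<Sum>i<n. \<nu> * s * (F (D i))\<^sup>2)"
  proof (rule sum_mono)
  fix i
  show "(if 1 / (\<nu> * s) < F (D i) then F (D i) else 0) <= \<nu> * s * (F (D i))\<^sup>2"
  proof (cases "1 / (\<nu> * s) < F (D i)")
  case True
  then have 1: "1 <= \<nu> * s * F (D i)" using B0 by (simp add: field_simps)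
  have "0 < 1 / (\<nu> * s)" using B0 by simp
  then have "0 < F (D i)" using True by linarith
  then have "1 * F (D i) <= \<nu> * s * F (D i) * F (D i)" using 1 by (intro mult_right_mono) auto
  then show ?thesis using True by (simp add: power2_eq_square mult.assoc)
  qed (use B0 in simp)
  qed
  also have "... = \<nu> * s * (\<Sum>i<n. (F (D i))\<^sup>2)" by (simp add: sum_distrib_left)
  also have "... <= \<nu> * s * (real n * L)" using D B0 by (intro mult_left_mono) (auto simp: good_def)
  finally show ?thesis by (simp add: \<rho>_def mult_ac)
 qed
 have "(\<integral>\<^sup>+D. en (exp (- (real n * \<nu> / 2) * (vnorm (avg_mom n X D th))\<^sup>2)) * indicator (good T L) D \<partial>SL)
  <= en (exp (real n * (\<nu> * s\<^sup>2 / 2 + \<nu> * s * (t + \<rho>) - \<nu> * s * \<mu> + \<nu>\<^sup>2 * s\<^sup>2 * K)))"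
  by (rule tail_expectation[OF th \<mu>0 \<mu>le \<nu>0 s0 refl G1 G2])
 also have "... <= en (exp (- (rate L / 4) * (rad th)\<^sup>2))"
 proof (intro ennreal_leI, subst exp_le_cancel_iff)
  have "\<nu> * s\<^sup>2 / 2 + \<nu> * s * (t + \<rho>) - \<nu> * s * \<mu> + \<nu>\<^sup>2 * s\<^sup>2 * K
  = \<nu> * \<sigma> * \<mu>\<^sup>2 * (\<sigma> * (1 / 2 + \<nu> * L + \<nu> * K) - 1) + \<nu> * \<sigma> * \<mu> * t"
  by (simp add: s_def \<rho>_def power2_eq_square algebra_simps)
  also have "... <= \<nu> * \<sigma> * \<mu>\<^sup>2 * (- 1 / 2) + \<nu> * \<sigma> * \<mu> * t"
  proof (intro add_right_mono mult_left_mono)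
  have "1 / 2 + \<nu> * L + \<nu> * K = (1 + 2 * \<nu> * (L + K)) / 2" by (simp add: distrib_left)
  moreover have "\<sigma> * ((1 + 2 * \<nu> * (L + K)) / 2) = 1 / 2" using den by (simp add: \<sigma>_def)
  ultimately have "\<sigma> * (1 / 2 + \<nu> * L + \<nu> * K) = 1 / 2" by presburger
  then show "\<sigma> * (1 / 2 + \<nu> * L + \<nu> * K) - 1 <= - 1 / 2" by linarith
  qed (use \<nu>0 \<sigma>0 in auto)
  finally have "real n * (\<nu> * s\<^sup>2 / 2 + \<nu> * s * (t + \<rho>) - \<nu> * s * \<mu> + \<nu>\<^sup>2 * s\<^sup>2 * K)
  <= real n * (\<nu> * \<sigma> * \<mu>\<^sup>2 * (- 1 / 2) + \<nu> * \<sigma> * \<mu> * t)" by (intro mult_left_mono) auto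
  also have "... = \<nu> * \<sigma> * (ka * rad th * T - (ka * rad th)\<^sup>2 / 2)"
  proof -
  have nt: "real n * t = rn * T"
  proof -
  have "real n * t = (real n / rn) * T" by (simp add: t_def)
  then show ?thesis using n_pos by (simp only: real_div_sqrt of_nat_0_le_iff)
  qed
  have nm: "real n * \<mu>\<^sup>2 = (ka * rad th)\<^sup>2" by (simp add: \<mu>_def rad_def power_mult_distrib)
  have "real n * (\<nu> * \<sigma> * \<mu>\<^sup>2 * (- 1 / 2) + \<nu> * \<sigma> * \<mu> * t) = \<nu> * \<sigma> * (\<mu> * (real n * t) - (real n * \<mu>\<^sup>2) / 2)"
  by (simp add: algebra_simps)
  then show ?thesis unfolding nt nm by (simp add: \<mu>_def rad_def mult_ac)
  qed
  also have "... <= \<nu> * \<sigma> * ((ka * rad th)\<^sup>2 / 4 - (ka * rad th)\<^sup>2 / 2)"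
  proof (intro mult_left_mono diff_right_mono)
  have "T <= ka * rad th / 4" using far(1) ka0 by (simp add: field_simps)
  then have "ka * rad th * T <= ka * rad th * (ka * rad th / 4)" using ka0 by (intro mult_left_mono) auto
  then show "ka * rad th * T <= (ka * rad th)\<^sup>2 / 4" by (simp add: power2_eq_square)
  qed (use \<nu>0 \<sigma>0 in auto)
  also have "... = - (rate L / 4) * (rad th)\<^sup>2"
  by (simp add: rate_def \<nu>_def \<sigma>_def power_mult_distrib)
  finally show "real n * (\<nu> * s\<^sup>2 / 2 + \<nu> * s * (t + \<rho>) - \<nu> * s * \<mu> + \<nu>\<^sup>2 * s\<^sup>2 * K) <= - (rate L / 4) * (rad th)\<^sup>2" .
 qed
 finally show ?thesis by (simp add: \<nu>_def)
qed

lemma tail_far_expectation: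
 assumes M: "M <= {..<p}" "true_model X <= M"
  and L: "0 <= L" and T: "0 <= T" and C: "4 * T / ka <= C" "0 < C"
 shows "tail_far C M : bm SL"
  and "(\<integral>\<^sup>+D. tail_far C M D * indicator (good T L) D \<partial>SL)
  <= en (exp (- (rate L / 4) * C\<^sup>2 / 2) * sqrt (2 * pi / (rate L / 4)) ^ card M)"
proof -
 have fin: "finite M" using M(1) finite_subset by blast
 let ?e = "%D th. en (exp (- (real n * (1 / b) / 2) * (vnorm (avg_mom n X D th))\<^sup>2))"
 let ?g = "%D th. ?e D th * indicator (submodel X M \<inter> {th. C <= rad th}) th"
 let ?h = "%D th. indicator (good T L) D * ?g D th"
 note [measurable] = vnorm_avg_pair
 have g: "(%z. ?g (fst z) (snd z)) : bm (SL \<Otimes>\<^sub>M borel)" by measurable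
 have h: "(%z. ?h (fst z) (snd z)) : bm (SL \<Otimes>\<^sub>M borel)"
  by (rule borel_measurable_times_ennreal[OF measurable_compose[OF measurable_fst borel_measurable_indicator[OF good_measurable]] g])
 show "tail_far C M : bm SL"
  using rint_measurable[OF fin g] by (simp add: tail_far_def[abs_def])
 have "tail_far C M D * indicator (good T L) D = rint M (?h D)" for D
  by (cases "D : good T L") (simp_all add: tail_far_def rint_def)
 then have "(\<integral>\<^sup>+D. tail_far C M D * indicator (good T L) D \<partial>SL) = rint M (%th. \<integral>\<^sup>+D. ?h D th \<partial>SL)"
  using rint_Tonelli[OF fin h] by simp
 also have "... <= rint M (%th. en (exp (- (rate L / 4) * (rad th)\<^sup>2)) * indicator {th. C <= rad th} th)"
 proof (intro rint_mono AE_I2)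
  fix th
  show "(\<integral>\<^sup>+D. ?h D th \<partial>SL) <= en (exp (- (rate L / 4) * (rad th)\<^sup>2)) * indicator {th. C <= rad th} th"
  proof (cases "th : submodel X M & C <= rad th")
  case True
  then have "th : par_space X" by (simp add: submodel_def)
  from tail_point[OF this _ _ L T] True C show ?thesis by (simp add: mult.commute)
  next
  case False
  then have "indicator (submodel X M \<inter> {th. C <= rad th}) th = (0 :: ennreal)" by auto
  then show ?thesis by simp
  qed
 qed
 also have "... <= en (exp (- (rate L / 4) * C\<^sup>2 / 2) * sqrt (2 * pi / (rate L / 4)) ^ card M)"
  unfolding rint_def using rate_pos[OF L] C by (intro rescaled_gauss_tail[OF M]) auto
 finally show "(\<integral>\<^sup>+D. tail_far C M D * indicator (good T L) D \<partial>SL)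
  <= en (exp (- (rate L / 4) * C\<^sup>2 / 2) * sqrt (2 * pi / (rate L / 4)) ^ card M)" .
qed

text \<open>At a fixed distance from the true parameter the law of large numbers for the truncated envelope
 makes the exponential rate free of any probability level.\<close>

definition sep_rate :: "real => real" where
 "sep_rate v = 1 / b * (1 / (1 + 16 * (1 / b) * K)) * (ka * v)\<^sup>2 / 4"

definition sep_level :: "real => real" where
 "sep_level v = 1 / (1 / b * (1 / (1 + 16 * (1 / b) * K) * (ka * v)))"

definition sep_good :: "real => (nat => 'd) set" where
 "sep_good v = {D : space SL. vnorm (avg_mom n X D th0) <= ka * v / 8 &
  (\<Sum>i<n. if sep_level v < F (D i) then F (D i) else 0) <= real n * (ka * v / 8)}"

lemma sep_good_measurable [measurable]: "sep_good v : sets SL"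
proof -
 have [measurable]: "(%D. vnorm (avg_mom n X D th0)) : bm SL"
  by (rule vnorm_measurable[OF avg_mom_carrier avg_measurable])
 show ?thesis unfolding sep_good_def by measurable
qed

lemma sep_consts:
 assumes v: "0 < v"
 shows "0 < sep_level v" "0 < sep_rate v" "K / sep_level v <= ka * v / 16"
proof -
 have den: "0 < 1 + 16 * (1 / b) * K" using b0 K0 by (intro add_pos_nonneg) auto
 show "0 < sep_level v" "0 < sep_rate v" using den b0 ka0 v by (simp_all add: sep_level_def sep_rate_def)
 have "k / (1 + 16 * k) <= 1 / 16" if "0 <= k" for k :: real using that by (simp add: field_simps)
 from this[of "1 / b * K"] have le: "1 / b * K / (1 + 16 * (1 / b) * K) <= 1 / 16" using b0 K0 by simp
 have "K / sep_level v = (1 / b * K / (1 + 16 * (1 / b) * K)) * (ka * v)" by (simp add: sep_level_def)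
 also have "... <= 1 / 16 * (ka * v)"
  using ka0 v by (intro mult_right_mono le) auto
 finally show "K / sep_level v <= ka * v / 16" by simp
qed

lemma separated_point:
 assumes th: "th : par_space X" and v: "0 < v" "v <= dist0 X th"
 shows "(\<integral>\<^sup>+D. en (exp (- (real n * (1 / b) / 2) * (vnorm (avg_mom n X D th))\<^sup>2)) * indicator (sep_good v) D \<partial>SL)
  <= en (exp (- (sep_rate v) * real n))"
proof -
 define \<nu> where "\<nu> = 1 / b"
 define \<sigma> where "\<sigma> = 1 / (1 + 16 * \<nu> * K)"
 define \<mu> where "\<mu> = ka * v"
 define s where "s = \<sigma> * \<mu>"
 have \<nu>0: "0 < \<nu>" using b0 by (simp add: \<nu>_def)
 have den: "0 < 1 + 16 * \<nu> * K" using \<nu>0 K0 by (intro add_pos_nonneg) auto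
 have \<sigma>0: "0 < \<sigma>" using den by (simp add: \<sigma>_def)
 have \<mu>0: "0 < \<mu>" using v ka0 by (simp add: \<mu>_def)
 have s0: "0 < s" using \<sigma>0 \<mu>0 by (simp add: s_def)
 have "ka * v <= ka * dist0 X th" using v ka0 by (intro mult_left_mono) auto
 then have \<mu>le: "\<mu> <= vnorm (mean_mom X th)" using ident[OF th] by (simp add: \<mu>_def)
 have lev: "sep_level v = 1 / (\<nu> * s)" by (simp add: sep_level_def \<nu>_def s_def \<sigma>_def \<mu>_def)
 have "(\<integral>\<^sup>+D. en (exp (- (real n * \<nu> / 2) * (vnorm (avg_mom n X D th))\<^sup>2)) * indicator (sep_good v) D \<partial>SL)
  <= en (exp (real n * (\<nu> * s\<^sup>2 / 2 + \<nu> * s * (\<mu> / 8 + \<mu> / 8) - \<nu> * s * \<mu> + \<nu>\<^sup>2 * s\<^sup>2 * K)))"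
  by (rule tail_expectation[OF th \<mu>0 \<mu>le \<nu>0 s0 lev]) (simp_all add: sep_good_def \<mu>_def)
 also have "... <= en (exp (- (sep_rate v) * real n))"
 proof (intro ennreal_leI, subst exp_le_cancel_iff)
  have "\<nu> * s\<^sup>2 / 2 + \<nu> * s * (\<mu> / 8 + \<mu> / 8) - \<nu> * s * \<mu> + \<nu>\<^sup>2 * s\<^sup>2 * K = \<nu> * \<sigma> * \<mu>\<^sup>2 * (\<sigma> * (1 / 2 + \<nu> * K) + 1 / 4 - 1)"
  by (simp add: s_def power2_eq_square algebra_simps)
  also have "... <= \<nu> * \<sigma> * \<mu>\<^sup>2 * (- 1 / 4)"
  proof (intro mult_left_mono)
  have "(1 / 2 + \<nu> * K) <= (1 + 16 * \<nu> * K) / 2" using \<nu>0 K0 by simp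
  then have "\<sigma> * (1 / 2 + \<nu> * K) <= \<sigma> * ((1 + 16 * \<nu> * K) / 2)" using \<sigma>0 by (intro mult_left_mono) auto
  also have "... = 1 / 2" using den by (simp add: \<sigma>_def)
  finally show "\<sigma> * (1 / 2 + \<nu> * K) + 1 / 4 - 1 <= - 1 / 4" by simp
  qed (use \<nu>0 \<sigma>0 in auto)
  also have "... = - sep_rate v" by (simp add: sep_rate_def \<nu>_def \<sigma>_def \<mu>_def)
  finally have "real n * (\<nu> * s\<^sup>2 / 2 + \<nu> * s * (\<mu> / 8 + \<mu> / 8) - \<nu> * s * \<mu> + \<nu>\<^sup>2 * s\<^sup>2 * K) <= real n * (- sep_rate v)"
  by (intro mult_left_mono) auto
  then show "real n * (\<nu> * s\<^sup>2 / 2 + \<nu> * s * (\<mu> / 8 + \<mu> / 8) - \<nu> * s * \<mu> + \<nu>\<^sup>2 * s\<^sup>2 * K) <= - (sep_rate v) * real n"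
  by (simp add: mult.commute)
 qed
 finally show ?thesis by (simp add: \<nu>_def)
qed

section \<open>Marginal likelihoods\<close>

definition wint :: "((nat => real) => real) => nat set => real" where
 "wint f M = (LINT th:submodel X M|leb M. f th * par_prior X M th)"

lemma models_iff: "M : models X \<longleftrightarrow> M <= {..<p}"
 by (auto simp: models_def)

lemma prior_measurable: "M : models X ==> par_prior X M : bm borel"
 using str by (simp add: gmm_structure_def)

lemma prior_nonneg: "M : models X ==> th : submodel X M ==> 0 <= par_prior X M th"
 using str by (simp add: gmm_structure_def)

lemma prior_integrable:
 assumes M: "M : models X"
 shows "integrable (leb M) (%th. indicator (submodel X M) th * par_prior X M th)"
  and "(\<integral>th. indicator (submodel X M) th * par_prior X M th \<partial>leb M) = 1"
  and "(\<integral>\<^sup>+th. en (par_prior X M th) * indicator (submodel X M) th \<partial>leb M) = 1"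
proof -
 show one: "(\<integral>th. indicator (submodel X M) th * par_prior X M th \<partial>leb M) = 1"
  using str M by (simp add: gmm_structure_def set_lebesgue_integral_def)
 show int: "integrable (leb M) (%th. indicator (submodel X M) th * par_prior X M th)"
 proof (rule ccontr)
  assume "\<not> ?thesis"
  from not_integrable_integral_eq[OF this] one show False by simp
 qed
 have "(\<integral>\<^sup>+th. en (par_prior X M th) * indicator (submodel X M) th \<partial>leb M)
  = (\<integral>\<^sup>+th. en (indicator (submodel X M) th * par_prior X M th) \<partial>leb M)"
  by (intro nn_integral_cong) (auto simp: indicator_def)
 also have "... = en 1"
  unfolding one[symmetric] by (intro nn_integral_eq_integral int AE_I2) (auto simp: indicator_def prior_nonneg[OF M])
 finally show "(\<integral>\<^sup>+th. en (par_prior X M th) * indicator (submodel X M) th \<partial>leb M) = 1" by simp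
qed

lemma quasi_lik_eq:
 "quasi_lik n X D th = Determinant.det ((2 * pi / real n) \<cdot>\<^sub>m wt X D) powr (- 1 / 2) * q_exp D th"
 by (simp add: quasi_lik_def q_exp_def)

lemma q_exp_eq: "q_exp D th = exp (- resid n X D / 2) * q_kernel D th"
 by (simp add: q_kernel_def flip: exp_add mult.assoc)

lemma wint_cmult: "wint (%th. c * f th) M = c * wint f M"
 unfolding wint_def by (simp add: mult.assoc)

lemma marg_q_eq:
 "marg_q n X D M = Determinant.det ((2 * pi / real n) \<cdot>\<^sub>m wt X D) powr (- 1 / 2) * wint (q_exp D) M"
proof -
 have "marg_q n X D M = wint (%th. Determinant.det ((2 * pi / real n) \<cdot>\<^sub>m wt X D) powr (- 1 / 2) * q_exp D th) M"
  by (simp only: marg_q_def wint_def quasi_lik_eq)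
 then show ?thesis unfolding wint_cmult .
qed

lemma wint_q_exp: "wint (q_exp D) M = exp (- resid n X D / 2) * wint (q_kernel D) M"
proof -
 have "wint (q_exp D) M = wint (%th. exp (- resid n X D / 2) * q_kernel D th) M"
  by (simp only: wint_def q_exp_eq)
 then show ?thesis unfolding wint_cmult .
qed

lemma marg_est_eq: "marg_est X D M = rn ^ p / gauss_int p (info X th0) * wint (e_kernel D) M"
proof -
 have "est_dens X (est X D) th = rn ^ p / gauss_int p (info X th0) * e_kernel D th" for th
  using gauss_int_info(3)[OF true_par_in] n_pos by (simp add: e_kernel_def scaled_dens_def)
 then have "marg_est X D M = wint (%th. rn ^ p / gauss_int p (info X th0) * e_kernel D th) M"
  by (simp only: marg_est_def wint_def)
 then show ?thesis unfolding wint_cmult .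
qed

lemma BFe0_eq: "BFe0 X D M = wint (e_kernel D) M / wint (e_kernel D) (true_model X)"
 using gauss_int_info(3)[OF true_par_in] n_pos by (simp add: BFe0_def BF_est_def marg_est_eq)

lemma det_weight_nonzero:
 assumes "form_in m (wt X D) a b"
 shows "Determinant.det ((2 * pi / real n) \<cdot>\<^sub>m wt X D) powr (- 1 / 2) ~= 0"
proof -
 have "Determinant.det (wt X D) ~= 0"
  by (rule minv_inverse(4)[OF form_inD(1)[OF assms] form_in_inj[OF assms a0]])
 then show ?thesis using n_pos form_inD(1)[OF assms] by (simp add: det_smult)
qed

lemma BFq0_eq:
 assumes "form_in m (wt X D) a b"
 shows "BFq0 n X D M = wint (q_exp D) M / wint (q_exp D) (true_model X)"
  and "BFq0 n X D M = wint (q_kernel D) M / wint (q_kernel D) (true_model X)"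
proof -
 show eq: "BFq0 n X D M = wint (q_exp D) M / wint (q_exp D) (true_model X)"
  unfolding BFq0_def BF_q_def marg_q_eq by (rule mult_divide_mult_cancel_left[OF det_weight_nonzero[OF assms]])
 show "BFq0 n X D M = wint (q_kernel D) M / wint (q_kernel D) (true_model X)"
  unfolding eq wint_q_exp by simp
qed

lemma wint_le:
 assumes M: "M : models X" and f: "f : bm borel" "!!th. 0 <= f th"
  and le: "AE th in leb M. th : submodel X M --> f th <= c" and c: "0 <= c"
 shows "wint f M <= c"
proof -
 note [measurable] = f(1) prior_measurable[OF M]
 let ?w = "%th. indicator (submodel X M) th * par_prior X M th"
 have w0: "0 <= ?w th" for th using prior_nonneg[OF M] by (auto simp: indicator_def)
 have ae: "AE th in leb M. f th * ?w th <= c * ?w th"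
  using le
 proof eventually_elim
  case (elim th)
  then show ?case using w0[of th] by (cases "th : submodel X M") (auto intro: mult_right_mono)
 qed
 have ci: "integrable (leb M) (%th. c * ?w th)" using prior_integrable(1)[OF M] by simp
 have fi: "integrable (leb M) (%th. f th * ?w th)"
 proof (rule Bochner_Integration.integrable_bound[OF ci])
  show "AE th in leb M. norm (f th * ?w th) <= norm (c * ?w th)"
  using ae
  proof eventually_elim
  case (elim th)
  have "norm (f th * ?w th) = f th * ?w th" "norm (c * ?w th) = c * ?w th"
  unfolding real_norm_def by (rule abs_of_nonneg[OF mult_nonneg_nonneg[OF f(2) w0]] abs_of_nonneg[OF mult_nonneg_nonneg[OF c w0]])+
  then show ?case using elim by metis
  qed
 qed simp
 have "wint f M = (\<integral>th. f th * ?w th \<partial>leb M)"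
  unfolding wint_def set_lebesgue_integral_def by (intro Bochner_Integration.integral_cong) (auto simp: mult_ac)
 also have "... <= (\<integral>th. c * ?w th \<partial>leb M)" by (rule integral_mono_AE[OF fi ci ae])
 also have "... = c" using prior_integrable(2)[OF M] by simp
 finally show ?thesis .
qed

definition sep_int :: "nat set => (nat => 'd) => ennreal" where
 "sep_int M D = (\<integral>\<^sup>+th. en (exp (- (real n * (1 / b) / 2) * (vnorm (avg_mom n X D th))\<^sup>2))
  * (en (par_prior X M th) * indicator (submodel X M) th) \<partial>leb M)"

lemma wint_q_exp_le:
 assumes M: "M : models X" and D: "D : space SL" and wt: "form_in m (wt X D) a b"
  and le: "sep_int M D <= en x" and x: "0 <= x"
 shows "wint (q_exp D) M <= x"
proof -
 note [measurable] = q_exp_measurable[OF D wt] prior_measurable[OF M]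
 let ?w = "%th. indicator (submodel X M) th * par_prior X M th"
 have w0: "0 <= ?w th" for th using prior_nonneg[OF M] by (auto simp: indicator_def)
 have q0: "0 <= q_exp D th" for th by (simp add: q_exp_def)
 have eq: "wint (q_exp D) M = (\<integral>th. q_exp D th * ?w th \<partial>leb M)"
  unfolding wint_def set_lebesgue_integral_def by (intro Bochner_Integration.integral_cong) (auto simp: mult_ac)
 have "wint (q_exp D) M = enn2real (\<integral>\<^sup>+th. en (q_exp D th * ?w th) \<partial>leb M)"
  unfolding eq using q0 w0 by (intro integral_eq_nn_integral) auto
 also have "... <= x"
 proof (rule enn2real_leI[OF x])
  have "(\<integral>\<^sup>+th. en (q_exp D th * ?w th) \<partial>leb M) <= sep_int M D"
  unfolding sep_int_def
  proof (intro nn_integral_mono)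
  fix th
  have "en (q_exp D th * ?w th) = en (q_exp D th) * (en (par_prior X M th) * indicator (submodel X M) th)"
  using q0 by (auto simp: indicator_def ennreal_mult')
  also have "... <= en (exp (- (real n * (1 / b) / 2) * (vnorm (avg_mom n X D th))\<^sup>2)) * (en (par_prior X M th) * indicator (submodel X M) th)"
  by (intro mult_right_mono ennreal_leI q_exp_le[OF wt]) simp
  finally show "en (q_exp D th * ?w th) <= en (exp (- (real n * (1 / b) / 2) * (vnorm (avg_mom n X D th))\<^sup>2)) * (en (par_prior X M th) * indicator (submodel X M) th)" .
  qed
  then show "(\<integral>\<^sup>+th. en (q_exp D th * ?w th) \<partial>leb M) <= en x" using le by simp
 qed
 finally show ?thesis .
qed

lemma sep_int_expectation:
 assumes M: "M : models X" and v: "0 < v" "!!th. th : submodel X M ==> v <= dist0 X th"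
 shows "sep_int M : bm SL"
  and "(\<integral>\<^sup>+D. sep_int M D * indicator (sep_good v) D \<partial>SL) <= en (exp (- sep_rate v * real n))"
proof -
 have fin: "finite M" using M models_iff finite_subset by blast
 interpret A: prob_space SL by (rule prob_SL)
 interpret B: sigma_finite_measure "leb M" by (rule sigma_finite_leb[OF fin])
 interpret AB: pair_sigma_finite SL "leb M" ..
 note [measurable] = vnorm_avg_pair prior_measurable[OF M] measurable_compose[OF measurable_snd prior_measurable[OF M]]
  measurable_compose[OF measurable_fst borel_measurable_indicator[OF sep_good_measurable[of v]]]
 let ?e = "%D th. en (exp (- (real n * (1 / b) / 2) * (vnorm (avg_mom n X D th))\<^sup>2))"
 let ?w = "%th. en (par_prior X M th) * indicator (submodel X M) th"
 have g: "(%(D, th). ?e D th * ?w th) : bm (SL \<Otimes>\<^sub>M leb M)"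
  unfolding pair_leb_cong split_beta' by measurable
 have em: "(%z. ?e (fst z) (snd z)) : bm (SL \<Otimes>\<^sub>M borel)" by measurable
 have wm: "(%z. ?w (snd z)) : bm (SL \<Otimes>\<^sub>M borel)" by measurable
 have im: "(%z. indicator (sep_good v) (fst z) :: ennreal) : bm (SL \<Otimes>\<^sub>M borel)" by measurable
 have h: "(%(D, th). ?e D th * indicator (sep_good v) D * ?w th) : bm (SL \<Otimes>\<^sub>M leb M)"
  unfolding pair_leb_cong split_beta' by (intro borel_measurable_times_ennreal em im wm)
 show "sep_int M : bm SL"
  unfolding sep_int_def[abs_def] by (rule B.borel_measurable_nn_integral[OF g])
 have "(\<integral>\<^sup>+D. sep_int M D * indicator (sep_good v) D \<partial>SL) = (\<integral>\<^sup>+D. (\<integral>\<^sup>+th. ?e D th * indicator (sep_good v) D * ?w th \<partial>leb M) \<partial>SL)"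
 proof (intro nn_integral_cong)
  fix D
  show "sep_int M D * indicator (sep_good v) D = (\<integral>\<^sup>+th. ?e D th * indicator (sep_good v) D * ?w th \<partial>leb M)"
  by (cases "D : sep_good v") (simp_all add: sep_int_def)
 qed
 also have "... = (\<integral>\<^sup>+th. (\<integral>\<^sup>+D. ?e D th * indicator (sep_good v) D * ?w th \<partial>SL) \<partial>leb M)"
  using AB.Fubini'[OF h] by simp
 also have "... <= (\<integral>\<^sup>+th. en (exp (- sep_rate v * real n)) * ?w th \<partial>leb M)"
 proof (intro nn_integral_mono)
  fix th
  show "(\<integral>\<^sup>+D. ?e D th * indicator (sep_good v) D * ?w th \<partial>SL) <= en (exp (- sep_rate v * real n)) * ?w th"
  proof (cases "th : submodel X M")
  case True
  then have th: "th : par_space X" by (simp add: submodel_def)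
  have [measurable]: "(%D. vnorm (avg_mom n X D th)) : bm SL"
  by (rule vnorm_measurable[OF avg_mom_carrier avg_measurable])
  have "(\<integral>\<^sup>+D. ?e D th * indicator (sep_good v) D * ?w th \<partial>SL) = (\<integral>\<^sup>+D. ?e D th * indicator (sep_good v) D \<partial>SL) * ?w th"
  by (rule nn_integral_multc) measurable
  also have "... <= en (exp (- sep_rate v * real n)) * ?w th"
  by (intro mult_right_mono separated_point[OF th v(1) v(2)[OF True]]) simp
  finally show ?thesis .
  qed simp
 qed
 also have "... = en (exp (- sep_rate v * real n)) * (\<integral>\<^sup>+th. ?w th \<partial>leb M)"
  by (rule nn_integral_cmult) measurable
 finally show "(\<integral>\<^sup>+D. sep_int M D * indicator (sep_good v) D \<partial>SL) <= en (exp (- sep_rate v * real n))"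
  by (simp add: prior_integrable(3)[OF M])
qed

lemma wint_e_kernel_separated:
 assumes M: "M : models X" and v: "0 < v" "!!th. th : submodel X M ==> v <= dist0 X th"
  and up: "AE th in leb M. th : submodel X M --> e_kernel D th <= est_upper t (est X D) th"
  and t: "0 <= t" and h: "nrm p (%j. rn * dev X (est X D) j) <= T" and T: "2 * T <= rn * v"
 shows "wint (e_kernel D) M <= gu / gl * (exp (- (a / b / 8) * v\<^sup>2 * real n) + pc * t * (1 / (sqrt (a / b) / 2 * v * rn) ^ (p + 1)))"
  (is "_ <= ?U")
proof (rule wint_le[OF M e_kernel_measurable])
 have r0: "0 < sqrt (a / b)" using ab0 by simp
 have s0: "0 < rn" using n_pos by simp
 show "0 <= e_kernel D th" for th unfolding e_kernel_def by (rule scaled_dens_nonneg)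
 show "0 <= ?U" using consts_pos t r0 s0 v by (intro mult_nonneg_nonneg add_nonneg_nonneg divide_nonneg_nonneg zero_le_power) auto
 show "AE th in leb M. th : submodel X M --> e_kernel D th <= ?U"
  using up
 proof eventually_elim
  case (elim th)
  show ?case
  proof
  assume sub: "th : submodel X M"
  have d: "v <= dist0 X th" by (rule v(2)[OF sub])
  then have rv: "rn * v <= rad th" unfolding rad_def using s0 by (intro mult_left_mono) auto
  have "e_kernel D th <= est_upper t (est X D) th" using elim sub by simp
  also have "... <= gu / gl * (exp (- (a / b / 8) * (rad th)\<^sup>2) + pc * t * (1 / (1 + (sqrt (a / b) / 2 * rad th) ^ (p + 1))))"
  using half_distance[OF h T rv] t by (rule est_upper_far)
  also have "... <= ?U"
  proof (intro mult_left_mono add_mono)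
  have "(rn * v)\<^sup>2 <= (rad th)\<^sup>2" using rv s0 v by (intro power_mono) auto
  then have "a / b / 8 * (v\<^sup>2 * real n) <= a / b / 8 * (rad th)\<^sup>2"
  using a0 b0 by (intro mult_left_mono) (auto simp: power_mult_distrib mult.commute)
  then show "exp (- (a / b / 8) * (rad th)\<^sup>2) <= exp (- (a / b / 8) * v\<^sup>2 * real n)" by (simp add: mult.assoc)
  have "sqrt (a / b) / 2 * (rn * v) <= sqrt (a / b) / 2 * rad th" using rv r0 by (intro mult_left_mono) auto
  then have "(sqrt (a / b) / 2 * v * rn) ^ (p + 1) <= (sqrt (a / b) / 2 * rad th) ^ (p + 1)"
  using r0 v s0 by (intro power_mono) (auto simp: mult_ac)
  moreover have "0 < (sqrt (a / b) / 2 * v * rn) ^ (p + 1)" using r0 v s0 by simp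
  ultimately show "1 / (1 + (sqrt (a / b) / 2 * rad th) ^ (p + 1)) <= 1 / (sqrt (a / b) / 2 * v * rn) ^ (p + 1)"
  by (intro frac_le) linarith+
  qed (use consts_pos t in auto)
  finally show "e_kernel D th <= ?U" .
  qed
 qed
qed

section \<open>Measurability of the Bayes factors\<close>

lemma est_measurable: "est X : bm SL"
 using str by (simp add: gmm_structure_def)

lemma set_integral_measurable:
 assumes M: "M : models X" and f: "(%z. f (fst z) (snd z)) : bm (SL \<Otimes>\<^sub>M borel)"
 shows "(%D. LINT th:submodel X M|leb M. f D th * par_prior X M th) : bm SL"
proof -
 have fin: "finite M" using M models_iff finite_subset by blast
 interpret B: sigma_finite_measure "leb M" by (rule sigma_finite_leb[OF fin])
 note [measurable] = f measurable_compose[OF measurable_snd prior_measurable[OF M]]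
 have "(%(D, th). indicat_real (submodel X M) th *\<^sub>R (f D th * par_prior X M th)) : bm (SL \<Otimes>\<^sub>M leb M)"
  unfolding pair_leb_cong split_beta' by measurable
 then show ?thesis unfolding set_lebesgue_integral_def by (rule B.borel_measurable_lebesgue_integral)
qed

lemma true_model_in: "true_model X : models X"
 by (auto simp: models_def true_model_def)

lemma BFe0_measurable:
 assumes M: "M : models X"
 shows "(%D. BFe0 X D M) : bm SL"
proof -
 have "(%z. (est X (fst z), snd z)) : measurable (SL \<Otimes>\<^sub>M borel) (borel \<Otimes>\<^sub>M borel)"
  by (intro measurable_Pair measurable_compose[OF measurable_fst est_measurable] measurable_snd)
 from measurable_compose[OF this est_dens_pair_measurable]
 have "(%z. est_dens X (est X (fst z)) (snd z)) : bm (SL \<Otimes>\<^sub>M borel)" by simp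
 from set_integral_measurable[OF _ this] show ?thesis
  unfolding BFe0_def BF_est_def marg_est_def using M true_model_in by (intro borel_measurable_divide)
qed

lemma BFq0_measurable:
 assumes M: "M : models X" and pd: "!!D. D : space SL ==> pos_def m (wt X D)"
 shows "(%D. BFq0 n X D M) : bm SL"
proof -
 have wc: "wt X D : carrier_mat m m" for D using str by (simp add: gmm_structure_def)
 have wm: "(%D. wt X D $$ (k, l)) : bm SL" if "k < m" "l < m" for k l
  using str that by (simp add: gmm_structure_def)
 have inj: "v = 0\<^sub>v m" if "D : space SL" "v : carrier_vec m" "wt X D *\<^sub>v v = 0\<^sub>v m" for D v
  using pd[OF that(1)] that(2,3) by (auto simp: pos_def_def)
 have iv: "(%D. minv (wt X D) $$ (k, l)) : bm SL" if "k < m" "l < m" for k l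
  by (rule minv_entry_measurable[OF wc wm inj that])
 have det: "(%D. Determinant.det ((2 * pi / real n) \<cdot>\<^sub>m wt X D)) : bm SL"
 proof (rule det_measurable)
  fix k l assume kl: "k < m" "l < m"
  have "((2 * pi / real n) \<cdot>\<^sub>m wt X D) $$ (k, l) = (2 * pi / real n) * wt X D $$ (k, l)" for D
  using wc[of D] kl by simp
  then show "(%D. ((2 * pi / real n) \<cdot>\<^sub>m wt X D) $$ (k, l)) : bm SL" using wm[OF kl] by simp
 qed (use wc in simp)
 have "(%z. \<Sum>k<m. \<Sum>l<m. avg_mom n X (fst z) (snd z) $ k * minv (wt X (fst z)) $$ (k, l) * avg_mom n X (fst z) (snd z) $ l)
  : bm (SL \<Otimes>\<^sub>M borel)"
  by (intro borel_measurable_sum borel_measurable_times avg_pair_measurable measurable_compose[OF measurable_fst iv]) auto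
 then have "(%z. avg_mom n X (fst z) (snd z) \<star> (minv (wt X (fst z)) *\<^sub>v avg_mom n X (fst z) (snd z))) : bm (SL \<Otimes>\<^sub>M borel)"
 proof (rule measurable_cong[THEN iffD1, rotated])
  fix z assume "z : space (SL \<Otimes>\<^sub>M borel :: ((nat => 'd) \<times> (nat => real)) measure)"
  then have z: "fst z : space SL" by (auto simp: space_pair_measure)
  have "minv (wt X (fst z)) : carrier_mat m m"
  by (rule minv_inverse(1)[OF wc]) (rule inj[OF z])
  then show "(\<Sum>k<m. \<Sum>l<m. avg_mom n X (fst z) (snd z) $ k * minv (wt X (fst z)) $$ (k, l) * avg_mom n X (fst z) (snd z) $ l)
  = avg_mom n X (fst z) (snd z) \<star> (minv (wt X (fst z)) *\<^sub>v avg_mom n X (fst z) (snd z))"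
  by (rule dot_mult_mat_vec_sum[OF _ avg_mom_carrier avg_mom_carrier, symmetric])
 qed
 then have "(%z. quasi_lik n X (fst z) (snd z)) : bm (SL \<Otimes>\<^sub>M borel)"
  unfolding quasi_lik_def using measurable_compose[OF measurable_fst det] by measurable
 from set_integral_measurable[OF _ this] show ?thesis
  unfolding BFq0_def BF_q_def marg_q_def using M true_model_in by (intro borel_measurable_divide)
qed

end

section \<open>Events of high probability\<close>

text \<open>Most of the events below are described by quantifiers over uncountable sets of parameters and
 need not be measurable, so "probability at least \<open>1 - dl\<close>" means that the event contains a
 measurable one of that probability.\<close>

definition likely :: "'s measure => real => ('s => bool) => bool" where
 "likely N dl Q \<longleftrightarrow> (EX E:sets N. 1 - dl <= measure N E & (ALL x:E. Q x))"

lemma likely_mono: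
 assumes "likely N dl Q" "dl <= dl'" "!!x. x : space N ==> Q x ==> Q' x"
 shows "likely N dl' Q'"
proof -
 obtain E where E: "E : sets N" "1 - dl <= measure N E" "ALL x:E. Q x"
  using assms(1) by (auto simp: likely_def)
 have "ALL x:E. Q' x" using E sets.sets_into_space[OF E(1)] assms(3) by blast
 then show ?thesis using E assms(2) by (auto simp: likely_def intro!: bexI[of _ E])
qed

lemma likely_conj:
 assumes N: "prob_space N" and Q: "likely N dl Q" "likely N dl' Q'"
 shows "likely N (dl + dl') (%x. Q x & Q' x)"
proof -
 interpret prob_space N by fact
 obtain E where E: "E : sets N" "1 - dl <= measure N E" "ALL x:E. Q x"
  using Q by (auto simp: likely_def)
 obtain E' where E': "E' : sets N" "1 - dl' <= measure N E'" "ALL x:E'. Q' x"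
  using Q by (auto simp: likely_def)
 have "1 - measure N (E \<inter> E') = measure N (space N - (E \<inter> E'))"
  using E E' by (simp add: prob_compl)
 also have "space N - (E \<inter> E') = (space N - E) \<union> (space N - E')" by auto
 also have "measure N ((space N - E) \<union> (space N - E')) <= measure N (space N - E) + measure N (space N - E')"
  using E E' by (intro measure_Un_le) auto
 also have "... = (1 - measure N E) + (1 - measure N E')" using E E' by (simp add: prob_compl)
 finally show ?thesis using E E' by (auto simp: likely_def intro!: bexI[of _ "E \<inter> E'"])
qed

lemma likely_Markov:
 assumes N: "prob_space N" and Z: "Z : bm N"
  and le: "(\<integral>\<^sup>+om. Z om \<partial>N) <= en y" and x: "0 < x" and y: "y <= dl * x" "0 <= y"
 shows "likely N dl (%om. Z om <= en x)"
proof -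
 interpret prob_space N by fact
 note [measurable] = Z
 let ?E = "{om : space N. Z om <= en x}"
 let ?B = "{om : space N. 1 <= en (1 / x) * Z om}"
 have E: "?E : sets N" and B: "?B : sets N" by measurable
 have sub: "space N - ?E <= ?B"
 proof
  fix om assume om: "om : space N - ?E"
  have "en (1 / x) * en x = 1" using x by (simp flip: ennreal_mult)
  moreover have "en (1 / x) * en x <= en (1 / x) * Z om"
  using om by (intro mult_left_mono) auto
  ultimately show "om : ?B" using om by auto
 qed
 have "emeasure N ?B <= en (1 / x) * (\<integral>\<^sup>+om. Z om * indicator (space N) om \<partial>N)"
  by (rule nn_integral_Markov_inequality) (use Z in auto)
 also have "(\<integral>\<^sup>+om. Z om * indicator (space N) om \<partial>N) = (\<integral>\<^sup>+om. Z om \<partial>N)" by (intro nn_integral_cong) auto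
 also have "en (1 / x) * (\<integral>\<^sup>+om. Z om \<partial>N) <= en (1 / x) * en y" by (intro mult_left_mono le) simp
 also have "... = en (y / x)" using x by (simp flip: ennreal_mult')
 also have "... <= en dl" using y x by (intro ennreal_leI) (simp add: pos_divide_le_eq)
 finally have B1: "emeasure N ?B <= en dl" .
 have dl: "0 <= dl"
  using y x mult_neg_pos[of dl x] by linarith
 have "emeasure N (space N - ?E) <= en dl"
  using emeasure_mono[OF sub B] B1 by simp
 then have "measure N (space N - ?E) <= dl"
  using dl by (simp add: emeasure_eq_measure ennreal_le_iff)
 then show ?thesis using E prob_compl[OF E] by (auto simp: likely_def intro!: bexI[of _ ?E])
qed

lemma likely_AE:
 assumes N: "prob_space N" and Q: "AE x in N. Q x"
 shows "likely N 0 Q"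
proof -
 interpret prob_space N by fact
 obtain Z where Z: "Z : null_sets N" "{x : space N. \<not> Q x} <= Z"
  using Q unfolding eventually_ae_filter by auto
 have "Z : sets N" "measure N Z = 0" using Z(1) by (auto simp: measure_eq_0_null_sets)
 then have "measure N (space N - Z) = 1" by (simp add: prob_compl)
 then show ?thesis using Z by (auto simp: likely_def intro!: bexI[of _ "space N - Z"])
qed

lemma likely_event:
 assumes N: "prob_space N" and Q: "likely N dl Q" and m: "{x : space N. Q x} : sets N"
 shows "1 - dl <= measure N {x : space N. Q x}"
proof -
 interpret prob_space N by fact
 obtain E where E: "E : sets N" "1 - dl <= measure N E" "ALL x:E. Q x"
  using Q by (auto simp: likely_def)
 have "measure N E <= measure N {x : space N. Q x}"
  using E sets.sets_into_space[OF E(1)] by (intro finite_measure_mono m) auto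
 then show ?thesis using E by simp
qed

lemma likely_if_event:
 assumes "1 - dl <= measure N {x : space N. Q x}" "dl < 1"
 shows "likely N dl Q"
proof -
 have "{x : space N. Q x} : sets N"
  using assms measure_notin_sets[of "{x : space N. Q x}" N] by fastforce
 then show ?thesis using assms by (auto simp: likely_def intro!: bexI[of _ "{x : space N. Q x}"])
qed

section \<open>Likely events for one sample size\<close>

lemma pred_tail_bound:
 fixes f g :: "'z => real"
 assumes [measurable]: "f : bm N" "g : bm N"
 shows "Measurable.pred N (%z. f z <= u * (exp (- v * (w * (g z)\<^sup>2) / 2) + x / (1 + (y * (s * g z)) ^ k)))"
 unfolding pred_def
proof (rule borel_measurable_le[OF assms(1)])
 note m = assms(2) borel_measurable_times borel_measurable_const borel_measurable_power borel_measurable_add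
  borel_measurable_divide
 have "(%z. - v * (w * (g z)\<^sup>2) / 2) : bm N" by (intro m)
 then have "(%z. exp (- v * (w * (g z)\<^sup>2) / 2)) : bm N" by (rule measurable_compose[OF _ borel_measurable_exp])
 then show "(%z. u * (exp (- v * (w * (g z)\<^sup>2) / 2) + x / (1 + (y * (s * g z)) ^ k))) : bm N"
  by (intro m)
qed

lemma pred_exp_close:
 fixes f g :: "'z => real"
 assumes [measurable]: "f : bm N" "g : bm N"
 shows "Measurable.pred N (%z. \<bar>f z - exp (- u * g z / 2)\<bar> <= v)"
 unfolding pred_def
proof (rule borel_measurable_le[OF _ borel_measurable_const])
 have "(%z. - u * g z / 2) : bm N" by measurable
 then have "(%z. exp (- u * g z / 2)) : bm N" by (rule measurable_compose[OF _ borel_measurable_exp])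
 then show "(%z. \<bar>f z - exp (- u * g z / 2)\<bar>) : bm N"
  by (intro borel_measurable_abs borel_measurable_diff assms(1))
qed

context bounded_gmm
begin

lemma pair_diff_measurable:
 "(%z. (%j. fst z j - snd z j)) : measurable (borel \<Otimes>\<^sub>M borel) (borel :: (nat => real) measure)"
proof (rule measurable_coordinatewise_then_product)
 fix j :: nat
 have c: "(%x :: nat => real. x j) : bm borel" by measurable
 show "(%z. fst z j - snd z j) : bm (borel \<Otimes>\<^sub>M borel :: ((nat => real) \<times> (nat => real)) measure)"
  by (intro borel_measurable_diff measurable_compose[OF measurable_fst c] measurable_compose[OF measurable_snd c])
qed

lemma ball0_measurable [measurable]: "ball0 X r : sets borel"
proof -
 have par [measurable]: "par_space X : sets borel" using compact_imp_closed[OF cpt] by (rule borel_closed)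
 have [measurable]: "(%th. nrm p (%j. th j - th0 j)) : bm borel"
  by (intro measurable_compose[OF _ borel_measurable_nrm] borel_measurable_funI) measurable
 have "ball0 X r = par_space X \<inter> {th : space borel. nrm p (%j. th j - th0 j) < r}"
  by (auto simp: ball0_def dist0_def)
 also have "... : sets borel" by measurable
 finally show ?thesis .
qed

lemma scaled_dens_pair_measurable: "(%z. scaled_dens (fst z) (snd z)) : bm (borel \<Otimes>\<^sub>M borel)"
 unfolding scaled_dens_def using est_dens_pair_measurable by measurable

lemma models_finite: "M : models X ==> finite M"
 using models_iff finite_subset by blast

text \<open>For each parameter the bound on the density of the estimator holds up to a null set of values of
 the estimator.  By Fubini it holds for almost every sample at almost every parameter, which is
 all that an integral over the parameter sees.\<close>

lemma AE_est_upper: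
 assumes M: "M : models X" and reg: "!!th. th : par_space X ==> est_regular th t" and t: "0 <= t"
 shows "AE D in SL. AE th in leb M. th : submodel X M --> e_kernel D th <= est_upper t (est X D) th"
 unfolding e_kernel_def
proof (rule AE_est_transfer[OF models_finite[OF M] submodel_measurable])
 have d: "(%z. nrm p (%j. fst z j - snd z j)) : bm (borel \<Otimes>\<^sub>M borel)"
  by (rule measurable_compose[OF pair_diff_measurable borel_measurable_nrm])
 show "Measurable.pred (borel \<Otimes>\<^sub>M borel) (%z. scaled_dens (fst z) (snd z) <= est_upper t (fst z) (snd z))"
  unfolding est_upper_def by (rule pred_tail_bound[OF scaled_dens_pair_measurable d])
 show "AE x in leb {..<p}. scaled_dens x th <= est_upper t x th" if "th : submodel X M" for th
 proof -
  have "th : par_space X" using that by (simp add: submodel_def)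
  from scaled_dens_le[OF this reg[OF this] t] show ?thesis unfolding est_upper_def .
 qed
qed

definition dens_err :: "real => real => real" where
 "dens_err om t = 2 * om / (a / b) * sqrt (4 * pi / (a / b)) ^ p / gl * (1 + pc * t) + om / (a / b) + pc * t"

lemma AE_est_local:
 assumes M: "M : models X" and reg: "!!th. th : par_space X ==> est_regular th t" and t: "0 <= t"
  and close: "!!th x. th : ball0 X r ==> \<bar>qf p (info X th) x - qf p (info X th0) x\<bar> <= om * (nrm p x)\<^sup>2" and om: "0 <= om"
 shows "AE D in SL. AE th in leb M. th : submodel X M \<inter> ball0 X r -->
  \<bar>e_kernel D th - exp (- real n * qf p (info X th0) (%j. est X D j - th j) / 2)\<bar> <= dens_err om t"
 unfolding e_kernel_def
proof (rule AE_est_transfer[OF models_finite[OF M]])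
 show "submodel X M \<inter> ball0 X r : sets borel" by measurable
 have d: "(%z. qf p (info X th0) (%j. fst z j - snd z j)) : bm (borel \<Otimes>\<^sub>M borel)"
  by (rule measurable_compose[OF pair_diff_measurable qf0_measurable])
 show "Measurable.pred (borel \<Otimes>\<^sub>M borel) (%z. \<bar>scaled_dens (fst z) (snd z)
  - exp (- real n * qf p (info X th0) (%j. fst z j - snd z j) / 2)\<bar> <= dens_err om t)"
  by (rule pred_exp_close[OF scaled_dens_pair_measurable d])
 show "AE x in leb {..<p}. \<bar>scaled_dens x th - exp (- real n * qf p (info X th0) (%j. x j - th j) / 2)\<bar> <= dens_err om t"
  if "th : submodel X M \<inter> ball0 X r" for th
 proof -
  have th: "th : par_space X" "th : ball0 X r" using that by (auto simp: submodel_def)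
  from scaled_dens_local[OF th(1) reg[OF th(1)] t close[OF th(2)] om] show ?thesis unfolding dens_err_def .
 qed
qed

lemma likely_score:
 assumes T: "0 < T" "real m * b <= dl * T\<^sup>2"
 shows "likely SL dl (%D. vnorm (score n X D) <= T)"
proof (rule likely_mono[OF likely_Markov[OF prob_SL _ score_second_moment _ T(2)] order.refl])
 show "0 <= real m * b" using b0 by simp
 show "(%D. en ((vnorm (score n X D))\<^sup>2)) : bm SL" by measurable
 show "0 < T\<^sup>2" using T by simp
 fix D assume "en ((vnorm (score n X D))\<^sup>2) <= en (T\<^sup>2)"
 then have "(vnorm (score n X D))\<^sup>2 <= T\<^sup>2" by (simp add: ennreal_le_iff)
 then show "vnorm (score n X D) <= T" by (rule power2_le_imp_le) (rule less_imp_le[OF T(1)])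
qed

lemma likely_good:
 assumes T: "0 < T" "real m * b <= dl * T\<^sup>2" and L: "0 < L" "K <= dl' * L"
 shows "likely SL (dl + dl') (%D. D : good T L)"
proof -
 have "likely SL dl' (%D. en (\<Sum>i<n. (F (D i))\<^sup>2) <= en (real n * L))"
 proof (rule likely_Markov[OF prob_SL _ env_sum_moment])
  show "(%D. en (\<Sum>i<n. (F (D i))\<^sup>2)) : bm SL"
  by (intro measurable_compose[OF _ measurable_ennreal] borel_measurable_sum borel_measurable_power
  measurable_compose[OF coordinate_measurable env_measurable]) simp
  show "0 <= real n * K" using K0 by simp
  show "0 < real n * L" using L n_pos by simp
  show "real n * K <= dl' * (real n * L)" using mult_left_mono[OF L(2), of "real n"] by (simp add: mult_ac)
 qed
 from likely_conj[OF prob_SL likely_score[OF T] this] show ?thesis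
  by (rule likely_mono) (use L n_pos in \<open>auto simp: good_def ennreal_le_iff\<close>)
qed

text \<open>An expectation restricted to an event of high probability is enough for a bound in probability;
 the exponential moment bounds hold only on such events.\<close>

lemma likely_restricted:
 assumes E: "likely SL dl (%D. D : E)" and Es: "E : sets SL" and Z: "Z : bm SL"
  and le: "(\<integral>\<^sup>+D. Z D * indicator E D \<partial>SL) <= en y" and x: "0 < x" and y: "y <= dl' * x" "0 <= y"
 shows "likely SL (dl + dl') (%D. D : E & Z D <= en x)"
proof -
 have "(%D. Z D * indicator E D) : bm SL" using Es Z by measurable
 from likely_conj[OF prob_SL E likely_Markov[OF prob_SL this le x y]]
 show ?thesis by (rule likely_mono) auto
qed

lemma nrm_centre_le:
 assumes "vnorm (score n X D) <= T"
 shows "nrm p (centre D) <= sqrt b / a * (b / a) * T"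
proof -
 have "nrm p (centre D) <= sqrt b / a * (b / a) * vnorm (score n X D)"
  unfolding centre_eq by (rule vnorm_oracle_dev_le)
 also have "... <= sqrt b / a * (b / a) * T" using assms a0 b0 by (intro mult_left_mono) auto
 finally show ?thesis .
qed

definition resid_max :: "real => real" where
 "resid_max T = (T + sqrt b * (sqrt b / a * (b / a) * T))\<^sup>2 / a"

definition quasi_err :: "real => real => real => real => real => real => real => nat set => real" where
 "quasi_err T C ze r e ph \<upsilon> M = exp (resid_max T / 2) *
  (((ze + 2 * ((T + sqrt b * C)\<^sup>2 / ze + 1) * r\<^sup>2) / a + e * (T + sqrt b * C)\<^sup>2 / a\<^sup>2) * volc C M
  + 2 * ((T + sqrt b * C)\<^sup>2 / ze + 1) / a * ph + \<upsilon>) + tailc C M"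

text \<open>Nothing is controlled uniformly over the parameter space: the fluctuation near the true parameter
 and the quasi-likelihood far from it are bounded in mean after integration over the parameter,
 and then by Markov's inequality.\<close>

lemma likely_q_kernel_close:
 assumes M: "M <= {..<p}" "true_model X <= M"
  and ball: "{th : Rn p. dist0 X th < C / rn} <= par_space X"
  and wt: "likely SL dl1 (%D. form_in m (wt X D) a b & opnorm (wt X D - var_mom X th0) <= e)"
  and taylor: "!!th. th : ball0 X (C / rn) ==>
  rn * vnorm (mean_mom X th - jac X th0 *\<^sub>v vec p (dev X th)) <= r"
  and h: "!!th et. th : ball0 X (C / rn) ==> et : unit_vecs m ==> L2_norm P (mom_diff X et th) <= h"
  and r: "0 <= r" and ze: "0 < ze" and e: "0 <= e"
  and T: "0 < T" "real m * b <= dl2 * T\<^sup>2" and L: "0 < L" "K <= dl3 * L"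
  and C: "2 * (sqrt b / a * (b / a) * T) <= C" "4 * T / ka <= C" "0 < C"
  and ph: "0 < ph" "real m * h\<^sup>2 * volc C M <= dl4 * ph"
  and \<upsilon>: "0 < \<upsilon>" "exp (- (rate L / 4) * C\<^sup>2 / 2) * sqrt (2 * pi / (rate L / 4)) ^ card M <= dl5 * \<upsilon>"
 shows "likely SL (dl1 + (dl4 + (dl2 + dl3 + dl5))) (%D. form_in m (wt X D) a b & vnorm (score n X D) <= T &
  kernel_dist (q_kernel D) D M <= en (quasi_err T C ze r e ph \<upsilon> M))"
proof -
 have rad_ball: "th : ball0 X (C / rn)" if "th : submodel X M" "rad th < C" for th
  using that n_pos by (simp add: ball0_def submodel_def rad_def pos_less_divide_eq mult.commute)
 have h': "L2_norm P (mom_diff X et th) <= h" if "th : submodel X M" "rad th < C" "et : unit_vecs m" for th et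
  by (rule h[OF rad_ball[OF that(1,2)] that(3)])
 have L0: "0 <= L" and T0: "0 <= T" using L T by auto
 have f1: "fluct_near C M : bm SL"
  by (rule fluct_near_expectation(1)[OF M]) (rule h')
 have f2: "(\<integral>\<^sup>+D. fluct_near C M D \<partial>SL) <= en (real m * h\<^sup>2 * volc C M)"
  by (rule fluct_near_expectation(2)[OF M]) (rule h')
 have f3: "0 <= real m * h\<^sup>2 * volc C M"
  by (intro mult_nonneg_nonneg volc_nonneg zero_le_power2 of_nat_0_le_iff)
 note tf = tail_far_expectation[OF M L0 T0 C(2,3)]
 have l1: "likely SL dl4 (%D. fluct_near C M D <= en ph)"
  by (rule likely_Markov[OF prob_SL f1 f2 ph f3])
 have l2: "likely SL (dl2 + dl3 + dl5) (%D. D : good T L & tail_far C M D <= en \<upsilon>)"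
  by (rule likely_restricted[OF likely_good[OF T L] good_measurable tf \<upsilon>])
  (intro mult_nonneg_nonneg zero_le_power real_sqrt_ge_zero divide_nonneg_nonneg, auto simp: rate_pos[OF L0, THEN less_imp_le])
 from likely_conj[OF prob_SL wt likely_conj[OF prob_SL l1 l2]] show ?thesis
 proof (rule likely_mono[OF _ order.refl])
  fix D assume D: "D : space SL"
  and Q: "(form_in m (wt X D) a b & opnorm (wt X D - var_mom X th0) <= e) &
  fluct_near C M D <= en ph & D : good T L & tail_far C M D <= en \<upsilon>"
  have sc: "vnorm (score n X D) <= T" using Q by (simp add: good_def)
  have wtf: "form_in m (wt X D) a b" using Q by simp
  have ee: "\<bar>x \<star> (wt X D *\<^sub>v y) - x \<star> (var_mom X th0 *\<^sub>v y)\<bar> <= e * vnorm x * vnorm y"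
  if xy: "x : carrier_vec m" "y : carrier_vec m" for x y
  proof -
  have "\<bar>x \<star> (wt X D *\<^sub>v y) - x \<star> (var_mom X th0 *\<^sub>v y)\<bar> <= opnorm (wt X D - var_mom X th0) * vnorm x * vnorm y"
  by (rule opnorm_diff_dot[OF form_inD(1)[OF wtf] var_mom_carrier xy])
  also have "... <= e * vnorm x * vnorm y" using Q by (intro mult_right_mono) auto
  finally show ?thesis .
  qed
  have fn: "fluct_near C M D <= en ph" and tn: "tail_far C M D <= en \<upsilon>" using Q by auto
  have pos: "0 <= ph" "0 <= \<upsilon>" "0 <= C" using ph \<upsilon> C by auto
  have R: "resid n X D <= resid_max T" unfolding resid_max_def by (rule resid_bounds(2)[OF sc])
  have "kernel_dist (q_kernel D) D M <= en (quasi_err T C ze r e ph \<upsilon> M)"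
  unfolding quasi_err_def
  by (rule q_kernel_dist[OF M D ball wtf ee e taylor r ze sc R refl nrm_centre_le[OF sc] C(1) pos(3) fn pos(1) tn pos(2)])
  then show "form_in m (wt X D) a b & vnorm (score n X D) <= T &
  kernel_dist (q_kernel D) D M <= en (quasi_err T C ze r e ph \<upsilon> M)" using wtf sc by simp
 qed
qed

definition est_err :: "real => real => real => real => real => nat set => real" where
 "est_err T C om t d M = (dens_err om t + b / a * d * (T + C)) * volc C M
  + gu / gl * (tailc C M + pc * t * polyc M) + tailc C M"

lemma est_dev_le:
 assumes h: "nrm p (centre D) <= T" and d: "rn * nrm p (%j. est X D j - oracle_est n X D j) <= d"
 shows "nrm p (%j. rn * dev X (est X D) j) <= T + d"
proof -
 have "nrm p (%j. rn * dev X (est X D) j)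
  = nrm p (%j. rn * (est X D j - oracle_est n X D j) + centre D j)"
  by (rule arg_cong[where f = "nrm p"]) (auto simp: centre_def dev_def algebra_simps)
 also have "... <= nrm p (%j. rn * (est X D j - oracle_est n X D j)) + nrm p (centre D)"
  by (rule nrm_triangle)
 also have "nrm p (%j. rn * (est X D j - oracle_est n X D j)) = rn * nrm p (%j. est X D j - oracle_est n X D j)"
  by (simp add: nrm_scale)
 finally show ?thesis using h d by linarith
qed

lemma AE_e_kernel_close:
 assumes M: "M : models X" "true_model X <= M"
  and ball: "{th : Rn p. dist0 X th < C / rn} <= par_space X"
  and reg: "!!th. th : par_space X ==> est_regular th t" and t: "0 <= t"
  and close: "!!th x. th : ball0 X (C / rn) ==> \<bar>qf p (info X th) x - qf p (info X th0) x\<bar> <= om * (nrm p x)\<^sup>2"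
  and om: "0 <= om" and C: "2 * (T + d) <= C" "0 <= C" and d: "0 <= d"
 shows "AE D in SL. nrm p (centre D) <= T --> rn * nrm p (%j. est X D j - oracle_est n X D j) <= d -->
  kernel_dist (e_kernel D) D M <= en (est_err (T + d) C om t d M)"
proof -
 have u: "AE D in SL. AE th in leb M. th : submodel X M --> e_kernel D th <= est_upper t (est X D) th"
  by (rule AE_est_upper[OF M(1) _ t]) (rule reg)
 have l: "AE D in SL. AE th in leb M. th : submodel X M \<inter> ball0 X (C / rn) -->
  \<bar>e_kernel D th - exp (- real n * qf p (info X th0) (%j. est X D j - th j) / 2)\<bar> <= dens_err om t"
  by (rule AE_est_local[OF M(1) _ t close om]) (rule reg)
 show ?thesis using u l
proof (eventually_elim)
 case (elim D)
 show ?case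
 proof (intro impI)
  assume h: "nrm p (centre D) <= T" and dd: "rn * nrm p (%j. est X D j - oracle_est n X D j) <= d"
  have h': "nrm p (%j. rn * dev X (est X D) j) <= T + d" by (rule est_dev_le[OF h dd])
  have hT: "nrm p (centre D) <= T + d" using h d by linarith
  have de: "0 <= dens_err om t" using consts_pos om t a0 b0
  unfolding dens_err_def by (intro add_nonneg_nonneg mult_nonneg_nonneg divide_nonneg_nonneg zero_le_power) auto
  have M': "M <= {..<p}" using M(1) models_iff by simp
  show "kernel_dist (e_kernel D) D M <= en (est_err (T + d) C om t d M)"
  unfolding est_err_def by (rule e_kernel_dist[OF M' M(2) ball elim(1) elim(2) t de hT h' dd C])
 qed
qed
qed

end

section \<open>Constants uniform in the dimensions\<close>

text \<open>The dimensions may vary with the sample size below a fixed bound; these two inequalities make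
 constants that are powers with a dimension in the exponent uniform.\<close>

lemma power_le_max:
 fixes x :: real
 assumes "0 <= x" "k <= N"
 shows "x ^ k <= max 1 x ^ N"
proof -
 have "x ^ k <= max 1 x ^ k" using assms by (intro power_mono) auto
 also have "... <= max 1 x ^ N" using assms by (intro power_increasing) auto
 finally show ?thesis .
qed

lemma min_le_power:
 fixes x :: real
 assumes "0 < x" "k <= N"
 shows "min 1 x ^ N <= x ^ k"
proof -
 have "min 1 x ^ N <= min 1 x ^ k" using assms by (intro power_decreasing) auto
 also have "... <= x ^ k" using assms by (intro power_mono) auto
 finally show ?thesis .
qed

lemma small_factor:
 fixes c ep :: real
 assumes "0 <= c" "0 < ep"
 shows "\<exists>x>0. x <= 1 & c * x <= ep"
proof (intro exI conjI)
 let ?x = "min 1 (ep / (c + 1))"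
 show "0 < ?x" using assms by simp
 show "?x <= 1" by simp
 have "c * ?x <= c * (ep / (c + 1))" using assms by (intro mult_left_mono) auto
 also have "... <= ep" using assms by (simp add: pos_divide_le_eq field_simps)
 finally show "c * ?x <= ep" .
qed

lemma double_le:
 fixes u d C :: real
 assumes "2 * (u + d) <= C" "0 <= d"
 shows "2 * u <= C"
 using assms by (simp add: distrib_left)

lemma gauss_tail_small:
 fixes c k ep :: real
 assumes "0 < c" "0 < ep"
 shows "\<forall>\<^sub>F C in at_top. exp (- c * C\<^sup>2 / 2) * k <= ep"
proof -
 have "((%C. exp (- c * C\<^sup>2 / 2) * k) \<longlongrightarrow> 0) at_top" using assms(1) by real_asymp
 from order_tendstoD(2)[OF this assms(2)] show ?thesis by eventually_elim simp
qed

text \<open>The constants are chosen in the order \<open>ze\<close>, \<open>r\<close>, \<open>e\<close>,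
 \<open>ph\<close>: each may depend on the earlier ones, and each makes one of the four
 summands small.\<close>

lemma small_constants:
 fixes A V a Y ep :: real
 assumes A: "0 < A" and V: "0 <= V" and a: "0 < a" and ep: "0 < ep"
 shows "\<exists>ze>0. \<exists>r>0. \<exists>e>0. \<exists>ph>0.
  A * (((ze + 2 * (Y\<^sup>2 / ze + 1) * r\<^sup>2) / a + e * Y\<^sup>2 / a\<^sup>2) * V + 2 * (Y\<^sup>2 / ze + 1) / a * ph) <= ep"
proof -
 have e4: "0 < ep / 4" using ep by simp
 have c1: "0 <= A / a * V" using assms by simp
 from small_factor[OF c1 e4] obtain ze where ze: "0 < ze" "A / a * V * ze <= ep / 4" by blast
 define B where "B = 2 * (Y\<^sup>2 / ze + 1)"
 have B: "0 <= B" using ze by (simp add: B_def)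
 have c2: "0 <= A / a * V * B" "0 <= A * Y\<^sup>2 / a\<^sup>2 * V" "0 <= A * B / a" using assms B by auto
 from small_factor[OF c2(1) e4] obtain r where r: "0 < r" "r <= 1" "A / a * V * B * r <= ep / 4" by blast
 from small_factor[OF c2(2) e4] obtain e where e: "0 < e" "A * Y\<^sup>2 / a\<^sup>2 * V * e <= ep / 4" by blast
 from small_factor[OF c2(3) e4] obtain ph where ph: "0 < ph" "A * B / a * ph <= ep / 4" by blast
 have "r\<^sup>2 <= r" using r by (simp add: power2_eq_square mult_left_le)
 then have r2: "A / a * V * B * r\<^sup>2 <= ep / 4" using mult_left_mono[OF _ c2(1), of "r\<^sup>2" r] r by linarith
 have "A * (((ze + B * r\<^sup>2) / a + e * Y\<^sup>2 / a\<^sup>2) * V + B / a * ph)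
  = A / a * V * ze + A / a * V * B * r\<^sup>2 + A * Y\<^sup>2 / a\<^sup>2 * V * e + A * B / a * ph"
  by (simp add: add_divide_distrib distrib_left distrib_right mult_ac)
 also have "... <= ep" using ze r2 e ph by linarith
 finally show ?thesis using ze(1) r(1) e(1) ph(1) unfolding B_def by blast
qed

context bounded_gmm
begin

lemma uniform_bounds:
 assumes N: "p <= N" and M: "M <= {..<p}"
 shows "tailc C M <= exp (- (a / b / 8) * C\<^sup>2 / 2) * max 1 (sqrt (2 * pi / (a / b / 8))) ^ N"
  and "volc C M <= exp (C\<^sup>2) * max 1 (sqrt pi) ^ N"
  and "polyc M <= max 1 (1 / (sqrt (a / b) / 2)) ^ N * (2 ^ (N + 1) * max 1 (2 * real N) ^ N)"
  and "pc <= max 1 (sqrt (2 * pi)) ^ N"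
  and "gu / gl <= max 1 (sqrt (2 * pi / (a / b))) ^ N / min 1 (sqrt (2 * pi / (b / a))) ^ N"
  and "0 <= om ==> 0 <= t ==> dens_err om t <= 2 * om / (a / b) * max 1 (sqrt (4 * pi / (a / b))) ^ N / min 1 (sqrt (2 * pi / (b / a))) ^ N
  * (1 + max 1 (sqrt (2 * pi)) ^ N * t) + om / (a / b) + max 1 (sqrt (2 * pi)) ^ N * t"
proof -
 have cM: "card M <= p" using card_mono[OF _ M] by simp
 then have cN: "card M <= N" using N by simp
 have x0: "0 <= sqrt (2 * pi / (a / b / 8))" "0 <= sqrt pi" "0 <= 1 / (sqrt (a / b) / 2)" "0 <= sqrt (2 * pi)"
  "0 <= sqrt (2 * pi / (a / b))" "0 < sqrt (2 * pi / (b / a))" "0 <= sqrt (4 * pi / (a / b))"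
  using a0 b0 by auto
 have m0: "0 < min 1 (sqrt (2 * pi / (b / a))) ^ N" using a0 b0 by simp
 show "tailc C M <= exp (- (a / b / 8) * C\<^sup>2 / 2) * max 1 (sqrt (2 * pi / (a / b / 8))) ^ N"
  unfolding tailc_def by (intro mult_left_mono power_le_max x0 cN) simp
 show "volc C M <= exp (C\<^sup>2) * max 1 (sqrt pi) ^ N"
  unfolding volc_def by (intro mult_left_mono power_le_max x0 cN) simp
 have "(2 * real p) ^ card M <= (2 * real N) ^ card M" using N by (intro power_mono) auto
 also have "... <= max 1 (2 * real N) ^ N" by (intro power_le_max cN) simp
 finally have "(2 * real p) ^ card M <= max 1 (2 * real N) ^ N" .
 moreover have "(2 :: real) ^ (p + 1) <= 2 ^ (N + 1)" using N by (intro power_increasing) auto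
 ultimately show "polyc M <= max 1 (1 / (sqrt (a / b) / 2)) ^ N * (2 ^ (N + 1) * max 1 (2 * real N) ^ N)"
  unfolding polyc_def using x0(3) by (intro mult_mono power_le_max cN mult_nonneg_nonneg zero_le_power) auto
 show pc: "pc <= max 1 (sqrt (2 * pi)) ^ N"
  unfolding pc_def by (intro power_le_max x0 N)
 have gl: "min 1 (sqrt (2 * pi / (b / a))) ^ N <= gl"
  unfolding gl_def by (rule min_le_power[OF x0(6) N])
 show "gu / gl <= max 1 (sqrt (2 * pi / (a / b))) ^ N / min 1 (sqrt (2 * pi / (b / a))) ^ N"
  using gl m0 consts_pos unfolding gu_def by (intro frac_le power_le_max x0 N) auto
 assume om: "0 <= om" and t: "0 <= t"
 show "dens_err om t <= 2 * om / (a / b) * max 1 (sqrt (4 * pi / (a / b))) ^ N / min 1 (sqrt (2 * pi / (b / a))) ^ N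
  * (1 + max 1 (sqrt (2 * pi)) ^ N * t) + om / (a / b) + max 1 (sqrt (2 * pi)) ^ N * t"
  unfolding dens_err_def
  by (intro add_mono mult_mono frac_le mult_left_mono power_le_max x0 N pc gl m0 order.refl mult_right_mono
  mult_nonneg_nonneg divide_nonneg_nonneg add_nonneg_nonneg zero_le_power t)
  (use om a0 b0 consts_pos t x0 in auto)
qed

section \<open>Marginal likelihoods close to their limits\<close>

definition local_regular :: "real => real => bool" where
 "local_regular C e \<longleftrightarrow>
  {th : Rn p. dist0 X th < C / rn} <= par_space X &
  (ALL th:ball0 X (C / rn).
  rn * vnorm (mean_mom X th - jac X th0 *\<^sub>v vec p (dev X th)) <= e &
  (\<forall>x. \<bar>qf p (info X th) x - qf p (info X th0) x\<bar> <= e * (nrm p x)\<^sup>2) &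
  (ALL et:unit_vecs m. L2_norm P (mom_diff X et th) <= e))"

definition limit_mass :: "nat set => (nat => 'd) => real" where
 "limit_mass M D = par_prior X M th0 * gmass M (centre D)"

definition mass_event :: "real => real => nat set => (nat => 'd) => bool" where
 "mass_event T ep M D \<longleftrightarrow> form_in m (wt X D) a b & vnorm (score n X D) <= T &
  \<bar>sc M * wint (q_kernel D) M - limit_mass M D\<bar> <= ep &
  \<bar>sc M * wint (e_kernel D) M - limit_mass M D\<bar> <= ep"

definition tc :: real where
 "tc = sqrt b / a * (b / a)"

lemma true_par_in_submodel:
 assumes "true_model X <= M"
 shows "th0 : submodel X M"
 unfolding submodel_def
proof (intro CollectI conjI allI impI true_par_in)
 fix j assume j: "j \<notin> M"
 show "th0 j = 0"
 proof (cases "j < p")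
  case True
  then show ?thesis using j assms by (auto simp: true_model_def)
 next
  case False
  then show ?thesis using true_par_in par_subset by (auto simp: Rn_def)
 qed
qed

text \<open>Both marginal likelihoods, rescaled, are integrals of a kernel against the prior density.  The
 kernels are close in \<open>L\<^sup>1\<close> to the same Gaussian kernel, and the prior density
 is nearly constant where that kernel lives, so both are close to \<open>limit_mass\<close>.\<close>

lemma likely_mass_event:
 assumes M: "M : models X" "true_model X <= M"
  and lr: "local_regular C r" "local_regular C h" "local_regular C om" "0 <= r" "0 <= om"
  and wt: "likely SL dl1 (%D. form_in m (wt X D) a b & opnorm (wt X D - var_mom X th0) <= e)"
  and ze: "0 < ze" and e: "0 <= e"
  and T: "0 < T" "real m * b <= dl2 * T\<^sup>2" and L: "0 < L" "K <= dl3 * L"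
  and C: "2 * (tc * T + d) <= C" "4 * T / ka <= C" "0 < C" and d: "0 <= d"
  and ph: "0 < ph" "real m * h\<^sup>2 * volc C M <= dl4 * ph"
  and \<upsilon>: "0 < \<upsilon>" "exp (- (rate L / 4) * C\<^sup>2 / 2) * sqrt (2 * pi / (rate L / 4)) ^ card M <= dl5 * \<upsilon>"
  and est: "likely SL dl6 (%D. rn * nrm p (%j. est X D j - oracle_est n X D j) <= d)"
  and reg: "!!th. th : par_space X ==> est_regular th t" and t: "0 <= t"
  and qb: "quasi_err T C ze r e ph \<upsilon> M <= ep'" and eb: "est_err (tc * T + d) C om t d M <= ep'" and ep': "0 <= ep'"
  and cu: "!!th. th : submodel X M ==> par_prior X M th <= c"
  and near: "!!th. th : submodel X M ==> th : ball0 X (C / rn) ==> \<bar>par_prior X M th - par_prior X M th0\<bar> <= et"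
  and et: "0 <= et"
  and fin: "c * ep' + et * (exp (a / b * (tc * T)\<^sup>2 / 2) * sqrt (4 * pi / (a / b)) ^ card M) + c * tailc C M <= ep"
 shows "likely SL ((dl1 + (dl4 + (dl2 + dl3 + dl5))) + (dl6 + 0)) (mass_event T ep M)"
proof -
 have M': "M <= {..<p}" using M(1) models_iff by simp
 have tcT: "0 <= tc * T" using T a0 b0 by (simp add: tc_def)
 have C2: "2 * (tc * T) <= C" "0 <= C" by (rule double_le[OF C(1) d], rule less_imp_le[OF C(3)])
 have C1: "2 * (sqrt b / a * (b / a) * T) <= C" by (rule C2(1)[unfolded tc_def])
 have ball: "{th : Rn p. dist0 X th < C / rn} <= par_space X" using lr(1) by (simp add: local_regular_def)
 have taylor: "rn * vnorm (mean_mom X th - jac X th0 *\<^sub>v vec p (dev X th)) <= r"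
  if "th : ball0 X (C / rn)" for th using lr(1) that by (simp add: local_regular_def)
 have hh: "L2_norm P (mom_diff X et th) <= h"
  if "th : ball0 X (C / rn)" "et : unit_vecs m" for th et using lr(2) that by (simp add: local_regular_def)
 have close: "\<bar>qf p (info X th) x - qf p (info X th0) x\<bar> <= om * (nrm p x)\<^sup>2"
  if "th : ball0 X (C / rn)" for th x using lr(3) that by (simp add: local_regular_def)
 have q: "likely SL (dl1 + (dl4 + (dl2 + dl3 + dl5))) (%D. form_in m (wt X D) a b & vnorm (score n X D) <= T &
  kernel_dist (q_kernel D) D M <= en (quasi_err T C ze r e ph \<upsilon> M))"
  by (rule likely_q_kernel_close[OF M' M(2) ball wt taylor hh lr(4) ze e T L C1 C(2,3) ph \<upsilon>])
 have ae: "AE D in SL. nrm p (centre D) <= tc * T --> rn * nrm p (%j. est X D j - oracle_est n X D j) <= d -->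
  kernel_dist (e_kernel D) D M <= en (est_err (tc * T + d) C om t d M)"
  by (rule AE_e_kernel_close[OF M ball _ t close lr(5) C(1) C2(2) d]) (rule reg)
 from likely_conj[OF prob_SL q likely_conj[OF prob_SL est likely_AE[OF prob_SL ae]]] show ?thesis
 proof (rule likely_mono[OF _ order.refl])
  fix D assume D: "D : space SL"
  and Q: "(form_in m (wt X D) a b & vnorm (score n X D) <= T &
  kernel_dist (q_kernel D) D M <= en (quasi_err T C ze r e ph \<upsilon> M)) &
  rn * nrm p (%j. est X D j - oracle_est n X D j) <= d &
  (nrm p (centre D) <= tc * T --> rn * nrm p (%j. est X D j - oracle_est n X D j) <= d -->
  kernel_dist (e_kernel D) D M <= en (est_err (tc * T + d) C om t d M))"
  have wtf: "form_in m (wt X D) a b" and sT: "vnorm (score n X D) <= T" using Q by auto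
  have h: "nrm p (centre D) <= tc * T" unfolding tc_def by (rule nrm_centre_le[OF sT])
  have kq: "kernel_dist (q_kernel D) D M <= en ep'" using Q ennreal_leI[OF qb] by (meson order.trans)
  have ke: "kernel_dist (e_kernel D) D M <= en ep'" using Q h ennreal_leI[OF eb] by (meson order.trans)
  have th0: "th0 : submodel X M" by (rule true_par_in_submodel[OF M(2)])
  have pr: "0 <= par_prior X M th0" "par_prior X M th0 <= c" using prior_nonneg[OF M(1) th0] cu[OF th0] by auto
  have g: "gmass M (centre D) <= exp (a / b * (tc * T)\<^sup>2 / 2) * sqrt (4 * pi / (a / b)) ^ card M"
  by (rule gmass_bounds(2)[OF M' h])
  have "c * ep' + et * gmass M (centre D) + c * (exp (- (a / b / 8) * C\<^sup>2 / 2) * sqrt (2 * pi / (a / b / 8)) ^ card M) <= ep"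
  using fin mult_left_mono[OF g et] unfolding tailc_def by linarith
  note close' = order.trans[OF weighted_kernel_close[OF M' M(2) ball _ prior_measurable[OF M(1)] prior_nonneg[OF M(1)] cu near pr et _ ep' h C2] this]
  have qm: "q_kernel D : bm borel"
  unfolding q_kernel_def[abs_def] by (intro borel_measurable_times borel_measurable_const q_exp_measurable[OF D wtf])
  have "\<bar>sc M * wint (q_kernel D) M - limit_mass M D\<bar> <= ep"
  unfolding wint_def limit_mass_def by (rule close'[OF qm _ _ _ _ kq])
  moreover have "\<bar>sc M * wint (e_kernel D) M - limit_mass M D\<bar> <= ep"
  unfolding wint_def limit_mass_def by (rule close'[OF e_kernel_measurable _ _ _ _ ke])
  ultimately show "mass_event T ep M D" using wtf sT by (simp add: mass_event_def)
 qed
qed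

definition mass_lower :: "nat => real => real => real" where
 "mass_lower N c T = c * (exp (- (b / a) * (tc * T)\<^sup>2) * min 1 (sqrt (pi / (b / a))) ^ N)"

definition mass_upper :: "nat => real => real => real" where
 "mass_upper N c T = c * (exp (a / b * (tc * T)\<^sup>2 / 2) * max 1 (sqrt (4 * pi / (a / b))) ^ N)"

lemma limit_mass_bounds:
 assumes M: "M : models X" and N: "p <= N" and sT: "vnorm (score n X D) <= T"
  and pr: "cl <= par_prior X M th0" "par_prior X M th0 <= cu" "0 < cl"
 shows "mass_lower N cl T <= limit_mass M D" "limit_mass M D <= mass_upper N cu T" "0 < mass_lower N cl T"
proof -
 have M': "M <= {..<p}" using M(1) models_iff by simp
 have cN: "card M <= N" using card_mono[OF _ M'] N by simp
 have h: "nrm p (centre D) <= tc * T" unfolding tc_def by (rule nrm_centre_le[OF sT])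
 have x0: "0 < sqrt (pi / (b / a))" "0 <= sqrt (4 * pi / (a / b))" using a0 b0 by auto
 have "exp (- (b / a) * (tc * T)\<^sup>2) * min 1 (sqrt (pi / (b / a))) ^ N <= exp (- (b / a) * (tc * T)\<^sup>2) * sqrt (pi / (b / a)) ^ card M"
  by (intro mult_left_mono min_le_power x0 cN) simp
 also have "... <= gmass M (centre D)" by (rule gmass_bounds(3)[OF M' h])
 finally have l: "exp (- (b / a) * (tc * T)\<^sup>2) * min 1 (sqrt (pi / (b / a))) ^ N <= gmass M (centre D)" .
 have l0: "0 < exp (- (b / a) * (tc * T)\<^sup>2) * min 1 (sqrt (pi / (b / a))) ^ N" using x0 by simp
 have "gmass M (centre D) <= exp (a / b * (tc * T)\<^sup>2 / 2) * sqrt (4 * pi / (a / b)) ^ card M"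
  by (rule gmass_bounds(2)[OF M' h])
 also have "... <= exp (a / b * (tc * T)\<^sup>2 / 2) * max 1 (sqrt (4 * pi / (a / b))) ^ N"
  by (intro mult_left_mono power_le_max x0 cN) simp
 finally have u: "gmass M (centre D) <= exp (a / b * (tc * T)\<^sup>2 / 2) * max 1 (sqrt (4 * pi / (a / b))) ^ N" .
 show "mass_lower N cl T <= limit_mass M D" unfolding mass_lower_def limit_mass_def
  using pr l l0 by (intro mult_mono) auto
 show "limit_mass M D <= mass_upper N cu T" unfolding mass_upper_def limit_mass_def
  using pr l l0 u by (intro mult_mono) auto
 show "0 < mass_lower N cl T" unfolding mass_lower_def by (rule mult_pos_pos[OF pr(3) l0])
qed

text \<open>The constant does not involve the location of the Gaussian kernel, so the lower bound on a Bayes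
 factor derived from it holds with one constant for all confidence levels.\<close>

lemma limit_mass_mono:
 assumes M: "M : models X" "true_model X <= M" and N: "p <= N"
  and pr: "cl <= par_prior X M th0" "par_prior X (true_model X) th0 <= cu" "0 < cl" "0 < cu"
 shows "cl / cu * min 1 (sqrt (2 * pi / (b / a))) ^ N * limit_mass (true_model X) D <= limit_mass M D"
proof -
 have M': "M <= {..<p}" using M(1) models_iff by simp
 have cN: "card (M - true_model X) <= N" using card_mono[OF _ M'] card_mono[OF finite_subset[OF M'] Diff_subset[of M "true_model X"]] N by simp
 have x0: "0 < sqrt (2 * pi / (b / a))" using a0 b0 by simp
 have g0: "0 <= gmass (true_model X) (centre D)" by (simp add: gmass_def)
 have "min 1 (sqrt (2 * pi / (b / a))) ^ N * gmass (true_model X) (centre D)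
  <= sqrt (2 * pi / (b / a)) ^ card (M - true_model X) * gmass (true_model X) (centre D)"
  by (intro mult_right_mono min_le_power x0 cN g0)
 also have "... <= gmass M (centre D)" by (rule gmass_mono[OF M(2) M'])
 finally have g: "min 1 (sqrt (2 * pi / (b / a))) ^ N * gmass (true_model X) (centre D) <= gmass M (centre D)" .
 have gp: "0 <= min 1 (sqrt (2 * pi / (b / a))) ^ N * gmass (true_model X) (centre D)"
  using x0 g0 by (intro mult_nonneg_nonneg zero_le_power) auto
 have "cl / cu * par_prior X (true_model X) th0 <= cl / cu * cu" using pr by (intro mult_left_mono) auto
 also have "... = cl" using pr by simp
 finally have c: "cl / cu * par_prior X (true_model X) th0 <= par_prior X M th0" using pr by linarith
 have "cl / cu * min 1 (sqrt (2 * pi / (b / a))) ^ N * limit_mass (true_model X) D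
  = (cl / cu * par_prior X (true_model X) th0) * (min 1 (sqrt (2 * pi / (b / a))) ^ N * gmass (true_model X) (centre D))"
  by (simp add: limit_mass_def)
 also have "... <= limit_mass M D" unfolding limit_mass_def using c g gp pr by (intro mult_mono) auto
 finally show ?thesis .
qed

lemma sc_ratio: "sc (true_model X) / sc M = real n powr (- (real (card M) - real (k0 X)) / 2)"
proof -
 have "rn ^ k = real n powr (real k / 2)" for k
  using n_pos by (simp add: powr_half_sqrt[symmetric] powr_powr powr_realpow[symmetric])
 then show ?thesis by (simp add: sc_def k0_def powr_diff[symmetric] diff_divide_distrib)
qed

end

text \<open>If all four quantities have small relative error, so have their quotients.  The common limits
 cancel in the double quotient.\<close>

lemma ratio_close:
 fixes A A0 q q0 e e0 L et :: real
 assumes L: "0 < L" "L <= A" "L <= A0" and et: "0 < et" "et <= 1 / 8"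
  and close: "\<bar>q - A\<bar> <= et * L" "\<bar>q0 - A0\<bar> <= et * L" "\<bar>e - A\<bar> <= et * L" "\<bar>e0 - A0\<bar> <= et * L"
 shows "\<bar>(q / q0) / (e / e0) - 1\<bar> <= 8 * et" "A / A0 / 2 <= q / q0" "q / q0 <= 2 * (A / A0)"
  "A / A0 / 2 <= e / e0" "e / e0 <= 2 * (A / A0)"
proof -
 have l: "et * L <= et * A" "et * L <= et * A0" using L et by (auto intro: mult_left_mono)
 have b: "(1 - et) * A <= q" "q <= (1 + et) * A" "(1 - et) * A0 <= q0" "q0 <= (1 + et) * A0"
  "(1 - et) * A <= e" "e <= (1 + et) * A" "(1 - et) * A0 <= e0" "e0 <= (1 + et) * A0"
  using close l by (auto simp: distrib_right left_diff_distrib abs_le_iff)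
 have A: "0 < A" "0 < A0" using L by auto
 have pos: "0 < (1 - et) * A" "0 < (1 - et) * A0" using A et by auto
 then have p: "0 < q" "0 < q0" "0 < e" "0 < e0" using b by linarith+
 have half: "A / A0 / 2 <= x / y" "x / y <= 2 * (A / A0)"
  if "(1 - et) * A <= x" "x <= (1 + et) * A" "(1 - et) * A0 <= y" "y <= (1 + et) * A0" for x y
 proof -
  have xy: "7 / 8 * A <= x" "x <= 9 / 8 * A" "7 / 8 * A0 <= y" "y <= 9 / 8 * A0"
  proof -
  have "7 / 8 * z <= (1 - et) * z" "(1 + et) * z <= 9 / 8 * z" if "0 < z" for z
  using et that by (auto intro!: mult_right_mono)
  from this[OF A(1)] this[OF A(2)] show "7 / 8 * A <= x" "x <= 9 / 8 * A" "7 / 8 * A0 <= y" "y <= 9 / 8 * A0"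
  using that by linarith+
  qed
  have y: "0 < y" using xy A by linarith
  have "(7 / 8 * A) / (9 / 8 * A0) <= x / y" using xy A y by (intro frac_le) auto
  moreover have "x / y <= (9 / 8 * A) / (7 / 8 * A0)" using xy A y by (intro frac_le) auto
  moreover have "A / A0 / 2 <= (7 / 8 * A) / (9 / 8 * A0)" "(9 / 8 * A) / (7 / 8 * A0) <= 2 * (A / A0)"
  using A by (auto simp: field_simps)
  ultimately show "A / A0 / 2 <= x / y" "x / y <= 2 * (A / A0)" by linarith+
 qed
 show "A / A0 / 2 <= q / q0" "q / q0 <= 2 * (A / A0)" by (rule half[OF b(1-4)])+
 show "A / A0 / 2 <= e / e0" "e / e0 <= 2 * (A / A0)" by (rule half[OF b(5-8)])+
 have n0: "0 <= q" "0 <= q0" "0 <= e" "0 <= e0" "0 <= (1 + et) * A" "0 <= (1 + et) * A0" "0 <= (1 - et) * A" "0 <= (1 - et) * A0"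
  using p pos A et by (simp_all add: less_imp_le)
 have u: "q * e0 <= ((1 + et) * A) * ((1 + et) * A0)" "q0 * e <= ((1 + et) * A0) * ((1 + et) * A)"
  by (rule mult_mono[OF b(2,8) n0(5,4)], rule mult_mono[OF b(4,6) n0(6,3)])
 have v: "((1 - et) * A) * ((1 - et) * A0) <= q * e0" "((1 - et) * A0) * ((1 - et) * A) <= q0 * e"
  by (rule mult_mono[OF b(1,7) n0(1,8)], rule mult_mono[OF b(3,5) n0(2,7)])
 have "\<bar>q * e0 - q0 * e\<bar> <= 4 * et * (A * A0)"
  using u v by (auto simp: abs_le_iff algebra_simps)
 moreover have "1 / 2 * (A * A0) <= q0 * e"
 proof -
  have "1 / 2 <= (1 - et) * (1 - et)"
  using mult_mono[of "7 / 8" "1 - et" "7 / 8" "1 - et"] et by simp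
  then have "1 / 2 * (A * A0) <= (1 - et) * (1 - et) * (A * A0)" using A by (intro mult_right_mono) auto
  also have "... = ((1 - et) * A0) * ((1 - et) * A)" by (simp add: mult_ac)
  finally show ?thesis using v by linarith
 qed
 ultimately have "\<bar>q * e0 - q0 * e\<bar> / (q0 * e) <= (4 * et * (A * A0)) / (1 / 2 * (A * A0))"
  using A et by (intro frac_le) auto
 also have "... = 8 * et" using A by simp
 finally have "\<bar>q * e0 - q0 * e\<bar> / (q0 * e) <= 8 * et" .
 moreover have "(q / q0) / (e / e0) - 1 = (q * e0 - q0 * e) / (q0 * e)" using p by (simp add: field_simps)
 ultimately show "\<bar>(q / q0) / (e / e0) - 1\<bar> <= 8 * et" using p by (simp add: abs_divide abs_mult)
qed

context bounded_gmm
begin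

text \<open>All terms except the two Gaussian tails are small for a large sample once the radius
 \<open>C\<close> is fixed; they are collected in the factor of \<open>x\<close>.\<close>

lemma est_err_uniform:
 assumes N: "p <= N" and M: "M <= {..<p}" and om: "0 <= om" "om <= x" and t: "0 <= t" "t <= x" and d: "0 <= d" "d <= x"
  and x: "x <= 1" and T: "0 <= T" and C: "0 <= C"
 defines "G \<equiv> max 1 (sqrt (2 * pi / (a / b))) ^ N / min 1 (sqrt (2 * pi / (b / a))) ^ N"
  and "Pc \<equiv> max 1 (sqrt (2 * pi)) ^ N"
  and "D4 \<equiv> 2 / (a / b) * max 1 (sqrt (4 * pi / (a / b))) ^ N / min 1 (sqrt (2 * pi / (b / a))) ^ N"
  and "Q \<equiv> max 1 (1 / (sqrt (a / b) / 2)) ^ N * (2 ^ (N + 1) * max 1 (2 * real N) ^ N)"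
  and "V \<equiv> exp (C\<^sup>2) * max 1 (sqrt pi) ^ N"
  and "y \<equiv> exp (- (a / b / 8) * C\<^sup>2 / 2) * max 1 (sqrt (2 * pi / (a / b / 8))) ^ N"
 shows "est_err (T + d) C om t d M <= x * ((D4 * (1 + Pc) + 1 / (a / b) + Pc + b / a * (T + 1 + C)) * V + G * Pc * Q) + G * y + y"
proof -
 note ub = uniform_bounds[OF N M]
 have y: "tailc C M <= y" and V: "volc C M <= V" and Q: "polyc M <= Q" and P: "pc <= Pc" and G: "gu / gl <= G"
  using ub(1-5) unfolding y_def V_def Q_def Pc_def G_def by auto
 have de: "dens_err om t <= om * D4 * (1 + Pc * t) + om / (a / b) + Pc * t"
  using ub(6)[OF om(1) t(1)] unfolding D4_def Pc_def by (simp add: mult_ac)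
 have x0: "0 <= x" using om by linarith
 have r0: "0 < a / b" "0 < b / a" using a0 b0 by auto
 have P0: "0 <= Pc" and V0: "0 <= V" and Q0: "0 <= Q" unfolding Pc_def V_def Q_def by (auto intro!: mult_nonneg_nonneg zero_le_power)
 have D0: "0 <= D4" unfolding D4_def using a0 b0 by (intro divide_nonneg_nonneg mult_nonneg_nonneg zero_le_power) auto
 have G0: "0 <= G" using G consts_pos divide_nonneg_nonneg[of gu gl] by linarith
 have "om * D4 * (1 + Pc * t) <= x * D4 * (1 + Pc)"
  using om D0 P0 t x x0 by (intro mult_mono add_mono mult_left_le) auto
 moreover have "om / (a / b) <= x * (1 / (a / b))" unfolding times_divide_eq_right mult_1_right
  by (rule divide_right_mono[OF om(2) less_imp_le[OF r0(1)]])
 moreover have "Pc * t <= x * Pc" using mult_left_mono[OF t(2) P0] by (simp add: mult.commute)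
 ultimately have de': "dens_err om t <= x * (D4 * (1 + Pc) + 1 / (a / b) + Pc)" using de by (simp only: distrib_left mult.assoc)
 have "d * (T + d + C) <= x * (T + 1 + C)" using d x T C by (intro mult_mono) auto
 then have bd: "b / a * d * (T + d + C) <= x * (b / a * (T + 1 + C))"
  using mult_left_mono[OF _ less_imp_le[OF r0(2)], of "d * (T + d + C)" "x * (T + 1 + C)"] by (simp only: mult.assoc mult.left_commute)
 have E0: "0 <= x * (D4 * (1 + Pc) + 1 / (a / b) + Pc + b / a * (T + 1 + C))"
  using x0 D0 P0 r0 T C by (intro mult_nonneg_nonneg add_nonneg_nonneg) auto
 have "(dens_err om t + b / a * d * (T + d + C)) * volc C M
  <= (x * (D4 * (1 + Pc) + 1 / (a / b) + Pc + b / a * (T + 1 + C))) * volc C M"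
  using de' bd by (intro mult_right_mono volc_nonneg) (simp only: distrib_left)
 also have "... <= (x * (D4 * (1 + Pc) + 1 / (a / b) + Pc + b / a * (T + 1 + C))) * V"
  by (rule mult_left_mono[OF V E0])
 finally have 1: "(dens_err om t + b / a * d * (T + d + C)) * volc C M
  <= (x * (D4 * (1 + Pc) + 1 / (a / b) + Pc + b / a * (T + 1 + C))) * V" .
 have "pc * t * polyc M <= Pc * x * Q"
  using P t Q P0 x0 Q0 polyc_nonneg consts_pos by (intro mult_mono mult_nonneg_nonneg) auto
 then have "tailc C M + pc * t * polyc M <= y + Pc * x * Q" using y by linarith
 then have 2: "gu / gl * (tailc C M + pc * t * polyc M) <= G * (y + Pc * x * Q)"
  using G G0 tailc_nonneg consts_pos t polyc_nonneg by (intro mult_mono add_nonneg_nonneg mult_nonneg_nonneg) auto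
 have "est_err (T + d) C om t d M <= (x * (D4 * (1 + Pc) + 1 / (a / b) + Pc + b / a * (T + 1 + C))) * V + G * (y + Pc * x * Q) + y"
  unfolding est_err_def using 1 2 y by linarith
 also have "... = x * ((D4 * (1 + Pc) + 1 / (a / b) + Pc + b / a * (T + 1 + C)) * V + G * Pc * Q) + G * y + y"
  by (simp add: distrib_left mult_ac)
 finally show ?thesis .
qed

lemma quasi_err_uniform:
 assumes N: "p <= N" and M: "M <= {..<p}" and pos: "0 < ze" "0 <= e" "0 <= ph"
 shows "quasi_err T C ze r e ph \<upsilon> M \<le>
  exp (resid_max T / 2) * (((ze + 2 * ((T + sqrt b * C)\<^sup>2 / ze + 1) * r\<^sup>2) / a + e * (T + sqrt b * C)\<^sup>2 / a\<^sup>2) * (exp (C\<^sup>2) * max 1 (sqrt pi) ^ N)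
  + 2 * ((T + sqrt b * C)\<^sup>2 / ze + 1) / a * ph) + exp (resid_max T / 2) * \<upsilon>
  + exp (- (a / b / 8) * C\<^sup>2 / 2) * max 1 (sqrt (2 * pi / (a / b / 8))) ^ N"
proof -
 note ub = uniform_bounds[OF N M]
 define Y where "Y = (T + sqrt b * C)\<^sup>2"
 define Z where "Z = (ze + 2 * (Y / ze + 1) * r\<^sup>2) / a + e * Y / a\<^sup>2"
 have Y: "0 <= Y" by (simp add: Y_def)
 have Z: "0 <= Z" unfolding Z_def using Y pos a0 by (intro add_nonneg_nonneg divide_nonneg_nonneg mult_nonneg_nonneg) auto
 have "Z * volc C M <= Z * (exp (C\<^sup>2) * max 1 (sqrt pi) ^ N)" by (rule mult_left_mono[OF ub(2) Z])
 then have "exp (resid_max T / 2) * (Z * volc C M + 2 * (Y / ze + 1) / a * ph + \<upsilon>)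
  <= exp (resid_max T / 2) * (Z * (exp (C\<^sup>2) * max 1 (sqrt pi) ^ N) + 2 * (Y / ze + 1) / a * ph + \<upsilon>)"
  by (intro mult_left_mono) auto
 also have "... = exp (resid_max T / 2) * (Z * (exp (C\<^sup>2) * max 1 (sqrt pi) ^ N) + 2 * (Y / ze + 1) / a * ph) + exp (resid_max T / 2) * \<upsilon>"
  by (rule distrib_left)
 finally show ?thesis using ub(1)[of C] unfolding quasi_err_def Y_def[symmetric] Z_def[symmetric] by linarith
qed

end

section \<open>Sequences of models\<close>

text \<open>The asymptotic conditions in the form in which they are used: constants common to all large
 sample sizes, and everything local to the true parameter on the scale \<open>1 / sqrt n\<close>.\<close>

locale gmm_sequence =
 fixes S :: "nat => 'd gmm" and a b ka K :: real and F :: "nat => 'd => real" and N :: nat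
  and \<tau> :: "nat => real" and cl cu v :: real
 assumes bounded: "EV n. bounded_gmm n (S n) a b ka K (F n)"
  and dims: "EV n. dim_par (S n) <= N & dim_mom (S n) <= N"
  and weight_pos: "EV n. ALL D:space (sample_law n (S n) (true_par (S n))). pos_def (dim_mom (S n)) (wt (S n) D)"
  and weight: "!!dl e. 0 < dl ==> 0 < e ==> EV n. likely (sample_law n (S n) (true_par (S n))) dl
  (%D. form_in (dim_mom (S n)) (wt (S n) D) a b & opnorm (wt (S n) D - var_mom (S n) (true_par (S n))) <= e)"
  and near_regular: "!!C e. 0 < C ==> 0 < e ==> EV n. bounded_gmm.local_regular n (S n) C e"
  and density: "EV n. 0 <= \<tau> n & (ALL th:par_space (S n). bounded_gmm.est_regular n (S n) th (\<tau> n))"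
  and \<tau>0: "\<tau> \<longlonglongrightarrow> 0"
  and est_rate: "!!dl. 0 < dl ==> \<exists>d>0. EV n. likely (sample_law n (S n) (true_par (S n))) dl
  (%D. nrm (dim_par (S n)) (%j. est (S n) D j - oracle_est n (S n) D j) <= d * (1 / real n))"
  and cl: "0 < cl" and cu: "0 < cu"
  and prior_bounds: "EV n. ALL M:models (S n). (ALL th:submodel (S n) M. par_prior (S n) M th <= cu) &
  (true_model (S n) <= M --> cl <= par_prior (S n) M (true_par (S n)))"
  and prior_near: "!!C e. 0 < C ==> 0 < e ==> EV n. ALL M:models (S n). true_model (S n) <= M -->
  (ALL th:submodel (S n) M \<inter> ball0 (S n) (C / sqrt (real n)). \<bar>par_prior (S n) M th - par_prior (S n) M (true_par (S n))\<bar> <= e)"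
  and v: "0 < v"
  and signal_bound: "EV n. ALL j:true_model (S n). v <= \<bar>true_par (S n) j\<bar>"
begin

abbreviation "law_n n \<equiv> sample_law n (S n) (true_par (S n))"

lemma constants: "0 < a" "0 < b" "0 < ka" "0 <= K"
proof -
 from eventually_happens[OF bounded] obtain n where "bounded_gmm n (S n) a b ka K (F n)" by auto
 then interpret bounded_gmm n "S n" a b ka K "F n" .
 show "0 < a" "0 < b" "0 < ka" "0 <= K" by (rule a0 b0 ka0 K0)+
qed

text \<open>The order of the quantifiers matters: \<open>T\<close> bounds the centre of the limiting Gaussian
 kernel and depends only on the confidence level, so the limits stay in a fixed compact subset of
 the positive axis while the precision is refined.\<close>

lemma mass_events:
 assumes dl: "0 < dl"
 shows "\<exists>T>0. \<forall>ep>0. \<forall>M. (EV n. M n : models (S n) & true_model (S n) <= M n) -->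
  (EV n. likely (law_n n) dl (bounded_gmm.mass_event n (S n) a b T ep (M n)))"
proof -
 note c = constants
 define dl' where "dl' = dl / 6"
 have dl': "0 < dl'" using dl by (simp add: dl'_def)
 define T where "T = sqrt (real N * b / dl') + 1"
 have sq0: "0 <= sqrt (real N * b / dl')" using c dl' by simp
 have T: "0 < T" using sq0 unfolding T_def by linarith
 have "real N * b / dl' <= T\<^sup>2"
 proof -
  have "(sqrt (real N * b / dl'))\<^sup>2 <= T\<^sup>2" using sq0 by (intro power_mono) (auto simp: T_def)
  then show ?thesis using c dl' by simp
 qed
 then have T2: "real N * b <= dl' * T\<^sup>2" using dl' by (simp add: pos_divide_le_eq mult.commute)
 define L where "L = K / dl' + 1"
 have L: "0 < L" "K <= dl' * L" using c dl' by (auto simp: L_def distrib_left add_nonneg_pos)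
 define tC where "tC = sqrt b / a * (b / a)"
 have tC0': "0 <= tC" using c by (simp add: tC_def)
 have tC0: "0 <= tC * T" using c T by (simp add: tC_def)
 define A where "A = exp ((T + sqrt b * (tC * T))\<^sup>2 / a / 2)"
 have A: "0 < A" by (simp add: A_def)
 define rt where "rt = 1 / b * (1 / (1 + 2 * (1 / b) * (L + K))) * ka\<^sup>2"
 have rt: "0 < rt" using c L unfolding rt_def by (intro mult_pos_pos divide_pos_pos add_pos_nonneg) auto
 define GU where "GU = exp (a / b * (tC * T)\<^sup>2 / 2) * max 1 (sqrt (4 * pi / (a / b))) ^ N"
 have GU: "0 <= GU" by (simp add: GU_def)
 define G where "G = max 1 (sqrt (2 * pi / (a / b))) ^ N / min 1 (sqrt (2 * pi / (b / a))) ^ N"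
 define Pc where "Pc = max 1 (sqrt (2 * pi)) ^ N"
 define D4 where "D4 = 2 / (a / b) * max 1 (sqrt (4 * pi / (a / b))) ^ N / min 1 (sqrt (2 * pi / (b / a))) ^ N"
 define Q where "Q = max 1 (1 / (sqrt (a / b) / 2)) ^ N * (2 ^ (N + 1) * max 1 (2 * real N) ^ N)"
 have nn: "0 <= G" "0 <= Pc" "0 <= D4" "0 <= Q" using c unfolding G_def Pc_def D4_def Q_def
  by (auto intro!: mult_nonneg_nonneg zero_le_power divide_nonneg_nonneg)
 show ?thesis
 proof (intro exI conjI allI impI)
  show "0 < T" by (rule T)
  fix ep :: real and M assume ep: "0 < ep"
  and M: "EV n. M n : models (S n) & true_model (S n) <= M n"
  define ep' where "ep' = ep / (3 * cu)"
  have ep': "0 < ep'" "cu * ep' = ep / 3" using ep cu by (auto simp: ep'_def)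
  have e4: "0 < ep' / 4" "0 < ep / 3" using ep' ep by auto
  define \<upsilon> where "\<upsilon> = ep' / 4 / A"
  have \<upsilon>: "0 < \<upsilon>" "A * \<upsilon> = ep' / 4" using A ep' by (auto simp: \<upsilon>_def)
  from small_factor[OF GU e4(2)] obtain et where et: "0 < et" "GU * et <= ep / 3" by blast
  have "0 < a / b / 8" "0 < rt / 4" "0 < dl' * \<upsilon>" using c rt dl' \<upsilon> by auto
  note tails = gauss_tail_small[OF this(1) e4(1), of "max 1 (sqrt (2 * pi / (a / b / 8))) ^ N"]
  gauss_tail_small[OF this(1) e4(1), of "G * max 1 (sqrt (2 * pi / (a / b / 8))) ^ N"]
  gauss_tail_small[OF this(2) this(3), of "max 1 (sqrt (2 * pi / (rt / 4))) ^ N"]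
  eventually_ge_at_top[of "2 * (tC * T + 1)"] eventually_ge_at_top[of "4 * T / ka"] eventually_ge_at_top[of "1 :: real"]
  have "\<forall>\<^sub>F C in at_top. exp (- (a / b / 8) * C\<^sup>2 / 2) * max 1 (sqrt (2 * pi / (a / b / 8))) ^ N <= ep' / 4 &
  exp (- (a / b / 8) * C\<^sup>2 / 2) * (G * max 1 (sqrt (2 * pi / (a / b / 8))) ^ N) <= ep' / 4 &
  exp (- (rt / 4) * C\<^sup>2 / 2) * max 1 (sqrt (2 * pi / (rt / 4))) ^ N <= dl' * \<upsilon> &
  2 * (tC * T + 1) <= C & 4 * T / ka <= C & 1 <= C"
  by (intro eventually_conj tails)
  from eventually_happens[OF this] obtain C where
  C1: "exp (- (a / b / 8) * C\<^sup>2 / 2) * max 1 (sqrt (2 * pi / (a / b / 8))) ^ N <= ep' / 4"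
  and C2: "exp (- (a / b / 8) * C\<^sup>2 / 2) * (G * max 1 (sqrt (2 * pi / (a / b / 8))) ^ N) <= ep' / 4"
  and C3: "exp (- (rt / 4) * C\<^sup>2 / 2) * max 1 (sqrt (2 * pi / (rt / 4))) ^ N <= dl' * \<upsilon>"
  and C4: "2 * (tC * T + 1) <= C" "4 * T / ka <= C" "0 < C" by (auto simp: trivial_limit_at_top_linorder)
  define V where "V = exp (C\<^sup>2) * max 1 (sqrt pi) ^ N"
  define y where "y = exp (- (a / b / 8) * C\<^sup>2 / 2) * max 1 (sqrt (2 * pi / (a / b / 8))) ^ N"
  have V: "0 <= V" by (simp add: V_def)
  have yb: "y <= ep' / 4" "G * y <= ep' / 4" using C1 C2 by (simp_all add: y_def mult_ac)
  obtain ze r e ph where ze: "0 < ze" and r: "0 < r" and e: "0 < e" and ph: "0 < ph" and qs: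
  "A * (((ze + 2 * ((T + sqrt b * C)\<^sup>2 / ze + 1) * r\<^sup>2) / a + e * (T + sqrt b * C)\<^sup>2 / a\<^sup>2) * V
  + 2 * ((T + sqrt b * C)\<^sup>2 / ze + 1) / a * ph) <= ep' / 4"
  using small_constants[OF A V c(1) e4(1)] by blast
  have NV: "0 <= real N * V" using V by simp
  from small_factor[OF NV mult_pos_pos[OF dl' ph]] obtain h where h: "0 < h" "h <= 1" "real N * V * h <= dl' * ph" by blast
  have "0 <= (D4 * (1 + Pc) + 1 / (a / b) + Pc + b / a * (tC * T + 1 + C)) * V + G * Pc * Q"
  using nn c V tC0' less_imp_le[OF T] C4 by (intro add_nonneg_nonneg mult_nonneg_nonneg) auto
  from small_factor[OF this e4(1)] obtain x where x: "0 < x" "x <= 1"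
  and xb: "((D4 * (1 + Pc) + 1 / (a / b) + Pc + b / a * (tC * T + 1 + C)) * V + G * Pc * Q) * x <= ep' / 4" by blast
  from est_rate[OF dl'] obtain d0 where d0: "0 < d0" and er: "EV n. likely (law_n n) dl'
  (%D. nrm (dim_par (S n)) (%j. est (S n) D j - oracle_est n (S n) D j) <= d0 * (1 / real n))" by blast
  have "(%n. d0 / sqrt (real n)) \<longlonglongrightarrow> 0" by real_asymp
  from order_tendstoD(2)[OF this x(1)] have dn: "EV n. d0 / sqrt (real n) < x" .
  have tn: "EV n. \<tau> n < x" by (rule order_tendstoD(2)[OF \<tau>0 x(1)])
  show "EV n. likely (law_n n) dl (bounded_gmm.mass_event n (S n) a b T ep (M n))"
  using bounded dims weight[OF dl' e] near_regular[OF C4(3) r] near_regular[OF C4(3) h(1)] near_regular[OF C4(3) x(1)] density er dn tn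
  prior_bounds prior_near[OF C4(3) et(1)] M
  proof eventually_elim
  case (elim n)
  interpret bounded_gmm n "S n" a b ka K "F n" by (rule elim(1))
  have pN: "p <= N" and mN: "real m <= real N" using elim(2) by auto
  have M1: "M n : models (S n)" "true_model (S n) <= M n" using elim(13) by auto
  have M': "M n <= {..<p}" using M1(1) models_iff by simp
  have cN: "card (M n) <= N" using card_mono[OF _ M'] pN by simp
  have t: "0 <= \<tau> n" "\<tau> n <= x" and reg: "est_regular th (\<tau> n)" if "th : par_space (S n)" for th
  using elim(7,10) that by auto
  have t: "0 <= \<tau> n" "\<tau> n <= x" using elim(7,10) by auto
  have tc': "tc = tC" by (simp add: tc_def tC_def)
  have rt': "rate L = rt" by (simp add: rate_def rt_def)
  have RA: "exp (resid_max T / 2) = A" unfolding resid_max_def A_def tC_def ..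
  have T2': "real m * b <= dl' * T\<^sup>2" using mult_right_mono[OF mN, of b] c T2 by linarith
  have ex: "likely SL dl' (%D. sqrt (real n) * nrm p (%j. est (S n) D j - oracle_est n (S n) D j) <= x)"
  using elim(8)
  proof (rule likely_mono)
  fix D assume "nrm p (%j. est (S n) D j - oracle_est n (S n) D j) <= d0 * (1 / real n)"
  then have "sqrt (real n) * nrm p (%j. est (S n) D j - oracle_est n (S n) D j) <= sqrt (real n) * (d0 * (1 / real n))"
  by (intro mult_left_mono) auto
  also have "... = d0 / sqrt (real n)" using n_pos by (simp add: field_simps)
  finally show "sqrt (real n) * nrm p (%j. est (S n) D j - oracle_est n (S n) D j) <= x" using elim(9) by linarith
  qed simp
  have wt: "likely SL dl' (%D. form_in m (wt (S n) D) a b & opnorm (wt (S n) D - var_mom (S n) th0) <= e)" by (rule elim(3))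
  have C': "2 * (tc * T + x) <= C"
  proof -
  have "2 * (tC * T + x) <= 2 * (tC * T + 1)" using x by (intro mult_left_mono) auto
  then show ?thesis using C4(1) unfolding tc' by (rule order.trans)
  qed
  have "h\<^sup>2 <= h" using h by (simp add: power2_eq_square mult_left_le)
  then have "real m * h\<^sup>2 * volc C (M n) <= real N * h * V"
  using mN h uniform_bounds(2)[OF pN M', of C] volc_nonneg unfolding V_def by (intro mult_mono) auto
  also have "... = real N * V * h" by simp
  finally have ph': "real m * h\<^sup>2 * volc C (M n) <= dl' * ph" using h by linarith
  have "exp (- (rt / 4) * C\<^sup>2 / 2) * sqrt (2 * pi / (rt / 4)) ^ card (M n) <= exp (- (rt / 4) * C\<^sup>2 / 2) * max 1 (sqrt (2 * pi / (rt / 4))) ^ N"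
  using rt by (intro mult_left_mono power_le_max cN) auto
  then have \<upsilon>': "exp (- (rate L / 4) * C\<^sup>2 / 2) * sqrt (2 * pi / (rate L / 4)) ^ card (M n) <= dl' * \<upsilon>"
  using C3 unfolding rt' by linarith
  have qb: "quasi_err T C ze r e ph \<upsilon> (M n) <= ep'"
  using quasi_err_uniform[OF pN M' ze, of e ph T C r \<upsilon>] e ph qs \<upsilon>(2) yb(1) ep'
  unfolding RA V_def[symmetric] y_def[symmetric] by linarith
  have "est_err (tc * T + x) C x (\<tau> n) x (M n) \<le>
  x * ((D4 * (1 + Pc) + 1 / (a / b) + Pc + b / a * (tC * T + 1 + C)) * V + G * Pc * Q) + G * y + y"
  using est_err_uniform[OF pN M' less_imp_le[OF x(1)] order.refl t less_imp_le[OF x(1)] order.refl x(2) tC0 less_imp_le[OF C4(3)]]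
  unfolding G_def[symmetric] Pc_def[symmetric] D4_def[symmetric] Q_def[symmetric] V_def[symmetric] y_def[symmetric] tc' .
  then have eb: "est_err (tc * T + x) C x (\<tau> n) x (M n) <= ep'"
  using xb yb ep' unfolding mult.commute[of x] by linarith
  have near: "\<bar>par_prior (S n) (M n) th - par_prior (S n) (M n) th0\<bar> <= et"
  if "th : submodel (S n) (M n)" "th : ball0 (S n) (C / sqrt (real n))" for th
  using elim(12) M1 that by blast
  have cup: "par_prior (S n) (M n) th <= cu" if "th : submodel (S n) (M n)" for th
  using elim(11) M1 that by blast
  have "exp (a / b * (tc * T)\<^sup>2 / 2) * sqrt (4 * pi / (a / b)) ^ card (M n) <= GU"
  unfolding GU_def tc' using c by (intro mult_left_mono power_le_max cN) auto
  then have g: "et * (exp (a / b * (tc * T)\<^sup>2 / 2) * sqrt (4 * pi / (a / b)) ^ card (M n)) <= ep / 3"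
  using mult_left_mono[OF _ less_imp_le[OF et(1)]] et(2) unfolding mult.commute[of GU] by (meson order.trans)
  have "tailc C (M n) <= ep'" using uniform_bounds(1)[OF pN M', of C] yb ep' unfolding y_def by linarith
  then have "cu * tailc C (M n) <= ep / 3" unfolding ep'(2)[symmetric] using cu by (intro mult_left_mono) auto
  then have fin: "cu * ep' + et * (exp (a / b * (tc * T)\<^sup>2 / 2) * sqrt (4 * pi / (a / b)) ^ card (M n)) + cu * tailc C (M n) <= ep"
  using g ep'(2) by linarith
  have "likely SL ((dl' + (dl' + (dl' + dl' + dl'))) + (dl' + 0)) (mass_event T ep (M n))"
  by (rule likely_mass_event[OF M1 elim(4,5,6) less_imp_le[OF r] less_imp_le[OF x(1)] wt ze less_imp_le[OF e] T T2' L C'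
  C4(2,3) less_imp_le[OF x(1)] ph ph' \<upsilon>(1) \<upsilon>' ex reg t(1) qb eb less_imp_le[OF ep'(1)] cup near less_imp_le[OF et(1)] fin])
  then show ?case by (rule likely_mono) (auto simp: dl'_def)
  qed
 qed
qed

end

lemma sqrt_le_self:
 fixes x :: real
 assumes "1 <= x"
 shows "sqrt x <= x"
proof -
 have "x * 1 <= x * x" using assms by (intro mult_left_mono) auto
 then show ?thesis using assms by (intro real_le_lsqrt) (auto simp: power2_eq_square)
qed

lemma exp_beats_power:
 fixes c k :: real
 assumes c: "0 < c" and k: "0 <= k"
 shows "EV n. k * sqrt (real n) ^ N * exp (- c * real n) <= 1"
proof -
 have lim: "filterlim (%n. c * real n) at_top sequentially"
  by (rule filterlim_tendsto_pos_mult_at_top[OF tendsto_const c filterlim_real_sequentially])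
 have "(%n. (c * real n) ^ N / exp (c * real n)) \<longlonglongrightarrow> 0"
  by (rule filterlim_compose[OF tendsto_power_div_exp_0 lim])
 then have "(%n. k / c ^ N * ((c * real n) ^ N / exp (c * real n))) \<longlonglongrightarrow> 0"
  by (rule tendsto_mult_right_zero)
 then have "EV n. k / c ^ N * ((c * real n) ^ N / exp (c * real n)) < 1"
  by (rule order_tendstoD(2)) simp
 then show ?thesis using eventually_ge_at_top[of "1 :: nat"]
 proof eventually_elim
  case (elim n)
  have "sqrt (real n) <= real n" using elim(2) by (intro sqrt_le_self) auto
  then have "sqrt (real n) ^ N <= real n ^ N" by (intro power_mono) auto
  then have "k * sqrt (real n) ^ N * exp (- c * real n) <= k * real n ^ N * exp (- c * real n)"
  using k by (intro mult_left_mono mult_right_mono) auto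
  also have "... = k / c ^ N * ((c * real n) ^ N / exp (c * real n))"
  using c by (simp add: power_mult_distrib exp_minus divide_inverse)
  finally show ?case using elim(1) by linarith
 qed
qed

context bounded_gmm
begin

section \<open>Bayes factors against the true model\<close>

lemma superset_bayes_factors:
 fixes cl cu et T :: real and N :: nat
 defines "l \<equiv> mass_lower N cl T" and "u \<equiv> mass_upper N cu T"
  and "c \<equiv> cl / cu * min 1 (sqrt (2 * pi / (b / a))) ^ N"
 assumes M: "M : models X" "true_model X <= M" and N: "p <= N"
  and pr: "!!M'. M' : models X ==> true_model X <= M' ==> cl <= par_prior X M' th0 & par_prior X M' th0 <= cu"
  and pos: "0 < cl" "0 < cu" and et: "0 < et" "et <= 1 / 8"
  and D: "mass_event T (et * l) M D" "mass_event T (et * l) (true_model X) D"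
 defines "R \<equiv> real n powr (- (real (card M) - real (k0 X)) / 2)"
 shows "\<bar>BFq0 n X D M / BFe0 X D M - 1\<bar> <= 8 * et"
  and "c / 2 * R <= BFq0 n X D M" "c / 2 * R <= BFe0 X D M"
  and "BFq0 n X D M <= 2 * (u / l) * R" "BFe0 X D M <= 2 * (u / l) * R"
proof -
 let ?M0 = "true_model X"
 have wtf: "form_in m (wt X D) a b" and sT: "vnorm (score n X D) <= T" using D(1) by (auto simp: mass_event_def)
 note b1 = limit_mass_bounds[OF M(1) N sT conjunct1[OF pr[OF M]] conjunct2[OF pr[OF M]] pos(1), folded l_def u_def]
 note b0 = limit_mass_bounds[OF true_model_in N sT conjunct1[OF pr[OF true_model_in order.refl]]
  conjunct2[OF pr[OF true_model_in order.refl]] pos(1), folded l_def u_def]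
 have mono: "c * limit_mass ?M0 D <= limit_mass M D" unfolding c_def
  by (rule limit_mass_mono[OF M N conjunct1[OF pr[OF M]] conjunct2[OF pr[OF true_model_in order.refl]] pos])
 let ?q = "sc M * wint (q_kernel D) M" and ?qz = "sc ?M0 * wint (q_kernel D) ?M0"
 let ?e = "sc M * wint (e_kernel D) M" and ?ez = "sc ?M0 * wint (e_kernel D) ?M0"
 have close: "\<bar>?q - limit_mass M D\<bar> <= et * l" "\<bar>?qz - limit_mass ?M0 D\<bar> <= et * l"
  "\<bar>?e - limit_mass M D\<bar> <= et * l" "\<bar>?ez - limit_mass ?M0 D\<bar> <= et * l"
  using D by (auto simp: mass_event_def)
 note rc = ratio_close[OF b1(3) b1(1) b0(1) et close]
 have s: "0 < sc M" "0 < sc ?M0" by (rule sc_pos)+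
 have R: "R = sc ?M0 / sc M" unfolding R_def by (rule sc_ratio[symmetric])
 have R0: "0 < R" unfolding R using s by simp
 have cancel: "x / y = (sc M * x) / (sc ?M0 * y) * R" for x y
  unfolding R using s by (simp add: field_simps)
 have q: "BFq0 n X D M = ?q / ?qz * R" unfolding BFq0_eq(2)[OF wtf] by (rule cancel)
 have e: "BFe0 X D M = ?e / ?ez * R" unfolding BFe0_eq by (rule cancel)
 have "BFq0 n X D M / BFe0 X D M = (?q / ?qz) / (?e / ?ez)" unfolding q e using R0 by simp
 then show "\<bar>BFq0 n X D M / BFe0 X D M - 1\<bar> <= 8 * et" using rc(1) by simp
 have A0: "0 < limit_mass ?M0 D" using b0 by linarith
 have lo: "c / 2 <= limit_mass M D / limit_mass ?M0 D / 2" using mono A0 by (simp add: pos_le_divide_eq)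
 have up: "limit_mass M D / limit_mass ?M0 D <= u / l" using b1 b0 by (intro frac_le) auto
 have up2: "2 * (limit_mass M D / limit_mass ?M0 D) <= 2 * (u / l)" by (rule mult_left_mono[OF up]) simp
 show "c / 2 * R <= BFq0 n X D M" "c / 2 * R <= BFe0 X D M" unfolding q e
  by (rule mult_right_mono[OF order.trans[OF lo rc(2)] less_imp_le[OF R0]],
  rule mult_right_mono[OF order.trans[OF lo rc(4)] less_imp_le[OF R0]])
 show "BFq0 n X D M <= 2 * (u / l) * R" "BFe0 X D M <= 2 * (u / l) * R" unfolding q e
  by (rule mult_right_mono[OF order.trans[OF rc(3) up2] less_imp_le[OF R0]],
  rule mult_right_mono[OF order.trans[OF rc(5) up2] less_imp_le[OF R0]])
qed

text \<open>Both probabilities tend to 1 by Chebyshev's inequality, for the score and for the truncated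
 envelope.  Hence the exponential rate on this event does not depend on the confidence level.\<close>

lemma likely_sep_good:
 assumes v: "0 < v" and 1: "real m * b <= dl * (real n * (ka * v / 8)\<^sup>2)" and 2: "K / real n <= dl' * (ka * v / 16)\<^sup>2"
 shows "likely SL (dl + dl') (%D. D : sep_good v)"
proof -
 have kv: "0 < ka * v" using v ka0 by simp
 have k16: "0 < ka * v / 16" by (rule divide_pos_pos[OF kv]) simp
 have s0: "0 < sqrt (real n)" using n_pos by simp
 have z: "0 < sqrt (real n) * (ka * v / 8)" using kv s0 by simp
 have e: "(sqrt (real n) * (ka * v / 8))\<^sup>2 = real n * (ka * v / 8)\<^sup>2"
  by (simp only: power_mult_distrib real_sqrt_pow2[OF of_nat_0_le_iff])
 have "real m * b <= dl * (sqrt (real n) * (ka * v / 8))\<^sup>2" unfolding e by (rule 1)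
 from likely_score[OF z this] have l1: "likely SL dl (%D. vnorm (score n X D) <= sqrt (real n) * (ka * v / 8))" .
 obtain c where c: "c <= K / sep_level v" "(\<integral>\<^sup>+D. en (((\<Sum>i<n. if sep_level v < F (D i) then F (D i) else 0) / real n - c)\<^sup>2) \<partial>SL) <= en (K / real n)"
  using env_excess[OF sep_consts(1)[OF v]] by blast
 have l2: "likely SL dl' (%D. en (((\<Sum>i<n. if sep_level v < F (D i) then F (D i) else 0) / real n - c)\<^sup>2) <= en ((ka * v / 16)\<^sup>2))"
 proof (rule likely_Markov[OF prob_SL _ c(2) _ 2])
  have g: "(%d. if sep_level v < F d then F d else 0) : bm P" by measurable
  have "(%D. if sep_level v < F (D i) then F (D i) else 0) : bm SL" if "i < n" for i
  by (rule measurable_compose[OF coordinate_measurable[OF that] g])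
  then show "(%D. en (((\<Sum>i<n. if sep_level v < F (D i) then F (D i) else 0) / real n - c)\<^sup>2)) : bm SL"
  by (intro measurable_compose[OF _ measurable_ennreal] borel_measurable_power borel_measurable_diff borel_measurable_divide
  borel_measurable_sum borel_measurable_const) auto
  show "0 < (ka * v / 16)\<^sup>2" by (rule zero_less_power[OF k16])
  show "0 <= K / real n" using K0 by simp
 qed
 from likely_conj[OF prob_SL l1 l2] show ?thesis
 proof (rule likely_mono[OF _ order.refl])
  fix D assume D: "D : space SL"
  and Q: "vnorm (score n X D) <= sqrt (real n) * (ka * v / 8) &
  en (((\<Sum>i<n. if sep_level v < F (D i) then F (D i) else 0) / real n - c)\<^sup>2) <= en ((ka * v / 16)\<^sup>2)"
  have sq: "vnorm (score n X D) = sqrt (real n) * vnorm (avg_mom n X D th0)" by (simp add: score_def vnorm_smult)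
  have "sqrt (real n) * vnorm (avg_mom n X D th0) <= sqrt (real n) * (ka * v / 8)" using conjunct1[OF Q] unfolding sq .
  then have a: "vnorm (avg_mom n X D th0) <= ka * v / 8" by (rule mult_left_le_imp_le[OF _ s0])
  let ?S = "\<Sum>i<n. if sep_level v < F (D i) then F (D i) else 0"
  have "(?S / real n - c)\<^sup>2 <= (ka * v / 16)\<^sup>2"
  using conjunct2[OF Q] by (subst (asm) ennreal_le_iff) simp_all
  then have "?S / real n - c <= ka * v / 16" by (rule power2_le_imp_le) (rule less_imp_le[OF k16])
  then have "?S / real n <= ka * v / 8" using c(1) sep_consts(3)[OF v] by linarith
  then have "?S <= real n * (ka * v / 8)" by (simp only: pos_divide_le_eq[OF n_pos] mult.commute)
  then show "D : sep_good v" using D a by (simp add: sep_good_def)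
 qed
qed

text \<open>A submodel that misses a coordinate of the true model stays at distance at least \<open>v\<close>
 from the true parameter.  Half of the exponential rate is spent in Markov's inequality.\<close>

lemma likely_wint_q_exp:
 assumes M: "M : models X" "true_model X - M ~= {}" and v: "0 < v" "!!j. j : true_model X ==> v <= \<bar>th0 j\<bar>"
  and g: "likely SL dl (%D. D : sep_good v)" and small: "exp (- (sep_rate v / 2) * real n) <= dl'"
 shows "likely SL (dl + dl') (%D. form_in m (wt X D) a b --> wint (q_exp D) M <= exp (- (sep_rate v / 2) * real n))"
  and "!!th. th : submodel X M ==> v <= dist0 X th"
proof -
 obtain j where j: "j : true_model X" "j \<notin> M" using M(2) by auto
 then have jp: "j < p" by (simp add: true_model_def)
 show far: "v <= dist0 X th" if "th : submodel X M" for th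
  using dist0_le[OF j(2) that jp] v(2)[OF j(1)] by linarith
 have x: "exp (- sep_rate v * real n) = exp (- (sep_rate v / 2) * real n) * exp (- (sep_rate v / 2) * real n)"
  by (simp flip: exp_add)
 have y: "exp (- sep_rate v * real n) <= dl' * exp (- (sep_rate v / 2) * real n)"
  unfolding x by (intro mult_right_mono small) simp
 have m: "sep_int M : bm SL" by (rule sep_int_expectation(1)[OF M(1) v(1)]) (rule far)
 have i: "(\<integral>\<^sup>+D. sep_int M D * indicator (sep_good v) D \<partial>SL) <= en (exp (- sep_rate v * real n))"
  by (rule sep_int_expectation(2)[OF M(1) v(1)]) (rule far)
 have "likely SL (dl + dl') (%D. D : sep_good v & sep_int M D <= en (exp (- (sep_rate v / 2) * real n)))"
  by (rule likely_restricted[OF g sep_good_measurable m i _ y]) simp_all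
 then show "likely SL (dl + dl') (%D. form_in m (wt X D) a b --> wint (q_exp D) M <= exp (- (sep_rate v / 2) * real n))"
  by (rule likely_mono[OF _ order.refl]) (auto intro!: wint_q_exp_le[OF M(1)])
qed

lemma true_model_masses:
 fixes cl cu T :: real and N :: nat
 defines "l \<equiv> mass_lower N cl T"
 assumes N: "p <= N" and pr: "cl <= par_prior X (true_model X) th0" "par_prior X (true_model X) th0 <= cu" "0 < cl"
  and D: "mass_event T (l / 2) (true_model X) D"
 shows "exp (- resid_max T / 2) * (l / 2) / sqrt (real n) ^ k0 X <= wint (q_exp D) (true_model X)"
  and "l / 2 / sqrt (real n) ^ k0 X <= wint (e_kernel D) (true_model X)" and "0 < l"
proof -
 let ?M0 = "true_model X"
 have sT: "vnorm (score n X D) <= T" using D by (simp add: mass_event_def)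
 note lb = limit_mass_bounds[OF true_model_in N sT pr, folded l_def]
 show "0 < l" by (rule lb(3))
 have sc: "sc ?M0 = sqrt (real n) ^ k0 X" by (simp add: sc_def k0_def)
 have s: "0 < sqrt (real n) ^ k0 X" using n_pos by simp
 have lower: "l / 2 <= x" if "\<bar>x - A\<bar> <= l / 2" "l <= A" for x A using that by linarith
 have m1: "\<bar>sc ?M0 * wint (q_kernel D) ?M0 - limit_mass ?M0 D\<bar> <= l / 2"
  "\<bar>sc ?M0 * wint (e_kernel D) ?M0 - limit_mass ?M0 D\<bar> <= l / 2"
  using D unfolding mass_event_def by blast+
 have q: "l / 2 <= sqrt (real n) ^ k0 X * wint (q_kernel D) ?M0" "l / 2 <= sqrt (real n) ^ k0 X * wint (e_kernel D) ?M0"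
  by (rule lower[OF m1(1) lb(1), unfolded sc], rule lower[OF m1(2) lb(1), unfolded sc])
 show "l / 2 / sqrt (real n) ^ k0 X <= wint (e_kernel D) ?M0"
  unfolding pos_divide_le_eq[OF s] using q(2) by (simp only: mult.commute)
 have "exp (- resid_max T / 2) * (l / 2) / sqrt (real n) ^ k0 X <= exp (- resid n X D / 2) * wint (q_kernel D) ?M0"
 proof -
  have r: "exp (- resid_max T / 2) <= exp (- resid n X D / 2)"
  using resid_bounds(2)[OF sT] by (simp add: resid_max_def)
  have "l / 2 / sqrt (real n) ^ k0 X <= wint (q_kernel D) ?M0"
  unfolding pos_divide_le_eq[OF s] using q(1) by (simp only: mult.commute)
  then have "exp (- resid_max T / 2) * (l / 2 / sqrt (real n) ^ k0 X) <= exp (- resid n X D / 2) * wint (q_kernel D) ?M0"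
  using r lb(3) s by (intro mult_mono) auto
  then show ?thesis by (simp only: times_divide_eq_right)
 qed
 then show "exp (- resid_max T / 2) * (l / 2) / sqrt (real n) ^ k0 X <= wint (q_exp D) ?M0" unfolding wint_q_exp .
qed

lemma AE_wint_e_kernel:
 assumes M: "M : models X" and v: "0 < v" and far: "!!th. th : submodel X M ==> v <= dist0 X th"
  and N: "p <= N" and reg: "!!th. th : par_space X ==> est_regular th t" and t: "0 <= t"
  and T: "2 * (T + d) <= sqrt (real n) * v"
 defines "G \<equiv> max 1 (sqrt (2 * pi / (a / b))) ^ N / min 1 (sqrt (2 * pi / (b / a))) ^ N"
  and "Pc \<equiv> max 1 (sqrt (2 * pi)) ^ N"
  and "Q \<equiv> max 1 (1 / (sqrt (a / b) / 2 * v)) ^ (N + 1)"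
 shows "AE D in SL. nrm p (centre D) <= T --> sqrt (real n) * nrm p (%j. est X D j - oracle_est n X D j) <= d -->
  wint (e_kernel D) M <= G * exp (- (a / b / 8) * v\<^sup>2 * real n) + G * Pc * Q * t / sqrt (real n) ^ (p + 1)"
proof -
 have u: "AE D in SL. AE th in leb M. th : submodel X M --> e_kernel D th <= est_upper t (est X D) th"
  by (rule AE_est_upper[OF M _ t]) (rule reg)
 then show ?thesis
 proof eventually_elim
  case (elim D)
  show ?case
  proof (intro impI)
  assume h: "nrm p (centre D) <= T" and d: "sqrt (real n) * nrm p (%j. est X D j - oracle_est n X D j) <= d"
  let ?c = "sqrt (a / b) / 2 * v"
  have r0: "0 < sqrt (a / b)" using a0 b0 by simp
  then have c0: "0 < ?c" using v by simp
  have s0: "0 < sqrt (real n)" using n_pos by simp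
  have "wint (e_kernel D) M <= gu / gl * (exp (- (a / b / 8) * v\<^sup>2 * real n) + pc * t * (1 / (?c * sqrt (real n)) ^ (p + 1)))"
  by (rule wint_e_kernel_separated[OF M v _ elim t est_dev_le[OF h d] T]) (rule far)
  have z: "0 <= Pc" "0 <= 1 / (?c * sqrt (real n)) ^ (p + 1)"
  using c0 s0 by (auto simp: Pc_def intro!: divide_nonneg_nonneg zero_le_power simp del: power_Suc power_add)
  note \<open>wint (e_kernel D) M <= gu / gl * (exp (- (a / b / 8) * v\<^sup>2 * real n) + pc * t * (1 / (?c * sqrt (real n)) ^ (p + 1)))\<close>
  also have "gu / gl * (exp (- (a / b / 8) * v\<^sup>2 * real n) + pc * t * (1 / (?c * sqrt (real n)) ^ (p + 1)))
  <= G * (exp (- (a / b / 8) * v\<^sup>2 * real n) + Pc * t * (Q / sqrt (real n) ^ (p + 1)))"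
  proof (intro mult_mono add_mono order.refl mult_nonneg_nonneg add_nonneg_nonneg)
  have ub: "gu / gl <= G" "pc <= Pc" unfolding G_def Pc_def by (rule uniform_bounds(5,4)[OF N empty_subsetI])+
  show "gu / gl <= G" "pc <= Pc" by (rule ub)+
  show "0 <= G" using ub(1) consts_pos divide_nonneg_nonneg[of gu gl] by linarith
  have "1 / (?c * sqrt (real n)) ^ (p + 1) = (1 / ?c) ^ (p + 1) / sqrt (real n) ^ (p + 1)"
  by (simp only: power_mult_distrib power_one_over divide_divide_eq_left)
  also have "... <= Q / sqrt (real n) ^ (p + 1)"
  unfolding Q_def using c0 N s0 by (intro divide_right_mono power_le_max zero_le_power) auto
  finally show "1 / (?c * sqrt (real n)) ^ (p + 1) <= Q / sqrt (real n) ^ (p + 1)" .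
  qed (rule z exp_ge_zero less_imp_le[OF consts_pos(1)] t)+
  also have "... = G * exp (- (a / b / 8) * v\<^sup>2 * real n) + G * Pc * Q * t / sqrt (real n) ^ (p + 1)"
  by (simp add: distrib_left mult_ac)
  finally show "wint (e_kernel D) M <= G * exp (- (a / b / 8) * v\<^sup>2 * real n) + G * Pc * Q * t / sqrt (real n) ^ (p + 1)" .
  qed
 qed
qed

end

lemma sqrt_power_ratio:
 fixes x :: real
 assumes "0 < x"
 shows "sqrt x ^ k / sqrt x ^ (p + 1) = x powr (- (real p - real k + 1) / 2)"
proof -
 have e: "sqrt x ^ j = x powr (real j / 2)" for j
  using assms by (simp add: powr_half_sqrt[symmetric] powr_powr powr_realpow[symmetric])
 have d: "real k / 2 - real (p + 1) / 2 = - (real p - real k + 1) / 2" by (simp add: field_simps)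
 show ?thesis by (simp only: e powr_diff[symmetric] d)
qed

lemma wpa1_if_likely:
 assumes Q: "!!dl. 0 < dl ==> EV n. likely (sample_law n (S n) (true_par (S n))) dl (Q n)"
  and m: "EV n. prob_space (sample_law n (S n) (true_par (S n))) &
  {D : space (sample_law n (S n) (true_par (S n))). Q n D} : sets (sample_law n (S n) (true_par (S n)))"
 shows "wpa1 S Q"
 unfolding wpa1_def
proof (rule tendstoI)
 fix e :: real assume e: "0 < e"
 then have "0 < e / 2" by simp
 from Q[OF this] m show "EV n. dist (wprob S Q n) 1 < e"
 proof eventually_elim
  case (elim n)
  interpret prob_space "sample_law n (S n) (true_par (S n))" using elim by simp
  have "1 - e / 2 <= wprob S Q n" unfolding wprob_def using elim by (intro likely_event) auto
  moreover have "wprob S Q n <= 1" unfolding wprob_def by (rule prob_le_1)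
  ultimately show ?case using e by (simp add: dist_real_def)
 qed
qed

lemma likely_if_wpa1:
 assumes "wpa1 S Q" "0 < dl"
 shows "EV n. likely (sample_law n (S n) (true_par (S n))) dl (Q n)"
proof -
 define dl' where "dl' = min dl (1 / 2)"
 have "0 < dl'" using assms by (simp add: dl'_def)
 then have "EV n. 1 - dl' < wprob S Q n"
  using assms(1) unfolding wpa1_def by (intro order_tendstoD(1)[of _ 1]) auto
 then show ?thesis
 proof eventually_elim
  case (elim n)
  have "likely (sample_law n (S n) (true_par (S n))) dl' (Q n)"
  using elim unfolding wprob_def by (intro likely_if_event) (auto simp: dl'_def)
  then show ?case by (rule likely_mono) (auto simp: dl'_def)
 qed
qed

context gmm_sequence
begin

lemma bayes_measurable:
 assumes M: "EV n. M n : models (S n)"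
 shows "EV n. prob_space (law_n n) & 1 <= n &
  (%D. BFq0 n (S n) D (M n)) : bm (law_n n) & (%D. BFe0 (S n) D (M n)) : bm (law_n n)"
 using bounded weight_pos M
proof eventually_elim
 case (elim n)
 interpret bounded_gmm n "S n" a b ka K "F n" by (rule elim(1))
 show ?case using prob_SL n1 BFe0_measurable[OF elim(3)] BFq0_measurable[OF elim(3)] elim(2) by simp
qed

lemma true_model_eventually:
 "EV n. true_model (S n) : models (S n) & true_model (S n) <= true_model (S n)"
 by (intro always_eventually allI) (auto simp: models_def true_model_def)

text \<open>The constant \<open>c\<close> precedes the confidence level because the limiting masses of the two
 models are comparable from below independently of the position of the Gaussian; the upper
 constant needs that position to be bounded.\<close>

lemma superset_events:
 assumes M: "EV n. M n : models (S n) & true_model (S n) <= M n"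
 defines "R \<equiv> %n. real n powr (- (real (card (M n)) - real (k0 (S n))) / 2)"
 shows "\<exists>c>0. \<forall>dl>0. \<exists>B>0. \<forall>et. 0 < et --> et <= 1 / 8 --> (EV n. likely (law_n n) dl (%D.
  \<bar>BFq0 n (S n) D (M n) / BFe0 (S n) D (M n) - 1\<bar> <= 8 * et &
  c * R n <= BFq0 n (S n) D (M n) & c * R n <= BFe0 (S n) D (M n) &
  BFq0 n (S n) D (M n) <= B * R n & BFe0 (S n) D (M n) <= B * R n))"
proof -
 note co = constants
 define c where "c = cl / cu * min 1 (sqrt (2 * pi / (b / a))) ^ N / 2"
 have c: "0 < c" using cl cu co by (simp add: c_def)
 show ?thesis
 proof (rule exI[of _ c], intro conjI c allI impI)
  fix dl :: real assume "0 < dl"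
  then have d2: "0 < dl / 2" by simp
  from mass_events[OF this] obtain T where T: "!!ep M'. 0 < ep ==> (EV n. M' n : models (S n) & true_model (S n) <= M' n) ==>
  (EV n. likely (law_n n) (dl / 2) (bounded_gmm.mass_event n (S n) a b T ep (M' n)))" by blast
  define tC where "tC = sqrt b / a * (b / a)"
  define l where "l = cl * (exp (- (b / a) * (tC * T)\<^sup>2) * min 1 (sqrt (pi / (b / a))) ^ N)"
  define u where "u = cu * (exp (a / b * (tC * T)\<^sup>2 / 2) * max 1 (sqrt (4 * pi / (a / b))) ^ N)"
  have l: "0 < l" using cl co by (simp add: l_def)
  have u: "0 < u" using cu by (simp add: u_def)
  show "\<exists>B>0. \<forall>et. 0 < et --> et <= 1 / 8 --> (EV n. likely (law_n n) dl (%D.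
  \<bar>BFq0 n (S n) D (M n) / BFe0 (S n) D (M n) - 1\<bar> <= 8 * et &
  c * R n <= BFq0 n (S n) D (M n) & c * R n <= BFe0 (S n) D (M n) &
  BFq0 n (S n) D (M n) <= B * R n & BFe0 (S n) D (M n) <= B * R n))"
  proof (intro exI[of _ "2 * (u / l)"] conjI allI impI)
  show "0 < 2 * (u / l)" using l u by simp
  fix et :: real assume et: "0 < et" "et <= 1 / 8"
  have el: "0 < et * l" using et l by simp
  show "EV n. likely (law_n n) dl (%D.
  \<bar>BFq0 n (S n) D (M n) / BFe0 (S n) D (M n) - 1\<bar> <= 8 * et &
  c * R n <= BFq0 n (S n) D (M n) & c * R n <= BFe0 (S n) D (M n) &
  BFq0 n (S n) D (M n) <= 2 * (u / l) * R n & BFe0 (S n) D (M n) <= 2 * (u / l) * R n)"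
  using T[OF el M] T[OF el true_model_eventually] bounded dims prior_bounds M
  proof eventually_elim
  case (elim n)
  interpret bounded_gmm n "S n" a b ka K "F n" by (rule elim(3))
  have N: "p <= N" using elim(4) by simp
  have pr: "cl <= par_prior (S n) M' th0 & par_prior (S n) M' th0 <= cu"
  if "M' : models (S n)" "true_model (S n) <= M'" for M'
  using elim(5) that true_par_in_submodel[OF that(2)] by blast
  have lu: "mass_lower N cl T = l" "mass_upper N cu T = u"
  by (simp_all add: mass_lower_def mass_upper_def l_def u_def tc_def tC_def)
  have "likely SL (dl / 2 + dl / 2) (%D. mass_event T (et * l) (M n) D & mass_event T (et * l) (true_model (S n)) D)"
  by (rule likely_conj[OF prob_SL elim(1,2)])
  then show ?case
  proof (rule likely_mono)
  fix D assume "mass_event T (et * l) (M n) D & mass_event T (et * l) (true_model (S n)) D"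
  then have D: "mass_event T (et * mass_lower N cl T) (M n) D" "mass_event T (et * mass_lower N cl T) (true_model (S n)) D"
  unfolding lu by auto
  note sb = superset_bayes_factors[OF conjunct1[OF elim(6)] conjunct2[OF elim(6)] N pr cl cu et D]
  show "\<bar>BFq0 n (S n) D (M n) / BFe0 (S n) D (M n) - 1\<bar> <= 8 * et &
  c * R n <= BFq0 n (S n) D (M n) & c * R n <= BFe0 (S n) D (M n) &
  BFq0 n (S n) D (M n) <= 2 * (u / l) * R n & BFe0 (S n) D (M n) <= 2 * (u / l) * R n"
  using sb unfolding lu c_def R_def by blast
  qed simp
  qed
  qed
 qed
qed

definition sepr :: real where
 "sepr = 1 / b * (1 / (1 + 16 * (1 / b) * K)) * (ka * v)\<^sup>2 / 4"

lemma sepr_pos: "0 < sepr"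
 unfolding sepr_def using constants v
 by (intro divide_pos_pos mult_pos_pos add_pos_nonneg zero_less_power mult_nonneg_nonneg) auto

text \<open>The denominator is of order \<open>n\<close> to the power of minus half the true dimension, so it
 only costs a part of the exponential rate of the numerator.\<close>

lemma q_separated:
 assumes M: "EV n. M n : models (S n) & true_model (S n) - M n ~= {}"
  and C: "C * v\<^sup>2 <= sepr / 4" and dl: "0 < dl"
 shows "EV n. likely (law_n n) dl (%D. BFq0 n (S n) D (M n) <= exp (- C * real n * v\<^sup>2))"
proof -
 note co = constants
 define dl' where "dl' = dl / 4"
 have dl': "0 < dl'" using dl by (simp add: dl'_def)
 from mass_events[OF this] obtain T where T: "!!ep M'. 0 < ep ==> (EV n. M' n : models (S n) & true_model (S n) <= M' n) ==>
  (EV n. likely (law_n n) dl' (bounded_gmm.mass_event n (S n) a b T ep (M' n)))" by blast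
 define tC where "tC = sqrt b / a * (b / a)"
 define l where "l = cl * (exp (- (b / a) * (tC * T)\<^sup>2) * min 1 (sqrt (pi / (b / a))) ^ N)"
 define Rm where "Rm = exp (- ((T + sqrt b * (tC * T))\<^sup>2 / a) / 2)"
 have l: "0 < l" using cl co by (simp add: l_def)
 then have l2: "0 < l / 2" by simp
 have Rm: "0 < Rm" by (simp add: Rm_def)
 have s4: "0 < sepr / 4" "0 < sepr / 2" using sepr_pos by auto
 have kv: "0 < ka * v" using co v by simp
 have "(%n. real N * b / (ka * v / 8)\<^sup>2 / real n) \<longlonglongrightarrow> 0" by real_asymp
 from order_tendstoD(2)[OF this dl'] have e1: "EV n. real N * b / (ka * v / 8)\<^sup>2 / real n < dl'" .
 have "(%n. K / (ka * v / 16)\<^sup>2 / real n) \<longlonglongrightarrow> 0" by real_asymp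
 from order_tendstoD(2)[OF this dl'] have e2: "EV n. K / (ka * v / 16)\<^sup>2 / real n < dl'" .
 have "(%n. exp (- (sepr / 2) * real n)) \<longlonglongrightarrow> 0" using s4 by real_asymp
 from order_tendstoD(2)[OF this dl'] have e3: "EV n. exp (- (sepr / 2) * real n) < dl'" .
 have k0: "0 <= 1 / (Rm * (l / 2))" using Rm l by simp
 show ?thesis
  using T[OF l2 true_model_eventually] bounded dims prior_bounds M signal_bound e1 e2 e3
  exp_beats_power[OF s4(1) k0, of N]
 proof eventually_elim
  case (elim n)
  interpret bounded_gmm n "S n" a b ka K "F n" by (rule elim(2))
  have N: "p <= N" and mN: "real m <= real N" using elim(3) by auto
  have sr: "sep_rate v = sepr" by (simp add: sep_rate_def sepr_def)
  have pr: "cl <= par_prior (S n) (true_model (S n)) th0" "par_prior (S n) (true_model (S n)) th0 <= cu"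
  using elim(4) true_model_in true_par_in_submodel[OF order.refl] by blast+
  have ll: "mass_lower N cl T = l" by (simp add: mass_lower_def l_def tc_def tC_def)
  have rr: "exp (- resid_max T / 2) = Rm" by (simp add: Rm_def resid_max_def tC_def)
  have kk: "0 < (ka * v / 8)\<^sup>2" "0 < (ka * v / 16)\<^sup>2" using kv by (auto simp del: power_divide)
  have "real N * b <= dl' * (real n * (ka * v / 8)\<^sup>2)"
  using elim(7) kk n_pos by (simp only: pos_divide_less_eq mult_ac less_imp_le)
  then have g1: "real m * b <= dl' * (real n * (ka * v / 8)\<^sup>2)" using mult_right_mono[OF mN, of b] co by linarith
  have g2: "K / real n <= dl' * (ka * v / 16)\<^sup>2"
  proof -
  have "K / real n / (ka * v / 16)\<^sup>2 <= dl'" using elim(8) by (simp only: divide_divide_eq_left mult.commute)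
  then show ?thesis using kk by (simp only: pos_divide_le_eq)
  qed
  have small: "exp (- (sep_rate v / 2) * real n) <= dl'" unfolding sr using elim(9) by linarith
  have "likely SL ((dl' + dl') + dl') (%D. form_in m (wt (S n) D) a b --> wint (q_exp D) (M n) <= exp (- (sep_rate v / 2) * real n))"
  by (rule likely_wint_q_exp(1)[OF conjunct1[OF elim(5)] conjunct2[OF elim(5)] v _ likely_sep_good[OF v g1 g2] small])
  (use elim(6) in blast)
  from likely_conj[OF prob_SL this elim(1)] show ?case
  proof (rule likely_mono)
  fix D assume Q: "(form_in m (wt (S n) D) a b --> wint (q_exp D) (M n) <= exp (- (sep_rate v / 2) * real n))
  & mass_event T (l / 2) (true_model (S n)) D"
  have wtf: "form_in m (wt (S n) D) a b" using Q by (simp add: mass_event_def)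
  have D: "mass_event T (mass_lower N cl T / 2) (true_model (S n)) D" using Q unfolding ll by simp
  note tm = true_model_masses[OF N pr cl D, unfolded ll rr]
  let ?s = "sqrt (real n) ^ k0 (S n)" and ?e = "exp (- (sepr / 4) * real n)"
  have s: "0 < ?s" using n_pos by simp
  have kN: "k0 (S n) <= N"
  proof -
  have "card (true_model (S n)) <= card {..<p}" by (rule card_mono) (auto simp: true_model_def)
  then show ?thesis using N by (simp add: k0_def)
  qed
  have sN: "?s <= sqrt (real n) ^ N" using kN n1 by (intro power_increasing) auto
  have sq: "?e * ?e = exp (- (sepr / 2) * real n)" by (simp flip: exp_add)
  have num: "wint (q_exp D) (M n) <= ?e * ?e" using Q wtf unfolding sr sq by blast
  have den: "0 < Rm * (l / 2) / ?s" using Rm l s by simp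
  have "BFq0 n (S n) D (M n) = wint (q_exp D) (M n) / wint (q_exp D) (true_model (S n))" by (rule BFq0_eq(1)[OF wtf])
  also have "... <= (?e * ?e) / (Rm * (l / 2) / ?s)"
  by (rule frac_le[OF _ num den tm(1)]) simp
  also have "... = (1 / (Rm * (l / 2)) * ?s * ?e) * ?e" by (simp add: field_simps)
  also have "... <= (1 / (Rm * (l / 2)) * sqrt (real n) ^ N * ?e) * ?e"
  using sN k0 by (intro mult_right_mono mult_left_mono) auto
  also have "... <= 1 * ?e" using elim(10) by (intro mult_right_mono) auto
  also have "1 * ?e <= exp (- C * real n * v\<^sup>2)"
  proof -
  have "C * v\<^sup>2 * real n <= sepr / 4 * real n" by (rule mult_right_mono[OF C]) simp
  then show ?thesis by (simp add: mult_ac)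
  qed
  finally show "BFq0 n (S n) D (M n) <= exp (- C * real n * v\<^sup>2)" .
  qed (simp add: dl'_def)
 qed
qed

text \<open>Away from the true parameter the estimator has a Gaussian tail and an error of size \<open>\<tau>
 n\<close> times the reciprocal of a power \<open>p + 1\<close> of the distance.  The exponential
 term absorbs the polynomial denominator; the error term keeps its exact order.\<close>

lemma e_separated:
 assumes M: "EV n. M n : models (S n) & true_model (S n) - M n ~= {}"
  and C: "C <= a / b / 16" and dl: "0 < dl"
 shows "\<exists>B>0. EV n. likely (law_n n) dl (%D. BFe0 (S n) D (M n) \<le>
  max (exp (- C * real n * v\<^sup>2)) (B * \<tau> n * real n powr (- (real (dim_par (S n)) - real (k0 (S n)) + 1) / 2)))"
proof -
 note co = constants
 define dl' where "dl' = dl / 3"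
 have dl': "0 < dl'" using dl by (simp add: dl'_def)
 from mass_events[OF this] obtain T where T0: "0 < T" and T: "!!ep M'. 0 < ep ==> (EV n. M' n : models (S n) & true_model (S n) <= M' n) ==>
  (EV n. likely (law_n n) dl' (bounded_gmm.mass_event n (S n) a b T ep (M' n)))" by blast
 define tC where "tC = sqrt b / a * (b / a)"
 define l where "l = cl * (exp (- (b / a) * (tC * T)\<^sup>2) * min 1 (sqrt (pi / (b / a))) ^ N)"
 have l: "0 < l" using cl co by (simp add: l_def)
 then have l2: "0 < l / 2" by simp
 define G where "G = max 1 (sqrt (2 * pi / (a / b))) ^ N / min 1 (sqrt (2 * pi / (b / a))) ^ N"
 define Pc where "Pc = max 1 (sqrt (2 * pi)) ^ N"
 define Q where "Q = max 1 (1 / (sqrt (a / b) / 2 * v)) ^ (N + 1)"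
 have G: "0 < G" unfolding G_def using co by (intro divide_pos_pos zero_less_power) auto
 have PQ: "0 < Pc" "0 < Q" unfolding Pc_def Q_def by (auto intro!: zero_less_power simp del: power_Suc power_add)
 define B where "B = 2 * (G * Pc * Q / (l / 2))"
 have B: "0 < B" unfolding B_def using G PQ l2 by (intro mult_pos_pos divide_pos_pos) auto
 from est_rate[OF dl'] obtain d0 where d0: "0 < d0" and er: "EV n. likely (law_n n) dl'
  (%D. nrm (dim_par (S n)) (%j. est (S n) D j - oracle_est n (S n) D j) <= d0 * (1 / real n))" by blast
 have "filterlim (%n. sqrt (real n) * v) at_top sequentially" using v by real_asymp
 then have e1: "EV n. 2 * (tC * T + d0) <= sqrt (real n) * v" by (simp add: filterlim_at_top)
 have gap: "0 < a / b / 16 * v\<^sup>2" using co v by simp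
 have k0: "0 <= 2 * (G / (l / 2))" using G l by simp
 show ?thesis
 proof (intro exI conjI)
  show "0 < B" by (rule B)
  show "EV n. likely (law_n n) dl (%D. BFe0 (S n) D (M n) \<le>
  max (exp (- C * real n * v\<^sup>2)) (B * \<tau> n * real n powr (- (real (dim_par (S n)) - real (k0 (S n)) + 1) / 2)))"
  using T[OF l2 true_model_eventually] bounded dims prior_bounds M signal_bound density er e1
  exp_beats_power[OF gap k0, of N]
  proof eventually_elim
  case (elim n)
  interpret bounded_gmm n "S n" a b ka K "F n" by (rule elim(2))
  have N: "p <= N" using elim(3) by simp
  have M1: "M n : models (S n)" using elim(5) by simp
  obtain j where j: "j : true_model (S n)" "j \<notin> M n" using elim(5) by auto
  then have jp: "j < p" by (simp add: true_model_def)
  have far: "v <= dist0 (S n) th" if "th : submodel (S n) (M n)" for th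
  using dist0_le[OF j(2) that jp] elim(6) j(1) by force
  have pr: "cl <= par_prior (S n) (true_model (S n)) th0" "par_prior (S n) (true_model (S n)) th0 <= cu"
  using elim(4) true_model_in true_par_in_submodel[OF order.refl] by blast+
  have ll: "mass_lower N cl T = l" by (simp add: mass_lower_def l_def tc_def tC_def)
  have tc': "tc = tC" by (simp add: tc_def tC_def)
  have t: "0 <= \<tau> n" and reg: "!!th. th : par_space (S n) ==> est_regular th (\<tau> n)" using elim(7) by auto
  have TT: "2 * (tc * T + d0) <= sqrt (real n) * v" unfolding tc' by (rule elim(9))
  have ae: "AE D in SL. nrm p (centre D) <= tc * T --> sqrt (real n) * nrm p (%j. est (S n) D j - oracle_est n (S n) D j) <= d0 -->
  wint (e_kernel D) (M n) <= G * exp (- (a / b / 8) * v\<^sup>2 * real n) + G * Pc * Q * \<tau> n / sqrt (real n) ^ (p + 1)"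
  unfolding G_def Pc_def Q_def by (rule AE_wint_e_kernel[OF M1 v _ N _ t TT]) (rule far reg, assumption)+
  from likely_conj[OF prob_SL elim(1) likely_conj[OF prob_SL elim(8) likely_AE[OF prob_SL ae]]] show ?case
  proof (rule likely_mono)
  fix D assume H: "mass_event T (l / 2) (true_model (S n)) D &
  nrm p (%j. est (S n) D j - oracle_est n (S n) D j) <= d0 * (1 / real n) &
  (nrm p (centre D) <= tc * T --> sqrt (real n) * nrm p (%j. est (S n) D j - oracle_est n (S n) D j) <= d0 -->
  wint (e_kernel D) (M n) <= G * exp (- (a / b / 8) * v\<^sup>2 * real n) + G * Pc * Q * \<tau> n / sqrt (real n) ^ (p + 1))"
  have D: "mass_event T (mass_lower N cl T / 2) (true_model (S n)) D" using H unfolding ll by simp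
  note tm = true_model_masses[OF N pr cl D, unfolded ll]
  have sT: "vnorm (score n (S n) D) <= T" using D by (simp add: mass_event_def)
  have h: "nrm p (centre D) <= tc * T" unfolding tc_def by (rule nrm_centre_le[OF sT])
  have d: "sqrt (real n) * nrm p (%j. est (S n) D j - oracle_est n (S n) D j) <= d0"
  proof -
  have "sqrt (real n) * nrm p (%j. est (S n) D j - oracle_est n (S n) D j) <= sqrt (real n) * (d0 * (1 / real n))"
  using H by (intro mult_left_mono) auto
  also have "... <= real n * (d0 * (1 / real n))"
  using d0 n1 by (intro mult_right_mono sqrt_le_self) auto
  also have "... = d0" using n_pos by simp
  finally show ?thesis .
  qed
  let ?s = "sqrt (real n) ^ k0 (S n)" and ?e = "exp (- (a / b / 16 * v\<^sup>2) * real n)"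
  have s: "0 < ?s" using n_pos by simp
  have kN: "k0 (S n) <= N"
  proof -
  have "card (true_model (S n)) <= card {..<p}" by (rule card_mono) (auto simp: true_model_def)
  then show ?thesis using N by (simp add: k0_def)
  qed
  have sN: "?s <= sqrt (real n) ^ N" using kN n1 by (intro power_increasing) auto
  let ?R = "real n powr (- (real p - real (k0 (S n)) + 1) / 2)"
  have R: "?s / sqrt (real n) ^ (p + 1) = ?R" by (rule sqrt_power_ratio[OF n_pos])
  have ee: "exp (- (a / b / 8) * v\<^sup>2 * real n) = ?e * ?e"
  proof -
  have "- (x / 8) * y * z = - (x / 16 * y) * z + - (x / 16 * y) * z" for x y z :: real by simp
  from this[of "a / b" "v\<^sup>2" "real n"] show ?thesis by (simp only: exp_add)
  qed
  have num: "wint (e_kernel D) (M n) <= G * (?e * ?e) + G * Pc * Q * \<tau> n / sqrt (real n) ^ (p + 1)"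
  using H h d unfolding ee by blast
  have num0: "0 <= G * (?e * ?e) + G * Pc * Q * \<tau> n / sqrt (real n) ^ (p + 1)"
  using G PQ t by (intro add_nonneg_nonneg mult_nonneg_nonneg divide_nonneg_nonneg zero_le_power) auto
  have den: "0 < l / 2 / ?s" using l2 s by (rule divide_pos_pos)
  have "BFe0 (S n) D (M n) = wint (e_kernel D) (M n) / wint (e_kernel D) (true_model (S n))" by (rule BFe0_eq)
  also have "... <= (G * (?e * ?e) + G * Pc * Q * \<tau> n / sqrt (real n) ^ (p + 1)) / (l / 2 / ?s)"
  by (rule frac_le[OF num0 num den tm(2)])
  also have "... = (2 * (G / (l / 2)) * ?s * ?e) * ?e / 2 + B * \<tau> n * (?s / sqrt (real n) ^ (p + 1)) / 2"
  proof -
  have "(g * (e * e) + g * P * q * t / w) / (k / s) = (2 * (g / k) * s * e) * e / 2 + 2 * (g * P * q / k) * t * (s / w) / 2"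
  if "k ~= 0" "s ~= 0" "w ~= 0" for g e P q t w k s :: real
  using that by (simp add: field_simps)
  from this[of "l / 2" ?s "sqrt (real n) ^ (p + 1)"] show ?thesis using l2 s n_pos unfolding B_def by simp
  qed
  also have "... <= ?e / 2 + B * \<tau> n * ?R / 2"
  proof -
  have "2 * (G / (l / 2)) * ?s * ?e <= 2 * (G / (l / 2)) * sqrt (real n) ^ N * ?e"
  by (rule mult_right_mono[OF mult_left_mono[OF sN k0]]) simp
  also have "... <= 1" by (rule elim(10))
  finally have f: "2 * (G / (l / 2)) * ?s * ?e * ?e <= 1 * ?e" by (rule mult_right_mono) simp
  show ?thesis unfolding R by (rule add_right_mono, rule divide_right_mono[OF f[unfolded mult_1_left]]) simp
  qed
  also have "... <= max (exp (- C * real n * v\<^sup>2)) (B * \<tau> n * ?R)"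
  proof -
  have neg: "- (q * w) * k <= - C * k * w" if "C * (k * w) <= q * (k * w)" for q k w :: real
  using that by (simp add: mult_ac)
  have half: "x / 2 + y / 2 <= max E y" if "x <= E" for x y E :: real
  using that by (cases "E <= y") (simp_all add: max_def)
  have "C * (real n * v\<^sup>2) <= a / b / 16 * (real n * v\<^sup>2)" by (rule mult_right_mono[OF C]) simp
  then have "?e <= exp (- C * real n * v\<^sup>2)" by (simp only: exp_le_cancel_iff) (rule neg)
  then show ?thesis by (rule half)
  qed
  finally show "BFe0 (S n) D (M n) <= max (exp (- C * real n * v\<^sup>2)) (B * \<tau> n * ?R)" .
  qed (use dl in \<open>simp add: dl'_def\<close>)
  qed
 qed
qed

end

section \<open>Verifying the conditions for a sequence\<close>

lemma eigs_in_mono: "eigs_in A a b ==> a' <= a ==> b <= b' ==> eigs_in A a' b'"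
 unfolding eigs_in_def by force

lemma nrm_le_Sup:
 assumes c: "compact S" and S: "(SUP th\<in>S. nrm p th) = R" and x: "x : S"
 shows "nrm p x <= R"
proof -
 have "continuous_on S (%x :: nat => real. x i)" for i
  by (rule continuous_on_product_coordinates[THEN continuous_on_subset]) simp
 then have "continuous_on S (nrm p)"
  unfolding nrm_def[abs_def] L2_set_def by (intro continuous_intros)
 then have "compact (nrm p ` S)" by (rule compact_continuous_image[OF _ c])
 then have "bdd_above (nrm p ` S)" by (intro bounded_imp_bdd_above compact_imp_bounded)
 from cSUP_upper[OF x this] S show ?thesis by simp
qed

lemma nrm_diff_le: "nrm p (%j. x j - y j) <= nrm p x + nrm p y"
proof -
 have "nrm p (%j. x j + - y j) <= nrm p x + nrm p (%j. - y j)" unfolding nrm_def by (rule L2_set_triangle_ineq)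
 also have "nrm p (%j. - y j) = nrm p y" by (simp add: nrm_def L2_set_def)
 finally show ?thesis by simp
qed

text \<open>Turns closeness of logarithms into closeness, for numbers bounded by \<open>c\<close>.\<close>

lemma diff_le_ln_diff:
 fixes x y c :: real
 assumes x: "0 < x" "x <= c" and y: "0 < y" "y <= c"
 shows "\<bar>x - y\<bar> <= c * \<bar>ln x - ln y\<bar>"
proof -
 have one: "u - w <= c * \<bar>ln u - ln w\<bar>" if u: "0 < u" "u <= c" and w: "0 < w" for u w
 proof -
  have "ln (w / u) <= w / u - 1" using u w by (intro ln_le_minus_one) auto
  then have "1 - w / u <= ln u - ln w" using u w by (simp add: ln_div)
  then have "u * (1 - w / u) <= u * \<bar>ln u - ln w\<bar>" using u by (intro mult_left_mono) auto
  also have "u * (1 - w / u) = u - w" using u by (simp add: right_diff_distrib)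
  also have "u * \<bar>ln u - ln w\<bar> <= c * \<bar>ln u - ln w\<bar>" using u by (intro mult_right_mono) auto
  finally show ?thesis .
 qed
 show ?thesis using one[OF x y(1)] one[OF y x(1)] by (simp add: abs_le_iff abs_minus_commute)
qed

lemma ball0_subset_eps:
 assumes "1 <= dim_par X" "1 <= n" "0 < C"
 shows "ball0 X (C / sqrt (real n)) <= ball0 X (C * eps n X)"
proof -
 have "1 / sqrt (real n) <= sqrt (real (dim_par X)) / sqrt (real n)"
  using assms by (intro divide_right_mono) auto
 then have "C * (1 / sqrt (real n)) <= C * eps n X"
  unfolding eps_def real_sqrt_divide using assms by (intro mult_left_mono) auto
 then show ?thesis by (auto simp: ball0_def)
qed

text \<open>Two derivatives of the mean moment bound the linearisation error by the square of the distance,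
 and the modulus of continuity of the moments in \<open>L\<^sup>2\<close> controls both the
 variance matrix and the fluctuations.\<close>

lemma (in bounded_gmm) local_regularI:
 assumes ball: "{th : Rn p. dist0 X th < C / sqrt (real n)} <= par_space X"
  and hess: "!!xi. xi : ball0 X (C / sqrt (real n)) ==> has_hess X xi"
  and H: "!!xi u w. xi : ball0 X (C / sqrt (real n)) ==> u : unit_vecs p ==> w : unit_vecs p ==> vnorm (hess_form X xi u w) <= H"
  and h: "!!th et. th : ball0 X (C / sqrt (real n)) ==> et : unit_vecs m ==> L2_norm P (mom_diff X et th) <= h"
  and nn: "0 <= H" "0 < C" "0 <= h" and mN: "m <= N"
  and small: "H * C\<^sup>2 / sqrt (real n) <= e" "2 * sqrt b / a * (H * (C / sqrt (real n))) + (real N)\<^sup>2 * (2 * sqrt b * h) * b / a\<^sup>2 <= e" "h <= e"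
 shows "local_regular C e"
 unfolding local_regular_def
proof (intro conjI ballI allI ball)
 fix th assume th: "th : ball0 X (C / sqrt (real n))"
 have par: "th : par_space X" and d: "dist0 X th <= C / sqrt (real n)" using th by (auto simp: ball0_def)
 have s0: "0 < sqrt (real n)" using n_pos by simp
 have "vnorm (mean_mom X th - jac X th0 *\<^sub>v vec p (dev X th)) <= H * (dist0 X th)\<^sup>2"
  by (rule mean_mom_taylor[OF hess H ball th nn(1)])
 also have "... <= H * (C / sqrt (real n))\<^sup>2" using d nn by (intro mult_left_mono power_mono) auto
 finally have "sqrt (real n) * vnorm (mean_mom X th - jac X th0 *\<^sub>v vec p (dev X th)) <= sqrt (real n) * (H * (C / sqrt (real n))\<^sup>2)"
  using s0 by (intro mult_left_mono) auto
 also have "... = H * C\<^sup>2 / sqrt (real n)"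
 proof -
  have "s * (H * (C / s)\<^sup>2) = H * C\<^sup>2 / s" if "s ~= 0" for s using that by (simp add: power2_eq_square)
  from this[of "sqrt (real n)"] s0 show ?thesis by simp
 qed
 finally show "sqrt (real n) * vnorm (mean_mom X th - jac X th0 *\<^sub>v vec p (dev X th)) <= e" using small(1) by linarith
 fix x
 have g: "vnorm (jac X th *\<^sub>v y - jac X th0 *\<^sub>v y) <= H * (C / sqrt (real n)) * vnorm y" if y: "y : carrier_vec p" for y
 proof -
  have "vnorm (jac X th *\<^sub>v y - jac X th0 *\<^sub>v y) <= H * dist0 X th * vnorm y"
  by (rule jac_lipschitz[OF hess H ball th y nn(1)])
  also have "... <= H * (C / sqrt (real n)) * vnorm y" using d nn by (intro mult_right_mono mult_left_mono) auto
  finally show ?thesis .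
 qed
 have vm: "\<bar>y \<star> (var_mom X th *\<^sub>v z) - y \<star> (var_mom X th0 *\<^sub>v z)\<bar> <= (real N)\<^sup>2 * (2 * sqrt b * h) * vnorm y * vnorm z"
  if y: "y : carrier_vec m" and z: "z : carrier_vec m" for y z
 proof -
  have "\<bar>y \<star> (var_mom X th *\<^sub>v z) - y \<star> (var_mom X th0 *\<^sub>v z)\<bar> <= (real m)\<^sup>2 * (2 * sqrt b * h) * vnorm y * vnorm z"
  by (rule var_mom_close[OF par h[OF th] y z])
  also have "... <= (real N)\<^sup>2 * (2 * sqrt b * h) * vnorm y * vnorm z"
  using mN nn b0 by (intro mult_right_mono power_mono) auto
  finally show ?thesis .
 qed
 have e0: "0 <= (real N)\<^sup>2 * (2 * sqrt b * h)" using nn b0 by simp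
 have "\<bar>qf p (info X th) x - qf p (info X th0) x\<bar>
  <= (2 * sqrt b / a * (H * (C / sqrt (real n))) + (real N)\<^sup>2 * (2 * sqrt b * h) * b / a\<^sup>2) * (nrm p x)\<^sup>2"
  by (rule info_close[OF par e0 g vm])
 also have "... <= e * (nrm p x)\<^sup>2" by (rule mult_right_mono[OF small(2)]) simp
 finally show "\<bar>qf p (info X th) x - qf p (info X th0) x\<bar> <= e * (nrm p x)\<^sup>2" .
next
 fix th et assume "th : ball0 X (C / sqrt (real n))" "et : unit_vecs m"
 from h[OF this] show "L2_norm P (mom_diff X et th) <= e" using small(3) by linarith
qed

lemma SUP_pointwise:
 fixes f :: "'x => 'z => real"
 assumes "(SUP x\<in>A. SUP z\<in>B. ereal (f x z)) = ereal t" "x : A" "z : B"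
 shows "f x z <= t"
proof -
 have "ereal (f x z) <= (SUP z\<in>B. ereal (f x z))" by (rule SUP_upper[OF assms(3)])
 also have "... <= (SUP x\<in>A. SUP z\<in>B. ereal (f x z))" by (rule SUP_upper[OF assms(2)])
 finally show ?thesis unfolding assms(1) by simp
qed

text \<open>The identification constant uses compactness: distances on the parameter space are at most
 \<open>2 R\<close>, so the bound that is linear only near the true parameter is linear
 everywhere with a smaller slope.\<close>

lemma gmm_sequence_exists:
 fixes S :: "nat => 'd gmm" and \<alpha> th\<^sub>l :: real and \<tau> :: "nat => real"
 assumes str: "EV n. gmm_structure n (S n)"
  and par: "cond_parameter_space S"
  and dim: "cond_dimensions S \<alpha>"
  and mom: "cond_moment_class S \<alpha>"
  and ide: "cond_identification S"
  and wei: "cond_weight S"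
  and pri: "cond_par_prior S"
  and fix': "cond_fixed_dimension S th\<^sub>l"
  and den: "cond_est_density S \<tau>"
 shows "\<exists>a b ka K F N cl cu. gmm_sequence S a b ka K F N \<tau> cl cu th\<^sub>l"
proof -
 obtain R where R: "0 < R" and cptE: "EV n. compact (par_space (S n)) & connected (par_space (S n)) &
  (SUP th\<in>par_space (S n). nrm (dim_par (S n)) th) = R"
  using par unfolding cond_parameter_space_def by blast
 from cptE have cpt: "EV n. compact (par_space (S n)) &
  (SUP th\<in>par_space (S n). nrm (dim_par (S n)) th) = R"
  by eventually_elim blast
 obtain \<rho> where \<rho>: "0 < \<rho>" and ballE: "EV n. {th : Rn (dim_par (S n)). dist0 (S n) th < \<rho>} <= par_space (S n)"
  using par unfolding cond_parameter_space_def by blast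
 obtain pm where pm: "EV n. 1 <= dim_par (S n) & dim_par (S n) <= pm"
  using fix' unfolding cond_fixed_dimension_def by blast
 have "(%n. real (dim_mom (S n))) : O(%n. real (dim_par (S n)))"
  using dim unfolding cond_dimensions_def by (simp add: bigtheta_def bigomega_iff_bigo)
 then obtain c1 where c1: "0 < c1" "EV n. norm (real (dim_mom (S n))) <= c1 * norm (real (dim_par (S n)))"
  by (elim landau_o.bigE) auto
 define N where "N = max pm (nat \<lceil>c1 * real pm\<rceil>)"
 have dims: "EV n. dim_par (S n) <= N & dim_mom (S n) <= N"
  using pm c1(2)
 proof eventually_elim
  case (elim n)
  have "real (dim_mom (S n)) <= c1 * real (dim_par (S n))" using elim by simp
  also have "... <= c1 * real pm" using elim c1 by (intro mult_left_mono) auto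
  finally have "dim_mom (S n) <= nat \<lceil>c1 * real pm\<rceil>" by linarith
  then show ?case unfolding N_def le_max_iff_disj using elim(1) by blast
 qed
 obtain a1 b1 where a1: "0 < a1" "0 < b1" and eig1: "EV n. ALL th:par_space (S n).
  eigs_in (transpose_mat (jac (S n) th) * jac (S n) th) a1 b1 & eigs_in (var_mom (S n) th) a1 b1"
  using fix' unfolding cond_fixed_dimension_def by blast
 obtain a2 b2 where a2: "0 < a2" "0 < b2" and eig2: "wpa1 S (%n D. eigs_in (wt (S n) D) a2 b2 &
  eigs_in (var_mom (S n) (true_par (S n))) a2 b2)"
  using wei unfolding cond_weight_def by blast
 define a where "a = min a1 a2"
 define b where "b = max b1 b2"
 have ab: "0 < a" "0 < b" "a <= a1" "a <= a2" "b1 <= b" "b2 <= b" using a1 a2 by (auto simp: a_def b_def)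
 obtain d0 d1 where d01: "0 < d0" "0 < d1" and ident: "EV n. ALL th:par_space (S n).
  min d0 (d1 * dist0 (S n) th) <= vnorm (mean_mom (S n) th)"
  using ide unfolding cond_identification_def by blast
 define ka where "ka = min (d0 / (2 * R)) d1"
 have ka: "0 < ka" using d01 R by (simp add: ka_def)
 obtain F where F: "EV n. F n : L2_space (obs_law (S n)) &
  (ALL f:mom_class (S n). ALL d:space (obs_law (S n)). \<bar>f d\<bar> <= F n d)"
  and FO: "(%n. L2_norm (obs_law (S n)) (F n)) : O(%n. sqrt (real (dim_par (S n))))"
  using mom unfolding cond_moment_class_def by blast
 from FO obtain c2 where c2: "0 < c2" "EV n. norm (L2_norm (obs_law (S n)) (F n)) <= c2 * norm (sqrt (real (dim_par (S n))))"
  by (elim landau_o.bigE) auto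
 define K where "K = c2\<^sup>2 * real N"
 obtain hk where hk: "EV n. ALL th:par_space (S n). ALL et:unit_vecs (dim_mom (S n)).
  L2_norm (obs_law (S n)) (mom_diff (S n) et th) <= hk * (sqrt (real (dim_par (S n))) * dist0 (S n) th) powr \<alpha>"
  and \<alpha>: "0 < \<alpha>"
  using mom unfolding cond_moment_class_def by blast
 have jacE: "EV n. ALL th:par_space (S n). has_jac (S n) th"
 proof -
  have "EV n.
  (ALL th:par_space (S n). has_jac (S n) th) &
  (\<forall>k<dim_mom (S n). \<forall>l<dim_mom (S n).
  continuous_on (par_space (S n)) (%th. var_mom (S n) th $$ (k, l))) &
  (\<forall>k<dim_mom (S n). \<forall>j<dim_par (S n).
  continuous_on (par_space (S n)) (%th. jac (S n) th $$ (k, j)))"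
  using fix' unfolding cond_fixed_dimension_def by blast
  then show ?thesis by eventually_elim blast
 qed
 have bounded: "EV n. bounded_gmm n (S n) a b ka K (F n)"
  using str cpt pm dims eig1 ident F c2(2) jacE eventually_ge_at_top[of 1]
 proof eventually_elim
  case (elim n)
  let ?X = "S n"
  have tp: "true_par ?X : par_space ?X" using elim(1) by (simp add: gmm_structure_def)
  have dist: "dist0 ?X th <= 2 * R" if "th : par_space ?X" for th
  proof -
  have "dist0 ?X th <= nrm (dim_par ?X) th + nrm (dim_par ?X) (true_par ?X)" unfolding dist0_def by (rule nrm_diff_le)
  then show ?thesis
  using nrm_le_Sup[OF conjunct1[OF elim(2)] conjunct2[OF elim(2)] that] nrm_le_Sup[OF conjunct1[OF elim(2)] conjunct2[OF elim(2)] tp] by linarith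
  qed
  show ?case
  proof (rule bounded_gmm.intro)
  show "gmm_structure n ?X" "1 <= n" "1 <= dim_par ?X" "0 < a" "0 < b" "0 < ka"
  by (rule elim(1), rule elim(10), rule conjunct1[OF elim(3)], rule ab(1), rule ab(2), rule ka)
  show "0 <= K" by (simp add: K_def)
  show "compact (par_space ?X)" using elim by simp
  show "eigs_in (var_mom ?X th) a b" "eigs_in (transpose_mat (jac ?X th) * jac ?X th) a b" "has_jac ?X th" if "th : par_space ?X" for th
  using elim(5,9) that by (auto intro: eigs_in_mono[OF _ ab(3,5)])
  show "ka * dist0 ?X th <= vnorm (mean_mom ?X th)" if th: "th : par_space ?X" for th
  proof -
  have "ka * dist0 ?X th <= d0 / (2 * R) * (2 * R)"
  using dist[OF th] d01 R by (intro mult_mono) (auto simp: ka_def)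
  also have "... = d0" using R by simp
  finally have "ka * dist0 ?X th <= d0" .
  moreover have "ka * dist0 ?X th <= d1 * dist0 ?X th" by (intro mult_right_mono) (auto simp: ka_def)
  moreover have "min d0 (d1 * dist0 ?X th) <= vnorm (mean_mom ?X th)" using elim(6) th by blast
  ultimately show ?thesis by (meson min.boundedI order.trans)
  qed
  show "F n : L2_space (obs_law ?X)" "!!f d. f : mom_class ?X ==> d : space (obs_law ?X) ==> \<bar>f d\<bar> <= F n d" using elim(7) by blast+
  have i0: "0 <= (\<integral>d. (F n d)\<^sup>2 \<partial>obs_law ?X)" by (intro Bochner_Integration.integral_nonneg) simp
  then have "(\<integral>d. (F n d)\<^sup>2 \<partial>obs_law ?X) = (L2_norm (obs_law ?X) (F n))\<^sup>2" by (simp add: L2_norm_def)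
  also have "... <= (c2 * sqrt (real (dim_par ?X)))\<^sup>2"
  proof (rule power_mono)
  show l0: "0 <= L2_norm (obs_law ?X) (F n)" using i0 by (simp add: L2_norm_def)
  show "L2_norm (obs_law ?X) (F n) <= c2 * sqrt (real (dim_par ?X))" using elim(8) l0 by simp
  qed
  also have "... = c2\<^sup>2 * real (dim_par ?X)" by (simp add: power_mult_distrib)
  also have "... <= K" unfolding K_def using elim(4) by (intro mult_left_mono) auto
  finally show "(\<integral>d. (F n d)\<^sup>2 \<partial>obs_law ?X) <= K" .
  qed
 qed
 have weight_pos: "EV n. ALL D:space (sample_law n (S n) (true_par (S n))). pos_def (dim_mom (S n)) (wt (S n) D)"
  using wei unfolding cond_weight_def by blast
 obtain cp where cp: "EV n. ALL M:models (S n). ALL th:submodel (S n) M. par_prior (S n) M th <= cp"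
  using pri unfolding cond_par_prior_def by blast
 obtain e0 where e0: "0 < e0" and pl: "EV n. ALL M:models (S n). true_model (S n) <= M -->
  exp (- e0 * real (card M)) <= par_prior (S n) M (true_par (S n))"
 proof -
  obtain e0 e1 where e0: "0 < e0" and E: "EV n. ALL M:models (S n). true_model (S n) <= M -->
  exp (- e0 * real (card M)) <= par_prior (S n) M (true_par (S n)) &
  \<bar>ln (par_prior (S n) M (true_par (S n)))
  - ln (par_prior (S n) (true_model (S n)) (true_par (S n)))\<bar>
  <= e1 * (real (card M) - real (k0 (S n)))"
  using pri unfolding cond_par_prior_def by blast
  from E have "EV n. ALL M:models (S n). true_model (S n) <= M -->
  exp (- e0 * real (card M)) <= par_prior (S n) M (true_par (S n))"
  by eventually_elim blast
  with e0 show ?thesis using that by blast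
 qed
 define cu where "cu = max 1 cp"
 define cl where "cl = exp (- e0 * real N)"
 have cuN: "0 < cu" "cp <= cu" "0 < cl" by (auto simp: cu_def cl_def)
 have prior: "EV n. ALL M:models (S n). (ALL th:submodel (S n) M. par_prior (S n) M th <= cu) &
  (true_model (S n) <= M --> cl <= par_prior (S n) M (true_par (S n)))"
  using cp pl dims
 proof (eventually_elim, intro ballI conjI impI)
  fix n M th
  assume "ALL M:models (S n). ALL th:submodel (S n) M. par_prior (S n) M th <= cp" "M : models (S n)" "th : submodel (S n) M"
  then show "par_prior (S n) M th <= cu" using cuN by force
 next
  fix n M
  assume A: "ALL M:models (S n). true_model (S n) <= M --> exp (- e0 * real (card M)) <= par_prior (S n) M (true_par (S n))"
  "dim_par (S n) <= N & dim_mom (S n) <= N" "M : models (S n)" "true_model (S n) <= M"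
  have "card M <= card {..<dim_par (S n)}" using A(3) by (intro card_mono) (auto simp: models_def)
  then have "e0 * real (card M) <= e0 * real N" using A(2) e0 by (intro mult_left_mono) auto
  then have "cl <= exp (- e0 * real (card M))" by (simp add: cl_def)
  then show "cl <= par_prior (S n) M (true_par (S n))" using A(1,3,4) by force
 qed
 show ?thesis
 proof (intro exI, rule gmm_sequence.intro)
  show "EV n. bounded_gmm n (S n) a b ka K (F n)" by (rule bounded)
  show "EV n. dim_par (S n) <= N & dim_mom (S n) <= N" by (rule dims)
  show "EV n. ALL D:space (sample_law n (S n) (true_par (S n))). pos_def (dim_mom (S n)) (wt (S n) D)" by (rule weight_pos)
  show "0 < cl" "0 < cu" by (rule cuN)+
  show "EV n. ALL M:models (S n). (ALL th:submodel (S n) M. par_prior (S n) M th <= cu) &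
  (true_model (S n) <= M --> cl <= par_prior (S n) M (true_par (S n)))" by (rule prior)
  show "0 < th\<^sub>l" "EV n. ALL j:true_model (S n). th\<^sub>l <= \<bar>true_par (S n) j\<bar>"
  using fix' unfolding cond_fixed_dimension_def by auto
  show "\<tau> \<longlonglongrightarrow> 0" using den unfolding cond_est_density_def by blast
 next
  fix dl e :: real assume dl: "0 < dl" and e: "0 < e"
  have w1: "wpa1 S (%n D. opnorm (wt (S n) D - var_mom (S n) (true_par (S n))) < e)"
  using wei e unfolding cond_weight_def by blast
  have d2: "0 < dl / 2" using dl by simp
  show "EV n. likely (sample_law n (S n) (true_par (S n))) dl
  (%D. form_in (dim_mom (S n)) (wt (S n) D) a b & opnorm (wt (S n) D - var_mom (S n) (true_par (S n))) <= e)"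
  using bounded weight_pos likely_if_wpa1[OF eig2 d2] likely_if_wpa1[OF w1 d2]
  proof eventually_elim
  case (elim n)
  from likely_conj[OF bounded_gmm.prob_SL[OF elim(1)] elim(3,4)] show ?case
  proof (rule likely_mono)
  fix D assume D: "D : space (sample_law n (S n) (true_par (S n)))"
  and Q: "(eigs_in (wt (S n) D) a2 b2 & eigs_in (var_mom (S n) (true_par (S n))) a2 b2) & opnorm (wt (S n) D - var_mom (S n) (true_par (S n))) < e"
  have "pos_def (dim_mom (S n)) (wt (S n) D)" using elim(2) D by blast
  then have "wt (S n) D : carrier_mat (dim_mom (S n)) (dim_mom (S n))" "transpose_mat (wt (S n) D) = wt (S n) D"
  by (auto simp: pos_def_def)
  then have "form_in (dim_mom (S n)) (wt (S n) D) a b"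
  by (rule form_in_if_eigs_in) (rule eigs_in_mono[OF _ ab(4,6)], use Q in blast)
  then show "form_in (dim_mom (S n)) (wt (S n) D) a b & opnorm (wt (S n) D - var_mom (S n) (true_par (S n))) <= e" using Q by simp
  qed simp
  qed
 next
  fix C e :: real assume C: "0 < C" and e: "0 < e"
  obtain Kh where Kh: "EV n. ALL th:ball0 (S n) (C * eps n (S n)).
  has_jac (S n) th & has_hess (S n) th &
  (ALL u:unit_vecs (dim_par (S n)). ALL v:unit_vecs (dim_par (S n)).
  vnorm (hess_form (S n) th u v) <= Kh * sqrt (real (dim_par (S n))))"
  using ide C unfolding cond_identification_def by blast
  define H where "H = \<bar>Kh\<bar> * sqrt (real N)"
  define h where "h = (%n. \<bar>hk\<bar> * (sqrt (real N) * (C / sqrt (real n))) powr \<alpha>)"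
  have H: "0 <= H" by (simp add: H_def)
  have Cn: "(%n. C / sqrt (real n)) \<longlonglongrightarrow> 0" by real_asymp
  have "(%n. sqrt (real N) * (C / sqrt (real n))) \<longlonglongrightarrow> 0" by (rule tendsto_mult_right_zero[OF Cn])
  then have "(%n. (sqrt (real N) * (C / sqrt (real n))) powr \<alpha>) \<longlonglongrightarrow> 0"
  proof (rule tendsto_zero_powrI[OF _ tendsto_const])
  show "EV n. 0 <= sqrt (real N) * (C / sqrt (real n))"
  using C by (intro always_eventually allI mult_nonneg_nonneg divide_nonneg_nonneg) auto
  qed (rule \<alpha>)
  then have h0: "h \<longlonglongrightarrow> 0" unfolding h_def by (rule tendsto_mult_right_zero)
  have l1: "(%n. H * C\<^sup>2 / sqrt (real n)) \<longlonglongrightarrow> 0" by real_asymp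
  have "(%n. 2 * sqrt b / a * (H * (C / sqrt (real n))) + (real N)\<^sup>2 * (2 * sqrt b) * b / a\<^sup>2 * h n) \<longlonglongrightarrow> 0 + 0"
  by (intro tendsto_add tendsto_mult_right_zero Cn h0)
  then have l2: "(%n. 2 * sqrt b / a * (H * (C / sqrt (real n))) + (real N)\<^sup>2 * (2 * sqrt b) * b / a\<^sup>2 * h n) \<longlonglongrightarrow> 0" by simp
  show "EV n. bounded_gmm.local_regular n (S n) C e"
  using bounded dims pm Kh hk ballE order_tendstoD(2)[OF Cn \<rho>] order_tendstoD(2)[OF h0 e] order_tendstoD(2)[OF l1 e] order_tendstoD(2)[OF l2 e]
  proof eventually_elim
  case (elim n)
  interpret bounded_gmm n "S n" a b ka K "F n" by (rule elim(1))
  have sub: "ball0 (S n) (C / sqrt (real n)) <= ball0 (S n) (C * eps n (S n))" by (rule ball0_subset_eps[OF p1 n1 C])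
  show ?case
  proof (rule local_regularI[where H = H and h = "h n" and N = N])
  show "{th : Rn p. dist0 (S n) th < C / sqrt (real n)} <= par_space (S n)"
  by (rule order.trans[OF _ elim(6)]) (use elim(7) in auto)
  show "has_hess (S n) xi" if "xi : ball0 (S n) (C / sqrt (real n))" for xi using elim(4) that sub by blast
  show "vnorm (hess_form (S n) xi u w) <= H"
  if "xi : ball0 (S n) (C / sqrt (real n))" "u : unit_vecs p" "w : unit_vecs p" for xi u w
  proof -
  have "vnorm (hess_form (S n) xi u w) <= Kh * sqrt (real p)" using elim(4) that sub by blast
  also have "... <= \<bar>Kh\<bar> * sqrt (real N)" using elim(2) by (intro mult_mono) auto
  finally show ?thesis unfolding H_def .
  qed
  show "L2_norm P (mom_diff (S n) et th) <= h n" if "th : ball0 (S n) (C / sqrt (real n))" "et : unit_vecs m" for th et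
  proof -
  have d: "dist0 (S n) th <= C / sqrt (real n)" "th : par_space (S n)" using that by (auto simp: ball0_def)
  have "L2_norm P (mom_diff (S n) et th) <= hk * (sqrt (real p) * dist0 (S n) th) powr \<alpha>" using elim(5) d that by blast
  also have "... <= \<bar>hk\<bar> * (sqrt (real N) * (C / sqrt (real n))) powr \<alpha>"
  using elim(2) d \<alpha> C by (intro mult_mono powr_mono2 mult_nonneg_nonneg) auto
  finally show ?thesis unfolding h_def .
  qed
  show "0 <= h n" by (simp add: h_def)
  show "m <= N" using elim(2) by simp
  show "H * C\<^sup>2 / sqrt (real n) <= e" "h n <= e"
  by (rule less_imp_le[OF elim(9)], rule less_imp_le[OF elim(8)])
  show "2 * sqrt b / a * (H * (C / sqrt (real n))) + (real N)\<^sup>2 * (2 * sqrt b * h n) * b / a\<^sup>2 <= e"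
  proof -
  have "(real N)\<^sup>2 * (2 * sqrt b * h n) * b / a\<^sup>2 = (real N)\<^sup>2 * (2 * sqrt b) * b / a\<^sup>2 * h n" by simp
  then show ?thesis using elim(10) by linarith
  qed
  qed (rule H C)+
  qed
 next
  have s: "EV n. ALL th:par_space (S n).
  root (S n) th : carrier_mat (dim_par (S n)) (dim_par (S n)) &
  transpose_mat (root (S n) th) * root (S n) th
  = transpose_mat (jac (S n) th) * minv (var_mom (S n) th) * jac (S n) th &
  (\<forall>z. 0 <= std_dens (S n) z th) &
  distributed (sample_law n (S n) th) (leb {..<dim_par (S n)}) (std_est n (S n) th)
  (%z. en (std_dens (S n) z th))"
  and t: "EV n.
  (SUP th\<in>par_space (S n). SUP z\<in>Rn (dim_par (S n)).
  ereal ((1 + nrm (dim_par (S n)) z ^ (dim_par (S n) + 1)) *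
  \<bar>std_dens (S n) z th - std_mvn (dim_par (S n)) z\<bar>)) = ereal (\<tau> n)"
  using den unfolding cond_est_density_def by blast+
  show "EV n. 0 <= \<tau> n & (ALL th:par_space (S n). bounded_gmm.est_regular n (S n) th (\<tau> n))"
  using bounded s t
  proof eventually_elim
  case (elim n)
  interpret bounded_gmm n "S n" a b ka K "F n" by (rule elim(1))
  note pt = SUP_pointwise[OF elim(3)]
  have "(%_. 0) : Rn p" by (simp add: Rn_def)
  from pt[OF true_par_in this] have "(1 + nrm p (%_. 0) ^ (p + 1)) * \<bar>std_dens (S n) (%_. 0) th0 - std_mvn p (%_. 0)\<bar> <= \<tau> n" .
  moreover have "0 <= (1 + nrm p (%_. 0) ^ (p + 1)) * \<bar>std_dens (S n) (%_. 0) th0 - std_mvn p (%_. 0)\<bar>"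
  by (intro mult_nonneg_nonneg add_nonneg_nonneg zero_le_power) (auto simp: nrm_def L2_set_nonneg)
  ultimately have "0 <= \<tau> n" by linarith
  moreover have "est_regular th (\<tau> n)" if "th : par_space (S n)" for th
  unfolding est_regular_def info_def using elim(2) that pt[OF that] by blast
  ultimately show ?case by blast
  qed
 next
  fix dl :: real assume dl: "0 < dl"
  define dl' where "dl' = min dl (1 / 2)"
  have dl': "0 < dl'" using dl by (simp add: dl'_def)
  have "Op S (%n D. nrm (dim_par (S n)) (%j. est (S n) D j - oracle_est n (S n) D j)) (%n. 1 / real n)"
  using fix' unfolding cond_fixed_dimension_def by blast
  then obtain d where d: "0 < d" and w: "EV n. 1 - dl' <= wprob S (%n D. \<bar>nrm (dim_par (S n)) (%j. est (S n) D j - oracle_est n (S n) D j)\<bar> <= d * (1 / real n)) n"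
  using dl' unfolding Op_def by blast
  show "\<exists>d>0. EV n. likely (sample_law n (S n) (true_par (S n))) dl
  (%D. nrm (dim_par (S n)) (%j. est (S n) D j - oracle_est n (S n) D j) <= d * (1 / real n))"
  proof (intro exI[of _ d] conjI d)
  show "EV n. likely (sample_law n (S n) (true_par (S n))) dl
  (%D. nrm (dim_par (S n)) (%j. est (S n) D j - oracle_est n (S n) D j) <= d * (1 / real n))"
  using w
  proof eventually_elim
  case (elim n)
  have "likely (sample_law n (S n) (true_par (S n))) dl' (%D. \<bar>nrm (dim_par (S n)) (%j. est (S n) D j - oracle_est n (S n) D j)\<bar> <= d * (1 / real n))"
  using elim unfolding wprob_def by (intro likely_if_event) (auto simp: dl'_def)
  then show ?case by (rule likely_mono) (auto simp: dl'_def)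
  qed
  qed
 next
  fix C e :: real assume C: "0 < C" and e: "0 < e"
  have "0 < e / cu" using e cuN by simp
  then have near: "EV n. ALL M:models (S n). true_model (S n) <= M -->
  (ALL th:submodel (S n) M \<inter> ball0 (S n) (C * eps n (S n)).
  0 < par_prior (S n) M th &
  \<bar>ln (par_prior (S n) M th) - ln (par_prior (S n) M (true_par (S n)))\<bar> < e / cu)"
  using pri C unfolding cond_par_prior_def by blast
  show "EV n. ALL M:models (S n). true_model (S n) <= M -->
  (ALL th:submodel (S n) M \<inter> ball0 (S n) (C / sqrt (real n)). \<bar>par_prior (S n) M th - par_prior (S n) M (true_par (S n))\<bar> <= e)"
  using bounded near prior
  proof (eventually_elim)
  case (elim n)
  interpret bounded_gmm n "S n" a b ka K "F n" by (rule elim(1))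
  show ?case
  proof (intro ballI impI)
  fix M th assume M: "M : models (S n)" "true_model (S n) <= M" and th: "th : submodel (S n) M \<inter> ball0 (S n) (C / sqrt (real n))"
  have "th : submodel (S n) M \<inter> ball0 (S n) (C * eps n (S n))" using th ball0_subset_eps[OF p1 n1 C] by blast
  then have l: "0 < par_prior (S n) M th" "\<bar>ln (par_prior (S n) M th) - ln (par_prior (S n) M th0)\<bar> < e / cu"
  using elim(2) M by blast+
  have u: "par_prior (S n) M th <= cu" "par_prior (S n) M th0 <= cu" "cl <= par_prior (S n) M th0"
  using elim(3) M th true_par_in_submodel[OF M(2)] by blast+
  have "0 < par_prior (S n) M th0" using u(3) cuN by linarith
  then have "\<bar>par_prior (S n) M th - par_prior (S n) M th0\<bar> <= cu * \<bar>ln (par_prior (S n) M th) - ln (par_prior (S n) M th0)\<bar>"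
  by (rule diff_le_ln_diff[OF l(1) u(1) _ u(2)])
  also have "... <= cu * (e / cu)" using l(2) cuN by (intro mult_left_mono) auto
  also have "... = e" using cuN by simp
  finally show "\<bar>par_prior (S n) M th - par_prior (S n) M th0\<bar> <= e" .
  qed
  qed
 qed
qed

context gmm_sequence
begin

lemma superset_case:
 assumes M: "EV n. M n : models (S n) & true_model (S n) <= M n"
 shows "(\<forall>e>0. wpa1 S (%n D.
  \<bar>BFq0 n (S n) D (M n) / BFe0 (S n) D (M n) - 1\<bar> < e)) &
  (\<exists>c>0. \<exists>C>0. wpa1 S (%n D.
  c * BFe0 (S n) D (M n) <= BFq0 n (S n) D (M n) &
  BFq0 n (S n) D (M n) <= C * BFe0 (S n) D (M n))) &
  (\<exists>c>0. wpa1 S (%n D.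
  c * real n powr (- (real (card (M n)) - real (k0 (S n))) / 2) <= BFq0 n (S n) D (M n) &
  c * real n powr (- (real (card (M n)) - real (k0 (S n))) / 2) <= BFe0 (S n) D (M n))) &
  Op S (%n D. BFq0 n (S n) D (M n))
  (%n. real n powr (- (real (card (M n)) - real (k0 (S n))) / 2)) &
  Op S (%n D. BFe0 (S n) D (M n))
  (%n. real n powr (- (real (card (M n)) - real (k0 (S n))) / 2)) &
  (%n. real n powr (- (real (dim_par (S n)) - real (k0 (S n))) / 2))
  : O(%n. real n powr (- (real (card (M n)) - real (k0 (S n))) / 2))"
proof -
 let ?R = "%n. real n powr (- (real (card (M n)) - real (k0 (S n))) / 2)"
 let ?q = "%n D. BFq0 n (S n) D (M n)" and ?e = "%n D. BFe0 (S n) D (M n)"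
 have Mm: "EV n. M n : models (S n)" using M by (auto elim: eventually_mono)
 note bm = bayes_measurable[OF Mm]
 obtain c where c: "0 < c" and B: "!!dl. 0 < dl ==> \<exists>B>0. \<forall>et. 0 < et --> et <= 1 / 8 --> (EV n. likely (law_n n) dl (%D.
  \<bar>?q n D / ?e n D - 1\<bar> <= 8 * et & c * ?R n <= ?q n D & c * ?R n <= ?e n D & ?q n D <= B * ?R n & ?e n D <= B * ?R n))"
  using superset_events[OF M] by blast
 have ev: "EV n. likely (law_n n) dl (%D. \<bar>?q n D / ?e n D - 1\<bar> <= 8 * et & c * ?R n <= ?q n D & c * ?R n <= ?e n D)"
  if dl: "0 < dl" and et: "0 < et" "et <= 1 / 8" for dl et
 proof -
  from B[OF dl] et obtain B' where "EV n. likely (law_n n) dl (%D.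
  \<bar>?q n D / ?e n D - 1\<bar> <= 8 * et & c * ?R n <= ?q n D & c * ?R n <= ?e n D & ?q n D <= B' * ?R n & ?e n D <= B' * ?R n)"
  by blast
  then show ?thesis by eventually_elim (erule likely_mono; simp)
 qed
 have up: "\<exists>B>0. EV n. likely (law_n n) dl (%D. \<bar>?q n D\<bar> <= B * ?R n & \<bar>?e n D\<bar> <= B * ?R n)"
  if dl: "0 < dl" for dl
 proof -
  have "0 < (1 / 8 :: real)" "(1 / 8 :: real) <= 1 / 8" by simp_all
  with B[OF dl] obtain B' where B': "0 < B'" and evB: "EV n. likely (law_n n) dl (%D.
  \<bar>?q n D / ?e n D - 1\<bar> <= 8 * (1 / 8) & c * ?R n <= ?q n D & c * ?R n <= ?e n D & ?q n D <= B' * ?R n & ?e n D <= B' * ?R n)"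
  by blast
  show ?thesis
  proof (intro exI[of _ B'] conjI B')
  show "EV n. likely (law_n n) dl (%D. \<bar>?q n D\<bar> <= B' * ?R n & \<bar>?e n D\<bar> <= B' * ?R n)"
  using evB
  proof eventually_elim
  case (elim n)
  then show ?case
  proof (rule likely_mono)
  fix D assume Q: "\<bar>?q n D / ?e n D - 1\<bar> <= 8 * (1 / 8) & c * ?R n <= ?q n D & c * ?R n <= ?e n D & ?q n D <= B' * ?R n & ?e n D <= B' * ?R n"
  have "0 <= c * ?R n" using c by (intro mult_nonneg_nonneg) auto
  then have "0 <= ?q n D" "0 <= ?e n D" using Q order.trans by blast+
  then show "\<bar>?q n D\<bar> <= B' * ?R n & \<bar>?e n D\<bar> <= B' * ?R n" using Q by (simp only: abs_of_nonneg)
  qed simp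
  qed
  qed
 qed
 have "\<forall>e>0. wpa1 S (%n D. \<bar>?q n D / ?e n D - 1\<bar> < e)"
 proof (intro allI impI)
  fix e :: real assume e: "0 < e"
  define et where "et = min (1 / 8) (e / 16)"
  have et: "0 < et" "et <= 1 / 8" "8 * et < e" using e by (auto simp: et_def min_def)
  show "wpa1 S (%n D. \<bar>?q n D / ?e n D - 1\<bar> < e)"
  proof (rule wpa1_if_likely)
  fix dl :: real assume "0 < dl"
  from ev[OF this et(1,2)] show "EV n. likely (law_n n) dl (%D. \<bar>?q n D / ?e n D - 1\<bar> < e)"
  by eventually_elim (erule likely_mono, use et(3) in \<open>auto intro: le_less_trans\<close>)
  next
  show "EV n. prob_space (law_n n) & {D : space (law_n n). \<bar>?q n D / ?e n D - 1\<bar> < e} : sets (law_n n)"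
  using bm by eventually_elim (intro conjI borel_measurable_less borel_measurable_abs borel_measurable_diff
  borel_measurable_divide borel_measurable_const, auto)
  qed
 qed
 moreover have "\<exists>c>0. \<exists>C>0. wpa1 S (%n D. c * ?e n D <= ?q n D & ?q n D <= C * ?e n D)"
 proof (intro exI conjI)
  show "0 < (1 / 2 :: real)" "0 < (2 :: real)" by simp_all
  show "wpa1 S (%n D. 1 / 2 * ?e n D <= ?q n D & ?q n D <= 2 * ?e n D)"
  proof (rule wpa1_if_likely)
  fix dl :: real assume dl: "0 < dl"
  have "0 < (1 / 16 :: real)" "(1 / 16 :: real) <= 1 / 8" by simp_all
  from ev[OF dl this] eventually_gt_at_top[of 0]
  show "EV n. likely (law_n n) dl (%D. 1 / 2 * ?e n D <= ?q n D & ?q n D <= 2 * ?e n D)"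
  proof eventually_elim
  case (elim n)
  from elim(1) show ?case
  proof (rule likely_mono)
  fix D assume Q: "\<bar>?q n D / ?e n D - 1\<bar> <= 8 * (1 / 16) & c * ?R n <= ?q n D & c * ?R n <= ?e n D"
  have "0 < c * ?R n" using c elim(2) by (intro mult_pos_pos) auto
  then have e0: "0 < ?e n D" using Q by linarith
  have r: "1 / 2 <= x" "x <= 2" if "\<bar>x - 1\<bar> <= 8 * (1 / 16)" for x :: real using that by linarith+
  have "1 / 2 <= ?q n D / ?e n D" "?q n D / ?e n D <= 2"
  by (rule r(1)[OF conjunct1[OF Q]], rule r(2)[OF conjunct1[OF Q]])
  then show "1 / 2 * ?e n D <= ?q n D & ?q n D <= 2 * ?e n D" using e0 by (simp only: pos_le_divide_eq pos_divide_le_eq)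
  qed simp
  qed
  next
  show "EV n. prob_space (law_n n) & {D : space (law_n n). 1 / 2 * ?e n D <= ?q n D & ?q n D <= 2 * ?e n D} : sets (law_n n)"
  using bm by eventually_elim (intro conjI sets.sets_Collect_conj borel_measurable_le borel_measurable_times borel_measurable_const, auto)
  qed
 qed
 moreover have "\<exists>c>0. wpa1 S (%n D. c * ?R n <= ?q n D & c * ?R n <= ?e n D)"
 proof (intro exI[of _ c] conjI c, rule wpa1_if_likely)
  fix dl :: real assume dl: "0 < dl"
  have "0 < (1 / 16 :: real)" "(1 / 16 :: real) <= 1 / 8" by simp_all
  from ev[OF dl this] show "EV n. likely (law_n n) dl (%D. c * ?R n <= ?q n D & c * ?R n <= ?e n D)"
  by eventually_elim (erule likely_mono; simp)
 next
  show "EV n. prob_space (law_n n) & {D : space (law_n n). c * ?R n <= ?q n D & c * ?R n <= ?e n D} : sets (law_n n)"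
  using bm by eventually_elim (intro conjI sets.sets_Collect_conj borel_measurable_le borel_measurable_const, auto)
 qed
 moreover have "Op S (%n D. ?q n D) ?R" "Op S (%n D. ?e n D) ?R"
 proof -
  have "\<exists>K>0. EV n. 1 - dl <= wprob S (%n D. \<bar>?q n D\<bar> <= K * ?R n) n & 1 - dl <= wprob S (%n D. \<bar>?e n D\<bar> <= K * ?R n) n"
  if "0 < dl" for dl
  proof -
  from up[OF that] obtain B' where B': "0 < B'" and l: "EV n. likely (law_n n) dl (%D. \<bar>?q n D\<bar> <= B' * ?R n & \<bar>?e n D\<bar> <= B' * ?R n)" by blast
  have "EV n. 1 - dl <= wprob S (%n D. \<bar>?q n D\<bar> <= B' * ?R n) n & 1 - dl <= wprob S (%n D. \<bar>?e n D\<bar> <= B' * ?R n) n"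
  using l bm
  proof eventually_elim
  case (elim n)
  have l1: "likely (law_n n) dl (%D. \<bar>?q n D\<bar> <= B' * ?R n)" "likely (law_n n) dl (%D. \<bar>?e n D\<bar> <= B' * ?R n)"
  by (rule likely_mono[OF elim(1) order.refl], blast)+
  have s: "{D : space (law_n n). \<bar>?q n D\<bar> <= B' * ?R n} : sets (law_n n)" "{D : space (law_n n). \<bar>?e n D\<bar> <= B' * ?R n} : sets (law_n n)"
  by (intro borel_measurable_le borel_measurable_abs borel_measurable_const; use elim(2) in blast)+
  show ?case unfolding wprob_def using likely_event[OF _ l1(1) s(1)] likely_event[OF _ l1(2) s(2)] elim(2) by blast
  qed
  then show ?thesis using B' by blast
  qed
  note both = this
  show "Op S (%n D. ?q n D) ?R" unfolding Op_def
  proof (intro allI impI)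
  fix dl :: real assume "0 < dl"
  from both[OF this] obtain K where K: "0 < K" and E: "EV n. 1 - dl <= wprob S (%n D. \<bar>?q n D\<bar> <= K * ?R n) n & 1 - dl <= wprob S (%n D. \<bar>?e n D\<bar> <= K * ?R n) n" by blast
  from E have "EV n. 1 - dl <= wprob S (%n D. \<bar>?q n D\<bar> <= K * ?R n) n" by eventually_elim blast
  then show "\<exists>K>0. EV n. 1 - dl <= wprob S (%n D. \<bar>?q n D\<bar> <= K * ?R n) n" using K by blast
  qed
  show "Op S (%n D. ?e n D) ?R" unfolding Op_def
  proof (intro allI impI)
  fix dl :: real assume "0 < dl"
  from both[OF this] obtain K where K: "0 < K" and E: "EV n. 1 - dl <= wprob S (%n D. \<bar>?q n D\<bar> <= K * ?R n) n & 1 - dl <= wprob S (%n D. \<bar>?e n D\<bar> <= K * ?R n) n" by blast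
  from E have "EV n. 1 - dl <= wprob S (%n D. \<bar>?e n D\<bar> <= K * ?R n) n" by eventually_elim blast
  then show "\<exists>K>0. EV n. 1 - dl <= wprob S (%n D. \<bar>?e n D\<bar> <= K * ?R n) n" using K by blast
  qed
 qed
 moreover have "(%n. real n powr (- (real (dim_par (S n)) - real (k0 (S n))) / 2)) : O(?R)"
 proof (rule bigoI[of _ 1])
  show "EV n. norm (real n powr (- (real (dim_par (S n)) - real (k0 (S n))) / 2)) <= 1 * norm (?R n)"
  using Mm eventually_ge_at_top[of 1]
  proof eventually_elim
  case (elim n)
  have "card (M n) <= card {..<dim_par (S n)}" using elim(1) by (intro card_mono) (auto simp: models_def)
  then have le: "- (real (dim_par (S n)) - real (k0 (S n))) / 2 <= - (real (card (M n)) - real (k0 (S n))) / 2" by simp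
  show ?case using powr_mono[OF le, of "real n"] elim(2) by simp
  qed
 qed
 ultimately show ?thesis by blast
qed

text \<open>The constant is the smaller of the two exponential rates, up to factors that leave room for the
 polynomial terms.\<close>

lemma missing_signal_case:
 assumes M: "EV n. M n : models (S n) & true_model (S n) - M n ~= {}"
 shows "\<exists>C>0.
  wpa1 S (%n D. BFq0 n (S n) D (M n) <= exp (- C * real n * v\<^sup>2)) &
  (%n. exp (- C * real n * v\<^sup>2)) : o(%n. real n powr (- (real (dim_par (S n)) - real (k0 (S n)) + 1) / 2)) &
  (\<forall>dl>0. \<exists>K>0. EV n.
  wprob S (%n D. BFe0 (S n) D (M n) \<le>
  max (exp (- C * real n * v\<^sup>2)) (K * \<tau> n * real n powr (- (real (dim_par (S n)) - real (k0 (S n)) + 1) / 2))) n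
  \<ge> 1 - dl) &
  (%n. max (exp (- C * real n * v\<^sup>2)) (\<tau> n * real n powr (- (real (dim_par (S n)) - real (k0 (S n)) + 1) / 2)))
  : o(%n. real n powr (- (real (dim_par (S n)) - real (k0 (S n)) + 1) / 2)) &
  (\<forall>e>0. wpa1 S (%n D. BFe0 (S n) D (M n) \<le>
  e * real n powr (- (real (dim_par (S n)) - real (k0 (S n)) + 1) / 2)))"
proof -
 note co = constants
 let ?R = "%n. real n powr (- (real (dim_par (S n)) - real (k0 (S n)) + 1) / 2)"
 have Mm: "EV n. M n : models (S n)" using M by (auto elim: eventually_mono)
 note bm = bayes_measurable[OF Mm]
 define C where "C = min (sepr / 4 / v\<^sup>2) (a / b / 16)"
 have v2: "0 < v\<^sup>2" using v by simp
 have C: "0 < C" using sepr_pos v2 co by (simp add: C_def)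
 have Cq: "C * v\<^sup>2 <= sepr / 4"
 proof -
  have "C <= sepr / 4 / v\<^sup>2" by (simp add: C_def)
  then show ?thesis using v2 by (simp only: pos_le_divide_eq)
 qed
 have Ce: "C <= a / b / 16" by (simp add: C_def)
 have small: "EV n. exp (- C * real n * v\<^sup>2) <= e * ?R n" if e: "0 < e" for e :: real
 proof -
  have "0 < C * v\<^sup>2" "0 <= 1 / e" using C v2 e by simp_all
  from exp_beats_power[OF this, of "N + 1"] dims eventually_ge_at_top[of 1]
  show ?thesis
  proof eventually_elim
  case (elim n)
  have s1: "1 <= sqrt (real n)" and n0: "0 < real n" using elim(3) by auto
  have s: "0 < sqrt (real n) ^ (dim_par (S n) + 1)" "0 < sqrt (real n) ^ (N + 1)" using n0 by simp_all
  have "sqrt (real n) ^ (dim_par (S n) + 1) <= sqrt (real n) ^ (N + 1)" using s1 elim(2) by (intro power_increasing) auto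
  moreover have "1 <= sqrt (real n) ^ k0 (S n)" using s1 by (rule one_le_power)
  ultimately have "1 / sqrt (real n) ^ (N + 1) <= sqrt (real n) ^ k0 (S n) / sqrt (real n) ^ (dim_par (S n) + 1)"
  using s by (intro frac_le) auto
  then have R: "1 / sqrt (real n) ^ (N + 1) <= ?R n" unfolding sqrt_power_ratio[OF n0] .
  have eq: "- C * real n * v\<^sup>2 = - (C * v\<^sup>2) * real n" by simp
  have "(1 / e * sqrt (real n) ^ (N + 1) * exp (- (C * v\<^sup>2) * real n)) * (e / sqrt (real n) ^ (N + 1)) <= 1 * (e / sqrt (real n) ^ (N + 1))"
  using elim(1) e s by (intro mult_right_mono) auto
  also have "(1 / e * sqrt (real n) ^ (N + 1) * exp (- (C * v\<^sup>2) * real n)) * (e / sqrt (real n) ^ (N + 1)) = exp (- C * real n * v\<^sup>2)"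
  unfolding eq
  proof -
  have cancel: "(1 / e * s * x) * (e / s) = x" if "s ~= 0" for s x using that e by simp
  have z: "sqrt (real n) ^ (N + 1) ~= 0" using n0 by simp
  show "(1 / e * sqrt (real n) ^ (N + 1) * exp (- (C * v\<^sup>2) * real n)) * (e / sqrt (real n) ^ (N + 1)) = exp (- (C * v\<^sup>2) * real n)" by (rule cancel[OF z])
  qed
  also have "1 * (e / sqrt (real n) ^ (N + 1)) = e * (1 / sqrt (real n) ^ (N + 1))" by simp
  also have "... <= e * ?R n" using R e by (intro mult_left_mono) auto
  finally show ?case .
  qed
 qed
 have \<tau>small: "EV n. B * \<tau> n * ?R n <= e * ?R n" if e: "0 < e" for B e :: real
 proof -
  have "(%n. B * \<tau> n) \<longlonglongrightarrow> 0" by (rule tendsto_mult_right_zero[OF \<tau>0])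
  then have "EV n. B * \<tau> n < e" by (rule order_tendstoD(2)) (rule e)
  then show ?thesis by eventually_elim (intro mult_right_mono, auto)
 qed
 have tpos: "EV n. 0 <= \<tau> n" using density by (auto elim: eventually_mono)
 show ?thesis
 proof (rule exI[of _ C], intro conjI C allI impI)
  show "wpa1 S (%n D. BFq0 n (S n) D (M n) <= exp (- C * real n * v\<^sup>2))"
  proof (rule wpa1_if_likely)
  show "EV n. likely (law_n n) dl (%D. BFq0 n (S n) D (M n) <= exp (- C * real n * v\<^sup>2))" if "0 < dl" for dl
  by (rule q_separated[OF M Cq that])
  next
  show "EV n. prob_space (law_n n) & {D : space (law_n n). BFq0 n (S n) D (M n) <= exp (- C * real n * v\<^sup>2)} : sets (law_n n)"
  using bm by eventually_elim (intro conjI borel_measurable_le borel_measurable_const, auto)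
  qed
  show "(%n. exp (- C * real n * v\<^sup>2)) : o(?R)"
  proof (rule landau_o.smallI)
  fix e :: real assume "0 < e"
  from small[OF this] show "EV n. norm (exp (- C * real n * v\<^sup>2)) <= e * norm (?R n)"
  by eventually_elim simp
  qed
  show "(%n. max (exp (- C * real n * v\<^sup>2)) (\<tau> n * ?R n)) : o(?R)"
  proof (rule landau_o.smallI)
  fix e :: real assume e: "0 < e"
  from small[OF e] \<tau>small[OF e, of 1] tpos
  show "EV n. norm (max (exp (- C * real n * v\<^sup>2)) (\<tau> n * ?R n)) <= e * norm (?R n)"
  proof eventually_elim
  case (elim n)
  have "0 <= max (exp (- C * real n * v\<^sup>2)) (\<tau> n * ?R n)" by (simp add: le_max_iff_disj)
  then show ?case using elim by simp
  qed
  qed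
  fix dl :: real assume dl: "0 < dl"
  from e_separated[OF M Ce dl] obtain B where B: "0 < B" and l: "EV n. likely (law_n n) dl (%D. BFe0 (S n) D (M n) \<le>
  max (exp (- C * real n * v\<^sup>2)) (B * \<tau> n * ?R n))" by blast
  show "\<exists>K>0. EV n. 1 - dl <= wprob S (%n D. BFe0 (S n) D (M n) \<le>
  max (exp (- C * real n * v\<^sup>2)) (K * \<tau> n * ?R n)) n"
  proof (intro exI[of _ B] conjI B)
  show "EV n. 1 - dl <= wprob S (%n D. BFe0 (S n) D (M n) <= max (exp (- C * real n * v\<^sup>2)) (B * \<tau> n * ?R n)) n"
  using l bm
  proof eventually_elim
  case (elim n)
  have P: "prob_space (law_n n)" and m: "(%D. BFe0 (S n) D (M n)) : bm (law_n n)" using elim(2) by blast+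
  show ?case unfolding wprob_def
  by (rule likely_event[OF P elim(1)]) (rule borel_measurable_le[OF m borel_measurable_const])
  qed
  qed
 next
  fix e :: real assume e: "0 < e"
  show "wpa1 S (%n D. BFe0 (S n) D (M n) <= e * ?R n)"
  proof (rule wpa1_if_likely)
  fix dl :: real assume dl: "0 < dl"
  from e_separated[OF M Ce dl] obtain B where l: "EV n. likely (law_n n) dl (%D. BFe0 (S n) D (M n) \<le>
  max (exp (- C * real n * v\<^sup>2)) (B * \<tau> n * ?R n))" by blast
  show "EV n. likely (law_n n) dl (%D. BFe0 (S n) D (M n) <= e * ?R n)"
  using l small[OF e] \<tau>small[OF e, of B]
  proof eventually_elim
  case (elim n)
  have m: "max (exp (- C * real n * v\<^sup>2)) (B * \<tau> n * ?R n) <= e * ?R n" by (rule max.boundedI[OF elim(2,3)])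
  from elim(1) show ?case
  proof (rule likely_mono)
  fix D assume "BFe0 (S n) D (M n) <= max (exp (- C * real n * v\<^sup>2)) (B * \<tau> n * ?R n)"
  then show "BFe0 (S n) D (M n) <= e * ?R n" using m by (rule order.trans)
  qed simp
  qed
  next
  show "EV n. prob_space (law_n n) & {D : space (law_n n). BFe0 (S n) D (M n) <= e * ?R n} : sets (law_n n)"
  using bm by eventually_elim (intro conjI borel_measurable_le borel_measurable_const, auto)
  qed
 qed
qed

end

section \<open>The Bayes factors\<close>

theorem theorem2:
  fixes S :: "nat \<Rightarrow> 'd gmm" and \<alpha> \<theta>\<^sub>l :: real and \<tau> :: "nat \<Rightarrow> real"
  assumes "\<forall>\<^sub>F n in sequentially. gmm_structure n (S n)"
  and "cond_parameter_space S"
  and "cond_dimensions S \<alpha>"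
  and "cond_signal S"
  and "cond_moment_class S \<alpha>"
  and "cond_identification S"
  and "cond_weight S"
  and "cond_par_prior S"
  and "cond_mod_prior S"
  and "cond_fixed_dimension S \<theta>\<^sub>l"
  and "cond_est_density S \<tau>"
  shows
  "(\<forall>M :: nat \<Rightarrow> nat set.
  (\<forall>\<^sub>F n in sequentially. M n \<in> models (S n) \<and> true_model (S n) \<subseteq> M n) \<longrightarrow>
  (\<forall>e>0. wpa1 S (\<lambda>n D.
  \<bar>BFq0 n (S n) D (M n) / BFe0 (S n) D (M n) - 1\<bar> < e)) \<and>
  (\<exists>c>0. \<exists>C>0. wpa1 S (\<lambda>n D.
  c * BFe0 (S n) D (M n) \<le> BFq0 n (S n) D (M n) \<and>
  BFq0 n (S n) D (M n) \<le> C * BFe0 (S n) D (M n))) \<and>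
  (\<exists>c>0. wpa1 S (\<lambda>n D.
  c * real n powr (- (real (card (M n)) - real (k0 (S n))) / 2) \<le> BFq0 n (S n) D (M n) \<and>
  c * real n powr (- (real (card (M n)) - real (k0 (S n))) / 2) \<le> BFe0 (S n) D (M n))) \<and>
  Op S (\<lambda>n D. BFq0 n (S n) D (M n))
  (\<lambda>n. real n powr (- (real (card (M n)) - real (k0 (S n))) / 2)) \<and>
  Op S (\<lambda>n D. BFe0 (S n) D (M n))
  (\<lambda>n. real n powr (- (real (card (M n)) - real (k0 (S n))) / 2)) \<and>
  (\<lambda>n. real n powr (- (real (dim_par (S n)) - real (k0 (S n))) / 2))
  \<in> O(\<lambda>n. real n powr (- (real (card (M n)) - real (k0 (S n))) / 2))) \<and>
  (\<forall>M :: nat \<Rightarrow> nat set.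
  (\<forall>\<^sub>F n in sequentially. M n \<in> models (S n) \<and> true_model (S n) - M n \<noteq> {}) \<longrightarrow>
  (\<exists>C>0.
  wpa1 S (\<lambda>n D. BFq0 n (S n) D (M n) \<le> exp (- C * real n * \<theta>\<^sub>l\<^sup>2)) \<and>
  (\<lambda>n. exp (- C * real n * \<theta>\<^sub>l\<^sup>2)) \<in> o(\<lambda>n. real n powr (- (real (dim_par (S n)) - real (k0 (S n)) + 1) / 2)) \<and>
  (\<forall>\<delta>>0. \<exists>K>0. \<forall>\<^sub>F n in sequentially.
  wprob S (\<lambda>n D. BFe0 (S n) D (M n) \<le>
  max (exp (- C * real n * \<theta>\<^sub>l\<^sup>2)) (K * \<tau> n * real n powr (- (real (dim_par (S n)) - real (k0 (S n)) + 1) / 2))) n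
  \<ge> 1 - \<delta>) \<and>
  (\<lambda>n. max (exp (- C * real n * \<theta>\<^sub>l\<^sup>2)) (\<tau> n * real n powr (- (real (dim_par (S n)) - real (k0 (S n)) + 1) / 2)))
  \<in> o(\<lambda>n. real n powr (- (real (dim_par (S n)) - real (k0 (S n)) + 1) / 2)) \<and>
  (\<forall>e>0. wpa1 S (\<lambda>n D. BFe0 (S n) D (M n) \<le>
  e * real n powr (- (real (dim_par (S n)) - real (k0 (S n)) + 1) / 2)))))"
proof -
 obtain a b \<kappa> K F N cl cu where "gmm_sequence S a b \<kappa> K F N \<tau> cl cu \<theta>\<^sub>l"
  using gmm_sequence_exists[OF assms(1,2,3,5,6,7,8,10,11)] by blast
 then interpret gmm_sequence S a b \<kappa> K F N \<tau> cl cu \<theta>\<^sub>l .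
 show ?thesis
  by (rule conjI; rule allI; rule impI; (rule superset_case | rule missing_signal_case); assumption)
qed

end
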